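(* Let $(\zeta_0,\ \zeta_1=\lambda_0^{-1}(\zeta_0),\ \zeta_2=\lambda_1^{-1}(\zeta_1),\ldots)$ be a point of $\mathcal{S}_\infty$ and suppose that $\rho_0^{-1}(\zeta_0)$ is a tripod with lengths of legs $(x_1,x_2,x_3)$. Let $(k_1,k_2,\ldots)$ be the itinerary of the tripod $\rho_0^{-1}(\zeta_0)$. Then for every $n$ the tree $\rho_n^{-1}(\zeta_n)$ is isometric to $\Phi_{k_1}\circ\cdots\circ\Phi_{k_n}(T_n)$, where $T_n$ is the tripod with lengths of legs $F^n(x_1,x_2,x_3)$. The map $\iota_n:\rho_{n+1}^{-1}(\zeta_{n+1})\to\rho_n^{-1}(\zeta_n)$ projects each of the $2^n$ copies of the graph $\Phi_{k_{n+1}}(T_{n+1})$ in $\Phi_{k_1}\circ\cdots\circ\Phi_{k_n}(\Phi_{k_{n+1}}(T_{n+1}))$ onto its Hubbard tripod, divides the lengths of the legs $Z_\alpha O$ and $Z_\gamma O$ of it by two, and then identifies each copy with the corresponding copy of $T_n$ in $\Phi_{k_1}\circ\cdots\circ\Phi_{k_n}(T_n)$.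
   Context: Marked trees. A marked tree is a finite metric tree with three points marked $Z_\alpha,Z_\beta,Z_\gamma$, not all coinciding. Its Hubbard tripod is the convex hull of the marked points, $O$ denotes the common point of its legs. "A tripod with lengths of legs $(x_1,x_2,x_3)$" is a marked tripod whose legs $Z_\alpha O$, $Z_\beta O$, $Z_\gamma O$ have these lengths (zero allowed). For a marked tree $T$ and $i\in\{\mathbf1,\mathbf2\}$, $\Phi_i(T)$ is obtained from two copies $T_1,T_2$ of $T$ by identifying the two copies of $Z_\alpha$; the copy of $Z_\beta$ in $T_1$ is marked $Z_\alpha$, the copy of $Z_\beta$ in $T_2$ is marked $Z_\gamma$, and the copy of $Z_\gamma$ in $T_1$ (if $i=\mathbf1$) or in $T_2$ (if $i=\mathbf2$) is marked $Z_\beta$. The projection of a tree onto a subtree maps a point to the nearest point of the subtree. $F(x_1,x_2,x_3)=(|x_1-x_3|,\,2\min(x_1,x_3),\,x_2)$. The itinerary of $(x_1,x_2,x_3)$ is $(k_1,k_2,\ldots)$, where, with $F^{n-1}(x_1,x_2,x_3)=(y_1,y_2,y_3)$, $k_n=\mathbf1$ if $y_3>y_1$ and $k_n=\mathbf2$ otherwise. Complexes. Let $\mathsf{X}=\{1,2,3,4\}$ and $\mathsf{X}^*$ the rooted tree of finite words. For a permutation $\tau$ of $\mathsf{X}$ and automorphisms $g_i$ of $\mathsf{X}^*$, $\tau(g_1,g_2,g_3,g_4)$ denotes $xv\mapsto\tau(x)g_x(v)$ (trivial entries omitted). Sections: $g(xv)=g(x)\,g|_x(v)$, $g|_{xv}=g|_x|_v$.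 Let $\sigma=(1\,2)(3\,4)$, $\pi=(1\,3)(2\,4)$. $\Gamma$ is generated by $\alpha=\sigma$, $a=\pi$, $\beta=(\alpha,\gamma,\alpha,\gamma)$, $b=(a\alpha,a\alpha,c,c)$, $\gamma=(\beta,\varepsilon,\varepsilon,\beta)$, $c=(b\beta,b\beta,b,b)$. $\Gamma_A=\langle\beta,\gamma,b,c\rangle$, $\Gamma_B=\langle\alpha,\gamma,a,c\rangle$, $\Gamma_C=\langle\alpha,\beta,a,b\rangle$, $\Gamma_{A_1}=\langle\alpha,b,c\rangle$, $\Gamma_{B_1}=\langle\beta,a,c\gamma\rangle$, $\Gamma_{C_1}=\langle\gamma,a\alpha,b\beta\rangle$; $\mathcal{G}$ is the set of these groups and all their pairwise and triple intersections. $\Xi$ is the simplicial complex of chains of the poset of subsets $G\cdot g\subset\Gamma$ ($G\in\mathcal{G}$, $g\in\Gamma$) with the right translation action of $\Gamma$; $\mathcal{T}_0\subset\Xi$ is the subcomplex of chains in $\mathcal{G}$, identified with the union of three tetrahedra $A_1ABC$, $B_1ABC$, $C_1ABC$ with common face $ABC$ ($\Gamma_X$ is the vertex $X$, $\Gamma_X\cap\Gamma_Y$ the midpoint of $XY$, a non-trivial triple intersection the barycenter of the corresponding triangle, $\{\varepsilon\}$ the barycenter of $ABC$). $\mathcal{T}_0$ is embedded in $\mathbb{R}^5$ so that $B=0$ and $\overrightarrow{BA},\overrightarrow{BC},\overrightarrow{AA_1},\overrightarrow{BB_1},\overrightarrow{CC_1}$ is the standard basis. Bimodule: $\mathfrak{M}^{\otimes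 n}=\mathsf{X}^n\times\Gamma$, elements $v\cdot h$, $(v\cdot h)\cdot g=v\cdot hg$, $g\cdot(v\cdot h)=g(v)\cdot g|_vh$. $\Xi_n=\Xi\otimes\mathfrak{M}^{\otimes n}$ is the quotient of $\Xi\times\mathfrak{M}^{\otimes n}$ by $\xi\cdot g\otimes m=\xi\otimes g\cdot m$, with the right action on the last factor. $I:\Xi\otimes\mathfrak{M}\to\Xi$: for $x\in\mathsf{X}$ the map $\xi\mapsto I(\xi\otimes x)$ is affine on the three tetrahedra of $\mathcal{T}_0$ with (writing $(XY)$ for midpoints) $I(A\otimes1)=C$, $I(A\otimes2)=C_1$, $I(A\otimes3)=A_1$, $I(A\otimes4)=A$; $I(B\otimes x)=(AC)$, $I(C\otimes x)=B$ for all $x$; $I(A_1\otimes1)=I(A_1\otimes2)=(CC_1)$, $I(A_1\otimes3)=I(A_1\otimes4)=(AA_1)$; $I(B_1\otimes1)=I(B_1\otimes3)=(CA_1)$, $I(B_1\otimes2)=I(B_1\otimes4)=(AC_1)$; $I(C_1\otimes1)=I(C_1\otimes4)=B_1$, $I(C_1\otimes2)=I(C_1\otimes3)=B$; extended by $I(\xi\cdot g\otimes x\cdot h)=I(\xi\otimes g(x))\cdot g|_xh$. $I_n(\xi\otimes x\otimes v)=I(\xi\otimes x)\otimes v$ for $v\in\mathfrak{M}^{\otimes n}$. $\mathrm{IMG}(f)=\langle\alpha,\beta,\gamma,ab,bc\rangle<\Gamma$, $\mathcal{M}_n=\Xi_n/\mathrm{IMG}(f)$, and $\iota_n:\mathcal{M}_{n+1}\to\mathcal{M}_n$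 is induced by $I_n$. $\widehat\Gamma$ is the group of automorphisms of $\{\mathbf1,\mathbf2\}^*$ generated by $a$ (transposition of the first letter), $b=(a,c)$, $c=(b,b)$. It acts from the right on $\widehat\Xi=\mathbb{R}^2$, $a,b,c$ acting as reflections in the lines $B'C'$, $A'C'$, $A'B'$, where $A'=(1,0)$, $B'=(0,0)$, $C'=(0,1)$; $\mathfrak{M}_{\widehat\Gamma}=\{\mathbf1,\mathbf2\}\times\widehat\Gamma$, $\widehat\Xi_n=\widehat\Xi\otimes\mathfrak{M}_{\widehat\Gamma}^{\otimes n}$. $\nu:\Gamma\to\widehat\Gamma$ is given by $\alpha,\beta,\gamma\mapsto\varepsilon$, $a\mapsto a,b\mapsto b,c\mapsto c$; $\mu:\mathfrak{M}\to\mathfrak{M}_{\widehat\Gamma}$ by $\mu(1)=\mu(2)=\mathbf1$, $\mu(3)=\mu(4)=\mathbf2$, $\mu(x\cdot g)=\mu(x)\cdot\nu(g)$. $P:\Xi\to\widehat\Xi$ is affine on the tetrahedra of $\mathcal{T}_0$, maps $A,A_1\mapsto A'$, $B,B_1\mapsto B'$, $C,C_1\mapsto C'$, and $P(\xi\cdot g)=P(\xi)\cdot\nu(g)$; $P_n(\xi\otimes v)=P(\xi)\otimes\mu(v)$. $\mathcal{S}_n=\widehat\Xi_n/\nu(\mathrm{IMG}(f))$; $\rho_n:\mathcal{M}_n\to\mathcal{S}_n$ is induced by $P_n$; $\lambda_n:\mathcal{S}_{n+1}\to\mathcal{S}_n$ is induced by $L_n(\zeta\otimes x\otimes v)=L(\zeta\otimes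 x)\otimes v$, where $L(P(\xi)\otimes\mu(x))=P(I(\xi\otimes x))$. The $\lambda_n$ are homeomorphisms; $\mathcal{S}_\infty$ is the inverse limit of the $\mathcal{S}_n$ with respect to the $\lambda_n$. The fiber $\rho_0^{-1}$ of the image of $(x_1,x_2)$ from the triangle $A'B'C'$ is a union of three segments with common end $O=(x_1,x_2,0,0,0)$ and other ends $Z_\alpha=(x_1,x_2,x_1,0,0)$, $Z_\beta=(x_1,x_2,0,1-x_1-x_2,0)$, $Z_\gamma=(x_1,x_2,0,0,x_2)$; fibers over the other copy of the triangle in $\mathcal{S}_0$ are described in the same way. The fibers $\rho_n^{-1}(\zeta)$ are finite trees composed of copies (images of $\xi\mapsto\xi\otimes v\cdot g$, $v\in\mathsf X^n$) of fibers of $P:\mathcal{T}_0\to\mathcal{D}$, with the lengths inherited from these copies. *)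

theory Defs
  imports "HOL-Analysis.Analysis" "HOL-Algebra.Bij" "HOL-Algebra.Generated_Groups"
begin

section \<open>Marked trees\<close>

datatype bin = One | Two

text \<open>A marked tree is represented by its set of points, its metric and its three marked points.
  The operations below make sense for arbitrary marked metric spaces.\<close>

record 'a mtree =
  pts :: "'a set"
  tdist :: "'a \<Rightarrow> 'a \<Rightarrow> real"
  Zal :: 'a
  Zbe :: 'a
  Zga :: 'a

definition isometry :: "('a \<Rightarrow> 'b) \<Rightarrow> 'a set \<Rightarrow> ('a \<Rightarrow> 'a \<Rightarrow> real) \<Rightarrow> 'b set \<Rightarrow> ('b \<Rightarrow> 'b \<Rightarrow> real) \<Rightarrow> bool" where
  "isometry f A d B d' \<longleftrightarrow> bij_betw f A B \<and> (\<forall>p\<in>A. \<forall>q\<in>A. d' (f p) (f q) = d p q)"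

definition marked_isometry :: "('a \<Rightarrow> 'b) \<Rightarrow> 'a mtree \<Rightarrow> 'b mtree \<Rightarrow> bool" where
  "marked_isometry f T T' \<longleftrightarrow>
     {Zal T, Zbe T, Zga T} \<subseteq> pts T \<and>
     isometry f (pts T) (tdist T) (pts T') (tdist T') \<and>
     f (Zal T) = Zal T' \<and> f (Zbe T) = Zbe T' \<and> f (Zga T) = Zga T'"

definition segment :: "'a mtree \<Rightarrow> 'a \<Rightarrow> 'a \<Rightarrow> 'a set" where
  "segment T p q = {r \<in> pts T. tdist T p r + tdist T r q = tdist T p q}"

definition tree_convex :: "'a mtree \<Rightarrow> 'a set \<Rightarrow> bool" where
  "tree_convex T S \<longleftrightarrow> S \<subseteq> pts T \<and> (\<forall>p\<in>S. \<forall>q\<in>S. segment T p q \<subseteq> S)"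

definition hubbard :: "'a mtree \<Rightarrow> 'a set" where
  "hubbard T = \<Inter>{S. tree_convex T S \<and> {Zal T, Zbe T, Zga T} \<subseteq> S}"

definition center :: "'a mtree \<Rightarrow> 'a" where
  "center T = (THE r. r \<in> segment T (Zal T) (Zbe T) \<inter> segment T (Zbe T) (Zga T)
                          \<inter> segment T (Zal T) (Zga T))"

definition tree_proj :: "'a mtree \<Rightarrow> 'a set \<Rightarrow> 'a \<Rightarrow> 'a" where
  "tree_proj T S p = (THE q. q \<in> S \<and> (\<forall>r\<in>S. tdist T p q \<le> tdist T p r))"

text \<open>The Hubbard tripod with the lengths of the legs \<open>Zal O\<close> and \<open>Zga O\<close> divided by two:
  \<open>scaled_radius\<close> is the rescaled distance from \<open>O\<close>, and paths between different legs
  pass through \<open>O\<close>.\<close>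

definition scaled_radius :: "'a mtree \<Rightarrow> 'a \<Rightarrow> real" where
  "scaled_radius T p =
     (if p \<in> segment T (center T) (Zbe T) then tdist T (center T) p else tdist T (center T) p / 2)"

definition halved_hubbard :: "'a mtree \<Rightarrow> 'a mtree" where
  "halved_hubbard T =
     \<lparr>pts = hubbard T,
      tdist = (\<lambda>p q. if \<exists>Z\<in>{Zal T, Zbe T, Zga T}. {p, q} \<subseteq> segment T (center T) Z
                     then \<bar>scaled_radius T p - scaled_radius T q\<bar>
                     else scaled_radius T p + scaled_radius T q),
      Zal = Zal T, Zbe = Zbe T, Zga = Zga T\<rparr>"

text \<open>In order that \<open>Phi\<close> can be iterated, points carry a word in \<open>bin\<close> recording the copies they
  lie in.  Copy \<open>i\<close> of \<open>p\<close> is obtained by prepending the letter \<open>i\<close>; the two copies of \<open>Zal T\<close>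
  are identified by always representing them by the one with letter \<open>One\<close>.\<close>

definition glue_copy :: "(bin list \<times> 'a) mtree \<Rightarrow> bin \<Rightarrow> bin list \<times> 'a \<Rightarrow> bin list \<times> 'a" where
  "glue_copy T i p = ((if p = Zal T then One else i) # fst p, snd p)"

definition Phi :: "bin \<Rightarrow> (bin list \<times> 'a) mtree \<Rightarrow> (bin list \<times> 'a) mtree" where
  "Phi i T =
     \<lparr>pts = glue_copy T One ` pts T \<union> glue_copy T Two ` pts T,
      tdist = (\<lambda>p q. let p' = (tl (fst p), snd p); q' = (tl (fst q), snd q) in
                 if hd (fst p) = hd (fst q) then tdist T p' q'
                 else tdist T p' (Zal T) + tdist T (Zal T) q'),
      Zal = glue_copy T One (Zbe T),
      Zbe = glue_copy T i (Zga T),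
      Zga = glue_copy T Two (Zbe T)\<rparr>"

text \<open>\<open>foldr Phi [k\<^sub>1, \<dots>, k\<^sub>n] T\<close> is the composition of the \<open>Phi k\<^sub>i\<close> applied to \<open>T\<close>, the last one
  first.  It contains \<open>2 ^ n\<close> copies of \<open>T\<close>; \<open>copy_emb [k\<^sub>1, \<dots>, k\<^sub>n] T u\<close> is the embedding of the
  copy with index \<open>u\<close>, a word of length \<open>n\<close>.\<close>

primrec copy_emb ::
  "bin list \<Rightarrow> (bin list \<times> 'a) mtree \<Rightarrow> bin list \<Rightarrow> bin list \<times> 'a \<Rightarrow> bin list \<times> 'a" where
  "copy_emb [] T u p = p"
| "copy_emb (k # ks) T u p = glue_copy (foldr Phi ks T) (hd u) (copy_emb ks T (tl u) p)"

text \<open>The tripod is realised along the coordinate axes of a three-dimensional space; the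
  \<open>l1\<close>-distance is its path metric.\<close>

definition tripod :: "real \<times> real \<times> real \<Rightarrow> (bin list \<times> (real \<times> real \<times> real)) mtree" where
  "tripod = (\<lambda>(x1, x2, x3).
     \<lparr>pts = {([], s, 0, 0) | s. 0 \<le> s \<and> s \<le> x1} \<union> {([], 0, s, 0) | s. 0 \<le> s \<and> s \<le> x2}
              \<union> {([], 0, 0, s) | s. 0 \<le> s \<and> s \<le> x3},
      tdist = (\<lambda>(_, s1, s2, s3) (_, t1, t2, t3). \<bar>s1 - t1\<bar> + \<bar>s2 - t2\<bar> + \<bar>s3 - t3\<bar>),
      Zal = ([], x1, 0, 0), Zbe = ([], 0, x2, 0), Zga = ([], 0, 0, x3)\<rparr>)"

definition FF :: "real \<times> real \<times> real \<Rightarrow> real \<times> real \<times> real" where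
  "FF = (\<lambda>(x1, x2, x3). (\<bar>x1 - x3\<bar>, 2 * min x1 x3, x2))"

text \<open>Itineraries are indexed by \<open>n \<ge> 1\<close>.\<close>

definition itinerary :: "real \<times> real \<times> real \<Rightarrow> nat \<Rightarrow> bin" where
  "itinerary x n = (case (FF ^^ (n - 1)) x of (y1, y2, y3) \<Rightarrow> if y3 > y1 then One else Two)"

definition itinerary_prefix :: "real \<times> real \<times> real \<Rightarrow> nat \<Rightarrow> bin list" where
  "itinerary_prefix x n = map (itinerary x) [1..<Suc n]"


section \<open>Self-similar groups, bimodules and tensor products\<close>

text \<open>Automorphisms of the tree of words over \<open>'x\<close> are functions on words, composed as functions
  (left action), i.e. elements of \<open>BijGroup UNIV\<close>.  The element \<open>v \<cdot> h\<close> of the \<open>n\<close>-th tensor power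
  of the bimodule is the pair \<open>(v, h)\<close> with \<open>length v = n\<close>.\<close>

type_synonym 'x aut = "'x list \<Rightarrow> 'x list"

definition sect :: "'x aut \<Rightarrow> 'x list \<Rightarrow> 'x aut" where
  "sect g v = (\<lambda>w. drop (length v) (g (v @ w)))"

definition bimod :: "'x aut set \<Rightarrow> nat \<Rightarrow> ('x list \<times> 'x aut) set" where
  "bimod G n = {(v, h). length v = n \<and> h \<in> G}"

definition bimod_lact :: "'x aut \<Rightarrow> 'x list \<times> 'x aut \<Rightarrow> 'x list \<times> 'x aut" where
  "bimod_lact g = (\<lambda>(v, h). (g v, sect g v \<circ> h))"

text \<open>Points of the tensor product of a right \<open>G\<close>-space \<open>S\<close> with the \<open>n\<close>-th tensor power of the
  bimodule are equivalence classes of pairs, \<open>\<xi>\<cdot>g \<otimes> m = \<xi> \<otimes> g\<cdot>m\<close>.\<close>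

type_synonym ('s, 'x) tensor = "('s \<times> 'x list \<times> 'x aut) set"

definition tensor_rel ::
  "'x aut set \<Rightarrow> ('s \<Rightarrow> 'x aut \<Rightarrow> 's) \<Rightarrow> 's set \<Rightarrow> nat \<Rightarrow>
     (('s \<times> 'x list \<times> 'x aut) \<times> ('s \<times> 'x list \<times> 'x aut)) set" where
  "tensor_rel G act S n =
     {((act \<xi> g, m), (\<xi>, bimod_lact g m)) | \<xi> g m. \<xi> \<in> S \<and> g \<in> G \<and> m \<in> bimod G n}"

definition tensor_space ::
  "'x aut set \<Rightarrow> ('s \<Rightarrow> 'x aut \<Rightarrow> 's) \<Rightarrow> 's set \<Rightarrow> nat \<Rightarrow> ('s, 'x) tensor set" where
  "tensor_space G act S n = (S \<times> bimod G n) // tensor_rel G act S n"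

definition tensor_class ::
  "'x aut set \<Rightarrow> ('s \<Rightarrow> 'x aut \<Rightarrow> 's) \<Rightarrow> 's set \<Rightarrow> nat \<Rightarrow> 's \<Rightarrow> 'x list \<times> 'x aut \<Rightarrow> ('s, 'x) tensor" where
  "tensor_class G act S n \<xi> m = tensor_rel G act S n `` {(\<xi>, m)}"

definition tensor_ract :: "('s, 'x) tensor \<Rightarrow> 'x aut \<Rightarrow> ('s, 'x) tensor" where
  "tensor_ract t g = (\<lambda>(\<xi>, v, h). (\<xi>, v, h \<circ> g)) ` t"

definition tensor_orbit :: "'x aut set \<Rightarrow> ('s, 'x) tensor \<Rightarrow> ('s, 'x) tensor set" where
  "tensor_orbit K t = tensor_ract t ` K"


section \<open>The group \<open>\<Gamma>\<close>\<close>

datatype letter = X1 | X2 | X3 | X4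

fun sigma :: "letter \<Rightarrow> letter" where
  "sigma X1 = X2" | "sigma X2 = X1" | "sigma X3 = X4" | "sigma X4 = X3"

fun pi_perm :: "letter \<Rightarrow> letter" where
  "pi_perm X1 = X3" | "pi_perm X3 = X1" | "pi_perm X2 = X4" | "pi_perm X4 = X2"

fun g_al :: "letter aut" where
  "g_al [] = []"
| "g_al (x # v) = sigma x # v"

fun g_a :: "letter aut" where
  "g_a [] = []"
| "g_a (x # v) = pi_perm x # v"

fun g_be :: "letter aut" and g_ga :: "letter aut" where
  "g_be [] = []"
| "g_be (X1 # v) = X1 # g_al v"
| "g_be (X2 # v) = X2 # g_ga v"
| "g_be (X3 # v) = X3 # g_al v"
| "g_be (X4 # v) = X4 # g_ga v"
| "g_ga [] = []"
| "g_ga (X1 # v) = X1 # g_be v"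
| "g_ga (X2 # v) = X2 # v"
| "g_ga (X3 # v) = X3 # v"
| "g_ga (X4 # v) = X4 # g_be v"

lemma length_g_al [simp]: "length (g_al v) = length v"
  by (cases v) auto

lemma length_g_be_ga [simp, termination_simp]:
  "length (g_be v) = length v" "length (g_ga v) = length v"
  by (induction v and v rule: g_be_g_ga.induct) auto

fun g_b :: "letter aut" and g_c :: "letter aut" where
  "g_b [] = []"
| "g_b (X1 # v) = X1 # g_a (g_al v)"
| "g_b (X2 # v) = X2 # g_a (g_al v)"
| "g_b (X3 # v) = X3 # g_c v"
| "g_b (X4 # v) = X4 # g_c v"
| "g_c [] = []"
| "g_c (X1 # v) = X1 # g_b (g_be v)"
| "g_c (X2 # v) = X2 # g_b (g_be v)"
| "g_c (X3 # v) = X3 # g_b v"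
| "g_c (X4 # v) = X4 # g_b v"

abbreviation gen_by :: "'x aut set \<Rightarrow> 'x aut set" where
  "gen_by H \<equiv> generate (BijGroup UNIV) H"

definition Gam :: "letter aut set" where
  "Gam = gen_by {g_al, g_be, g_ga, g_a, g_b, g_c}"

definition IMG :: "letter aut set" where
  "IMG = gen_by {g_al, g_be, g_ga, g_a \<circ> g_b, g_b \<circ> g_c}"


section \<open>The complex \<open>\<Xi>\<close>\<close>

datatype vertex = VA | VB | VC | VA1 | VB1 | VC1

fun stab :: "vertex \<Rightarrow> letter aut set" where
  "stab VA = gen_by {g_be, g_ga, g_b, g_c}"
| "stab VB = gen_by {g_al, g_ga, g_a, g_c}"
| "stab VC = gen_by {g_al, g_be, g_a, g_b}"
| "stab VA1 = gen_by {g_al, g_b, g_c}"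
| "stab VB1 = gen_by {g_be, g_a, g_c \<circ> g_ga}"
| "stab VC1 = gen_by {g_ga, g_a \<circ> g_al, g_b \<circ> g_be}"

definition GG :: "letter aut set set" where
  "GG = {\<Inter>X\<in>S. stab X | S. 1 \<le> card S \<and> card S \<le> 3}"

definition cosets :: "letter aut set set" where
  "cosets = {(\<lambda>h. h \<circ> g) ` G | G g. G \<in> GG \<and> g \<in> Gam}"

text \<open>A point of (the geometric realisation of) the complex of chains of cosets is given by its
  barycentric coordinates.\<close>

type_synonym xi = "letter aut set \<Rightarrow> real"

definition supp :: "xi \<Rightarrow> letter aut set set" where
  "supp \<xi> = {C. \<xi> C \<noteq> 0}"

definition Xi :: "xi set" where
  "Xi = {\<xi>. (\<forall>C. 0 \<le> \<xi> C) \<and> finite (supp \<xi>) \<and> supp \<xi> \<subseteq> cosets \<and>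
            (\<forall>C\<in>supp \<xi>. \<forall>D\<in>supp \<xi>. C \<subseteq> D \<or> D \<subseteq> C) \<and> sum \<xi> (supp \<xi>) = 1}"

text \<open>The coordinate of \<open>\<xi>\<cdot>g\<close> at \<open>C\<close> is that of \<open>\<xi>\<close> at \<open>C\<cdot>g\<^sup>-\<^sup>1\<close>, which is written as a preimage.\<close>

definition xi_act :: "xi \<Rightarrow> letter aut \<Rightarrow> xi" where
  "xi_act \<xi> g = (\<lambda>C. \<xi> ((\<lambda>h. h \<circ> g) -` C))"

definition T0 :: "xi set" where
  "T0 = {\<xi> \<in> Xi. supp \<xi> \<subseteq> GG}"

definition vec5 :: "real \<Rightarrow> real \<Rightarrow> real \<Rightarrow> real \<Rightarrow> real \<Rightarrow> real ^ 5" where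
  "vec5 p q r s t = p *\<^sub>R axis 1 1 + q *\<^sub>R axis 2 1 + r *\<^sub>R axis 3 1 + s *\<^sub>R axis 4 1 + t *\<^sub>R axis 5 1"

fun vpos :: "vertex \<Rightarrow> real ^ 5" where
  "vpos VA = vec5 1 0 0 0 0"
| "vpos VB = vec5 0 0 0 0 0"
| "vpos VC = vec5 0 1 0 0 0"
| "vpos VA1 = vec5 1 0 1 0 0"
| "vpos VB1 = vec5 0 0 0 1 0"
| "vpos VC1 = vec5 0 1 0 0 1"

definition barycenter :: "vertex set \<Rightarrow> real ^ 5" where
  "barycenter S = (1 / real (card S)) *\<^sub>R (\<Sum>X\<in>S. vpos X)"

definition pos :: "letter aut set \<Rightarrow> real ^ 5" where
  "pos G = (if G = {id} then barycenter {VA, VB, VC}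
            else (THE p. \<exists>S. 1 \<le> card S \<and> card S \<le> 3 \<and> G = (\<Inter>X\<in>S. stab X) \<and> p = barycenter S))"

definition emb :: "xi \<Rightarrow> real ^ 5" where
  "emb \<xi> = (\<Sum>G\<in>supp \<xi>. \<xi> G *\<^sub>R pos G)"

definition T0_point :: "real ^ 5 \<Rightarrow> xi" where
  "T0_point p = (THE \<xi>. \<xi> \<in> T0 \<and> emb \<xi> = p)"

definition tetrahedra :: "vertex set set" where
  "tetrahedra = {{VA1, VA, VB, VC}, {VB1, VA, VB, VC}, {VC1, VA, VB, VC}}"

definition affine_ext :: "(vertex \<Rightarrow> 'b::real_vector) \<Rightarrow> real ^ 5 \<Rightarrow> 'b" where
  "affine_ext f p = (THE q. \<exists>S\<in>tetrahedra. \<exists>w. (\<forall>X\<in>S. 0 \<le> w X) \<and> sum w S = 1 \<and>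
      p = (\<Sum>X\<in>S. w X *\<^sub>R vpos X) \<and> q = (\<Sum>X\<in>S. w X *\<^sub>R f X))"


section \<open>The maps \<open>I\<close>, \<open>I\<^sub>n\<close>, \<open>\<iota>\<^sub>n\<close>\<close>

abbreviation Xi_n :: "nat \<Rightarrow> (xi, letter) tensor set" where
  "Xi_n n \<equiv> tensor_space Gam xi_act Xi n"

abbreviation Xi_tensor :: "nat \<Rightarrow> xi \<Rightarrow> letter list \<times> letter aut \<Rightarrow> (xi, letter) tensor" where
  "Xi_tensor n \<equiv> tensor_class Gam xi_act Xi n"

fun I_vert :: "letter \<Rightarrow> vertex \<Rightarrow> real ^ 5" where
  "I_vert X1 VA = vpos VC"
| "I_vert X2 VA = vpos VC1"
| "I_vert X3 VA = vpos VA1"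
| "I_vert X4 VA = vpos VA"
| "I_vert _ VB = midpoint (vpos VA) (vpos VC)"
| "I_vert _ VC = vpos VB"
| "I_vert X1 VA1 = midpoint (vpos VC) (vpos VC1)"
| "I_vert X2 VA1 = midpoint (vpos VC) (vpos VC1)"
| "I_vert X3 VA1 = midpoint (vpos VA) (vpos VA1)"
| "I_vert X4 VA1 = midpoint (vpos VA) (vpos VA1)"
| "I_vert X1 VB1 = midpoint (vpos VC) (vpos VA1)"
| "I_vert X3 VB1 = midpoint (vpos VC) (vpos VA1)"
| "I_vert X2 VB1 = midpoint (vpos VA) (vpos VC1)"
| "I_vert X4 VB1 = midpoint (vpos VA) (vpos VC1)"
| "I_vert X1 VC1 = vpos VB1"
| "I_vert X4 VC1 = vpos VB1"
| "I_vert X2 VC1 = vpos VB"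
| "I_vert X3 VC1 = vpos VB"

definition I_T0 :: "letter \<Rightarrow> xi \<Rightarrow> xi" where
  "I_T0 x \<xi> = T0_point (affine_ext (I_vert x) (emb \<xi>))"

text \<open>Maps defined on classes or orbits are described by their graph on representatives.\<close>

definition I_map :: "(xi, letter) tensor \<Rightarrow> xi" where
  "I_map t = (THE \<eta>. \<exists>\<xi>\<in>T0. \<exists>g\<in>Gam. \<exists>x. \<exists>h\<in>Gam.
      t = Xi_tensor 1 (xi_act \<xi> g) ([x], h) \<and>
      \<eta> = xi_act (I_T0 (hd (g [x])) \<xi>) (sect g [x] \<circ> h))"

definition I_n :: "nat \<Rightarrow> (xi, letter) tensor \<Rightarrow> (xi, letter) tensor" where
  "I_n n t = (THE s. \<exists>\<xi>\<in>Xi. \<exists>x v h. (v, h) \<in> bimod Gam n \<and>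
      t = Xi_tensor (Suc n) \<xi> (x # v, h) \<and>
      s = Xi_tensor n (I_map (Xi_tensor 1 \<xi> ([x], id))) (v, h))"

type_synonym M_point = "(xi, letter) tensor set"

definition MM :: "nat \<Rightarrow> M_point set" where
  "MM n = tensor_orbit IMG ` Xi_n n"

definition iota :: "nat \<Rightarrow> M_point \<Rightarrow> M_point" where
  "iota n m = (THE m'. \<exists>t\<in>Xi_n (Suc n). m = tensor_orbit IMG t \<and> m' = tensor_orbit IMG (I_n n t))"


section \<open>The group \<open>\<Gamma>\<close>-hat and the orbispaces \<open>S\<^sub>n\<close>\<close>

fun swap :: "bin \<Rightarrow> bin" where
  "swap One = Two" | "swap Two = One"

fun h_a :: "bin aut" where
  "h_a [] = []"
| "h_a (x # v) = swap x # v"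

fun h_b :: "bin aut" and h_c :: "bin aut" where
  "h_b [] = []"
| "h_b (One # v) = One # h_a v"
| "h_b (Two # v) = Two # h_c v"
| "h_c [] = []"
| "h_c (One # v) = One # h_b v"
| "h_c (Two # v) = Two # h_b v"

definition GamHat :: "bin aut set" where
  "GamHat = gen_by {h_a, h_b, h_c}"

text \<open>Reflection in the line through \<open>p\<close> with normal vector \<open>n\<close>.\<close>

definition reflection :: "real \<times> real \<Rightarrow> real \<times> real \<Rightarrow> real \<times> real \<Rightarrow> real \<times> real" where
  "reflection p n q = q - (2 * ((q - p) \<bullet> n) / (n \<bullet> n)) *\<^sub>R n"

text \<open>The three lines are \<open>B'C'\<close>, \<open>A'C'\<close> and \<open>A'B'\<close>; these conditions determine the action on
  \<open>GamHat\<close>, and similarly for \<open>\<nu>\<close> on \<open>Gam\<close>.\<close>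

definition hat_act :: "real \<times> real \<Rightarrow> bin aut \<Rightarrow> real \<times> real" where
  "hat_act = (SOME act.
      (\<forall>q. act q id = q) \<and>
      (\<forall>q. \<forall>g\<in>GamHat. \<forall>h\<in>GamHat. act q (g \<circ> h) = act (act q g) h) \<and>
      (\<forall>q. act q h_a = reflection (0, 0) (1, 0) q) \<and>
      (\<forall>q. act q h_b = reflection (1, 0) (1, 1) q) \<and>
      (\<forall>q. act q h_c = reflection (0, 0) (0, 1) q))"

definition nu :: "letter aut \<Rightarrow> bin aut" where
  "nu = (SOME f. f \<in> hom ((BijGroup UNIV)\<lparr>carrier := Gam\<rparr>) ((BijGroup UNIV)\<lparr>carrier := GamHat\<rparr>) \<and>
      f g_al = id \<and> f g_be = id \<and> f g_ga = id \<and> f g_a = h_a \<and> f g_b = h_b \<and> f g_c = h_c)"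

fun mu_letter :: "letter \<Rightarrow> bin" where
  "mu_letter X1 = One" | "mu_letter X2 = One" | "mu_letter X3 = Two" | "mu_letter X4 = Two"

definition mu :: "letter list \<times> letter aut \<Rightarrow> bin list \<times> bin aut" where
  "mu = (\<lambda>(v, h). (map mu_letter v, nu h))"

fun P_vert :: "vertex \<Rightarrow> real \<times> real" where
  "P_vert VA = (1, 0)"
| "P_vert VA1 = (1, 0)"
| "P_vert VB = (0, 0)"
| "P_vert VB1 = (0, 0)"
| "P_vert VC = (0, 1)"
| "P_vert VC1 = (0, 1)"

definition P_map :: "xi \<Rightarrow> real \<times> real" where
  "P_map \<eta> = (THE q. \<exists>\<xi>\<in>T0. \<exists>g\<in>Gam. \<eta> = xi_act \<xi> g \<and> q = hat_act (affine_ext P_vert (emb \<xi>)) (nu g))"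

type_synonym hat_tensor = "(real \<times> real, bin) tensor"
type_synonym S_point = "hat_tensor set"

abbreviation XiHat_n :: "nat \<Rightarrow> hat_tensor set" where
  "XiHat_n n \<equiv> tensor_space GamHat hat_act UNIV n"

abbreviation XiHat_tensor :: "nat \<Rightarrow> real \<times> real \<Rightarrow> bin list \<times> bin aut \<Rightarrow> hat_tensor" where
  "XiHat_tensor n \<equiv> tensor_class GamHat hat_act UNIV n"

definition P_n :: "nat \<Rightarrow> (xi, letter) tensor \<Rightarrow> hat_tensor" where
  "P_n n t = (THE s. \<exists>\<xi>\<in>Xi. \<exists>m\<in>bimod Gam n. t = Xi_tensor n \<xi> m \<and> s = XiHat_tensor n (P_map \<xi>) (mu m))"

definition SS :: "nat \<Rightarrow> S_point set" where
  "SS n = tensor_orbit (nu ` IMG) ` XiHat_n n"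

definition rho :: "nat \<Rightarrow> M_point \<Rightarrow> S_point" where
  "rho n m = (THE s. \<exists>t\<in>Xi_n n. m = tensor_orbit IMG t \<and> s = tensor_orbit (nu ` IMG) (P_n n t))"

definition L_map :: "hat_tensor \<Rightarrow> real \<times> real" where
  "L_map t = (THE q. \<exists>\<xi>\<in>Xi. \<exists>m\<in>bimod Gam 1.
      t = XiHat_tensor 1 (P_map \<xi>) (mu m) \<and> q = P_map (I_map (Xi_tensor 1 \<xi> m)))"

definition L_n :: "nat \<Rightarrow> hat_tensor \<Rightarrow> hat_tensor" where
  "L_n n t = (THE s. \<exists>\<zeta> x v h. (v, h) \<in> bimod GamHat n \<and>
      t = XiHat_tensor (Suc n) \<zeta> (x # v, h) \<and>
      s = XiHat_tensor n (L_map (XiHat_tensor 1 \<zeta> ([x], id))) (v, h))"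

definition lam :: "nat \<Rightarrow> S_point \<Rightarrow> S_point" where
  "lam n s = (THE s'. \<exists>t\<in>XiHat_n (Suc n). s = tensor_orbit (nu ` IMG) t \<and>
      s' = tensor_orbit (nu ` IMG) (L_n n t))"

definition S_infinity :: "(nat \<Rightarrow> S_point) set" where
  "S_infinity = {\<zeta>. \<forall>n. \<zeta> n \<in> SS n \<and> lam n (\<zeta> (Suc n)) = \<zeta> n}"


section \<open>Fibers\<close>

definition fiber :: "nat \<Rightarrow> S_point \<Rightarrow> M_point set" where
  "fiber n \<zeta> = {m \<in> MM n. rho n m = \<zeta>}"

text \<open>Paths inside a fiber of \<open>rho n\<close> and their lengths: each step moves, inside a copy
  \<open>\<xi> \<mapsto> \<xi> \<otimes> v\<cdot>g\<close> of a fiber of \<open>P\<close> on \<open>T0\<close>, along one of the three segments of that fiber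
  (the intersection of the fiber with one tetrahedron).\<close>

inductive fiber_path :: "nat \<Rightarrow> M_point \<Rightarrow> M_point \<Rightarrow> real \<Rightarrow> bool" for n where
  refl: "m \<in> MM n \<Longrightarrow> fiber_path n m m 0"
| step: "fiber_path n m (tensor_orbit IMG (Xi_tensor n \<xi> w)) l \<Longrightarrow>
    w \<in> bimod Gam n \<Longrightarrow> \<xi> \<in> T0 \<Longrightarrow> \<xi>' \<in> T0 \<Longrightarrow> P_map \<xi> = P_map \<xi>' \<Longrightarrow>
    S \<in> tetrahedra \<Longrightarrow> {emb \<xi>, emb \<xi>'} \<subseteq> convex hull (vpos ` S) \<Longrightarrow>
    fiber_path n m (tensor_orbit IMG (Xi_tensor n \<xi>' w)) (l + dist (emb \<xi>) (emb \<xi>'))"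

definition fiber_dist :: "nat \<Rightarrow> M_point \<Rightarrow> M_point \<Rightarrow> real" where
  "fiber_dist n m m' = Inf {l. fiber_path n m m' l}"

text \<open>The marked fiber of \<open>rho 0\<close> over the image of the point \<open>(p, q)\<close> of the triangle \<open>A'B'C'\<close> moved
  by \<open>nu g\<close>; the choice of \<open>g\<close> accounts for the two copies of the triangle in \<open>SS 0\<close>.\<close>

definition fiber0_base :: "real \<Rightarrow> real \<Rightarrow> letter aut \<Rightarrow> S_point" where
  "fiber0_base p q g = tensor_orbit (nu ` IMG) (XiHat_tensor 0 (p, q) ([], nu g))"

definition fiber0 :: "real \<Rightarrow> real \<Rightarrow> letter aut \<Rightarrow> M_point mtree" where
  "fiber0 p q g = (let pt = (\<lambda>z. tensor_orbit IMG (Xi_tensor 0 (T0_point z) ([], g))) in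
     \<lparr>pts = fiber 0 (fiber0_base p q g),
      tdist = fiber_dist 0,
      Zal = pt (vec5 p q p 0 0),
      Zbe = pt (vec5 p q 0 (1 - p - q) 0),
      Zga = pt (vec5 p q 0 0 q)\<rparr>)"

definition fiber0_is_tripod :: "S_point \<Rightarrow> real \<times> real \<times> real \<Rightarrow> bool" where
  "fiber0_is_tripod \<zeta> = (\<lambda>(x1, x2, x3). 0 \<le> x1 \<and> 0 \<le> x2 \<and> 0 \<le> x3 \<and>
     (\<exists>p q. \<exists>g\<in>Gam. 0 \<le> p \<and> 0 \<le> q \<and> p + q \<le> 1 \<and> \<zeta> = fiber0_base p q g \<and>
        (\<exists>f. marked_isometry f (fiber0 p q g) (tripod (x1, x2, x3)))))"

end

theory Submission
  imports Defs
begin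

text \<open>The elements \<open>\<alpha>\<close>, \<open>\<beta>\<close>, \<open>\<gamma>\<close> generate a group on which \<open>\<nu>\<close> is trivial, and \<open>\<nu>\<close> maps \<open>\<Gamma>\<close> onto a group of
  plane isometries that has the triangle \<open>A'B'C'\<close> as a fundamental domain. Hence a point of a fiber of
  \<open>\<rho>\<^sub>n\<close> is given by a point of the tripod over one fixed point of the triangle and by a word lying over a
  fixed word \<open>u\<close> in \<open>{One, Two}\<close>. An orientation preserving element of the stabiliser of a face that moves a
  word inside a fiber of \<open>\<mu>\<close> acts on it like an element generated by those of \<open>\<alpha>\<close>, \<open>\<beta>\<close>, \<open>\<gamma>\<close> that lie in the
  stabiliser. So two copies of the tripod are glued precisely along \<open>Zal\<close>, \<open>Zbe\<close>, \<open>Zga\<close> whenever their words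
  are exchanged by \<open>\<alpha>\<close>, \<open>\<beta>\<close>, \<open>\<gamma>\<close>, respectively, and the wreath recursion of these three elements over the
  letters of \<open>u\<close> is the gluing rule of the operations \<open>Phi\<close>. The word \<open>u\<close> is the reversed itinerary since
  the branches of \<open>L\<close> invert \<open>FF\<close> on the triangle. Finally, \<open>Phi k (tripod (FF x))\<close> is a tripod with one
  additional branch, and \<open>I\<close> in barycentric coordinates collapses that branch and halves two legs.\<close>

section \<open>Groups of tree automorphisms\<close>

text \<open>The objects of the statement are given by choice or description: \<open>nu\<close> and
  \<open>hat_act\<close> by \<open>SOME\<close>, the positions and all maps on classes by
  \<open>THE\<close>. Each has to be evaluated before anything can be said about fibers. The
  delicate one is \<open>hat_act\<close>: every relation among \<open>h_a\<close>,
  \<open>h_b\<close>, \<open>h_c\<close> must hold for the three reflections, and no presentation of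
  the group is at hand. If two isometries belong to the same automorphism, then the scaled squared
  distance between their values at \<open>y0\<close> is an integer, and passing to sections shows
  that it is divisible by every power of two; so it vanishes. Orientation enters because
  \<open>IMG\<close> is the subgroup of index two of orientation preserving elements, and because a
  reflection may exchange two words with the same image under \<open>mu_letter\<close>, while
  rotations cannot. Levels are counted from opposite ends: passing to level n + 1 puts a new first
  letter on the words, but a new innermost operation \<open>Phi\<close> into the composition. Hence
  indices of copies occur reversed throughout.\<close>

definition involutive :: "'x aut set \<Rightarrow> bool" where
  "involutive H \<longleftrightarrow> (\<forall>s\<in>H. s \<circ> s = id)"

lemma BijGroup_UNIV_mult: "bij g \<Longrightarrow> bij h \<Longrightarrow> g \<otimes>\<^bsub>BijGroup UNIV\<^esub> h = g \<circ> h"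
  by (auto simp: BijGroup_def Bij_def compose_def fun_eq_iff)

lemma BijGroup_UNIV_carrier: "carrier (BijGroup UNIV) = {g. bij g}"
  by (auto simp: BijGroup_def Bij_def)

lemma BijGroup_UNIV_one: "\<one>\<^bsub>BijGroup UNIV\<^esub> = id"
  by (auto simp: BijGroup_def fun_eq_iff)

lemma involutive_bij: "involutive H \<Longrightarrow> s \<in> H \<Longrightarrow> bij s"
  using o_bij unfolding involutive_def by blast

lemma involutive_inv:
  assumes "involutive H" "s \<in> H"
  shows "inv\<^bsub>BijGroup UNIV\<^esub> s = s"
  by (rule group.inv_equality[OF group_BijGroup])
    (use assms involutive_bij[OF assms] in
      \<open>auto simp: BijGroup_UNIV_mult BijGroup_UNIV_carrier BijGroup_UNIV_one involutive_def\<close>)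

lemma gen_by_bij: "involutive H \<Longrightarrow> g \<in> gen_by H \<Longrightarrow> bij g"
  using group.generate_in_carrier[OF group_BijGroup, of H UNIV g] involutive_bij
  by (fastforce simp: BijGroup_UNIV_carrier)

lemma gen_by_id: "id \<in> gen_by H"
  using generate.one[of "BijGroup UNIV" H] by (simp add: BijGroup_UNIV_one)

lemma gen_by_incl: "s \<in> H \<Longrightarrow> s \<in> gen_by H"
  by (rule generate.incl)

lemma gen_by_comp:
  assumes "involutive H" "g \<in> gen_by H" "h \<in> gen_by H"
  shows "g \<circ> h \<in> gen_by H"
  using generate.eng[OF assms(2,3)] gen_by_bij[OF assms(1)] assms(2,3)
  by (simp add: BijGroup_UNIV_mult)

text \<open>Generators that are involutions need no inverses, so left multiplication by them reaches
  the whole group. Since \<open>generate\<close> builds products of two arbitrary elements, the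
  induction is run on the statement that left multiplication by \<open>g\<close> preserves
  \<open>P\<close> on the group.\<close>

lemma gen_by_induct [consumes 2, case_names one step]:
  assumes "involutive H" "g \<in> gen_by H" "P id"
    and step: "\<And>s g. s \<in> H \<Longrightarrow> g \<in> gen_by H \<Longrightarrow> P g \<Longrightarrow> P (s \<circ> g)"
  shows "P g"
proof -
  have "\<forall>h\<in>gen_by H. P h \<longrightarrow> P (g \<circ> h)"
    using assms(2)
  proof (induction rule: generate.induct)
    case one
    then show ?case by (simp add: BijGroup_UNIV_one)
  next
    case (incl h)
    then show ?case using step by blast
  next
    case (inv h)
    show ?case
      unfolding involutive_inv[OF assms(1) inv] using step inv by blast
  next
    case (eng h1 h2)
    have "h1 \<otimes>\<^bsub>BijGroup UNIV\<^esub> h2 = h1 \<circ> h2"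
      using eng gen_by_bij[OF assms(1)] by (simp add: BijGroup_UNIV_mult)
    then show ?case
      using eng(3,4) gen_by_comp[OF assms(1) eng(2)] by (metis comp_assoc)
  qed
  then show ?thesis using assms(3) gen_by_id by force
qed

lemma gen_by_inverse:
  assumes "involutive H" "g \<in> gen_by H"
  shows "\<exists>g'\<in>gen_by H. g \<circ> g' = id \<and> g' \<circ> g = id"
  using assms
proof (induction rule: gen_by_induct)
  case one
  have "id \<circ> id = id" by simp
  then show ?case using gen_by_id by blast
next
  case (step s g)
  then obtain g' where g': "g' \<in> gen_by H" "g \<circ> g' = id" "g' \<circ> g = id" by blast
  have ss: "s \<circ> s = id" using step assms by (simp add: involutive_def)
  have "s \<circ> g \<circ> (g' \<circ> s) = s \<circ> (g \<circ> g') \<circ> s" "g' \<circ> s \<circ> (s \<circ> g) = g' \<circ> (s \<circ> s) \<circ> g"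
    by (simp_all add: comp_assoc)
  then have "s \<circ> g \<circ> (g' \<circ> s) = id" "g' \<circ> s \<circ> (s \<circ> g) = id"
    using g' ss by simp_all
  then show ?case
    using gen_by_comp[OF assms(1) g'(1) gen_by_incl[OF step(1)]] by blast
qed

lemma gen_by_least:
  assumes "involutive H" "H \<subseteq> G" "id \<in> G" "\<And>g h. g \<in> G \<Longrightarrow> h \<in> G \<Longrightarrow> g \<circ> h \<in> G"
  shows "gen_by H \<subseteq> G"
proof
  fix g assume "g \<in> gen_by H"
  with assms(1) show "g \<in> G"
  proof (induction rule: gen_by_induct)
    case one
    show ?case by (rule assms(3))
  next
    case (step s g)
    then show ?case by (blast intro: assms(4) subsetD[OF assms(2)])
  qed
qed

text \<open>Both \<open>Gam\<close> and \<open>GamHat\<close> are interpreted here, so that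
  sections, tensor products and orbits are treated only once.\<close>

locale ssgroup =
  fixes G :: "'x aut set"
  assumes id_in: "id \<in> G"
    and comp_in: "g \<in> G \<Longrightarrow> h \<in> G \<Longrightarrow> g \<circ> h \<in> G"
    and inv_ex: "g \<in> G \<Longrightarrow> \<exists>g'\<in>G. g \<circ> g' = id \<and> g' \<circ> g = id"
    and len [simp]: "g \<in> G \<Longrightarrow> length (g v) = length v"
    and app: "g \<in> G \<Longrightarrow> g (v @ w) = g v @ sect g v w"
    and sect_in: "g \<in> G \<Longrightarrow> sect g v \<in> G"
begin

lemma sect_comp: "g \<in> G \<Longrightarrow> h \<in> G \<Longrightarrow> sect (g \<circ> h) v = sect g (h v) \<circ> sect h v"
  by (rule ext, subst sect_def) (simp add: app)

lemma app_Nil [simp]: "g \<in> G \<Longrightarrow> g [] = []"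
  using len[of g "[]"] by (simp del: len)

lemma bij_in: "g \<in> G \<Longrightarrow> bij g"
  using inv_ex o_bij by blast

lemma app_Cons: "g \<in> G \<Longrightarrow> g (x # w) = hd (g [x]) # sect g [x] w"
  using app[of g "[x]" w] len[of g "[x]"] by (cases "g [x]") auto

lemma app_single: "g \<in> G \<Longrightarrow> g [x] = [hd (g [x])]"
  using app_Cons[of g x "[]"] sect_in by simp

lemma sect_app: "g \<in> G \<Longrightarrow> sect g (v @ w) = sect (sect g v) w"
  by (rule ext, subst (1 2) sect_def) (simp add: app sect_in)

lemma sect_Cons: "g \<in> G \<Longrightarrow> sect g (x # w) = sect (sect g [x]) w"
  using sect_app[of g "[x]" w] by simp

end

lemma sect_id [simp]: "sect id v = id"
  by (auto simp: sect_def)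

lemma sect_Nil [simp]: "sect g [] = g"
  by (auto simp: sect_def)

text \<open>Self-similarity needs checking on generators and single letters only: images of first
  letters and sections compose along a product, and induction on the word extends this to arbitrary
  prefixes.\<close>

lemma ssgroup_gen_by:
  fixes H :: "'x aut set"
  assumes inv: "involutive H"
    and nil: "\<And>s. s \<in> H \<Longrightarrow> s [] = []"
    and cons: "\<And>s x. s \<in> H \<Longrightarrow> \<exists>y. \<exists>t\<in>gen_by H. \<forall>v. s (x # v) = y # t v"
  shows "ssgroup (gen_by H)"
proof -
  have nil': "g [] = []" if "g \<in> gen_by H" for g
    using inv that
  proof (induction rule: gen_by_induct)
    case one
    show ?case by simp
  next
    case (step s g)
    then show ?case using nil[of s] by simp
  qed
  have cons': "\<exists>y. \<exists>t\<in>gen_by H. \<forall>v. g (x # v) = y # t v" if "g \<in> gen_by H" for g x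
    using inv that
  proof (induction arbitrary: x rule: gen_by_induct)
    case one
    show ?case using gen_by_id[of H] by (metis id_apply)
  next
    case (step s g)
    from step(3)[of x] obtain y t where yt: "t \<in> gen_by H" "\<forall>v. g (x # v) = y # t v" by blast
    from cons[OF step(1), of y] obtain z u where zu: "u \<in> gen_by H" "\<forall>v. s (y # v) = z # u v"
      by blast
    show ?case
      using yt zu gen_by_comp[OF inv zu(1) yt(1)] by (intro exI[of _ z] bexI[of _ "u \<circ> t"]) auto
  qed
  have len: "length (g v) = length v" if "g \<in> gen_by H" for g v
    using that
  proof (induction v arbitrary: g)
    case Nil
    then show ?case using nil' by simp
  next
    case (Cons x v)
    with cons'[OF Cons(2), of x] show ?case by fastforce
  qed
  have app: "\<exists>t\<in>gen_by H. \<forall>w. g (v @ w) = g v @ t w" if "g \<in> gen_by H" for g v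
    using that
  proof (induction v arbitrary: g)
    case Nil
    then show ?case using nil' by (intro bexI[of _ g]) auto
  next
    case (Cons x v)
    from cons'[OF Cons(2), of x] obtain y t where yt: "t \<in> gen_by H" "\<forall>v. g (x # v) = y # t v"
      by blast
    from Cons(1)[OF yt(1)] show ?case using yt by auto
  qed
  have sect: "sect g v \<in> gen_by H \<and> (\<forall>w. g (v @ w) = g v @ sect g v w)" if "g \<in> gen_by H" for g v
  proof -
    from app[OF that, of v] obtain t where t: "t \<in> gen_by H" "\<forall>w. g (v @ w) = g v @ t w" by blast
    then have "sect g v = t" using len[OF that, of v] by (auto simp: sect_def fun_eq_iff)
    then show ?thesis using t by simp
  qed
  show ?thesis
    by unfold_locales
      (use gen_by_id gen_by_comp[OF inv] gen_by_inverse[OF inv] len sect in auto)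
qed

section \<open>Tensor products\<close>

locale ssaction = ssgroup G for G :: "'x aut set" +
  fixes act :: "'s \<Rightarrow> 'x aut \<Rightarrow> 's" and S :: "'s set"
  assumes act_id: "\<xi> \<in> S \<Longrightarrow> act \<xi> id = \<xi>"
    and act_comp: "\<xi> \<in> S \<Longrightarrow> g \<in> G \<Longrightarrow> h \<in> G \<Longrightarrow> act \<xi> (g \<circ> h) = act (act \<xi> g) h"
    and act_in: "\<xi> \<in> S \<Longrightarrow> g \<in> G \<Longrightarrow> act \<xi> g \<in> S"
begin

lemma bimod_lact_in: "g \<in> G \<Longrightarrow> m \<in> bimod G n \<Longrightarrow> bimod_lact g m \<in> bimod G n"
  by (auto simp: bimod_def bimod_lact_def comp_in sect_in)

lemma bimod_lact_comp:
  "g \<in> G \<Longrightarrow> h \<in> G \<Longrightarrow> bimod_lact (g \<circ> h) m = bimod_lact g (bimod_lact h m)"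
  by (cases m) (auto simp: bimod_lact_def sect_comp comp_assoc)

lemma bimod_lact_id [simp]: "bimod_lact id m = m"
  by (cases m) (auto simp: bimod_lact_def)

lemma tensor_rel_iff:
  "((\<xi>, m), (\<xi>', m')) \<in> tensor_rel G act S n \<longleftrightarrow>
     \<xi>' \<in> S \<and> m \<in> bimod G n \<and> (\<exists>g\<in>G. act \<xi>' g = \<xi> \<and> m' = bimod_lact g m)"
  by (cases m) (force simp: tensor_rel_def)

lemma act_inverse:
  assumes "\<xi> \<in> S" "g \<in> G" "g' \<in> G" "g \<circ> g' = id"
  shows "act (act \<xi> g) g' = \<xi>"
  using act_comp[OF assms(1-3)] assms act_id by simp

text \<open>The defining relation is the orbit relation of the action of \<open>G\<close> on pairs
  that sends (\<xi>, m) to (\<xi> g^-1, g m). This is why it is an equivalence without passing to a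
  closure.\<close>

lemma equiv_tensor_rel: "equiv (S \<times> bimod G n) (tensor_rel G act S n)"
proof (rule equivI)
  show "tensor_rel G act S n \<subseteq> (S \<times> bimod G n) \<times> (S \<times> bimod G n)"
    by (auto simp: tensor_rel_def act_in bimod_lact_in)
  show "refl_on (S \<times> bimod G n) (tensor_rel G act S n)"
    using act_id id_in by (auto simp: refl_on_def tensor_rel_iff intro!: bexI[of _ id])
  show "sym (tensor_rel G act S n)"
  proof (rule symI)
    fix a b assume ab: "(a, b) \<in> tensor_rel G act S n"
    obtain \<xi> m \<xi>' m' where eq: "a = (\<xi>, m)" "b = (\<xi>', m')" by (cases a, cases b)
    from ab obtain g where g: "\<xi>' \<in> S" "m \<in> bimod G n" "g \<in> G" "act \<xi>' g = \<xi>" "m' = bimod_lact g m"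
      by (auto simp: eq tensor_rel_iff)
    obtain g' where g': "g' \<in> G" "g \<circ> g' = id" "g' \<circ> g = id" using inv_ex g by blast
    have "act \<xi> g' = \<xi>'" using act_inverse[OF g(1,3) g'(1,2)] g by simp
    moreover have "bimod_lact g' m' = m" using g g' by (simp flip: bimod_lact_comp)
    ultimately show "(b, a) \<in> tensor_rel G act S n"
      using g g' act_in[OF g(1,3)]
      by (auto simp: eq tensor_rel_iff bimod_lact_in intro!: bexI[of _ g'])
  qed
  show "trans (tensor_rel G act S n)"
  proof (rule transI)
    fix a b c assume ab: "(a, b) \<in> tensor_rel G act S n" and bc: "(b, c) \<in> tensor_rel G act S n"
    obtain \<xi> m \<xi>' m' \<xi>'' m'' where eq: "a = (\<xi>, m)" "b = (\<xi>', m')" "c = (\<xi>'', m'')"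
      by (cases a, cases b, cases c)
    from ab obtain g where g: "\<xi>' \<in> S" "m \<in> bimod G n" "g \<in> G" "act \<xi>' g = \<xi>" "m' = bimod_lact g m"
      by (auto simp: eq tensor_rel_iff)
    from bc obtain h where h: "\<xi>'' \<in> S" "h \<in> G" "act \<xi>'' h = \<xi>'" "m'' = bimod_lact h m'"
      by (auto simp: eq tensor_rel_iff)
    show "(a, c) \<in> tensor_rel G act S n"
      using g h by (auto simp: eq tensor_rel_iff act_comp bimod_lact_comp comp_in intro!: bexI[of _ "h \<circ> g"])
  qed
qed

lemma tensor_class_eq_iff:
  assumes "\<xi> \<in> S" "\<xi>' \<in> S" "m \<in> bimod G n" "m' \<in> bimod G n"
  shows "tensor_class G act S n \<xi> m = tensor_class G act S n \<xi>' m' \<longleftrightarrow>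
    (\<exists>g\<in>G. act \<xi>' g = \<xi> \<and> m' = bimod_lact g m)"
  unfolding tensor_class_def
  using eq_equiv_class_iff[OF equiv_tensor_rel, of "(\<xi>, m)" n "(\<xi>', m')"] assms
  by (auto simp: tensor_rel_iff)

lemma tensor_class_act:
  assumes "\<xi> \<in> S" "g \<in> G" "m \<in> bimod G n"
  shows "tensor_class G act S n (act \<xi> g) m = tensor_class G act S n \<xi> (bimod_lact g m)"
  using assms by (subst tensor_class_eq_iff) (auto simp: act_in bimod_lact_in)

lemma tensor_space_iff:
  "t \<in> tensor_space G act S n \<longleftrightarrow>
    (\<exists>\<xi>\<in>S. \<exists>v h. length v = n \<and> h \<in> G \<and> t = tensor_class G act S n \<xi> (v, h))"
  by (auto simp: tensor_space_def tensor_class_def quotient_def bimod_def)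

lemma tensor_ract_class:
  assumes "\<xi> \<in> S" "h \<in> G" "length v = n" "k \<in> G"
  shows "tensor_ract (tensor_class G act S n \<xi> (v, h)) k = tensor_class G act S n \<xi> (v, h \<circ> k)"
proof -
  have *: "tensor_class G act S n \<xi> (v, h) =
      {(\<xi>', g v, sect g v \<circ> h) | \<xi>' g. \<xi>' \<in> S \<and> g \<in> G \<and> act \<xi>' g = \<xi>}" if "h \<in> G" for h
    using that assms(3)
    by (auto simp: tensor_class_def tensor_rel_def bimod_def bimod_lact_def)
  show ?thesis
    unfolding *[OF assms(2)] *[OF comp_in[OF assms(2,4)]] tensor_ract_def
    by (force simp: comp_assoc)
qed

text \<open>Equality in the quotient is reduced to two group elements: \<open>g\<close> is carried
  across the tensor sign and \<open>k\<close> acts from the right. Computations in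
  \<open>MM n\<close> and \<open>SS n\<close> go through this criterion.\<close>

lemma tensor_orbit_eq_iff:
  assumes K: "K \<subseteq> G" "id \<in> K" "\<And>k k'. k \<in> K \<Longrightarrow> k' \<in> K \<Longrightarrow> k \<circ> k' \<in> K"
      "\<And>k. k \<in> K \<Longrightarrow> \<exists>k'\<in>K. k \<circ> k' = id \<and> k' \<circ> k = id"
    and "\<xi> \<in> S" "\<xi>' \<in> S" "h \<in> G" "h' \<in> G" "length v = n" "length v' = n"
  shows "tensor_orbit K (tensor_class G act S n \<xi> (v, h)) =
      tensor_orbit K (tensor_class G act S n \<xi>' (v', h')) \<longleftrightarrow>
    (\<exists>g\<in>G. \<exists>k\<in>K. act \<xi>' g = \<xi> \<and> v' = g v \<and> h' = sect g v \<circ> h \<circ> k)"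
    (is "?L = ?R \<longleftrightarrow> ?Q")
proof -
  have orb: "tensor_orbit K (tensor_class G act S n \<xi> (v, h)) =
      {tensor_class G act S n \<xi> (v, h \<circ> k) | k. k \<in> K}"
    if "\<xi> \<in> S" "h \<in> G" "length v = n" for \<xi> v h
    using tensor_ract_class[OF that] K(1) by (auto simp: tensor_orbit_def)
  show ?thesis
  proof
    assume "?L = ?R"
    then have "{tensor_class G act S n \<xi> (v, h \<circ> k) | k. k \<in> K} =
        {tensor_class G act S n \<xi>' (v', h' \<circ> k) | k. k \<in> K}"
      using orb assms by simp
    moreover have "tensor_class G act S n \<xi>' (v', h') \<in> {tensor_class G act S n \<xi>' (v', h' \<circ> k) | k. k \<in> K}"
      using K(2) by force
    ultimately obtain k where k: "k \<in> K"
      "tensor_class G act S n \<xi>' (v', h') = tensor_class G act S n \<xi> (v, h \<circ> k)"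
      by blast
    from k(2)[symmetric] show ?Q
      using assms k(1) comp_in K(1)
      by (subst (asm) tensor_class_eq_iff) (auto simp: bimod_def bimod_lact_def comp_assoc subset_iff)
  next
    assume ?Q
    then obtain g k where gk: "g \<in> G" "k \<in> K" "act \<xi>' g = \<xi>" "v' = g v" "h' = sect g v \<circ> h \<circ> k"
      by blast
    obtain k' where k': "k' \<in> K" "k \<circ> k' = id" "k' \<circ> k = id" using K(4) gk by blast
    have kG: "k \<in> G" "k' \<in> G" using gk k' K(1) by auto
    have eq: "tensor_class G act S n \<xi>' (v', h') = tensor_class G act S n \<xi> (v, h \<circ> k)"
      using gk assms kG comp_in
      by (subst eq_commute, subst tensor_class_eq_iff) (auto simp: bimod_def bimod_lact_def comp_assoc)
    have "tensor_orbit K (tensor_class G act S n \<xi> (v, h \<circ> k)) =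
        {tensor_class G act S n \<xi> (v, h \<circ> (k \<circ> j)) | j. j \<in> K}"
      using orb[of \<xi> "h \<circ> k" v] comp_in kG assms by (simp add: comp_assoc)
    also have "\<dots> = {tensor_class G act S n \<xi> (v, h \<circ> j) | j. j \<in> K}"
    proof -
      \<comment> \<open>The factor \<open>k\<close> is absorbed because left multiplication by it
        permutes the subgroup \<open>K\<close>.\<close>
      have "j \<in> (\<lambda>j. k \<circ> j) ` K" if "j \<in> K" for j
      proof -
        have "k \<circ> (k' \<circ> j) = j" by (simp add: k'(2) flip: comp_assoc)
        then show ?thesis using K(3)[OF k'(1) that] by (metis image_eqI)
      qed
      then have "(\<lambda>j. k \<circ> j) ` K = K" using K(3)[OF gk(2)] by blast
      then have "(\<lambda>j. tensor_class G act S n \<xi> (v, h \<circ> j)) ` ((\<lambda>j. k \<circ> j) ` K) =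
          (\<lambda>j. tensor_class G act S n \<xi> (v, h \<circ> j)) ` K" by (rule arg_cong)
      then show ?thesis unfolding image_image Setcompr_eq_image .
    qed
    finally show "?L = ?R" using orb assms eq by simp
  qed
qed

end

section \<open>The reflection group\<close>

lemma h_simps [simp]:
  "h_a (h_a v) = v" "h_b (h_b v) = v" "h_c (h_c v) = v"
proof -
  show a: "h_a (h_a v) = v" for v
    by (cases v) (auto, metis swap.elims swap.simps)
  have "h_b (h_b v) = v \<and> h_c (h_c v) = v" for v
  proof (induction "length v" arbitrary: v rule: less_induct)
    case less
    show ?case
    proof (cases v)
      case (Cons x w)
      with less[of w] a show ?thesis by (cases x) auto
    qed simp
  qed
  then show "h_b (h_b v) = v" "h_c (h_c v) = v" for v by auto
qed

lemma involutive_hat: "involutive {h_a, h_b, h_c}"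
  by (auto simp: involutive_def)

lemma GamHat_gens [simp]: "h_a \<in> GamHat" "h_b \<in> GamHat" "h_c \<in> GamHat"
  by (auto simp: GamHat_def intro: gen_by_incl)

interpretation hat: ssgroup GamHat
  unfolding GamHat_def
proof (rule ssgroup_gen_by[OF involutive_hat])
  fix s :: "bin aut" and x
  assume s: "s \<in> {h_a, h_b, h_c}"
  then show "s [] = []" by auto
  have "\<exists>y. \<exists>t\<in>{id, h_a, h_b, h_c}. \<forall>v. s (x # v) = y # t v"
    using s by (cases x) auto
  moreover have "{id, h_a, h_b, h_c} \<subseteq> gen_by {h_a, h_b, h_c}"
    using gen_by_id by (auto intro: gen_by_incl)
  ultimately show "\<exists>y. \<exists>t\<in>gen_by {h_a, h_b, h_c}. \<forall>v. s (x # v) = y # t v"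
    by (meson subsetD)
qed

lemma sect_hat [simp]:
  "sect h_a [x] = id"
  "sect h_b [One] = h_a" "sect h_b [Two] = h_c" "sect h_c [x] = h_b"
  by (cases x; auto simp: sect_def fun_eq_iff)+

text \<open>\<open>wi t e d i j\<close> is the signed permutation with signs \<open>e\<close> and \<open>d\<close> (exchanging the coordinates if
  \<open>t\<close> holds) followed by a translation; the parity of the translation is tied to \<open>t\<close>.\<close>

definition wi :: "bool \<Rightarrow> int \<Rightarrow> int \<Rightarrow> int \<Rightarrow> int \<Rightarrow> real \<times> real \<Rightarrow> real \<times> real" where
  "wi t e d i j = (\<lambda>(x, y).
     if t then (of_int e * y + of_int (2 * i + 1), of_int d * x + of_int (2 * j + 1))
     else (of_int e * x + of_int (2 * i), of_int d * y + of_int (2 * j)))"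

definition W :: "(real \<times> real \<Rightarrow> real \<times> real) set" where
  "W = {wi t e d i j | t e d i j. e \<in> {1, -1} \<and> d \<in> {1, -1}}"

definition ra :: "real \<times> real \<Rightarrow> real \<times> real" where "ra = (\<lambda>(x, y). (- x, y))"
definition rb :: "real \<times> real \<Rightarrow> real \<times> real" where "rb = (\<lambda>(x, y). (1 - y, 1 - x))"
definition rc :: "real \<times> real \<Rightarrow> real \<times> real" where "rc = (\<lambda>(x, y). (x, - y))"

lemmas r_defs = ra_def rb_def rc_def

lemma reflection_eq:
  "reflection (0, 0) (1, 0) = ra" "reflection (1, 0) (1, 1) = rb" "reflection (0, 0) (0, 1) = rc"
  by (auto simp: reflection_def r_defs fun_eq_iff inner_prod_def scaleR_prod_def field_simps)

lemma W_cases: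
  assumes "\<phi> \<in> W"
  obtains t e d i j where "e \<in> {1, -1}" "d \<in> {1, -1}" "\<phi> = wi t e d i j"
  using assms unfolding W_def by blast

lemma id_in_W: "id \<in> W"
proof -
  have "id = wi False 1 1 0 0" by (auto simp: wi_def)
  then show ?thesis unfolding W_def by blast
qed

lemma W_ra: "\<phi> \<in> W \<Longrightarrow> \<phi> \<circ> ra \<in> W"
proof (elim W_cases)
  fix t e d i j assume "e \<in> {1, -1}" "d \<in> {1, -1}" "\<phi> = wi t e d i j"
  moreover have "wi t e d i j \<circ> ra = (if t then wi t e (- d) i j else wi t (- e) d i j)"
    by (auto simp: wi_def ra_def)
  ultimately show ?thesis unfolding W_def by fastforce
qed

lemma W_rc: "\<phi> \<in> W \<Longrightarrow> \<phi> \<circ> rc \<in> W"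
proof (elim W_cases)
  fix t e d i j assume "e \<in> {1, -1}" "d \<in> {1, -1}" "\<phi> = wi t e d i j"
  moreover have "wi t e d i j \<circ> rc = (if t then wi t (- e) d i j else wi t e (- d) i j)"
    by (auto simp: wi_def rc_def)
  ultimately show ?thesis unfolding W_def by fastforce
qed

lemma W_rb: "\<phi> \<in> W \<Longrightarrow> \<phi> \<circ> rb \<in> W"
proof (elim W_cases)
  fix t e d i j assume ed: "e \<in> {1, -1}" "d \<in> {1, -1}" and \<phi>: "\<phi> = wi t e d i j"
  \<comment> \<open>The constants 1 in \<open>rb\<close> contribute \<open>e\<close> and
    \<open>d\<close> to the translation and so switch its parity; written in the other normal form,
    each index shifts for exactly one of the two signs.\<close>
  have "wi t e d i j \<circ> rb =
    (if t then wi False (- e) (- d) (i + (if e = 1 then 1 else 0)) (j + (if d = 1 then 1 else 0))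
     else wi True (- e) (- d) (i + (if e = 1 then 0 else - 1)) (j + (if d = 1 then 0 else - 1)))"
    using ed by (auto simp: wi_def rb_def algebra_simps)
  then have "\<exists>t' i' j'. \<phi> \<circ> rb = wi t' (- e) (- d) i' j'"
    unfolding \<phi> by (cases t) (simp_all only: if_True if_False, blast+)
  then show ?thesis using ed unfolding W_def by fastforce
qed

text \<open>The graph of the action, kept as a relation because nothing yet excludes that an
  identity between words in \<open>h_a\<close>, \<open>h_b\<close>, \<open>h_c\<close> fails for the
  reflections. Single-valuedness is \<open>hatrel_unique\<close>, injectivity follows from
  \<open>hatrel_faithful\<close>. The new reflection is composed on the right since a right action
  reverses products.\<close>

inductive hatrel :: "bin aut \<Rightarrow> (real \<times> real \<Rightarrow> real \<times> real) \<Rightarrow> bool" where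
  one: "hatrel id id"
| a: "hatrel g \<phi> \<Longrightarrow> hatrel (h_a \<circ> g) (\<phi> \<circ> ra)"
| b: "hatrel g \<phi> \<Longrightarrow> hatrel (h_b \<circ> g) (\<phi> \<circ> rb)"
| c: "hatrel g \<phi> \<Longrightarrow> hatrel (h_c \<circ> g) (\<phi> \<circ> rc)"

lemma hatrel_in: "hatrel g \<phi> \<Longrightarrow> g \<in> GamHat \<and> \<phi> \<in> W"
  by (induction rule: hatrel.induct)
    (use hat.id_in id_in_W W_ra W_rb W_rc hat.comp_in GamHat_gens in blast)+

lemma hatrel_ex: "g \<in> GamHat \<Longrightarrow> \<exists>\<phi>. hatrel g \<phi>"
  unfolding GamHat_def
proof (rule gen_by_induct[OF involutive_hat, where P = "\<lambda>g. \<exists>\<phi>. hatrel g \<phi>"])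
  fix s g assume "s \<in> {h_a, h_b, h_c}" "\<exists>\<phi>. hatrel g \<phi>"
  then show "\<exists>\<phi>. hatrel (s \<circ> g) \<phi>" using hatrel.intros by blast
qed (use hatrel.one in auto)

lemma hatrel_comp:
  assumes "hatrel g \<phi>" "hatrel h \<psi>"
  shows "hatrel (g \<circ> h) (\<psi> \<circ> \<phi>)"
  using assms(1)
proof (induction rule: hatrel.induct)
  case one
  show ?case using assms(2) by (metis comp_id id_comp)
qed (use hatrel.intros in \<open>metis comp_assoc\<close>)+

text \<open>These similarities of ratio 1/sqrt 2 map the triangle onto the two halves into which the
  altitude from B' divides it; \<open>L_map_eq\<close> expresses \<open>L_map\<close> by
  them.\<close>

definition LL :: "bin \<Rightarrow> real \<times> real \<Rightarrow> real \<times> real" where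
  "LL x = (\<lambda>(p, q). if x = One then (1/2 - p/2 - q/2, 1/2 + p/2 - q/2)
                    else (1/2 + p/2 - q/2, 1/2 - p/2 - q/2))"

text \<open>The recursion of a, b, c read geometrically: a exchanges the two halves, b restricts to
  a on one and to c on the other, and c restricts to b on both.\<close>

lemma LL_r:
  "LL x (ra y) = LL (swap x) y" "LL One (rb y) = ra (LL One y)" "LL Two (rb y) = rc (LL Two y)"
  "LL x (rc y) = rb (LL x y)"
  by (cases y; cases x; simp add: LL_def r_defs field_simps)+

text \<open>The bridge between combinatorics and geometry: passing to a section is conjugation by
  the contractions \<open>LL\<close>. Both the uniqueness and the faithfulness of the action rest on
  it.\<close>

lemma hatrel_sect:
  assumes "hatrel g \<phi>"
  shows "\<exists>\<phi>'. hatrel (sect g [x]) \<phi>' \<and> (\<forall>y. LL x (\<phi> y) = \<phi>' (LL (hd (g [x])) y))"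
  using assms
proof (induction rule: hatrel.induct)
  case one
  have "hatrel (sect id [x]) id \<and> (\<forall>y. LL x (id y) = id (LL (hd (id [x])) y))"
    using hatrel.one by simp
  then show ?case by blast
next
  case (a g \<phi>)
  then obtain \<phi>' where \<phi>': "hatrel (sect g [x]) \<phi>'" "\<forall>y. LL x (\<phi> y) = \<phi>' (LL (hd (g [x])) y)"
    by blast
  have g: "g \<in> GamHat" using hatrel_in a by blast
  obtain z where z: "g [x] = [z]" using hat.app_single[OF g] by blast
  have s: "sect (h_a \<circ> g) [x] = sect g [x]" using hat.sect_comp[OF GamHat_gens(1) g, of "[x]"] z by simp
  have "LL x ((\<phi> \<circ> ra) y) = \<phi>' (LL (hd ((h_a \<circ> g) [x])) y)" for y
    using \<phi>'(2)[rule_format, of "ra y"] z by (simp add: LL_r)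
  then show ?case unfolding s using \<phi>'(1) by blast
next
  case (b g \<phi>)
  then obtain \<phi>' where \<phi>': "hatrel (sect g [x]) \<phi>'" "\<forall>y. LL x (\<phi> y) = \<phi>' (LL (hd (g [x])) y)"
    by blast
  have g: "g \<in> GamHat" using hatrel_in b by blast
  obtain z where z: "g [x] = [z]" using hat.app_single[OF g] by blast
  show ?case
  proof (cases z)
    case One
    have s: "sect (h_b \<circ> g) [x] = h_a \<circ> sect g [x]"
      using hat.sect_comp[OF GamHat_gens(2) g, of "[x]"] z One by simp
    have "LL x ((\<phi> \<circ> rb) y) = (\<phi>' \<circ> ra) (LL (hd ((h_b \<circ> g) [x])) y)" for y
      using \<phi>'(2)[rule_format, of "rb y"] z One by (simp add: LL_r)
    then show ?thesis unfolding s using hatrel.a[OF \<phi>'(1)] by blast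
  next
    case Two
    have s: "sect (h_b \<circ> g) [x] = h_c \<circ> sect g [x]"
      using hat.sect_comp[OF GamHat_gens(2) g, of "[x]"] z Two by simp
    have "LL x ((\<phi> \<circ> rb) y) = (\<phi>' \<circ> rc) (LL (hd ((h_b \<circ> g) [x])) y)" for y
      using \<phi>'(2)[rule_format, of "rb y"] z Two by (simp add: LL_r)
    then show ?thesis unfolding s using hatrel.c[OF \<phi>'(1)] by blast
  qed
next
  case (c g \<phi>)
  then obtain \<phi>' where \<phi>': "hatrel (sect g [x]) \<phi>'" "\<forall>y. LL x (\<phi> y) = \<phi>' (LL (hd (g [x])) y)"
    by blast
  have g: "g \<in> GamHat" using hatrel_in c by blast
  obtain z where z: "g [x] = [z]" using hat.app_single[OF g] by blast
  have s: "sect (h_c \<circ> g) [x] = h_b \<circ> sect g [x]"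
    using hat.sect_comp[OF GamHat_gens(3) g, of "[x]"] z by simp
  have "LL x ((\<phi> \<circ> rc) y) = (\<phi>' \<circ> rb) (LL (hd ((h_c \<circ> g) [x])) y)" for y
    using \<phi>'(2)[rule_format, of "rc y"] z by (cases z) (simp_all add: LL_r)
  then show ?case unfolding s using hatrel.b[OF \<phi>'(1)] by blast
qed

section \<open>The triangle as a strict fundamental domain\<close>

definition DD :: "(real \<times> real) set" where
  "DD = {(p, q). 0 \<le> p \<and> 0 \<le> q \<and> p + q \<le> 1}"

lemma W_fundamental:
  assumes "\<phi> \<in> W" "y \<in> DD" "\<phi> y \<in> DD"
  shows "\<phi> y = y"
proof -
  obtain p q where y: "y = (p, q)" by fastforce
  from assms(1) obtain t e d i j where w: "e \<in> {1, -1}" "d \<in> {1, -1}" "\<phi> = wi t e d i j"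
    by (rule W_cases)
  have pq: "0 \<le> p" "0 \<le> q" "p + q \<le> 1" using assms(2) by (auto simp: y DD_def)
  have ed: "e = 1 \<or> e = -1" "d = 1 \<or> d = -1" using w by auto
  show ?thesis
  proof (cases t)
    case False
    define a b where "a = of_int e * p + 2 * of_int i" and "b = of_int d * q + 2 * of_int j"
    have \<phi>: "\<phi> y = (a, b)" using False w by (simp add: y wi_def a_def b_def)
    have A: "0 \<le> a" "0 \<le> b" "a + b \<le> 1" using assms(3) by (auto simp: \<phi> DD_def)
    \<comment> \<open>The triangle lies in the unit square, so only finitely many translations can
      bring one of its points back into it.\<close>
    have "(i = 0 \<or> i = 1) \<and> (j = 0 \<or> j = 1)"
      using ed A pq by (auto simp: a_def b_def)
    then have "(i = 0 \<or> i = 1)" "(j = 0 \<or> j = 1)" by auto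
    then have "a = p" "b = q"
      using ed A pq by (elim disjE; simp add: a_def b_def; linarith)+
    then show ?thesis using \<phi> y by simp
  next
    case True
    define a b where "a = of_int e * q + 2 * of_int i + 1" and "b = of_int d * p + 2 * of_int j + 1"
    have \<phi>: "\<phi> y = (a, b)" using True w by (simp add: y wi_def a_def b_def)
    have A: "0 \<le> a" "0 \<le> b" "a + b \<le> 1" using assms(3) by (auto simp: \<phi> DD_def)
    have "(i = 0 \<or> i = -1) \<and> (j = 0 \<or> j = -1)"
      using ed A pq by (auto simp: a_def b_def)
    then have "(i = 0 \<or> i = -1)" "(j = 0 \<or> j = -1)" by auto
    then have "a = p" "b = q"
      using ed A pq by (elim disjE; simp add: a_def b_def; linarith)+
    then show ?thesis using \<phi> y by simp
  qed
qed

lemma LL_DD: "y \<in> DD \<Longrightarrow> LL x y \<in> DD"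
  by (cases y) (auto simp: LL_def DD_def)

lemma LL_inj: "LL x y = LL x y' \<Longrightarrow> y = y'"
  by (cases y; cases y'; cases x) (auto simp: LL_def)

lemma LL_surj: "\<exists>y. LL x y = z"
proof (cases z)
  case (Pair p q)
  show ?thesis
    by (rule exI[of _ "if x = One then (q - p, 1 - p - q) else (p - q, 1 - p - q)"])
      (auto simp: Pair LL_def field_simps)
qed

abbreviation y0 :: "real \<times> real" where "y0 \<equiv> (1/5, 2/5)"

text \<open>The squared distance, scaled so as to be an integer on the orbit of \<open>y0\<close>,
  whose coordinates are multiples of 1/5.\<close>

definition sqd :: "real \<times> real \<Rightarrow> real \<times> real \<Rightarrow> real" where
  "sqd y z = 25 * ((fst y - fst z)\<^sup>2 + (snd y - snd z)\<^sup>2)"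

lemma sqd_LL: "sqd y z = 2 * sqd (LL x y) (LL x z)"
  by (cases y; cases z; cases x) (auto simp: sqd_def LL_def field_simps power2_eq_square)

lemma W_y0: "\<phi> \<in> W \<Longrightarrow> \<exists>k l :: int. \<phi> y0 = (of_int k / 5, of_int l / 5)"
proof (elim W_cases)
  fix t e d i j assume "\<phi> = wi t e d i j"
  then show ?thesis
    by (cases t)
      (intro exI[of _ "2 * e + 10 * i + 5"] exI[of _ "d + 10 * j + 5"],
       simp add: wi_def add_divide_distrib,
       intro exI[of _ "e + 10 * i"] exI[of _ "2 * d + 10 * j"],
       simp add: wi_def add_divide_distrib)
qed

lemma sqd_W: "\<phi> \<in> W \<Longrightarrow> \<psi> \<in> W \<Longrightarrow> \<exists>z :: int. sqd (\<phi> y0) (\<psi> y0) = of_int z"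
proof -
  assume "\<phi> \<in> W" "\<psi> \<in> W"
  then obtain k l k' l' :: int where "\<phi> y0 = (of_int k / 5, of_int l / 5)" "\<psi> y0 = (of_int k' / 5, of_int l' / 5)"
    using W_y0 by meson
  then have "sqd (\<phi> y0) (\<psi> y0) = of_int ((k - k')\<^sup>2 + (l - l')\<^sup>2)"
    by (simp add: sqd_def field_simps power2_eq_square)
  then show ?thesis by blast
qed

text \<open>\<open>y0\<close> is the fixed point of the contraction \<open>LL One\<close>, so that passing to sections halves the squared
  distance between the images of \<open>y0\<close>, which is an integer up to scaling.\<close>

lemma sqd_hatrel:
  assumes "hatrel g \<phi>" "hatrel g \<psi>"
  shows "\<exists>z :: int. sqd (\<phi> y0) (\<psi> y0) = 2 ^ k * of_int z"
  using assms
proof (induction k arbitrary: g \<phi> \<psi>)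
  case 0
  then show ?case using sqd_W hatrel_in by simp
next
  case (Suc k)
  have g: "g \<in> GamHat" using hatrel_in Suc by blast
  then obtain g' where g': "g' \<in> GamHat" "g \<circ> g' = id" using hat.inv_ex by blast
  \<comment> \<open>The letter is chosen so that \<open>g\<close> sends it to \<open>One\<close>.
    The isometries of the section are then evaluated at \<open>LL One y0\<close>, which is
    \<open>y0\<close> again, and the induction hypothesis applies.\<close>
  define x where "x = hd (g' [One])"
  have "g [x] = [One]" using hat.app_single[OF g'(1), of One] g'(2)
    by (metis comp_apply id_apply x_def)
  moreover obtain \<phi>' where \<phi>': "hatrel (sect g [x]) \<phi>'" "LL x (\<phi> y0) = \<phi>' (LL (hd (g [x])) y0)"
    using hatrel_sect[OF Suc(2)] by blast
  moreover obtain \<psi>' where \<psi>': "hatrel (sect g [x]) \<psi>'" "LL x (\<psi> y0) = \<psi>' (LL (hd (g [x])) y0)"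
    using hatrel_sect[OF Suc(3)] by blast
  moreover have "LL One y0 = y0" by (simp add: LL_def)
  ultimately have "sqd (\<phi> y0) (\<psi> y0) = 2 * sqd (\<phi>' y0) (\<psi>' y0)"
    using sqd_LL[of "\<phi> y0" "\<psi> y0" x] by simp
  then show ?case using Suc(1)[OF \<phi>'(1) \<psi>'(1)] by auto
qed

lemma W_eqI:
  assumes "\<phi> \<in> W" "\<psi> \<in> W" "\<phi> y0 = \<psi> y0"
  shows "\<phi> = \<psi>"
proof -
  from assms(1) obtain t e d i j where w: "e \<in> {1, -1}" "d \<in> {1, -1}" "\<phi> = wi t e d i j"
    by (rule W_cases)
  from assms(2) obtain t' e' d' i' j' where w': "e' \<in> {1, -1}" "d' \<in> {1, -1}" "\<psi> = wi t' e' d' i' j'"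
    by (rule W_cases)
  have int: "real_of_int k / 5 = real_of_int l / 5 \<longleftrightarrow> k = l" for k l by simp
  have y0: "wi t e d i j y0 = (if t then (of_int (2 * e + 10 * i + 5) / 5, of_int (d + 10 * j + 5) / 5)
      else (of_int (e + 10 * i) / 5, of_int (2 * d + 10 * j) / 5))" for t e d i j
    by (auto simp: wi_def)
  have "t = t' \<and> e = e' \<and> d = d' \<and> i = i' \<and> j = j'"
  proof -
    have eq: "(if t then (2 * e + 10 * i + 5, d + 10 * j + 5) else (e + 10 * i, 2 * d + 10 * j)) =
        (if t' then (2 * e' + 10 * i' + 5, d' + 10 * j' + 5) else (e' + 10 * i', 2 * d' + 10 * j'))"
      using assms(3) unfolding w(3) w'(3) y0 by (cases t; cases t'; simp only: if_True if_False prod.inject int)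
    have e: "e = 1 \<or> e = -1" "d = 1 \<or> d = -1" "e' = 1 \<or> e' = -1" "d' = 1 \<or> d' = -1"
      using w w' by auto
    \<comment> \<open>Numerators over 5 are compared modulo 10: the first one is 1 or 9 if the
      coordinates are not exchanged and 3 or 7 if they are, and within each type the residues
      determine the signs.\<close>
    have 1: "a = a' \<and> k = k'" if "a = 1 \<or> a = -1" "a' = 1 \<or> a' = -1" "a + 10 * k = a' + 10 * k'"
      for a a' k k' :: int
      using that by presburger
    have 2: "a + 10 * k \<noteq> 2 * a' + 10 * k' + 5" if "a = 1 \<or> a = -1" "a' = 1 \<or> a' = -1"
      for a a' k k' :: int
      using that by presburger
    have 3: "a = a' \<and> k = k'" if "a = 1 \<or> a = -1" "a' = 1 \<or> a' = -1" "2 * a + 10 * k = 2 * a' + 10 * k'"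
      for a a' k k' :: int
      using that by presburger
    show ?thesis
    proof (cases t; cases t')
      assume "t" "t'"
      then show ?thesis using eq 1[OF e(2,4), of j j'] 3[OF e(1,3), of i i'] by simp
    next
      assume "t" "\<not> t'"
      then show ?thesis using eq 2[OF e(3,1), of i' i] by simp
    next
      assume "\<not> t" "t'"
      then show ?thesis using eq 2[OF e(1,3), of i i'] by simp
    next
      assume "\<not> t" "\<not> t'"
      then show ?thesis using eq 1[OF e(1,3), of i i'] 3[OF e(2,4), of j j'] by simp
    qed
  qed
  then show ?thesis using w w' by simp
qed

lemma hatrel_unique:
  assumes "hatrel g \<phi>" "hatrel g \<psi>"
  shows "\<phi> = \<psi>"
proof -
  have W: "\<phi> \<in> W" "\<psi> \<in> W" using assms hatrel_in by auto
  obtain z :: int where z: "sqd (\<phi> y0) (\<psi> y0) = of_int z" using sqd_W[OF W] by blast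
  have "sqd (\<phi> y0) (\<psi> y0) \<ge> 0" by (simp add: sqd_def)
  then have "z \<ge> 0" using z by simp
  \<comment> \<open>A nonnegative integer divisible by all powers of two vanishes; the exponent
    \<open>nat z\<close> suffices because \<open>z < 2 ^ nat z\<close>.\<close>
  obtain z' :: int where "sqd (\<phi> y0) (\<psi> y0) = 2 ^ nat z * of_int z'"
    using sqd_hatrel[OF assms] by blast
  with z have zz: "z = 2 ^ nat z * z'" by (metis of_int_eq_iff of_int_mult of_int_numeral of_int_power)
  have "z < 2 ^ nat z"
    using \<open>z \<ge> 0\<close> less_exp[of "nat z"] by (metis int_nat_eq of_nat_less_iff of_nat_numeral of_nat_power)
  moreover have "2 ^ nat z dvd z" using zz by (metis dvd_triv_left)
  ultimately have "\<not> z > 0" using zdvd_not_zless by blast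
  then have "z = 0" using \<open>z \<ge> 0\<close> by simp
  then have "25 * ((fst (\<phi> y0) - fst (\<psi> y0))\<^sup>2 + (snd (\<phi> y0) - snd (\<psi> y0))\<^sup>2) = 0"
    using z unfolding sqd_def by (simp only: of_int_0)
  then have "(fst (\<phi> y0) - fst (\<psi> y0))\<^sup>2 + (snd (\<phi> y0) - snd (\<psi> y0))\<^sup>2 = 0"
    by (metis mult_eq_0_iff zero_neq_numeral)
  then have "\<phi> y0 = \<psi> y0"
    unfolding sum_power2_eq_zero_iff right_minus_eq by (simp only: prod_eq_iff)
  then show ?thesis using W_eqI W by blast
qed

text \<open>The images of \<open>y0\<close> under the two contractions are different points of the
  fundamental domain, so no isometry in \<open>W\<close> carries one to the other. Hence an element
  acting trivially on the plane fixes every first letter, its sections act trivially as well, and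
  induction on the word applies.\<close>

lemma hatrel_faithful:
  assumes "hatrel g id"
  shows "g = id"
proof -
  have "g w = w" if "hatrel g id" for w
    using that
  proof (induction w arbitrary: g)
    case Nil
    then show ?case using hatrel_in by simp
  next
    case (Cons x w)
    have g: "g \<in> GamHat" using Cons hatrel_in by blast
    define z where "z = hd (g [x])"
    obtain \<phi>' where \<phi>': "hatrel (sect g [x]) \<phi>'" "\<And>y. LL x y = \<phi>' (LL z y)"
      using hatrel_sect[OF Cons(2), of x] by (auto simp: z_def)
    have "y0 \<in> DD" by (simp add: DD_def)
    then have "LL x y0 = LL z y0"
      using W_fundamental[of \<phi>' "LL z y0"] \<phi>' LL_DD hatrel_in by metis
    then have "x = z" by (cases x; cases z) (auto simp: LL_def)
    then have "\<phi>' y = y" for y using \<phi>'(2) LL_surj[of z y] by metis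
    then have "\<phi>' = id" by auto
    then have "sect g [x] w = w" using Cons(1) \<phi>'(1) by blast
    then show ?case using hat.app_Cons[OF g, of x w] \<open>x = z\<close> z_def by metis
  qed
  then show ?thesis using assms by auto
qed

definition isom :: "bin aut \<Rightarrow> real \<times> real \<Rightarrow> real \<times> real" where
  "isom g = (THE \<phi>. hatrel g \<phi>)"

lemma isom_eq: "hatrel g \<phi> \<Longrightarrow> isom g = \<phi>"
  unfolding isom_def using hatrel_unique by blast

lemma hatrel_isom: "g \<in> GamHat \<Longrightarrow> hatrel g (isom g)"
  using hatrel_ex isom_eq by metis

lemma isom_W: "g \<in> GamHat \<Longrightarrow> isom g \<in> W"
  using hatrel_isom hatrel_in by blast

lemma isom_id [simp]: "isom id = id"
  using isom_eq hatrel.one by blast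

lemma isom_gens [simp]: "isom h_a = ra" "isom h_b = rb" "isom h_c = rc"
  using hatrel.a[OF hatrel.one] hatrel.b[OF hatrel.one] hatrel.c[OF hatrel.one] isom_eq by auto

lemma isom_comp: "g \<in> GamHat \<Longrightarrow> h \<in> GamHat \<Longrightarrow> isom (g \<circ> h) = isom h \<circ> isom g"
  by (rule isom_eq, rule hatrel_comp) (rule hatrel_isom, assumption)+

lemma isom_sect: "g \<in> GamHat \<Longrightarrow> LL x (isom g y) = isom (sect g [x]) (LL (hd (g [x])) y)"
  using hatrel_sect hatrel_isom isom_eq by metis

lemma isom_inj:
  assumes "g \<in> GamHat" "h \<in> GamHat" "isom g = isom h"
  shows "g = h"
proof -
  obtain h' where h': "h' \<in> GamHat" "h \<circ> h' = id" "h' \<circ> h = id" using hat.inv_ex assms by blast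
  have "isom (g \<circ> h') = isom (h \<circ> h')" using assms h' by (metis isom_comp)
  then have "hatrel (g \<circ> h') id" using h' hatrel_isom[of "g \<circ> h'"] assms hat.comp_in by simp
  then have "g \<circ> h' = id" by (rule hatrel_faithful)
  then have "g \<circ> (h' \<circ> h) = h" by (metis comp_assoc id_comp)
  then show ?thesis using h' by simp
qed

text \<open>\<open>isom\<close> shows that the conditions behind the choice are satisfiable; they
  determine the action along words in the generators, so the chosen action agrees with
  \<open>isom\<close> on \<open>GamHat\<close>.\<close>

lemma hat_act_eq: "g \<in> GamHat \<Longrightarrow> hat_act q g = isom g q"
proof -
  assume g: "g \<in> GamHat"
  let ?P = "\<lambda>act. (\<forall>q. act q id = q) \<and>
      (\<forall>q. \<forall>g\<in>GamHat. \<forall>h\<in>GamHat. act q (g \<circ> h) = act (act q g) h) \<and>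
      (\<forall>q. act q h_a = reflection (0, 0) (1, 0) q) \<and>
      (\<forall>q. act q h_b = reflection (1, 0) (1, 1) q) \<and>
      (\<forall>q. act q h_c = reflection (0, 0) (0, 1) q)"
  have "?P (\<lambda>q g. isom g q)" by (auto simp: isom_comp reflection_eq)
  then have "?P (SOME act. ?P act)" by (rule someI[of ?P])
  then have P: "?P hat_act" unfolding hat_act_def[symmetric] .
  have "\<forall>q. hat_act q g = isom g q"
    using g unfolding GamHat_def
  proof (rule gen_by_induct[OF involutive_hat, where P = "\<lambda>g. \<forall>q. hat_act q g = isom g q"])
    show "\<forall>q. hat_act q id = isom id q" using P by simp
  next
    fix s g assume s: "s \<in> {h_a, h_b, h_c}" and "g \<in> gen_by {h_a, h_b, h_c}"
      and IH: "\<forall>q. hat_act q g = isom g q"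
    then have g: "g \<in> GamHat" "s \<in> GamHat" by (auto simp: GamHat_def intro: gen_by_incl)
    have "hat_act q (s \<circ> g) = hat_act (hat_act q s) g" for q using P g by blast
    moreover have "hat_act q s = isom s q" for q using P s reflection_eq by (metis isom_gens insertE singletonD)
    ultimately show "\<forall>q. hat_act q (s \<circ> g) = isom (s \<circ> g) q" using IH g by (simp add: isom_comp)
  qed
  then show ?thesis by blast
qed

interpretation hat: ssaction GamHat hat_act UNIV
  by unfold_locales (use hat.id_in hat.comp_in in \<open>auto simp: hat_act_eq isom_comp\<close>)

lemma hat_cover: "\<exists>g\<in>GamHat. isom g y \<in> DD"
proof -
  have gx: "h_b \<circ> (h_c \<circ> h_b) \<in> GamHat" "h_b \<circ> (h_a \<circ> h_b) \<in> GamHat"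
    by (intro hat.comp_in GamHat_gens)+
  \<comment> \<open>The reflections in the lines x = 1 and y = 1. Together with those in the axes
    they fold each coordinate into the interval from -1 to 1, by induction on its size.\<close>
  have i: "isom (h_b \<circ> (h_c \<circ> h_b)) = (\<lambda>(p, q). (2 - p, q))" "isom (h_b \<circ> (h_a \<circ> h_b)) = (\<lambda>(p, q). (p, 2 - q))"
    by (auto simp: isom_comp hat.comp_in r_defs)
  have bx: "\<exists>g\<in>GamHat. \<exists>p'. \<bar>p'\<bar> \<le> 1 \<and> isom g (p, q) = (p', q)" if "\<bar>p\<bar> \<le> 1" for p q
    using that hat.id_in by (intro bexI[of _ id]) auto
  have b_y: "\<exists>g\<in>GamHat. \<exists>q'. \<bar>q'\<bar> \<le> 1 \<and> isom g (p, q) = (p, q')" if "\<bar>q\<bar> \<le> 1" for p q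
    using that hat.id_in by (intro bexI[of _ id]) auto
  have cx: "\<exists>g\<in>GamHat. \<exists>p'. \<bar>p'\<bar> \<le> 1 \<and> isom g (p, q) = (p', q)" if "\<bar>p\<bar> \<le> 2 * real n + 1" for n p q
    using that
  proof (induction n arbitrary: p)
    case 0
    from 0 show ?case by (intro bx) simp
  next
    case (Suc n)
    have pos: "\<exists>g\<in>GamHat. \<exists>p'. \<bar>p'\<bar> \<le> 1 \<and> isom g (p, q) = (p', q)" if "p \<ge> 0" "\<bar>p\<bar> \<le> 2 * real (Suc n) + 1" for p
    proof (cases "p \<le> 1")
      case True
      then show ?thesis using that hat.id_in by (intro bexI[of _ id]) auto
    next
      case False
      with that Suc(1)[of "2 - p"] obtain g p' where "g \<in> GamHat" "\<bar>p'\<bar> \<le> 1" "isom g (2 - p, q) = (p', q)"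
        by fastforce
      then show ?thesis using gx i by (intro bexI[of _ "h_b \<circ> (h_c \<circ> h_b) \<circ> g"]) (auto simp: isom_comp hat.comp_in)
    qed
    show "\<exists>g\<in>GamHat. \<exists>p'. \<bar>p'\<bar> \<le> 1 \<and> isom g (p, q) = (p', q)"
    proof (cases "p \<ge> 0")
      case False
      with Suc pos[of "- p"] obtain g p' where "g \<in> GamHat" "\<bar>p'\<bar> \<le> 1" "isom g (- p, q) = (p', q)"
        by fastforce
      then show ?thesis by (intro bexI[of _ "h_a \<circ> g"]) (auto simp: isom_comp hat.comp_in r_defs)
    qed (use Suc pos in auto)
  qed
  have cy: "\<exists>g\<in>GamHat. \<exists>q'. \<bar>q'\<bar> \<le> 1 \<and> isom g (p, q) = (p, q')" if "\<bar>q\<bar> \<le> 2 * real n + 1" for n p q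
    using that
  proof (induction n arbitrary: q)
    case 0
    from 0 show ?case by (intro b_y) simp
  next
    case (Suc n)
    have pos: "\<exists>g\<in>GamHat. \<exists>q'. \<bar>q'\<bar> \<le> 1 \<and> isom g (p, q) = (p, q')" if "q \<ge> 0" "\<bar>q\<bar> \<le> 2 * real (Suc n) + 1" for q
    proof (cases "q \<le> 1")
      case True
      then show ?thesis using that hat.id_in by (intro bexI[of _ id]) auto
    next
      case False
      with that Suc(1)[of "2 - q"] obtain g q' where "g \<in> GamHat" "\<bar>q'\<bar> \<le> 1" "isom g (p, 2 - q) = (p, q')"
        by fastforce
      then show ?thesis using gx i by (intro bexI[of _ "h_b \<circ> (h_a \<circ> h_b) \<circ> g"]) (auto simp: isom_comp hat.comp_in)
    qed
    show "\<exists>g\<in>GamHat. \<exists>q'. \<bar>q'\<bar> \<le> 1 \<and> isom g (p, q) = (p, q')"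
    proof (cases "q \<ge> 0")
      case False
      with Suc pos[of "- q"] obtain g q' where "g \<in> GamHat" "\<bar>q'\<bar> \<le> 1" "isom g (p, - q) = (p, q')"
        by fastforce
      then show ?thesis by (intro bexI[of _ "h_c \<circ> g"]) (auto simp: isom_comp hat.comp_in r_defs)
    qed (use Suc pos in auto)
  qed
  obtain p q where y: "y = (p, q)" by fastforce
  obtain n m where "\<bar>p\<bar> \<le> real n" "\<bar>q\<bar> \<le> real m" using real_arch_simple by meson
  then have nm: "\<bar>p\<bar> \<le> 2 * real n + 1" "\<bar>q\<bar> \<le> 2 * real m + 1" by linarith+
  obtain g p' where g: "g \<in> GamHat" "\<bar>p'\<bar> \<le> 1" "isom g (p, q) = (p', q)"
    using cx[OF nm(1)] by blast
  obtain h q' where h: "h \<in> GamHat" "\<bar>q'\<bar> \<le> 1" "isom h (p', q) = (p', q')"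
    using cy[OF nm(2)] by blast
  note gh = g h
  define k where "k = (if p' \<ge> 0 then id else h_a) \<circ> (if q' \<ge> 0 then id else h_c)"
  have k: "k \<in> GamHat" "isom k (p', q') = (\<bar>p'\<bar>, \<bar>q'\<bar>)"
    using hat.id_in by (auto simp: k_def hat.comp_in isom_comp r_defs)
  define l where "l = (if \<bar>p'\<bar> + \<bar>q'\<bar> \<le> 1 then id else h_b)"
  have l: "l \<in> GamHat" "isom l (\<bar>p'\<bar>, \<bar>q'\<bar>) \<in> DD"
    using hat.id_in gh by (auto simp: l_def r_defs DD_def)
  show ?thesis
    using gh k l by (intro bexI[of _ "g \<circ> (h \<circ> (k \<circ> l))"]) (auto simp: isom_comp hat.comp_in y)
qed

text \<open>Needed to lift an identification from level n to level n + 1 in \<open>lam_inj\<close>.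
  At the letter \<open>One\<close> the elements b, c and aba have the sections a, b and c; other
  pairs of letters follow by multiplying with a.\<close>

lemma hat_recurrent:
  assumes "g \<in> GamHat"
  shows "\<exists>k\<in>GamHat. k [x] = [x'] \<and> sect k [x] = g"
proof -
  have 1: "\<exists>k\<in>GamHat. k [One] = [One] \<and> sect k [One] = g"
    using assms[unfolded GamHat_def]
  proof (rule gen_by_induct[OF involutive_hat, where P = "\<lambda>g. \<exists>k\<in>GamHat. k [One] = [One] \<and> sect k [One] = g"])
    show "\<exists>k\<in>GamHat. k [One] = [One] \<and> sect k [One] = id"
      using hat.id_in by (intro bexI[of _ id]) auto
  next
    fix s g assume s: "s \<in> {h_a, h_b, h_c}" and "\<exists>k\<in>GamHat. k [One] = [One] \<and> sect k [One] = g"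
    then obtain k where k: "k \<in> GamHat" "k [One] = [One]" "sect k [One] = g" by blast
    have aba: "h_a \<circ> (h_b \<circ> h_a) \<in> GamHat" "sect (h_a \<circ> (h_b \<circ> h_a)) [One] = h_c"
      by (auto simp: hat.comp_in hat.sect_comp)
    have "\<exists>l\<in>GamHat. l [One] = [One] \<and> sect l [One] = s"
      using s aba by (elim insertE) (auto intro: bexI[of _ h_b] bexI[of _ h_c] bexI[of _ "h_a \<circ> (h_b \<circ> h_a)"])
    then obtain l where l: "l \<in> GamHat" "l [One] = [One]" "sect l [One] = s" by blast
    show "\<exists>k\<in>GamHat. k [One] = [One] \<and> sect k [One] = s \<circ> g"
      using k l by (intro bexI[of _ "l \<circ> k"]) (auto simp: hat.comp_in hat.sect_comp)
  qed
  then obtain k where k: "k \<in> GamHat" "k [One] = [One]" "sect k [One] = g" by blast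
  define u where "u z = (if z = One then id else h_a)" for z
  have u: "u z \<in> GamHat" "u z [z] = [One]" "u z [One] = [z]" "sect (u z) [w] = id" for z w
    using hat.id_in by (cases z; simp add: u_def)+
  show ?thesis
    using k u by (intro bexI[of _ "u x' \<circ> (k \<circ> u x)"]) (auto simp: hat.comp_in hat.sect_comp)
qed

text \<open>In a reflection group the stabiliser of a point is generated by the reflections in the
  walls through it. Here the normal form leaves few isometries that fix the point; each is matched
  with a word in the sides containing it, and \<open>isom_inj\<close> turns equality of isometries
  into equality of automorphisms.\<close>

lemma hat_stab:
  assumes "g \<in> GamHat" "(p, q) \<in> DD" "isom g (p, q) = (p, q)"
  shows "g \<in> gen_by {s. s = h_a \<and> p = 0 \<or> s = h_b \<and> p + q = 1 \<or> s = h_c \<and> q = 0}" (is "_ \<in> gen_by ?K")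
proof -
  define H where "H = ?K"
  have inv: "involutive H" by (auto simp: involutive_def H_def)
  have H: "H \<subseteq> GamHat" by (auto simp: H_def)
  have gens: "p = 0 \<Longrightarrow> h_a \<in> gen_by H" "p + q = 1 \<Longrightarrow> h_b \<in> gen_by H" "q = 0 \<Longrightarrow> h_c \<in> gen_by H"
    "id \<in> gen_by H"
    by (auto intro: gen_by_incl gen_by_id simp: H_def)
  note incl = gens gen_by_comp[OF inv]
  have sub: "gen_by H \<subseteq> GamHat"
    using gen_by_least[OF inv H hat.id_in hat.comp_in] by blast
  have *: "g \<in> gen_by H" if "w \<in> gen_by H" "isom g = isom w" for w
    using that sub isom_inj[OF assms(1)] by blast
  have pq: "0 \<le> p" "0 \<le> q" "p + q \<le> 1" using assms(2) by (auto simp: DD_def)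
  from isom_W[OF assms(1)] obtain t e d i j where w: "e \<in> {1, -1}" "d \<in> {1, -1}" "isom g = wi t e d i j"
    by (rule W_cases)
  note i = isom_comp hat.comp_in r_defs wi_def fun_eq_iff
  have "g \<in> gen_by H"
  proof (cases t)
    case False
    have e: "e = 1 \<and> i = 0 \<or> e = -1 \<and> i = 0 \<and> p = 0 \<or> e = -1 \<and> i = 1 \<and> p = 1 \<and> q = 0"
      using assms(3) w False pq by (auto simp: wi_def)
    have d: "d = 1 \<and> j = 0 \<or> d = -1 \<and> j = 0 \<and> q = 0 \<or> d = -1 \<and> j = 1 \<and> q = 1 \<and> p = 0"
      using assms(3) w False pq by (auto simp: wi_def)
    \<comment> \<open>Without exchange of coordinates the isometry splits into a horizontal and a
      vertical factor. A nonzero translation occurs only at A' or C', where the factor is the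
      reflection in x = 1 or y = 1.\<close>
    define gx where "gx = (if e = 1 then id else if i = 0 then h_a else h_b \<circ> (h_c \<circ> h_b))"
    define gy where "gy = (if d = 1 then id else if j = 0 then h_c else h_b \<circ> (h_a \<circ> h_b))"
    have bcb: "h_b \<circ> (h_c \<circ> h_b) \<in> gen_by H" if "p = 1" "q = 0"
    proof -
      have "h_b \<in> gen_by H" "h_c \<in> gen_by H" using that gens by simp_all
      then show ?thesis by (simp only: gen_by_comp[OF inv])
    qed
    have bab: "h_b \<circ> (h_a \<circ> h_b) \<in> gen_by H" if "p = 0" "q = 1"
    proof -
      have "h_b \<in> gen_by H" "h_a \<in> gen_by H" using that gens by simp_all
      then show ?thesis by (simp only: gen_by_comp[OF inv])
    qed
    have "gx \<in> gen_by H"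
      using e by (elim disjE conjE) (simp_all only: gx_def if_True if_False gens bcb, simp_all add: gens bcb)
    moreover have "gy \<in> gen_by H"
      using d by (elim disjE conjE) (simp_all only: gy_def if_True if_False gens bab, simp_all add: gens bab)
    ultimately have "gx \<in> gen_by H" "gy \<in> gen_by H" .
    then have g: "gx \<circ> gy \<in> gen_by H" by (rule gen_by_comp[OF inv])
    have "gx \<in> GamHat" "gy \<in> GamHat"
      by (auto simp: gx_def gy_def hat.comp_in hat.id_in)
    moreover have "isom gx = (\<lambda>(x, y). (of_int e * x + 2 * of_int i, y))"
      using e by (auto simp: gx_def i)
    moreover have "isom gy = (\<lambda>(x, y). (x, of_int d * y + 2 * of_int j))"
      using d by (auto simp: gy_def i)
    ultimately show ?thesis using False w by (intro *[OF g]) (auto simp: i)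
  next
    case True
    have "e = -1 \<and> d = -1 \<and> i = 0 \<and> j = 0 \<and> p + q = 1 \<or>
      e = 1 \<and> d = 1 \<and> i = 0 \<and> j = -1 \<and> p = 1 \<and> q = 0 \<or> e = 1 \<and> d = 1 \<and> i = -1 \<and> j = 0 \<and> p = 0 \<and> q = 1 \<or>
      e = 1 \<and> d = -1 \<and> i = 0 \<and> j = 0 \<and> p = 1 \<and> q = 0 \<or> e = 1 \<and> d = -1 \<and> i = -1 \<and> j = 0 \<and> p = 0 \<and> q = 1 \<or>
      e = -1 \<and> d = 1 \<and> i = 0 \<and> j = -1 \<and> p = 1 \<and> q = 0 \<or> e = -1 \<and> d = 1 \<and> i = 0 \<and> j = 0 \<and> p = 0 \<and> q = 1"
    proof -
      have ij: "(i = 0 \<or> i = -1) \<and> (j = 0 \<or> j = -1)"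
        using assms(3) w True pq by (auto simp: wi_def)
      have eq: "of_int e * q + of_int (2 * i + 1) = p" "of_int d * p + of_int (2 * j + 1) = q"
        using assms(3) w True by (simp_all add: wi_def)
      have "e = 1 \<or> e = -1" "d = 1 \<or> d = -1" "i = 0 \<or> i = -1" "j = 0 \<or> j = -1" using ij w by auto
      then show ?thesis using eq pq by (elim disjE; simp; linarith)
    qed
    then show ?thesis
    proof (elim disjE, goal_cases)
      case 1
      then have "h_b \<in> gen_by H" by (simp add: gens gen_by_comp[OF inv])
      moreover have "isom g = isom (h_b)" using 1 True w by (auto simp: i)
      ultimately show ?case by (rule *)
    next
      case 2
      then have "h_c \<circ> (h_b \<circ> h_c) \<in> gen_by H" by (simp add: gens gen_by_comp[OF inv])
      moreover have "isom g = isom (h_c \<circ> (h_b \<circ> h_c))" using 2 True w by (auto simp: i)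
      ultimately show ?case by (rule *)
    next
      case 3
      then have "h_a \<circ> (h_b \<circ> h_a) \<in> gen_by H" by (simp add: gens gen_by_comp[OF inv])
      moreover have "isom g = isom (h_a \<circ> (h_b \<circ> h_a))" using 3 True w by (auto simp: i)
      ultimately show ?case by (rule *)
    next
      case 4
      then have "h_c \<circ> h_b \<in> gen_by H" by (simp add: gens gen_by_comp[OF inv])
      moreover have "isom g = isom (h_c \<circ> h_b)" using 4 True w by (auto simp: i)
      ultimately show ?case by (rule *)
    next
      case 5
      then have "h_b \<circ> h_a \<in> gen_by H" by (simp add: gens gen_by_comp[OF inv])
      moreover have "isom g = isom (h_b \<circ> h_a)" using 5 True w by (auto simp: i)
      ultimately show ?case by (rule *)
    next
      case 6
      then have "h_b \<circ> h_c \<in> gen_by H" by (simp add: gens gen_by_comp[OF inv])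
      moreover have "isom g = isom (h_b \<circ> h_c)" using 6 True w by (auto simp: i)
      ultimately show ?case by (rule *)
    next
      case 7
      then have "h_a \<circ> h_b \<in> gen_by H" by (simp add: gens gen_by_comp[OF inv])
      moreover have "isom g = isom (h_a \<circ> h_b)" using 7 True w by (auto simp: i)
      ultimately show ?case by (rule *)
    qed
  qed
  then show ?thesis by (simp only: H_def)
qed

section \<open>Relations in the group \<open>\<Gamma>\<close>\<close>

lemma sigma_sigma [simp]: "sigma (sigma x) = x" and pi_pi [simp]: "pi_perm (pi_perm x) = x"
  by (cases x; simp)+

lemma mu_sigma [simp]: "mu_letter (sigma x) = mu_letter x"
  and mu_pi [simp]: "mu_letter (pi_perm x) = swap (mu_letter x)"
  by (cases x; simp)+

lemma word_cases:
  obtains "v = []" | w where "v = X1 # w" | w where "v = X2 # w" | w where "v = X3 # w" | w where "v = X4 # w"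
  by (metis letter.exhaust list.exhaust)

lemma rel_al [simp]: "g_al (g_al v) = v" "g_a (g_a v) = v" "g_a (g_al v) = g_al (g_a v)"
  by (cases v rule: word_cases; simp)+

lemma rel_be_ga [simp]: "g_be (g_be v) = v" "g_ga (g_ga v) = v"
proof -
  have "g_be (g_be v) = v \<and> g_ga (g_ga v) = v"
  proof (induction "length v" arbitrary: v rule: less_induct)
    case less
    show ?case by (cases v rule: word_cases) (use less in auto)
  qed
  then show "g_be (g_be v) = v" "g_ga (g_ga v) = v" by auto
qed

text \<open>Together with the neighbouring rules this says that \<alpha>, \<beta>, \<gamma> generate
  a normal subgroup. As rewrite rules they carry the Greek letters outwards past a, b, c and so
  normalise mixed words.\<close>

lemma rel_a [simp]:
  "g_a (g_be v) = g_be (g_a v)" "g_a (g_ga v) = g_al (g_ga (g_al (g_a v)))"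
  by (cases v rule: word_cases; simp)+

lemma rel_al2 [simp]: "g_b (g_al v) = g_al (g_b v)" "g_c (g_al v) = g_al (g_c v)"
  by (cases v rule: word_cases; simp)+

lemma rel_be [simp]: "g_b (g_be v) = g_be (g_b v)" "g_c (g_ga v) = g_ga (g_c v)"
proof -
  have "g_b (g_be v) = g_be (g_b v) \<and> g_c (g_ga v) = g_ga (g_c v)"
  proof (induction "length v" arbitrary: v rule: less_induct)
    case less
    show ?case by (cases v rule: word_cases) (use less in auto)
  qed
  then show "g_b (g_be v) = g_be (g_b v)" "g_c (g_ga v) = g_ga (g_c v)" by auto
qed

lemma rel_bb [simp]: "g_b (g_b v) = v" "g_c (g_c v) = v"
proof -
  have "g_b (g_b v) = v \<and> g_c (g_c v) = v"
  proof (induction "length v" arbitrary: v rule: less_induct)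
    case less
    show ?case by (cases v rule: word_cases) (use less in auto)
  qed
  then show "g_b (g_b v) = v" "g_c (g_c v) = v" by auto
qed

lemma rel_ga [simp]:
  "g_b (g_ga v) = g_be (g_ga (g_be (g_b v)))" "g_c (g_be v) = g_ga (g_be (g_ga (g_c v)))"
proof -
  have "g_b (g_ga v) = g_be (g_ga (g_be (g_b v))) \<and> g_c (g_be v) = g_ga (g_be (g_ga (g_c v)))"
  proof (induction "length v" arbitrary: v rule: less_induct)
    case less
    show ?case by (cases v rule: word_cases) (use less in auto)
  qed
  then show "g_b (g_ga v) = g_be (g_ga (g_be (g_b v)))" "g_c (g_be v) = g_ga (g_be (g_ga (g_c v)))" by auto
qed

abbreviation "Ggens \<equiv> {g_al, g_be, g_ga, g_a, g_b, g_c}"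

lemma involutive_Gam: "involutive Ggens"
  by (auto simp: involutive_def)

lemma Gam_gens [simp]:
  "g_al \<in> Gam" "g_be \<in> Gam" "g_ga \<in> Gam" "g_a \<in> Gam" "g_b \<in> Gam" "g_c \<in> Gam"
  by (auto simp: Gam_def intro: gen_by_incl)

interpretation G: ssgroup Gam
  unfolding Gam_def
proof (rule ssgroup_gen_by[OF involutive_Gam])
  fix s :: "letter aut" and x
  assume s: "s \<in> Ggens"
  then show "s [] = []" by auto
  have "\<exists>y. \<exists>t\<in>{id, g_al, g_be, g_ga, g_b, g_c, g_a \<circ> g_al, g_b \<circ> g_be}. \<forall>v. s (x # v) = y # t v"
    using s by (cases x) auto
  moreover have "{id, g_al, g_be, g_ga, g_b, g_c, g_a \<circ> g_al, g_b \<circ> g_be} \<subseteq> gen_by Ggens"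
  proof -
    have g: "t \<in> gen_by Ggens" if "t \<in> Ggens" for t using that by (rule gen_by_incl)
    have "g_a \<circ> g_al \<in> gen_by Ggens" "g_b \<circ> g_be \<in> gen_by Ggens"
      by (rule gen_by_comp[OF involutive_Gam]; rule g; simp)+
    then show ?thesis using g gen_by_id[of Ggens] by simp
  qed
  ultimately show "\<exists>y. \<exists>t\<in>gen_by Ggens. \<forall>v. s (x # v) = y # t v"
    by (meson subsetD)
qed

lemma Gam_induct [consumes 1, case_names one step]:
  assumes "g \<in> Gam" "P id" "\<And>s g. s \<in> Ggens \<Longrightarrow> g \<in> Gam \<Longrightarrow> P g \<Longrightarrow> P (s \<circ> g)"
  shows "P g"
  using gen_by_induct[OF involutive_Gam, of g P] assms unfolding Gam_def by blast

lemma sect_G [simp]: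
  "sect g_al [x] = id" "sect g_a [x] = id"
  "sect g_be [X1] = g_al" "sect g_be [X2] = g_ga" "sect g_be [X3] = g_al" "sect g_be [X4] = g_ga"
  "sect g_ga [X1] = g_be" "sect g_ga [X2] = id" "sect g_ga [X3] = id" "sect g_ga [X4] = g_be"
  "sect g_b [X1] = g_a \<circ> g_al" "sect g_b [X2] = g_a \<circ> g_al" "sect g_b [X3] = g_c" "sect g_b [X4] = g_c"
  "sect g_c [X1] = g_b \<circ> g_be" "sect g_c [X2] = g_b \<circ> g_be" "sect g_c [X3] = g_b" "sect g_c [X4] = g_b"
  by (simp_all add: sect_def fun_eq_iff)

section \<open>The homomorphism \<open>\<nu>\<close>\<close>

lemma mu_gens [simp]:
  "map mu_letter (g_al v) = map mu_letter v"
  "map mu_letter (g_be v) = map mu_letter v" "map mu_letter (g_ga v) = map mu_letter v"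
  "map mu_letter (g_a v) = h_a (map mu_letter v)"
  "map mu_letter (g_b v) = h_b (map mu_letter v)" "map mu_letter (g_c v) = h_c (map mu_letter v)"
proof -
  show al: "map mu_letter (g_al v) = map mu_letter v" for v
    by (cases v) auto
  show a: "map mu_letter (g_a v) = h_a (map mu_letter v)" for v
    by (cases v) auto
  have be: "map mu_letter (g_be v) = map mu_letter v \<and> map mu_letter (g_ga v) = map mu_letter v" for v
  proof (induction "length v" arbitrary: v rule: less_induct)
    case less
    show ?case by (cases v rule: word_cases) (use less al in auto)
  qed
  then show "map mu_letter (g_be v) = map mu_letter v" "map mu_letter (g_ga v) = map mu_letter v" by auto
  have "map mu_letter (g_b v) = h_b (map mu_letter v) \<and> map mu_letter (g_c v) = h_c (map mu_letter v)"
  proof (induction "length v" arbitrary: v rule: less_induct)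
    case less
    show ?case by (cases v rule: word_cases) (use less al a be in \<open>auto simp del: rel_al rel_be\<close>)
  qed
  then show "map mu_letter (g_b v) = h_b (map mu_letter v)" "map mu_letter (g_c v) = h_c (map mu_letter v)"
    by auto
qed

lemma mu_letter_surj: "\<exists>x. mu_letter x = y"
  by (cases y) (metis mu_letter.simps)+

lemma map_mu_surj: "\<exists>v. map mu_letter v = u"
proof (induction u)
  case (Cons y u)
  then show ?case using mu_letter_surj[of y] by (metis list.simps(9))
qed simp

text \<open>Elements of \<open>Gam\<close> respect the partition of words into fibers of
  \<open>mu_letter\<close>; the induced map on words over \<open>bin\<close> is unique because
  \<open>map mu_letter\<close> is surjective. It provides a concrete candidate for
  \<open>nu\<close>.\<close>

definition covers :: "letter aut \<Rightarrow> bin aut \<Rightarrow> bool" where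
  "covers g k \<longleftrightarrow> (\<forall>v. map mu_letter (g v) = k (map mu_letter v))"

lemma covers_unique: "covers g k \<Longrightarrow> covers g k' \<Longrightarrow> k = k'"
  unfolding covers_def fun_eq_iff using map_mu_surj by metis

lemma covers_comp: "covers g k \<Longrightarrow> covers g' k' \<Longrightarrow> covers (g \<circ> g') (k \<circ> k')"
  by (simp add: covers_def)

lemma covers_ex: "g \<in> Gam \<Longrightarrow> \<exists>k\<in>GamHat. covers g k"
proof (induction rule: Gam_induct)
  case one
  have "covers id id" by (simp add: covers_def)
  then show ?case using hat.id_in by blast
next
  case (step s g)
  have "\<exists>k\<in>GamHat. covers s k"
    using step(1) hat.id_in
    by (elim insertE) (auto simp: covers_def intro: bexI[of _ id] bexI[of _ h_a] bexI[of _ h_b] bexI[of _ h_c])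
  then show ?case using step(3) covers_comp hat.comp_in by blast
qed

lemma covers_gens:
  "covers g_al id" "covers g_be id" "covers g_ga id" "covers g_a h_a" "covers g_b h_b" "covers g_c h_c"
  "covers id id"
  by (auto simp: covers_def)

lemma BijGroup_mult_Gam: "g \<in> Gam \<Longrightarrow> h \<in> Gam \<Longrightarrow> g \<otimes>\<^bsub>BijGroup UNIV\<^esub> h = g \<circ> h"
  by (simp add: BijGroup_UNIV_mult G.bij_in)

lemma BijGroup_mult_GamHat: "g \<in> GamHat \<Longrightarrow> h \<in> GamHat \<Longrightarrow> g \<otimes>\<^bsub>BijGroup UNIV\<^esub> h = g \<circ> h"
  by (simp add: BijGroup_UNIV_mult hat.bij_in)

text \<open>The induced map on words is a homomorphism with the prescribed values, so the choice
  succeeds. A homomorphism is determined by its values on the generators, which identifies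
  \<open>nu\<close> with the induced map.\<close>

lemma nu_covers:
  assumes "g \<in> Gam"
  shows "nu g \<in> GamHat" "covers g (nu g)"
proof -
  let ?P = "\<lambda>f. f \<in> hom ((BijGroup UNIV)\<lparr>carrier := Gam\<rparr>) ((BijGroup UNIV)\<lparr>carrier := GamHat\<rparr>) \<and>
      f g_al = id \<and> f g_be = id \<and> f g_ga = id \<and> f g_a = h_a \<and> f g_b = h_b \<and> f g_c = h_c"
  define f where "f g = (THE k. covers g k)" for g
  have f: "f g = k" if "covers g k" for g k
    unfolding f_def using covers_unique that by blast
  have f': "f g \<in> GamHat" "covers g (f g)" if "g \<in> Gam" for g
    using covers_ex[OF that] f by auto
  have "f \<in> hom ((BijGroup UNIV)\<lparr>carrier := Gam\<rparr>) ((BijGroup UNIV)\<lparr>carrier := GamHat\<rparr>)"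
  proof (rule homI)
    fix g h assume "g \<in> carrier ((BijGroup UNIV)\<lparr>carrier := Gam\<rparr>)"
      "h \<in> carrier ((BijGroup UNIV)\<lparr>carrier := Gam\<rparr>)"
    then have gh: "g \<in> Gam" "h \<in> Gam" by auto
    have "f (g \<circ> h) = f g \<circ> f h" using f covers_comp f' gh by blast
    then show "f (g \<otimes>\<^bsub>(BijGroup UNIV)\<lparr>carrier := Gam\<rparr>\<^esub> h) = f g \<otimes>\<^bsub>(BijGroup UNIV)\<lparr>carrier := GamHat\<rparr>\<^esub> f h"
      using gh f' by (simp add: BijGroup_mult_Gam BijGroup_mult_GamHat)
  qed (use f' in auto)
  then have "?P f" using f covers_gens by blast
  then have "?P (SOME f. ?P f)" by (rule someI[of ?P])
  then have P: "?P nu" unfolding nu_def[symmetric] .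
  have mult: "nu (g \<circ> h) = nu g \<circ> nu h" if "g \<in> Gam" "h \<in> Gam" for g h
    using hom_mult[of nu "(BijGroup UNIV)\<lparr>carrier := Gam\<rparr>" "(BijGroup UNIV)\<lparr>carrier := GamHat\<rparr>" g h]
      hom_in_carrier[of nu "(BijGroup UNIV)\<lparr>carrier := Gam\<rparr>" "(BijGroup UNIV)\<lparr>carrier := GamHat\<rparr>"]
      P that by (simp add: BijGroup_mult_Gam BijGroup_mult_GamHat)
  have nuin: "nu g \<in> GamHat" if "g \<in> Gam" for g
    using hom_in_carrier[of nu "(BijGroup UNIV)\<lparr>carrier := Gam\<rparr>" "(BijGroup UNIV)\<lparr>carrier := GamHat\<rparr>"] P that
    by simp
  have nuid: "nu id = id"
  proof -
    have "nu id \<circ> nu id = nu id" using mult[OF G.id_in G.id_in] by simp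
    moreover obtain k where "k \<circ> nu id = id" using hat.inv_ex[OF nuin[OF G.id_in]] by blast
    ultimately show ?thesis by (metis comp_assoc id_comp)
  qed
  show "nu g \<in> GamHat" using nuin assms by blast
  show "covers g (nu g)"
    using assms
  proof (induction rule: Gam_induct)
    case one
    show "covers id (nu id)" by (simp add: nuid covers_def)
  next
    case (step s g)
    have "covers s (nu s)" using step(1) P covers_gens by auto
    moreover have "s \<in> Gam" using step(1) by auto
    ultimately show "covers (s \<circ> g) (nu (s \<circ> g))" using step mult covers_comp by simp
  qed
qed

lemma nu_in [simp]: "g \<in> Gam \<Longrightarrow> nu g \<in> GamHat"
  by (rule nu_covers)

lemma mu_app: "g \<in> Gam \<Longrightarrow> map mu_letter (g v) = nu g (map mu_letter v)"
  using nu_covers(2) unfolding covers_def by blast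

lemma nu_eqI: "g \<in> Gam \<Longrightarrow> covers g k \<Longrightarrow> nu g = k"
  using covers_unique nu_covers by blast

lemma nu_comp: "g \<in> Gam \<Longrightarrow> h \<in> Gam \<Longrightarrow> nu (g \<circ> h) = nu g \<circ> nu h"
  using nu_eqI[OF G.comp_in] covers_comp nu_covers(2) by blast

lemma nu_gens [simp]:
  "nu g_al = id" "nu g_be = id" "nu g_ga = id" "nu g_a = h_a" "nu g_b = h_b" "nu g_c = h_c" "nu id = id"
  using covers_gens by (auto intro!: nu_eqI simp: G.id_in)

lemma nu_sect:
  assumes g: "g \<in> Gam"
  shows "nu (sect g v) = sect (nu g) (map mu_letter v)"
proof (rule nu_eqI[OF G.sect_in[OF g]])
  show "covers (sect g v) (sect (nu g) (map mu_letter v))"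
    unfolding covers_def
  proof
    fix w
    have "map mu_letter (g v) @ map mu_letter (sect g v w) =
        nu g (map mu_letter v) @ sect (nu g) (map mu_letter v) (map mu_letter w)"
      using mu_app[OF g, of "v @ w"] G.app[OF g, of v w]
        hat.app[OF nu_in[OF g], of "map mu_letter v" "map mu_letter w"] by simp
    then show "map mu_letter (sect g v w) = sect (nu g) (map mu_letter v) (map mu_letter w)"
      using mu_app[OF g, of v] by simp
  qed
qed

lemma nu_surj: "k \<in> GamHat \<Longrightarrow> \<exists>g\<in>Gam. nu g = k"
  unfolding GamHat_def
proof (rule gen_by_induct[OF involutive_hat, where P = "\<lambda>k. \<exists>g\<in>Gam. nu g = k"])
  show "\<exists>g\<in>Gam. nu g = id" using G.id_in by (intro bexI[of _ id]) auto
next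
  fix s k assume s: "s \<in> {h_a, h_b, h_c}" and "\<exists>g\<in>Gam. nu g = k"
  then obtain g where g: "g \<in> Gam" "nu g = k" by blast
  have "\<exists>t\<in>Gam. nu t = s" using s nu_gens Gam_gens by blast
  then show "\<exists>g\<in>Gam. nu g = s \<circ> k" using g nu_comp G.comp_in by metis
qed

section \<open>Orientation\<close>

text \<open>For an affine map this is the determinant of its linear part.\<close>

definition dt :: "(real \<times> real \<Rightarrow> real \<times> real) \<Rightarrow> real" where
  "dt \<phi> = (let z = \<phi> (0, 0); u = \<phi> (1, 0) - z; v = \<phi> (0, 1) - z in fst u * snd v - snd u * fst v)"

definition aff :: "(real \<times> real \<Rightarrow> real \<times> real) \<Rightarrow> bool" where
  "aff \<phi> \<longleftrightarrow> (\<exists>p q r s t u. \<phi> = (\<lambda>(x, y). (p * x + q * y + r, s * x + t * y + u)))"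

lemma dt_comp:
  assumes "aff \<phi>" "aff \<psi>"
  shows "dt (\<phi> \<circ> \<psi>) = dt \<phi> * dt \<psi>"
proof -
  obtain p q r s t u where \<phi>: "\<phi> = (\<lambda>(x, y). (p * x + q * y + r, s * x + t * y + u))"
    using assms(1) unfolding aff_def by blast
  obtain p' q' r' s' t' u' where \<psi>: "\<psi> = (\<lambda>(x, y). (p' * x + q' * y + r', s' * x + t' * y + u'))"
    using assms(2) unfolding aff_def by blast
  show ?thesis
    unfolding \<phi> \<psi> dt_def Let_def by (simp add: algebra_simps)
qed

lemma aff_W: "\<phi> \<in> W \<Longrightarrow> aff \<phi>"
proof (elim W_cases)
  fix t e d i j assume "\<phi> = wi t e d i j"
  then have "\<phi> = (if t then (\<lambda>(x, y). (0 * x + of_int e * y + of_int (2 * i + 1), of_int d * x + 0 * y + of_int (2 * j + 1)))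
     else (\<lambda>(x, y). (of_int e * x + 0 * y + of_int (2 * i), 0 * x + of_int d * y + of_int (2 * j))))"
    by (auto simp: wi_def)
  then show "aff \<phi>" unfolding aff_def by (cases t) (simp_all only: if_True if_False, blast+)
qed

lemma aff_LL: "aff (LL x)"
proof (cases x)
  case One
  have "LL One = (\<lambda>(p, q). ((-1/2) * p + (-1/2) * q + 1/2, (1/2) * p + (-1/2) * q + 1/2))"
    by (auto simp: LL_def)
  then show ?thesis unfolding aff_def One by blast
next
  case Two
  have "LL Two = (\<lambda>(p, q). ((1/2) * p + (-1/2) * q + 1/2, (-1/2) * p + (-1/2) * q + 1/2))"
    by (auto simp: LL_def)
  then show ?thesis unfolding aff_def Two by blast
qed

lemma dt_LL: "dt (LL x) \<noteq> 0"
  by (cases x) (auto simp: dt_def LL_def)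

lemma dt_r [simp]: "dt ra = -1" "dt rb = -1" "dt rc = -1" "dt id = 1"
  by (auto simp: dt_def r_defs)

text \<open>The orientation character of \<open>GamHat\<close>. By \<open>IMG_iff\<close> it cuts
  \<open>IMG\<close> out of \<open>Gam\<close>, which turns membership in \<open>IMG\<close> into a
  sign computation.\<close>

definition par :: "bin aut \<Rightarrow> real" where
  "par g = dt (isom g)"

lemma par_comp: "g \<in> GamHat \<Longrightarrow> h \<in> GamHat \<Longrightarrow> par (g \<circ> h) = par g * par h"
  by (simp add: par_def isom_comp dt_comp aff_W isom_W)

lemma par_gens [simp]: "par h_a = -1" "par h_b = -1" "par h_c = -1" "par id = 1"
  by (simp_all add: par_def)

lemma par_cases: "g \<in> GamHat \<Longrightarrow> par g = 1 \<or> par g = -1"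
  unfolding par_def by (drule isom_W, elim W_cases) (auto simp: dt_def wi_def)

text \<open>When the letter is fixed, \<open>LL x\<close> conjugates \<open>isom g\<close> to the
  isometry of the section, and conjugation by an invertible affine map preserves the
  determinant.\<close>

lemma par_sect_single:
  assumes "g \<in> GamHat" "g [x] = [x]"
  shows "par (sect g [x]) = par g"
proof -
  have "LL x \<circ> isom g = isom (sect g [x]) \<circ> LL x"
    using isom_sect[OF assms(1), of x] assms(2) by auto
  then have "dt (LL x) * par g = par (sect g [x]) * dt (LL x)"
    using assms(1) hat.sect_in unfolding par_def by (metis dt_comp aff_LL aff_W isom_W)
  then show ?thesis using dt_LL by simp
qed

lemma par_sect: "g \<in> GamHat \<Longrightarrow> g u = u \<Longrightarrow> par (sect g u) = par g"
proof (induction u arbitrary: g)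
  case (Cons x u)
  have "g [x] = [x]" "sect g [x] u = u"
    using hat.app_Cons[OF Cons(2), of x u] hat.app_single[OF Cons(2), of x] Cons(3) by auto
  then show ?case
    using Cons(1)[of "sect g [x]"] Cons(2) hat.sect_in par_sect_single hat.sect_Cons[OF Cons(2), of x u] by simp
qed simp

text \<open>The generators ab and bc are not involutions, so closure under products and inverses is
  taken from the general subgroup lemmas, inside the subgroup of orientation preserving elements of
  \<open>Gam\<close>.\<close>

lemma IMG_comp: "g \<in> IMG \<Longrightarrow> h \<in> IMG \<Longrightarrow> g \<circ> h \<in> IMG"
  and IMG_inv: "g \<in> IMG \<Longrightarrow> \<exists>h\<in>IMG. g \<circ> h = id \<and> h \<circ> g = id"
  and IMG_sub: "g \<in> IMG \<Longrightarrow> g \<in> Gam \<and> par (nu g) = 1"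
proof -
  let ?H = "{g_al, g_be, g_ga, g_a \<circ> g_b, g_b \<circ> g_c}"
  let ?S = "{g \<in> Gam. par (nu g) = 1}"
  have inv: "inv\<^bsub>BijGroup UNIV\<^esub> g = h" if "bij g" "bij h" "h \<circ> g = id" for g h :: "letter aut"
    by (rule group.inv_equality[OF group_BijGroup])
      (use that in \<open>auto simp: BijGroup_UNIV_mult BijGroup_UNIV_carrier BijGroup_UNIV_one\<close>)
  have sub: "subgroup ?S (BijGroup UNIV)"
  proof (rule group.subgroupI[OF group_BijGroup])
    show "?S \<subseteq> carrier (BijGroup UNIV)" by (auto simp: BijGroup_UNIV_carrier G.bij_in)
    show "?S \<noteq> {}" using G.id_in by (auto intro!: exI[of _ id])
  next
    fix g assume g: "g \<in> ?S"
    then obtain h where h: "h \<in> Gam" "g \<circ> h = id" "h \<circ> g = id" using G.inv_ex by blast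
    have "par (nu g) * par (nu h) = 1" using g h nu_comp[of g h] par_comp[of "nu g" "nu h"] by simp
    then show "inv\<^bsub>BijGroup UNIV\<^esub> g \<in> ?S" using g h inv[of g h] G.bij_in by simp
  next
    fix g h assume "g \<in> ?S" "h \<in> ?S"
    then show "g \<otimes>\<^bsub>BijGroup UNIV\<^esub> h \<in> ?S"
      by (simp add: BijGroup_mult_Gam G.comp_in nu_comp par_comp)
  qed
  have H: "?H \<subseteq> ?S" by (auto simp: G.comp_in nu_comp par_comp)
  have IMG: "subgroup IMG (BijGroup UNIV)"
    unfolding IMG_def
    by (rule group.generate_is_subgroup[OF group_BijGroup]) (use H sub subgroup.subset in blast)
  have IS: "IMG \<subseteq> ?S"
    unfolding IMG_def by (rule group.generate_subgroup_incl[OF group_BijGroup H sub])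
  then show "g \<in> IMG \<Longrightarrow> g \<in> Gam \<and> par (nu g) = 1" by blast
  show "g \<in> IMG \<Longrightarrow> h \<in> IMG \<Longrightarrow> g \<circ> h \<in> IMG"
  proof -
    assume gh: "g \<in> IMG" "h \<in> IMG"
    then have "g \<otimes>\<^bsub>BijGroup UNIV\<^esub> h = g \<circ> h" using IS by (intro BijGroup_mult_Gam) auto
    then show ?thesis using subgroup.m_closed[OF IMG gh] by (simp only:)
  qed
  assume g: "g \<in> IMG"
  then obtain h where h: "h \<in> Gam" "g \<circ> h = id" "h \<circ> g = id" using G.inv_ex IS by blast
  have "inv\<^bsub>BijGroup UNIV\<^esub> g = h" using inv g h IS G.bij_in by blast
  then have "h \<in> IMG" using subgroup.m_inv_closed[OF IMG g] by simp
  then show "\<exists>h\<in>IMG. g \<circ> h = id \<and> h \<circ> g = id" using h by blast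
qed

lemma id_IMG: "id \<in> IMG"
  unfolding IMG_def by (rule gen_by_id)

lemma IMG_iff: "g \<in> IMG \<longleftrightarrow> g \<in> Gam \<and> par (nu g) = 1"
proof -
  have gens: "g_al \<in> IMG" "g_be \<in> IMG" "g_ga \<in> IMG" "g_a \<circ> g_b \<in> IMG" "g_b \<circ> g_c \<in> IMG"
    unfolding IMG_def by (auto intro: gen_by_incl)
  have ba: "g_b \<circ> g_a \<in> IMG" "g_c \<circ> g_b \<in> IMG"
  proof -
    obtain h where h: "h \<in> IMG" "g_a \<circ> g_b \<circ> h = id" using IMG_inv[OF gens(4)] by blast
    have "g_b \<circ> g_a \<circ> (g_a \<circ> g_b \<circ> h) = h" by auto
    then show "g_b \<circ> g_a \<in> IMG" using h by simp
    obtain h where h: "h \<in> IMG" "g_b \<circ> g_c \<circ> h = id" using IMG_inv[OF gens(5)] by blast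
    have "g_c \<circ> g_b \<circ> (g_b \<circ> g_c \<circ> h) = h" by auto
    then show "g_c \<circ> g_b \<in> IMG" using h by simp
  qed
  \<comment> \<open>The statement that \<open>IMG\<close> has index two: the induction must also
    track the orientation reversing elements, which become elements of \<open>IMG\<close> after
    multiplication by a.\<close>
  have "(par (nu g) = 1 \<longrightarrow> g \<in> IMG) \<and> (par (nu g) = -1 \<longrightarrow> g_a \<circ> g \<in> IMG)" if "g \<in> Gam"
    using that
  proof (induction rule: Gam_induct)
    case one
    have "par (nu id) = 1" by simp
    then show ?case using id_IMG by (metis one_neq_neg_one)
  next
    case (step s g)
    have s: "s \<in> Gam" using step by auto
    have par: "par (nu (s \<circ> g)) = par (nu s) * par (nu g)"
      using step s by (simp add: nu_comp par_comp)
    note c = IMG_comp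
    have IH: "par (nu g) = 1 \<Longrightarrow> g \<in> IMG" "par (nu g) = -1 \<Longrightarrow> g_a \<circ> g \<in> IMG"
      using step(3) by blast+
    have "(par (nu g) = par (nu s) \<longrightarrow> s \<circ> g \<in> IMG) \<and> (par (nu g) = - par (nu s) \<longrightarrow> g_a \<circ> (s \<circ> g) \<in> IMG)"
      using step(1)
    proof (elim insertE emptyE)
      assume "s = g_al"
      moreover have "g_a \<circ> (g_al \<circ> g) = g_al \<circ> (g_a \<circ> g)" by auto
      ultimately show ?thesis using IH gens c by simp
    next
      assume "s = g_be"
      moreover have "g_a \<circ> (g_be \<circ> g) = g_be \<circ> (g_a \<circ> g)" by auto
      ultimately show ?thesis using IH gens c by simp
    next
      assume "s = g_ga"
      moreover have "g_a \<circ> (g_ga \<circ> g) = g_al \<circ> (g_ga \<circ> (g_al \<circ> (g_a \<circ> g)))" by auto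
      ultimately show ?thesis using IH gens c by simp
    next
      assume "s = g_a"
      moreover have "g_a \<circ> (g_a \<circ> g) = g" by auto
      ultimately show ?thesis using IH by simp
    next
      assume "s = g_b"
      moreover have "g_b \<circ> g = g_b \<circ> g_a \<circ> (g_a \<circ> g)" "g_a \<circ> (g_b \<circ> g) = g_a \<circ> g_b \<circ> g" by auto
      ultimately show ?thesis using IH gens ba c by simp
    next
      assume "s = g_c"
      moreover have "g_c \<circ> g = g_c \<circ> g_b \<circ> (g_b \<circ> g_a \<circ> (g_a \<circ> g))"
        "g_a \<circ> (g_c \<circ> g) = g_a \<circ> g_b \<circ> (g_b \<circ> g_c \<circ> g)" by auto
      ultimately show ?thesis using IH gens ba c by simp
    qed
    moreover have "par (nu s) = 1 \<or> par (nu s) = -1" "par (nu g) = 1 \<or> par (nu g) = -1"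
      using par_cases nu_in s step(2) by blast+
    ultimately show "(par (nu (s \<circ> g)) = 1 \<longrightarrow> s \<circ> g \<in> IMG) \<and> (par (nu (s \<circ> g)) = -1 \<longrightarrow> g_a \<circ> (s \<circ> g) \<in> IMG)"
      unfolding par by (elim disjE) simp_all
  qed
  then show ?thesis using IMG_sub by blast
qed

section \<open>The vertex stabilisers\<close>

fun sg :: "vertex \<Rightarrow> letter aut set" where
  "sg VA = {g_be, g_ga, g_b, g_c}"
| "sg VB = {g_al, g_ga, g_a, g_c}"
| "sg VC = {g_al, g_be, g_a, g_b}"
| "sg VA1 = {g_al, g_b, g_c}"
| "sg VB1 = {g_be, g_a, g_c \<circ> g_ga}"
| "sg VC1 = {g_ga, g_a \<circ> g_al, g_b \<circ> g_be}"

lemma stab_sg: "stab X = gen_by (sg X)"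
  by (cases X) simp_all

lemma involutive_sg: "involutive (sg X)"
  by (cases X) (auto simp: involutive_def)

lemma sg_Gam: "sg X \<subseteq> Gam"
  by (cases X) (auto simp: G.comp_in)

lemma stab_id: "id \<in> stab X"
  unfolding stab_sg by (rule gen_by_id)

lemma stab_comp: "g \<in> stab X \<Longrightarrow> h \<in> stab X \<Longrightarrow> g \<circ> h \<in> stab X"
  unfolding stab_sg by (rule gen_by_comp[OF involutive_sg])

lemma stab_inv: "g \<in> stab X \<Longrightarrow> \<exists>h\<in>stab X. g \<circ> h = id \<and> h \<circ> g = id"
  unfolding stab_sg by (rule gen_by_inverse[OF involutive_sg])

lemma stab_incl: "s \<in> sg X \<Longrightarrow> s \<in> stab X"
  unfolding stab_sg by (rule gen_by_incl)

lemma stab_Gam: "g \<in> stab X \<Longrightarrow> g \<in> Gam"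
  unfolding stab_sg using gen_by_least[OF involutive_sg sg_Gam G.id_in G.comp_in] by blast

lemma stab_induct [consumes 1, case_names one step]:
  assumes "g \<in> stab X" "P id" "\<And>s g. s \<in> sg X \<Longrightarrow> g \<in> stab X \<Longrightarrow> P g \<Longrightarrow> P (s \<circ> g)"
  shows "P g"
  using gen_by_induct[OF involutive_sg, of g X P] assms unfolding stab_sg by blast

lemma stab_nu_fix: "g \<in> stab X \<Longrightarrow> isom (nu g) (P_vert X) = P_vert X"
proof (induction rule: stab_induct)
  case one
  have "isom (nu id) (P_vert X) = P_vert X" by simp
  then show ?case .
next
  case (step s g)
  have s: "s \<in> Gam" "g \<in> Gam" using step sg_Gam stab_Gam by auto
  have "isom (nu s) (P_vert X) = P_vert X"
    using step(1) by (cases X) (auto simp: nu_comp r_defs)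
  then show "isom (nu (s \<circ> g)) (P_vert X) = P_vert X"
    using step(3) s by (simp add: nu_comp isom_comp)
qed

text \<open>Every vertex stabiliser is the product of the subgroup generated by \<open>NN X\<close>, on which \<open>\<nu>\<close> is trivial, and
  of a dihedral group with generators \<open>d1 X\<close> and \<open>d2 X\<close> that embeds under \<open>\<nu>\<close>.\<close>

fun NN :: "vertex \<Rightarrow> letter aut set" where
  "NN VA = {g_be, g_ga}" | "NN VB = {g_al, g_ga}" | "NN VC = {g_al, g_be}"
| "NN VA1 = {g_al}" | "NN VB1 = {g_be}" | "NN VC1 = {g_ga}"

fun d1 :: "vertex \<Rightarrow> letter aut" where
  "d1 VA = g_b" | "d1 VA1 = g_b" | "d1 VB = g_a" | "d1 VB1 = g_a" | "d1 VC = g_a \<circ> g_al" | "d1 VC1 = g_a \<circ> g_al"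

fun d2 :: "vertex \<Rightarrow> letter aut" where
  "d2 VA = g_c" | "d2 VA1 = g_c" | "d2 VB = g_c \<circ> g_ga" | "d2 VB1 = g_c \<circ> g_ga"
| "d2 VC = g_b \<circ> g_be" | "d2 VC1 = g_b \<circ> g_be"

lemma involutive_NN: "involutive (NN X)"
  by (cases X) (auto simp: involutive_def)

lemma involutive_d: "involutive {d1 X, d2 X}"
  by (cases X) (auto simp: involutive_def)

lemma NN_sub: "NN X \<subseteq> {g_al, g_be, g_ga}"
  by (cases X) auto

lemma NN_sg: "NN X \<subseteq> sg X"
  by (cases X) auto

lemma d_stab: "d1 X \<in> stab X" "d2 X \<in> stab X"
  by (cases X; simp del: stab.simps; (intro stab_comp stab_incl)?; simp)+

lemma gen_d_stab: "gen_by {d1 X, d2 X} \<subseteq> stab X"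
  using gen_by_least[OF involutive_d _ stab_id stab_comp] d_stab by blast

lemma gen_NN3: "r \<in> NN X \<Longrightarrow> s \<in> NN X \<Longrightarrow> t \<in> NN X \<Longrightarrow> r \<circ> (s \<circ> t) \<in> gen_by (NN X)"
  by (intro gen_by_comp[OF involutive_NN] gen_by_incl)

lemma d_normal:
  assumes "s \<in> NN X" "d \<in> {d1 X, d2 X}"
  shows "\<exists>w\<in>gen_by (NN X). d \<circ> s = w \<circ> d"
proof -
  \<comment> \<open>Conjugation by a dihedral generator fixes a Greek generator or replaces it by
    its conjugate under the other one; the cases are sorted by that other generator.\<close>
  have "d \<circ> s = s \<circ> d \<or> (\<exists>r\<in>NN X. d \<circ> s = r \<circ> (s \<circ> r) \<circ> d)"
  proof -
    consider "(X, d, s) \<in> {(VA, g_b, g_ga), (VC, g_b \<circ> g_be, g_al)}"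
      | "(X, d, s) \<in> {(VA, g_c, g_be), (VB, g_c \<circ> g_ga, g_al)}"
      | "(X, d, s) \<in> {(VB, g_a, g_ga), (VC, g_a \<circ> g_al, g_be)}"
      | "(X, d, s) \<in> {(VA, g_b, g_be), (VA, g_c, g_ga), (VB, g_a, g_al), (VB, g_c \<circ> g_ga, g_ga),
          (VC, g_a \<circ> g_al, g_al), (VC, g_b \<circ> g_be, g_be), (VA1, g_b, g_al), (VA1, g_c, g_al),
          (VB1, g_a, g_be), (VB1, g_c \<circ> g_ga, g_be), (VC1, g_a \<circ> g_al, g_ga), (VC1, g_b \<circ> g_be, g_ga)}"
      using assms by (cases X) auto
    then show ?thesis
    proof cases
      case 1
      have "g_be \<in> NN X" using 1 by auto
      moreover have "d \<circ> s = g_be \<circ> (s \<circ> g_be) \<circ> d" using 1 by auto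
      ultimately show ?thesis by blast
    next
      case 2
      have "g_ga \<in> NN X" using 2 by auto
      moreover have "d \<circ> s = g_ga \<circ> (s \<circ> g_ga) \<circ> d" using 2 by auto
      ultimately show ?thesis by blast
    next
      case 3
      have "g_al \<in> NN X" using 3 by auto
      moreover have "d \<circ> s = g_al \<circ> (s \<circ> g_al) \<circ> d" using 3 by auto
      ultimately show ?thesis by blast
    next
      case 4
      then have "d \<circ> s = s \<circ> d" by auto
      then show ?thesis by blast
    qed
  qed
  then show ?thesis
  proof
    assume "d \<circ> s = s \<circ> d"
    then show ?thesis using gen_by_incl[OF assms(1)] by blast
  next
    assume "\<exists>r\<in>NN X. d \<circ> s = r \<circ> (s \<circ> r) \<circ> d"
    then show ?thesis using gen_NN3[OF _ assms(1)] by blast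
  qed
qed

lemma d_normal':
  assumes "n \<in> gen_by (NN X)" "d \<in> {d1 X, d2 X}"
  shows "\<exists>w\<in>gen_by (NN X). d \<circ> n = w \<circ> d"
  using involutive_NN assms(1)
proof (induction rule: gen_by_induct)
  case one
  have "d \<circ> id = id \<circ> d" by simp
  then show "\<exists>w\<in>gen_by (NN X). d \<circ> id = w \<circ> d" using gen_by_id by blast
next
  case (step s g)
  obtain w where w: "w \<in> gen_by (NN X)" "d \<circ> g = w \<circ> d" using step(3) by blast
  obtain w' where w': "w' \<in> gen_by (NN X)" "d \<circ> s = w' \<circ> d" using d_normal[OF step(1) assms(2)] by blast
  have "d \<circ> (s \<circ> g) = w' \<circ> w \<circ> d" using w w' by (metis comp_assoc)
  then show "\<exists>w\<in>gen_by (NN X). d \<circ> (s \<circ> g) = w \<circ> d"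
    using gen_by_comp[OF involutive_NN w'(1) w(1)] by blast
qed

text \<open>Some dihedral generators at \<open>VB\<close> and \<open>VC\<close> carry Greek factors
  in order to agree with those at \<open>VB1\<close> and \<open>VC1\<close>, which is used in
  \<open>GS_orbit\<close>. The last three cases recover the plain Latin generators from
  them.\<close>

lemma sg_decomp:
  assumes "s \<in> sg X"
  shows "\<exists>n\<in>gen_by (NN X). \<exists>d\<in>{id, d1 X, d2 X}. s = n \<circ> d"
proof -
  consider "s \<in> NN X" | "s \<in> {d1 X, d2 X}" | "X = VB" "s = g_c" | "X = VC" "s = g_a" | "X = VC" "s = g_b"
    using assms by (cases X) auto
  then show ?thesis
  proof cases
    case 1
    then show ?thesis using gen_by_incl[OF 1] by (intro bexI[of _ s] bexI[of _ id]) auto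
  next
    case 2
    then show ?thesis using gen_by_id[of "NN X"] by (intro bexI[of _ id] bexI[of _ s]) auto
  next
    case 3
    have "g_c = g_ga \<circ> (g_c \<circ> g_ga)" by auto
    then show ?thesis using gen_by_incl[of g_ga "NN VB"] 3 by (metis NN.simps(2) d2.simps(3) insertI1 insertI2)
  next
    case 4
    have "g_a = g_al \<circ> (g_a \<circ> g_al)" by auto
    then show ?thesis using gen_by_incl[of g_al "NN VC"] 4 by (metis NN.simps(3) d1.simps(5) insertI1 insertI2)
  next
    case 5
    have "g_b = g_be \<circ> (g_b \<circ> g_be)" by auto
    then show ?thesis using gen_by_incl[of g_be "NN VC"] 5 by (metis NN.simps(3) d2.simps(5) insertI1 insertI2)
  qed
qed

lemma stab_decomp: "g \<in> stab X \<Longrightarrow> \<exists>n\<in>gen_by (NN X). \<exists>d\<in>gen_by {d1 X, d2 X}. g = n \<circ> d"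
proof (induction rule: stab_induct)
  case one
  have "id = id \<circ> id" by simp
  then show "\<exists>n\<in>gen_by (NN X). \<exists>d\<in>gen_by {d1 X, d2 X}. id = n \<circ> d" using gen_by_id by metis
next
  case (step s g)
  obtain n d where nd: "n \<in> gen_by (NN X)" "d \<in> gen_by {d1 X, d2 X}" "g = n \<circ> d" using step(3) by blast
  obtain m e where me: "m \<in> gen_by (NN X)" "e \<in> {id, d1 X, d2 X}" "s = m \<circ> e"
    using sg_decomp[OF step(1)] by blast
  have "\<exists>w\<in>gen_by (NN X). e \<circ> n = w \<circ> e"
    using d_normal'[OF nd(1), of e] me(2) nd(1) by (cases "e = id") auto
  then obtain w where w: "w \<in> gen_by (NN X)" "e \<circ> n = w \<circ> e" by blast
  have "s \<circ> g = m \<circ> w \<circ> (e \<circ> d)" using nd me w by (metis comp_assoc)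
  moreover have "e \<in> gen_by {d1 X, d2 X}" using me(2) gen_by_id gen_by_incl[of e "{d1 X, d2 X}"] by auto
  ultimately show "\<exists>n\<in>gen_by (NN X). \<exists>d\<in>gen_by {d1 X, d2 X}. s \<circ> g = n \<circ> d"
    using gen_by_comp[OF involutive_NN me(1) w(1)] gen_by_comp[OF involutive_d _ nd(2)] by blast
qed

lemma nu_gen_greek:
  assumes "H \<subseteq> {g_al, g_be, g_ga}" "n \<in> gen_by H"
  shows "n \<in> Gam \<and> nu n = id"
proof -
  have "s \<circ> s = id" if "s \<in> {g_al, g_be, g_ga}" for s using that by auto
  then have inv: "involutive H" using assms(1) unfolding involutive_def by blast
  have H: "H \<subseteq> {n \<in> Gam. nu n = id}" using assms(1) by auto
  have "gen_by H \<subseteq> {n \<in> Gam. nu n = id}"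
    by (rule gen_by_least[OF inv H]) (simp_all add: G.id_in G.comp_in nu_comp)
  then show ?thesis using assms(2) by blast
qed

lemma par_d: "par (nu (d1 X)) = -1" "par (nu (d2 X)) = -1"
  by (cases X; simp add: nu_comp)+

lemma d_Gam: "d1 X \<in> Gam" "d2 X \<in> Gam"
  using d_stab stab_Gam by blast+

section \<open>Rotations that preserve the image of a word under \<open>mu_letter\<close>\<close>

lemma dihedral_word:
  assumes inv: "involutive {s, t}" and st: "s \<in> Gam" "t \<in> Gam" "par (nu s) = -1" "par (nu t) = -1"
    and "d \<in> gen_by {s, t}" "par (nu d) = 1"
  shows "\<exists>i. d = (s \<circ> t) ^^ i \<or> d = (t \<circ> s) ^^ i"
proof -
  have ss: "s \<circ> s = id" "t \<circ> t = id" using inv by (auto simp: involutive_def)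
  have c: "s \<circ> (s \<circ> f) = f" "t \<circ> (t \<circ> f) = f" for f using ss by (metis comp_assoc id_comp)+
  \<comment> \<open>Left multiplication by a generator alternates between rotations and reflections,
    so the induction has to carry the normal forms of both.\<close>
  have "d \<in> Gam \<and> (par (nu d) = 1 \<and> (\<exists>i. d = (s \<circ> t) ^^ i \<or> d = (t \<circ> s) ^^ i) \<or>
      par (nu d) = -1 \<and> (\<exists>i. d = s \<circ> (t \<circ> s) ^^ i \<or> d = t \<circ> (s \<circ> t) ^^ i))" (is "?P d")
    using inv assms(6)
  proof (induction rule: gen_by_induct)
    case one
    have "id = (s \<circ> t) ^^ 0" by simp
    then show "?P id" using G.id_in nu_gens(7) par_gens(4) by metis
  next
    case (step r g)
    have r: "r \<in> Gam" "par (nu r) = -1" using step(1) st by auto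
    have g: "g \<in> Gam" using step(3) by blast
    have rg: "r \<circ> g \<in> Gam" "par (nu (r \<circ> g)) = - par (nu g)"
      using r g by (simp_all add: G.comp_in nu_comp par_comp)
    have even: "\<exists>j. f \<circ> h = s \<circ> (t \<circ> s) ^^ j \<or> f \<circ> h = t \<circ> (s \<circ> t) ^^ j"
      if fh: "f \<in> {s, t}" "h = (s \<circ> t) ^^ i \<or> h = (t \<circ> s) ^^ i" for f h i
    proof (cases i)
      case 0
      then have "h = id" using fh by auto
      then have "f \<circ> h = s \<circ> (t \<circ> s) ^^ 0 \<or> f \<circ> h = t \<circ> (s \<circ> t) ^^ 0" using fh by auto
      then show ?thesis by blast
    next
      case (Suc j)
      have "s \<circ> (s \<circ> t) ^^ i = t \<circ> (s \<circ> t) ^^ j" "t \<circ> (t \<circ> s) ^^ i = s \<circ> (t \<circ> s) ^^ j"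
        by (simp_all add: Suc c comp_assoc)
      then show ?thesis using fh by auto
    qed
    have odd: "\<exists>j. f \<circ> h = (s \<circ> t) ^^ j \<or> f \<circ> h = (t \<circ> s) ^^ j"
      if fh: "f \<in> {s, t}" "h = s \<circ> (t \<circ> s) ^^ i \<or> h = t \<circ> (s \<circ> t) ^^ i" for f h i
    proof -
      have "s \<circ> (s \<circ> (t \<circ> s) ^^ i) = (t \<circ> s) ^^ i" "t \<circ> (t \<circ> (s \<circ> t) ^^ i) = (s \<circ> t) ^^ i"
        "s \<circ> (t \<circ> (s \<circ> t) ^^ i) = (s \<circ> t) ^^ Suc i" "t \<circ> (s \<circ> (t \<circ> s) ^^ i) = (t \<circ> s) ^^ Suc i"
        by (simp_all add: c comp_assoc)
      then show ?thesis using fh by (elim insertE emptyE disjE) metis+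
    qed
    from step(3) show "?P (r \<circ> g)"
    proof (elim conjE disjE exE)
      fix i assume p: "par (nu g) = 1" "g = (s \<circ> t) ^^ i"
      have "par (nu (r \<circ> g)) = -1" using rg(2) p(1) by simp
      then show ?thesis using rg(1) even[OF step(1), of g i] p(2) by blast
    next
      fix i assume p: "par (nu g) = 1" "g = (t \<circ> s) ^^ i"
      have "par (nu (r \<circ> g)) = -1" using rg(2) p(1) by simp
      then show ?thesis using rg(1) even[OF step(1), of g i] p(2) by blast
    next
      fix i assume p: "par (nu g) = -1" "g = s \<circ> (t \<circ> s) ^^ i"
      have "par (nu (r \<circ> g)) = 1" using rg(2) p(1) by simp
      then show ?thesis using rg(1) odd[OF step(1), of g i] p(2) by blast
    next
      fix i assume p: "par (nu g) = -1" "g = t \<circ> (s \<circ> t) ^^ i"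
      have "par (nu (r \<circ> g)) = 1" using rg(2) p(1) by simp
      then show ?thesis using rg(1) odd[OF step(1), of g i] p(2) by blast
    qed
  qed
  then show ?thesis using assms(7) by auto
qed

lemma funpow_inverse:
  fixes f g :: "'a \<Rightarrow> 'a"
  assumes "\<And>x. f (g x) = x"
  shows "(f ^^ i) ((g ^^ i) x) = x"
proof (induction i arbitrary: x)
  case (Suc i)
  have "(f ^^ Suc i) ((g ^^ Suc i) x) = (f ^^ i) (f (g ((g ^^ i) x)))"
    by (simp add: funpow_swap1)
  then show ?case using Suc assms by simp
qed simp

lemma funpow_involution: "(\<And>x. f (f x) = x) \<Longrightarrow> (f ^^ i) x = (if even i then x else f x)"
  by (induction i) auto

lemma funpow_Cons: "(\<And>w. f (x # w) = x # g w) \<Longrightarrow> (f ^^ i) (x # w) = x # (g ^^ i) w"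
  by (induction i) auto

lemma rot_inverse:
  assumes fix_st: "\<And>i v. map mu_letter (((s \<circ> t) ^^ i) v) = map mu_letter v \<Longrightarrow> ((s \<circ> t) ^^ i) v = v"
    and inv: "s \<circ> s = id" "t \<circ> t = id"
    and "map mu_letter (((t \<circ> s) ^^ i) v) = map mu_letter v"
  shows "((t \<circ> s) ^^ i) v = v"
proof -
  have c: "s (s x) = x" "t (t x) = x" for x using inv by (metis comp_apply id_apply)+
  have "((s \<circ> t) ^^ i) (((t \<circ> s) ^^ i) x) = x" for x
    by (rule funpow_inverse) (simp add: c)
  then show ?thesis using fix_st[of i "((t \<circ> s) ^^ i) v"] assms(4) by simp
qed

text \<open>The rotation about B' has order two, matching the right angle there, and it changes the
  image of the first letter. So an odd power never preserves the image of a nonempty word.\<close>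

lemma rot_B:
  assumes "map mu_letter (((g_a \<circ> (g_c \<circ> g_ga)) ^^ i) v) = map mu_letter v"
  shows "((g_a \<circ> (g_c \<circ> g_ga)) ^^ i) v = v"
proof -
  define r where "r = g_a \<circ> (g_c \<circ> g_ga)"
  have "r (r v) = v" for v unfolding r_def by (cases v rule: word_cases) simp_all
  then have p: "(r ^^ i) v = (if even i then v else r v)" by (rule funpow_involution)
  show ?thesis
  proof (cases "even i")
    case False
    then have "map mu_letter (r v) = map mu_letter v" using assms p unfolding r_def[symmetric] by simp
    then have "v = []" unfolding r_def by (cases v rule: word_cases) auto
    then have "r v = v" by (simp add: r_def)
    then show ?thesis using p unfolding r_def[symmetric] by simp
  qed (use p in \<open>simp add: r_def\<close>)
qed

lemma rel_ac:
  "g_al (g_ga (g_al (g_a (g_c v)))) = g_ga (g_c (g_a v))"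
  "g_al (g_ga (g_al (g_c (g_a v)))) = g_ga (g_a (g_c v))"
  by (cases v rule: word_cases; simp)+

text \<open>The angle at C' is half of that at B': the square of the rotation fixes the first letter
  and acts below it as the involution of \<open>rot_B\<close> or as its conjugate by \<alpha>. Odd
  powers change the image of the first letter.\<close>

lemma rot_C:
  assumes "map mu_letter (((g_a \<circ> g_al \<circ> (g_b \<circ> g_be)) ^^ i) v) = map mu_letter v"
  shows "((g_a \<circ> g_al \<circ> (g_b \<circ> g_be)) ^^ i) v = v"
proof -
  define t where "t = g_a \<circ> g_al \<circ> (g_b \<circ> g_be)"
  define r where "r = g_a \<circ> (g_c \<circ> g_ga)"
  define q where "q x w = (if x \<in> {X1, X4} then r w else g_al (r (g_al w)))" for x w
  have r2: "r (r v) = v" for v unfolding r_def by (cases v rule: word_cases) simp_all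
  have q2: "q x (q x w) = w" for x w
    unfolding q_def using r2 by (cases "x \<in> {X1, X4}") (simp_all only: if_True if_False rel_al)
  have t2: "(t ^^ 2) (x # w) = x # q x w" for x w
    by (cases x) (simp_all add: q_def t_def r_def numeral_2_eq_2 rel_ac)
  have t_even: "(t ^^ (2 * j)) (x # w) = x # (q x ^^ j) w" for j x w
    unfolding funpow_mult[symmetric] using t2 by (rule funpow_Cons)
  have mq: "q x w = w" if "map mu_letter (q x w) = map mu_letter w" for x w
  proof -
    have "w = []" using that unfolding q_def r_def by (cases w rule: word_cases) (auto split: if_splits)
    then show ?thesis by (simp add: q_def r_def)
  qed
  have q_pow: "(q x ^^ k) w = (if even k then w else q x w)" for k x w
    using q2 by (rule funpow_involution)
  have t_nil: "(t ^^ i) [] = []" by (induction i) (auto simp: t_def)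
  have t_mu: "map mu_letter (t (x # w)) \<noteq> map mu_letter (x # w')" for x w w'
    by (cases x) (simp_all add: t_def)
  show ?thesis
  proof (cases v)
    case (Cons x w)
    show ?thesis
    proof (cases "even i")
      case True
      then obtain j where i: "i = 2 * j" by blast
      have "map mu_letter ((q x ^^ j) w) = map mu_letter w"
        using assms t_even[of j x w] unfolding t_def[symmetric] Cons i by simp
      then have "(q x ^^ j) w = w" using q_pow[of j x w] mq[of x w] by (simp split: if_splits)
      then show ?thesis using t_even[of j x w] unfolding t_def[symmetric] Cons i by simp
    next
      case False
      then obtain j where i: "i = Suc (2 * j)" by (metis oddE Suc_eq_plus1)
      have "(t ^^ i) v = t (x # (q x ^^ j) w)" using t_even[of j x w] by (simp add: i Cons)
      then show ?thesis using assms t_mu unfolding t_def[symmetric] Cons by metis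
    qed
  qed (use t_nil in \<open>simp add: t_def\<close>)
qed

text \<open>The section of bc is the rotation of \<open>rot_C\<close> below \<open>X1\<close> and
  \<open>X2\<close>, and the inverse rotation cb below \<open>X3\<close> and \<open>X4\<close>; so
  the claim recurs on the length of the word.\<close>

lemma rot_A:
  "map mu_letter (((g_b \<circ> g_c) ^^ i) v) = map mu_letter v \<Longrightarrow> ((g_b \<circ> g_c) ^^ i) v = v"
proof (induction "length v" arbitrary: v i rule: less_induct)
  case less
  define t where "t = g_a \<circ> g_al \<circ> (g_b \<circ> g_be)"
  define r where "r = g_b \<circ> g_c"
  define r' where "r' = g_c \<circ> g_b"
  have c12: "(r ^^ i) (x # w) = x # (t ^^ i) w" if "x \<in> {X1, X2}" for x w
    by (rule funpow_Cons) (use that in \<open>auto simp: r_def t_def\<close>)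
  have c34: "(r ^^ i) (x # w) = x # (r' ^^ i) w" if "x \<in> {X3, X4}" for x w
    by (rule funpow_Cons) (use that in \<open>auto simp: r_def r'_def\<close>)
  have "(r ^^ i) v = v"
  proof (cases v)
    case Nil
    have "(r ^^ i) [] = []" by (induction i) (auto simp: r_def)
    then show ?thesis using Nil by simp
  next
    case (Cons x w)
    show ?thesis
    proof (cases "x \<in> {X1, X2}")
      case True
      then show ?thesis
        using c12[of x w] less(2) rot_C[of i w] unfolding Cons r_def[symmetric] t_def[symmetric] by simp
    next
      case False
      then have x: "x \<in> {X3, X4}" by (cases x) auto
      have inv: "(r ^^ i) ((r' ^^ i) w) = w" for w
        by (rule funpow_inverse) (simp add: r_def r'_def)
      have m: "map mu_letter ((r' ^^ i) w) = map mu_letter w"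
        using c34[OF x, of w] less(2) unfolding Cons r_def[symmetric] by simp
      have len: "length ((r' ^^ i) w) = length w" using m by (metis length_map)
      \<comment> \<open>The induction hypothesis is used at the image word: \<open>r ^^ i\<close>
        undoes \<open>r' ^^ i\<close> and so sends that word to \<open>w\<close>, which has the same
        image under \<open>mu_letter\<close>.\<close>
      have "(r ^^ i) ((r' ^^ i) w) = (r' ^^ i) w"
        unfolding r_def by (rule less(1)) (use Cons inv m len in \<open>auto simp: r_def\<close>)
      then show ?thesis using inv c34[OF x, of w] Cons by simp
    qed
  qed
  then show ?case by (simp only: r_def)
qed

text \<open>Orientation is essential: the reflection \<open>g_b \<circ> g_be\<close> sends
  \<open>[X3, X1]\<close> to \<open>[X3, X2]\<close>, which have the same image under
  \<open>mu_letter\<close>. Orientation preserving elements are powers of one rotation or of its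
  inverse.\<close>

lemma rot_fix:
  assumes d: "d \<in> gen_by {d1 X, d2 X}" and par: "par (nu d) = 1"
    and mu: "map mu_letter (d v) = map mu_letter v"
  shows "d v = v"
proof -
  have fix_st: "((d1 X \<circ> d2 X) ^^ i) v = v" if "map mu_letter (((d1 X \<circ> d2 X) ^^ i) v) = map mu_letter v" for i v
    using that rot_A[of i v] rot_B[of i v] rot_C[of i v] by (cases X) (simp_all only: d1.simps d2.simps)
  have inv: "d1 X \<circ> d1 X = id" "d2 X \<circ> d2 X = id" using involutive_d by (auto simp: involutive_def)
  obtain i where "d = (d1 X \<circ> d2 X) ^^ i \<or> d = (d2 X \<circ> d1 X) ^^ i"
    using dihedral_word[OF involutive_d d_Gam par_d d par] by blast
  then show ?thesis
  proof
    assume "d = (d1 X \<circ> d2 X) ^^ i"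
    then show ?thesis using fix_st mu by simp
  next
    assume "d = (d2 X \<circ> d1 X) ^^ i"
    then show ?thesis using rot_inverse[of "d1 X" "d2 X", OF fix_st inv, of i v] mu by simp
  qed
qed

lemma stab_fix:
  assumes g: "g \<in> stab X" and par: "par (nu g) = 1" and mu: "map mu_letter (g v) = map mu_letter v"
  obtains n d where "n \<in> gen_by (NN X)" "d \<in> gen_by {d1 X, d2 X}" "g = n \<circ> d" "g v = n v" "nu g = nu d"
proof -
  obtain n d where nd: "n \<in> gen_by (NN X)" "d \<in> gen_by {d1 X, d2 X}" "g = n \<circ> d"
    using stab_decomp[OF g] by blast
  have n: "n \<in> Gam" "nu n = id" using nu_gen_greek[OF NN_sub nd(1)] by auto
  have d: "d \<in> Gam" using nd(2) gen_d_stab stab_Gam by blast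
  have nu: "nu g = nu d" using nd(3) n d by (simp add: nu_comp)
  have "map mu_letter (d v) = map mu_letter v"
    using mu nd(3) n mu_app[OF n(1), of "d v"] by simp
  then have "d v = v" using rot_fix[OF nd(2)] par nu by simp
  then show ?thesis using that nd nu by simp
qed

lemma stab_kernel:
  assumes g: "g \<in> stab X" and nu: "nu g = id"
  shows "g \<in> gen_by (NN X)"
proof -
  \<comment> \<open>The empty word imposes no condition and thus yields a decomposition of
    \<open>g\<close>, whose dihedral part can then be tested on every word.\<close>
  have "par (nu g) = 1" "map mu_letter (g []) = map mu_letter []"
    using nu G.app_Nil[OF stab_Gam[OF g]] by simp_all
  then obtain n d where nd: "n \<in> gen_by (NN X)" "d \<in> gen_by {d1 X, d2 X}" "g = n \<circ> d" "nu g = nu d"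
    by (rule stab_fix[OF g])
  have d: "d \<in> Gam" using nd(2) gen_d_stab stab_Gam by blast
  have "d v = v" for v
    using rot_fix[OF nd(2), of v] nd(4) nu mu_app[OF d, of v] by simp
  then have "d = id" by auto
  then show ?thesis using nd by simp
qed

declare stab.simps [simp del]

section \<open>Intersections of groups generated by Greek letters\<close>

lemma gen_by_single:
  assumes "involutive {s}" "g \<in> gen_by {s}"
  shows "g = id \<or> g = s"
  using assms
proof (induction rule: gen_by_induct)
  case one
  show "id = id \<or> id = s" by simp
next
  case (step r g)
  then show "r \<circ> g = id \<or> r \<circ> g = s" using assms(1) by (auto simp: involutive_def)
qed

lemma involutive_greek: "s \<in> {g_al, g_be, g_ga} \<Longrightarrow> involutive {s}"
  by (auto simp: involutive_def)

text \<open>The elements of the dihedral group generated by \<open>g_al\<close> and \<open>g_ga\<close> are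
  \<open>\<sigma>\<^sup>e(\<beta>\<^sup>i, \<beta>\<^sup>j, \<beta>\<^sup>j, \<beta>\<^sup>i)\<close>.\<close>

definition AG :: "bool \<Rightarrow> bool \<Rightarrow> bool \<Rightarrow> letter aut \<Rightarrow> bool" where
  "AG e i j p \<longleftrightarrow> p [] = [] \<and> (\<forall>x w. p (x # w) = (if e then sigma x else x) #
     (if x \<in> {X1, X4} then (if i then g_be w else w) else (if j then g_be w else w)))"

lemma AG_al: "AG e i j p \<Longrightarrow> AG (\<not> e) i j (g_al \<circ> p)"
  by (auto simp: AG_def)

lemma AG_ga: "AG e i j p \<Longrightarrow> if e then AG e i (\<not> j) (g_ga \<circ> p) else AG e (\<not> i) j (g_ga \<circ> p)"
proof -
  assume A: "AG e i j p"
  have "p [] = []" using A by (simp add: AG_def)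
  moreover have "(g_ga \<circ> p) (x # w) = (if e then sigma x else x) #
     (if x \<in> {X1, X4} then (if (if e then i else \<not> i) then g_be w else w)
      else (if (if e then \<not> j else j) then g_be w else w))" for x w
    using A unfolding AG_def by (cases x) auto
  ultimately show ?thesis unfolding AG_def by (cases e) simp_all
qed

lemma AG_id: "AG False False False id"
  by (simp add: AG_def)

lemma AG_unique:
  assumes "AG e i j p" "AG e' i' j' p"
  shows "e = e' \<and> i = i' \<and> j = j'"
proof -
  have v: "p [X1] = [if e then X2 else X1]"
    "p [X1, X1, X1] = (if e then X2 else X1) # (if i then [X1, X2] else [X1, X1])"
    "p [X2, X1, X1] = (if e then X1 else X2) # (if j then [X1, X2] else [X1, X1])"
    if "AG e i j p" for e i j
    using that unfolding AG_def by (cases e; cases i; cases j; simp)+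
  show ?thesis
    using v[OF assms(1)] v[OF assms(2)] by (simp split: if_splits)
qed

lemma AG_be: "\<not> AG e i j g_be"
proof
  assume "AG e i j g_be"
  then have "g_be [X1] = (if e then sigma X1 else X1) # []"
    "g_be [X1, X1] = (if e then sigma X1 else X1) # (if i then g_be [X1] else [X1])"
    unfolding AG_def by simp_all
  then show False by (auto split: if_splits)
qed

lemma gen_al_ga:
  assumes "g \<in> gen_by {g_al, g_ga}"
  shows "\<exists>e i j. AG e i j g"
proof (rule gen_by_induct[OF _ assms, where P = "\<lambda>g. \<exists>e i j. AG e i j g"])
  show "\<exists>e i j. AG e i j id" using AG_id by blast
  fix s g assume "s \<in> {g_al, g_ga}" "\<exists>e i j. AG e i j g"
  then show "\<exists>e i j. AG e i j (s \<circ> g)" using AG_al AG_ga by (metis (full_types) insertE singletonD)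
qed (auto simp: involutive_def)

text \<open>At \<open>X2\<close> and \<open>X3\<close> the section of \<gamma> is trivial and that
  of \<beta> is an involution, so a product has only two possible sections there. This is enough to
  compare with the other two groups.\<close>

lemma gen_be_ga:
  assumes "g \<in> gen_by {g_be, g_ga}"
  shows "\<exists>i j. g [] = [] \<and> (\<forall>w. g (X2 # w) = X2 # (if i then g_ga w else w) \<and>
    g (X3 # w) = X3 # (if j then g_al w else w) \<and> hd (g (X1 # w)) = X1 \<and> hd (g (X4 # w)) = X4 \<and> g (X1 # w) \<noteq> [] \<and> g (X4 # w) \<noteq> [])"
    (is "?P g")
proof (rule gen_by_induct[OF _ assms, where P = ?P])
  have "?P id" by (intro exI[of _ False]) auto
  then show "?P id" .
  fix s g assume s: "s \<in> {g_be, g_ga}" and "?P g"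
  then obtain i j where g: "g [] = []" "\<And>w. g (X2 # w) = X2 # (if i then g_ga w else w)"
    "\<And>w. g (X3 # w) = X3 # (if j then g_al w else w)" "\<And>w. hd (g (X1 # w)) = X1" "\<And>w. hd (g (X4 # w)) = X4"
    "\<And>w. g (X1 # w) \<noteq> []" "\<And>w. g (X4 # w) \<noteq> []" by metis
  have X: "\<exists>u. g (X1 # w) = X1 # u" "\<exists>u. g (X4 # w) = X4 # u" for w
    using g(4-7)[of w] by (metis list.collapse)+
  have X': "hd (s (g (X1 # w))) = X1" "hd (s (g (X4 # w))) = X4" "s (g (X1 # w)) \<noteq> []" "s (g (X4 # w)) \<noteq> []" for w
    using s X[of w] by auto
  show "?P (s \<circ> g)"
  proof (cases "s = g_be")
    case True
    then show ?thesis
      using g(1-3) X' by (intro exI[of _ "\<not> i"] exI[of _ "\<not> j"]) auto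
  next
    case False
    then show ?thesis
      using g(1-3) X' s by (intro exI[of _ i] exI[of _ j]) auto
  qed
qed (auto simp: involutive_def)

text \<open>The shape \<sigma>^e(p, q, p, q) of the elements of the group generated by \<alpha> and
  \<beta>.\<close>

definition AB :: "bool \<Rightarrow> letter aut \<Rightarrow> letter aut \<Rightarrow> letter aut \<Rightarrow> bool" where
  "AB e p q g \<longleftrightarrow> g [] = [] \<and>
     (\<forall>x w. g (x # w) = (if e then sigma x else x) # (if x \<in> {X1, X3} then p w else q w))"

text \<open>The sections \<open>p\<close> and \<open>q\<close> of an element of the group generated by \<open>g_al\<close> and \<open>g_be\<close> are exchanged by the
  automorphism swapping \<open>g_al\<close> and \<open>g_ga\<close>. Only the resulting relation between the parities is needed.\<close>

definition linked :: "letter aut \<Rightarrow> letter aut \<Rightarrow> bool" where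
  "linked p q \<longleftrightarrow> (\<exists>e i j e' i' j'. AG e i j p \<and> AG e' i' j' q \<and> e = (i' \<noteq> j') \<and> e' = (i \<noteq> j))"

lemma linked_sym: "linked p q \<Longrightarrow> linked q p"
  unfolding linked_def by blast

lemma linked_step: "linked p q \<Longrightarrow> linked (g_al \<circ> p) (g_ga \<circ> q)"
proof -
  assume "linked p q"
  then obtain e i j e' i' j' where *: "AG e i j p" "AG e' i' j' q" "e = (i' \<noteq> j')" "e' = (i \<noteq> j)"
    unfolding linked_def by blast
  have "AG e' (if e' then i' else \<not> i') (if e' then \<not> j' else j') (g_ga \<circ> q)"
    using AG_ga[OF *(2)] by (cases e') auto
  moreover have "(\<not> e) = ((if e' then i' else \<not> i') \<noteq> (if e' then \<not> j' else j'))" using *(3) by auto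
  ultimately show ?thesis using AG_al[OF *(1)] *(4) unfolding linked_def by blast
qed

lemma gen_al_be:
  assumes "g \<in> gen_by {g_al, g_be}"
  shows "\<exists>e p q. AB e p q g \<and> linked p q" (is "?P g")
proof (rule gen_by_induct[OF _ assms, where P = ?P])
  have "linked id id" unfolding linked_def using AG_id by blast
  moreover have "AB False id id id" by (simp add: AB_def)
  ultimately show "?P id" by blast
  fix s g assume s: "s \<in> {g_al, g_be}" and "?P g"
  then obtain e p q where g: "AB e p q g" "linked p q" by blast
  show "?P (s \<circ> g)"
  proof (cases "s = g_al")
    case True
    have "AB (\<not> e) p q (s \<circ> g)" using g(1) by (simp add: AB_def True)
    then show ?thesis using g(2) by blast
  next
    case False
    with s have s: "s = g_be" by simp
    show ?thesis
    proof (cases e)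
      case True
      have "(s \<circ> g) (x # w) = sigma x # (if x \<in> {X1, X3} then (g_ga \<circ> p) w else (g_al \<circ> q) w)" for x w
        using g(1) True by (cases x) (simp_all add: s AB_def)
      then have "AB e (g_ga \<circ> p) (g_al \<circ> q) (s \<circ> g)" using g(1) True by (simp add: AB_def s)
      moreover have "linked (g_ga \<circ> p) (g_al \<circ> q)" using g(2) linked_sym linked_step by blast
      ultimately show ?thesis by blast
    next
      case False
      have "(s \<circ> g) (x # w) = x # (if x \<in> {X1, X3} then (g_al \<circ> p) w else (g_ga \<circ> q) w)" for x w
        using g(1) False by (cases x) (simp_all add: s AB_def)
      then have "AB e (g_al \<circ> p) (g_ga \<circ> q) (s \<circ> g)" using g(1) False by (simp add: AB_def s)
      then show ?thesis using linked_step[OF g(2)] by blast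
    qed
  qed
qed (auto simp: involutive_def)

lemma AG_al_simp: "AG True False False g_al" "AG False True False g_ga"
  using AG_al[OF AG_id] AG_ga[OF AG_id] by auto

lemma greek_distinct:
  "g_al \<noteq> id" "g_be \<noteq> id" "g_ga \<noteq> id" "g_al \<noteq> g_be" "g_al \<noteq> g_ga" "g_be \<noteq> g_ga" "g_be \<noteq> g_al"
proof -
  have "g_al [X1] \<noteq> id [X1]" "g_be [X1, X1] \<noteq> id [X1, X1]" "g_ga [X1, X1, X1] \<noteq> id [X1, X1, X1]"
    "g_al [X1] \<noteq> g_be [X1]" "g_al [X1] \<noteq> g_ga [X1]" "g_be [X1, X1] \<noteq> g_ga [X1, X1]" "g_be [X1] \<noteq> g_al [X1]"
    by simp_all
  then show "g_al \<noteq> id" "g_be \<noteq> id" "g_ga \<noteq> id" "g_al \<noteq> g_be" "g_al \<noteq> g_ga" "g_be \<noteq> g_ga" "g_be \<noteq> g_al"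
    by metis+
qed

lemma N_AB:
  assumes "g \<in> gen_by {g_be, g_ga}" "g \<in> gen_by {g_al, g_ga}"
  shows "g \<in> {id, g_ga}"
proof -
  obtain e i j where AG: "AG e i j g" using gen_al_ga[OF assms(2)] by blast
  obtain i' j' where g: "\<And>w. g (X2 # w) = X2 # (if i' then g_ga w else w)"
    using gen_be_ga[OF assms(1)] by blast
  have "g (X2 # w) = (if e then sigma X2 else X2) # (if j then g_be w else w)" for w
    using AG unfolding AG_def by simp
  then have *: "X2 # (if i' then g_ga w else w) = (if e then sigma X2 else X2) # (if j then g_be w else w)" for w
    using g by metis
  have e: "\<not> e" using *[of "[]"] by (auto split: if_splits)
  have j: "\<not> j" using *[of "[X1, X1]"] e by (auto split: if_splits)
  have "g = (if i then g_ga else id)"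
  proof
    fix v show "g v = (if i then g_ga else id) v"
      using AG e j unfolding AG_def by (cases v rule: word_cases) simp_all
  qed
  then show ?thesis by simp
qed

text \<open>The first group restricts the sections at \<open>X2\<close> and \<open>X3\<close> to
  {id, \<gamma>} and {id, \<alpha>}; \<open>linked\<close> then forces both to be trivial or both to
  be nontrivial.\<close>

lemma N_AC:
  assumes "g \<in> gen_by {g_be, g_ga}" "g \<in> gen_by {g_al, g_be}"
  shows "g \<in> {id, g_be}"
proof -
  obtain e p q where A: "AB e p q g" "linked p q"
    using gen_al_be[OF assms(2)] by blast
  obtain i j where g: "\<forall>w. g (X2 # w) = X2 # (if i then g_ga w else w)"
    "\<forall>w. g (X3 # w) = X3 # (if j then g_al w else w)"
    using gen_be_ga[OF assms(1)] by blast
  have A6: "g (x # w) = (if e then sigma x else x) # (if x \<in> {X1, X3} then p w else q w)" for x w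
    using A(1) by (simp add: AB_def)
  have e: "\<not> e" using g(1)[rule_format, of "[]"] A6[of X2 "[]"] by (auto split: if_splits)
  have q: "q = (if i then g_ga else id)" using g(1) A6[of X2] e by auto
  have p: "p = (if j then g_al else id)" using g(2) A6[of X3] e by auto
  obtain e' i1 j1 e'' i2 j2 where L: "AG e' i1 j1 p" "AG e'' i2 j2 q" "e' = (i2 \<noteq> j2)"
    using A(2) unfolding linked_def by blast
  have "e' = j" using L(1) p AG_unique[OF L(1), of j False False] AG_id AG_al_simp(1) by (cases j) auto
  moreover have "(i2 \<noteq> j2) = i" using q AG_unique[OF L(2), of False i False] AG_id AG_al_simp(2) by (cases i) auto
  ultimately have ij: "i = j" using L(3) by simp
  show ?thesis
  proof (cases j)
    case True
    have "g v = g_be v" for v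
      using A(1) A6 p q e ij True by (cases v rule: word_cases) (simp_all add: AB_def)
    then show ?thesis by auto
  next
    case False
    have "g v = id v" for v
      using A(1) A6 p q e ij False by (cases v rule: word_cases) (simp_all add: AB_def)
    then have "g = id" by blast
    then show ?thesis by simp
  qed
qed

text \<open>After multiplication by \<alpha> the first letter may be assumed fixed. Both sections
  are then trivial or \<beta>, and \<beta> does not have the shape \<open>AG\<close> that
  \<open>linked\<close> demands.\<close>

lemma N_BC:
  assumes "g \<in> gen_by {g_al, g_ga}" "g \<in> gen_by {g_al, g_be}"
  shows "g \<in> {id, g_al}"
proof -
  have *: "g = id" if g: "g \<in> gen_by {g_al, g_ga}" "g \<in> gen_by {g_al, g_be}" "g [X1] = [X1]" for g
  proof -
    obtain e p q where A: "AB e p q g" "linked p q"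
      using gen_al_be[OF g(2)] by blast
    have A4: "g (x # w) = (if e then sigma x else x) # (if x \<in> {X1, X3} then p w else q w)" for x w
      using A(1) by (simp add: AB_def)
    obtain e' i j where B: "AG e' i j g" using gen_al_ga[OF g(1)] by blast
    have e: "\<not> e" using A4[of X1 "[]"] g(3) by (auto split: if_splits)
    have e': "\<not> e'"
    proof
      assume e'
      then have "g [X1] = [X2]" using B by (cases i) (simp_all add: AG_def)
      then show False using g(3) by simp
    qed
    have "p w = (if i then g_be w else w)" "q w = (if j then g_be w else w)" for w
      using A4[of X1 w] A4[of X2 w] B e e' by (simp_all add: AG_def)
    then have pq: "p = (if i then g_be else id)" "q = (if j then g_be else id)" by auto
    have "p \<noteq> g_be" "q \<noteq> g_be" using A(2) AG_be unfolding linked_def by blast+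
    then have pq: "p = id" "q = id" using pq by (auto split: if_splits)
    then have "g v = id v" for v
      using A(1) e by (cases v rule: word_cases) (simp_all add: AB_def)
    then show ?thesis by blast
  qed
  have inv: "involutive {g_al, g_ga}" "involutive {g_al, g_be}" by (auto simp: involutive_def)
  obtain e i j where AG: "AG e i j g" using gen_al_ga[OF assms(1)] by blast
  show ?thesis
  proof (cases e)
    case False
    then have "g [X1] = [X1]" using AG by (cases i) (simp_all add: AG_def)
    then show ?thesis using * assms by blast
  next
    case True
    then have "(g_al \<circ> g) [X1] = [X1]" using AG by (cases i) (simp_all add: AG_def)
    moreover have "g_al \<circ> g \<in> gen_by {g_al, g_ga}" "g_al \<circ> g \<in> gen_by {g_al, g_be}"
      using gen_by_comp[OF inv(1) gen_by_incl assms(1)] gen_by_comp[OF inv(2) gen_by_incl assms(2)] by auto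
    ultimately have "g_al \<circ> g = id" using * by blast
    then have "g v = g_al v" for v by (metis comp_apply id_apply rel_al(1))
    then have "g = g_al" by blast
    then show ?thesis by simp
  qed
qed

lemma NN_single: "X \<in> {VA1, VB1, VC1} \<Longrightarrow> g \<in> gen_by (NN X) \<Longrightarrow> g \<in> {id, g_al, g_be, g_ga}"
  using gen_by_single[OF involutive_greek, of g_al g] gen_by_single[OF involutive_greek, of g_be g]
    gen_by_single[OF involutive_greek, of g_ga g] by auto

lemma NN_inter:
  assumes "g \<in> gen_by (NN X)" "g \<in> gen_by (NN Y)" "P_vert X \<noteq> P_vert Y"
  shows "g \<in> {id, g_al, g_be, g_ga}"
proof (cases "X \<in> {VA1, VB1, VC1} \<or> Y \<in> {VA1, VB1, VC1}")
  case True
  then show ?thesis using NN_single assms by blast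
next
  case False
  then have "X \<in> {VA, VB, VC}" "Y \<in> {VA, VB, VC}" by (cases X, auto) (cases Y, auto)
  then show ?thesis
    using assms N_AB[of g] N_AC[of g] N_BC[of g] by auto
qed

lemma greek_notin:
  "g_al \<notin> gen_by (NN VA)" "g_be \<notin> gen_by (NN VB)" "g_ga \<notin> gen_by (NN VC)"
proof -
  show "g_al \<notin> gen_by (NN VA)"
  proof
    assume "g_al \<in> gen_by (NN VA)"
    then obtain i where "g_al (X2 # []) = X2 # (if i then g_ga [] else [])" using gen_be_ga[of g_al] by auto
    then show False by simp
  qed
  show "g_be \<notin> gen_by (NN VB)" using gen_al_ga[of g_be] AG_be by auto
  show "g_ga \<notin> gen_by (NN VC)"
  proof
    assume "g_ga \<in> gen_by (NN VC)"
    then obtain e p q where "AB e p q g_ga" using gen_al_be[of g_ga] by auto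
    then have *: "g_ga (x # w) = (if e then sigma x else x) # (if x \<in> {X1, X3} then p w else q w)" for x w
      unfolding AB_def by blast
    have "g_be w = w" for w using *[of X1 w] *[of X3 w] by (cases e) simp_all
    then have "g_be = id" by auto
    then show False using greek_distinct(2) by auto
  qed
qed

lemma nu_greek: "s \<in> {g_al, g_be, g_ga} \<Longrightarrow> nu s = id" by auto

text \<open>An element of a vertex stabiliser that \<open>nu\<close> kills lies in
  \<open>gen_by (NN X)\<close>, so the missing vertices are excluded by looking at sections of
  elements of these small groups.\<close>

lemma greek_stab:
  "g_al \<in> stab X \<longleftrightarrow> X \<in> {VB, VC, VA1}" "g_be \<in> stab X \<longleftrightarrow> X \<in> {VA, VC, VB1}"
  "g_ga \<in> stab X \<longleftrightarrow> X \<in> {VA, VB, VC1}"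
proof -
  have k: "s \<in> gen_by (NN X)" if "s \<in> stab X" "s \<in> {g_al, g_be, g_ga}" for s X
    using stab_kernel[OF that(1) nu_greek[OF that(2)]] .
  have s: "s = t" if "s \<in> gen_by {t}" "s \<noteq> id" "t \<in> {g_al, g_be, g_ga}" for s t
    using gen_by_single[OF involutive_greek[OF that(3)] that(1)] that(2) by blast
  note d = greek_distinct greek_distinct[symmetric] greek_notin
  show "g_al \<in> stab X \<longleftrightarrow> X \<in> {VB, VC, VA1}"
  proof
    assume "g_al \<in> stab X"
    then have "g_al \<in> gen_by (NN X)" using k by blast
    then show "X \<in> {VB, VC, VA1}" using d s[of g_al g_be] s[of g_al g_ga] by (cases X) auto
  next
    assume "X \<in> {VB, VC, VA1}"
    then show "g_al \<in> stab X" by (intro stab_incl) auto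
  qed
  show "g_be \<in> stab X \<longleftrightarrow> X \<in> {VA, VC, VB1}"
  proof
    assume "g_be \<in> stab X"
    then have "g_be \<in> gen_by (NN X)" using k by blast
    then show "X \<in> {VA, VC, VB1}" using d s[of g_be g_al] s[of g_be g_ga] by (cases X) auto
  next
    assume "X \<in> {VA, VC, VB1}"
    then show "g_be \<in> stab X" by (intro stab_incl) auto
  qed
  show "g_ga \<in> stab X \<longleftrightarrow> X \<in> {VA, VB, VC1}"
  proof
    assume "g_ga \<in> stab X"
    then have "g_ga \<in> gen_by (NN X)" using k by blast
    then show "X \<in> {VA, VB, VC1}" using d s[of g_ga g_al] s[of g_ga g_be] by (cases X) auto
  next
    assume "X \<in> {VA, VB, VC1}"
    then show "g_ga \<in> stab X" by (intro stab_incl) auto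
  qed
qed

text \<open>To each face of the three tetrahedra other than ABC an involution is attached that lies
  in the stabilisers of exactly the three vertices of the face. These elements separate the
  intersections of the stabilisers.\<close>

definition tri_gen :: "(vertex set \<times> letter aut) set" where
  "tri_gen = {({VA, VB, VA1}, g_c), ({VA, VB, VB1}, g_c \<circ> g_ga), ({VA, VB, VC1}, g_ga),
    ({VA, VC, VA1}, g_b), ({VA, VC, VB1}, g_be), ({VA, VC, VC1}, g_b \<circ> g_be),
    ({VB, VC, VA1}, g_al), ({VB, VC, VB1}, g_a), ({VB, VC, VC1}, g_a \<circ> g_al)}"

lemma stab_cancel_left: "g \<in> stab X \<Longrightarrow> g \<circ> g = id \<Longrightarrow> g \<circ> h \<in> stab X \<longleftrightarrow> h \<in> stab X"
proof
  assume "g \<in> stab X" "g \<circ> g = id" "g \<circ> h \<in> stab X"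
  then show "h \<in> stab X" using stab_comp[of g X "g \<circ> h"] by (metis comp_assoc id_comp)
qed (rule stab_comp)

text \<open>Vertices over the corner moved by the reflection are excluded in the plane. The wrong
  primed vertex is excluded because its stabiliser would acquire a Greek generator, against
  \<open>greek_stab\<close>.\<close>

lemma stab_latin:
  "g_c \<in> stab X \<longleftrightarrow> X \<in> {VA, VB, VA1}" "g_c \<circ> g_ga \<in> stab X \<longleftrightarrow> X \<in> {VA, VB, VB1}"
  "g_b \<in> stab X \<longleftrightarrow> X \<in> {VA, VC, VA1}" "g_b \<circ> g_be \<in> stab X \<longleftrightarrow> X \<in> {VA, VC, VC1}"
  "g_a \<in> stab X \<longleftrightarrow> X \<in> {VB, VC, VB1}" "g_a \<circ> g_al \<in> stab X \<longleftrightarrow> X \<in> {VB, VC, VC1}"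
proof -
  have invol: "g_a \<circ> g_a = id" "g_b \<circ> g_b = id" "g_c \<circ> g_c = id" "g_al \<circ> g_al = id" "g_be \<circ> g_be = id" "g_ga \<circ> g_ga = id"
    by auto
  have inv2: "(g_c \<circ> g_ga) \<circ> (g_c \<circ> g_ga) = id" "(g_b \<circ> g_be) \<circ> (g_b \<circ> g_be) = id" "(g_a \<circ> g_al) \<circ> (g_a \<circ> g_al) = id"
    by auto
  have fixc: "P_vert X \<noteq> (0, 1)" if "g_c \<in> stab X \<or> g_c \<circ> g_ga \<in> stab X" for X
    using that stab_nu_fix[of g_c X] stab_nu_fix[of "g_c \<circ> g_ga" X] by (auto simp: nu_comp r_defs)
  have fixb: "P_vert X \<noteq> (0, 0)" if "g_b \<in> stab X \<or> g_b \<circ> g_be \<in> stab X" for X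
    using that stab_nu_fix[of g_b X] stab_nu_fix[of "g_b \<circ> g_be" X] by (auto simp: nu_comp r_defs)
  have fixa: "P_vert X \<noteq> (1, 0)" if "g_a \<in> stab X \<or> g_a \<circ> g_al \<in> stab X" for X
    using that stab_nu_fix[of g_a X] stab_nu_fix[of "g_a \<circ> g_al" X] by (auto simp: nu_comp r_defs)
  have comm: "g_ga \<circ> g_c = g_c \<circ> g_ga" "g_be \<circ> g_b = g_b \<circ> g_be" "g_al \<circ> g_a = g_a \<circ> g_al" by auto
  have L: "g_c \<in> stab X" if "X \<in> {VA, VB, VA1}" for X using that by (intro stab_incl) auto
  have L2: "g_c \<circ> g_ga \<in> stab X" if "X \<in> {VA, VB, VB1}" for X
    using that by (elim insertE emptyE) (auto simp: stab_incl intro!: stab_comp simp del: stab.simps)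
  have L3: "g_b \<in> stab X" if "X \<in> {VA, VC, VA1}" for X using that by (intro stab_incl) auto
  have L4: "g_b \<circ> g_be \<in> stab X" if "X \<in> {VA, VC, VC1}" for X
    using that by (elim insertE emptyE) (auto simp: stab_incl intro!: stab_comp simp del: stab.simps)
  have L5: "g_a \<in> stab X" if "X \<in> {VB, VC, VB1}" for X using that by (intro stab_incl) auto
  have L6: "g_a \<circ> g_al \<in> stab X" if "X \<in> {VB, VC, VC1}" for X
    using that by (elim insertE emptyE) (auto simp: stab_incl intro!: stab_comp simp del: stab.simps)
  have c: "g_ga \<in> stab X" if "g_c \<in> stab X" "g_c \<circ> g_ga \<in> stab X" for X
    using stab_cancel_left[OF that(1) invol(3)] that(2) by blast
  have b: "g_be \<in> stab X" if "g_b \<in> stab X" "g_b \<circ> g_be \<in> stab X" for X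
    using stab_cancel_left[OF that(1) invol(2)] that(2) by blast
  have a: "g_al \<in> stab X" if "g_a \<in> stab X" "g_a \<circ> g_al \<in> stab X" for X
    using stab_cancel_left[OF that(1) invol(1)] that(2) by blast
  have c': "g_c \<in> stab X" if "g_ga \<in> stab X" "g_c \<circ> g_ga \<in> stab X" for X
    using stab_cancel_left[OF that(1) invol(6), of g_c] that(2) comm by simp
  have b': "g_b \<in> stab X" if "g_be \<in> stab X" "g_b \<circ> g_be \<in> stab X" for X
    using stab_cancel_left[OF that(1) invol(5), of g_b] that(2) comm by simp
  have a': "g_a \<in> stab X" if "g_al \<in> stab X" "g_a \<circ> g_al \<in> stab X" for X
    using stab_cancel_left[OF that(1) invol(4), of g_a] that(2) comm by simp
  show C: "g_c \<in> stab X \<longleftrightarrow> X \<in> {VA, VB, VA1}" for X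
  proof
    assume g: "g_c \<in> stab X"
    have "X \<noteq> VB1" using c[of X] g L2[of X] greek_stab(3)[of X] by auto
    moreover have "X \<noteq> VC1" "X \<noteq> VC" using fixc[of X] g by auto
    ultimately show "X \<in> {VA, VB, VA1}" by (cases X) auto
  qed (rule L)
  show "g_c \<circ> g_ga \<in> stab X \<longleftrightarrow> X \<in> {VA, VB, VB1}"
  proof
    assume g: "g_c \<circ> g_ga \<in> stab X"
    have "X \<noteq> VA1" using c[of X] g L[of X] greek_stab(3)[of X] by auto
    moreover have "X \<noteq> VC1" "X \<noteq> VC" using fixc[of X] g by auto
    ultimately show "X \<in> {VA, VB, VB1}" by (cases X) auto
  qed (rule L2)
  show "g_b \<in> stab X \<longleftrightarrow> X \<in> {VA, VC, VA1}"
  proof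
    assume g: "g_b \<in> stab X"
    have "X \<noteq> VC1" using b[of X] g L4[of X] greek_stab(2)[of X] by auto
    moreover have "X \<noteq> VB1" "X \<noteq> VB" using fixb[of X] g by auto
    ultimately show "X \<in> {VA, VC, VA1}" by (cases X) auto
  qed (rule L3)
  show "g_b \<circ> g_be \<in> stab X \<longleftrightarrow> X \<in> {VA, VC, VC1}"
  proof
    assume g: "g_b \<circ> g_be \<in> stab X"
    have "X \<noteq> VA1" using b[of X] g L3[of X] greek_stab(2)[of X] by auto
    moreover have "X \<noteq> VB1" "X \<noteq> VB" using fixb[of X] g by auto
    ultimately show "X \<in> {VA, VC, VC1}" by (cases X) auto
  qed (rule L4)
  show "g_a \<in> stab X \<longleftrightarrow> X \<in> {VB, VC, VB1}"
  proof
    assume g: "g_a \<in> stab X"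
    have "X \<noteq> VC1" using a[of X] g L6[of X] greek_stab(1)[of X] by auto
    moreover have "X \<noteq> VA1" "X \<noteq> VA" using fixa[of X] g by auto
    ultimately show "X \<in> {VB, VC, VB1}" by (cases X) auto
  qed (rule L5)
  show "g_a \<circ> g_al \<in> stab X \<longleftrightarrow> X \<in> {VB, VC, VC1}"
  proof
    assume g: "g_a \<circ> g_al \<in> stab X"
    have "X \<noteq> VB1" using a[of X] g L5[of X] greek_stab(1)[of X] by auto
    moreover have "X \<noteq> VA1" "X \<noteq> VA" using fixa[of X] g by auto
    ultimately show "X \<in> {VB, VC, VC1}" by (cases X) auto
  qed (rule L6)
qed

lemma tri_gen_stab: "(T, s) \<in> tri_gen \<Longrightarrow> s \<in> stab X \<longleftrightarrow> X \<in> T"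
  unfolding tri_gen_def
  by (elim insertE emptyE Pair_inject; simp only: greek_stab stab_latin)

section \<open>Elements that fix several vertices\<close>

lemma W_comb:
  assumes "\<phi> \<in> W" "s + t + u = 1"
  shows "\<phi> (s *\<^sub>R x + t *\<^sub>R y + u *\<^sub>R z) = s *\<^sub>R \<phi> x + t *\<^sub>R \<phi> y + u *\<^sub>R \<phi> z"
proof -
  have u: "u = 1 - s - t" using assms(2) by simp
  obtain e d i j b where "\<phi> = wi b e d i j" using assms(1) by (rule W_cases)
  then show ?thesis
    by (cases x; cases y; cases z; cases b) (simp_all add: wi_def u algebra_simps)
qed

lemma hat_stab_single:
  assumes "k \<in> GamHat" "isom k (p, q) = (p, q)" "(p, q) \<in> DD"
    "{s. s = h_a \<and> p = 0 \<or> s = h_b \<and> p + q = 1 \<or> s = h_c \<and> q = 0} \<subseteq> {s}" "s \<circ> s = id"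
  shows "k = id \<or> k = s"
proof -
  define H where "H = {s. s = h_a \<and> p = 0 \<or> s = h_b \<and> p + q = 1 \<or> s = h_c \<and> q = 0}"
  have H: "H \<subseteq> {s}" "k \<in> gen_by H"
    using assms(4) hat_stab[OF assms(1,3,2)] unfolding H_def by blast+
  have "involutive H" using H(1) assms(5) unfolding involutive_def by blast
  then have "gen_by H \<subseteq> {id, s}"
  proof (rule gen_by_least)
    show "H \<subseteq> {id, s}" using H(1) by blast
    show "g \<circ> h \<in> {id, s}" if "g \<in> {id, s}" "h \<in> {id, s}" for g h
      using that assms(5) by (elim insertE emptyE) simp_all
  qed simp
  then show ?thesis using H(2) by blast
qed

lemma hat_fix_two:
  assumes k: "k \<in> GamHat"
  shows "isom k (1, 0) = (1, 0) \<Longrightarrow> isom k (0, 0) = (0, 0) \<Longrightarrow> k = id \<or> k = h_c"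
    and "isom k (1, 0) = (1, 0) \<Longrightarrow> isom k (0, 1) = (0, 1) \<Longrightarrow> k = id \<or> k = h_b"
    and "isom k (0, 0) = (0, 0) \<Longrightarrow> isom k (0, 1) = (0, 1) \<Longrightarrow> k = id \<or> k = h_a"
proof -
  \<comment> \<open>The midpoint of a side lies on no other side, so only one of the three
    reflections can fix it.\<close>
  have mid: "isom k ((1/2) *\<^sub>R x + (1/2) *\<^sub>R y + 0 *\<^sub>R y) = (1/2) *\<^sub>R x + (1/2) *\<^sub>R y + 0 *\<^sub>R y"
    if "isom k x = x" "isom k y = y" for x y
    by (subst W_comb[OF isom_W[OF k]]) (use that in simp_all)
  show "k = id \<or> k = h_c" if "isom k (1, 0) = (1, 0)" "isom k (0, 0) = (0, 0)"
    by (rule hat_stab_single[OF k, of "1/2" 0]) (use mid[OF that] in \<open>auto simp: DD_def\<close>)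
  show "k = id \<or> k = h_b" if "isom k (1, 0) = (1, 0)" "isom k (0, 1) = (0, 1)"
    by (rule hat_stab_single[OF k, of "1/2" "1/2"]) (use mid[OF that] in \<open>auto simp: DD_def\<close>)
  show "k = id \<or> k = h_a" if "isom k (0, 0) = (0, 0)" "isom k (0, 1) = (0, 1)"
    by (rule hat_stab_single[OF k, of 0 "1/2"]) (use mid[OF that] in \<open>auto simp: DD_def\<close>)
qed

lemma hat_fix_two_par:
  assumes "k \<in> GamHat" "isom k (P_vert X) = P_vert X" "isom k (P_vert Y) = P_vert Y" "P_vert X \<noteq> P_vert Y"
    "par k = 1"
  shows "k = id"
  using hat_fix_two[OF assms(1)] assms(2-5)
  by (cases X; cases Y) auto

text \<open>If \<open>nu g\<close> is trivial, two different Greek generators are compared.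
  Otherwise \<open>nu g\<close> is the reflection in the common side; its lifts in the two
  stabilisers differ by a third Greek generator. Multiplying \<open>g\<close> by these lifts leads
  into both kernels, each of order two, and the results are incompatible.\<close>

lemma stab_inter_primes:
  "g \<in> stab VA1 \<Longrightarrow> g \<in> stab VB1 \<Longrightarrow> g = id"
  "g \<in> stab VA1 \<Longrightarrow> g \<in> stab VC1 \<Longrightarrow> g = id"
  "g \<in> stab VB1 \<Longrightarrow> g \<in> stab VC1 \<Longrightarrow> g = id"
proof -
  have single: "n = id \<or> n = s" if "n \<in> stab X" "nu n = id" "NN X = {s}" "s \<in> {g_al, g_be, g_ga}" for n X s
    using gen_by_single[OF involutive_greek[OF that(4)]] stab_kernel[OF that(1,2)] that(3) by simp
  have fx: "isom (nu g) (P_vert X) = P_vert X" if "g \<in> stab X" for X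
    using stab_nu_fix[OF that] .
  note d = greek_distinct greek_distinct[symmetric]
  show "g = id" if g: "g \<in> stab VA1" "g \<in> stab VB1"
  proof -
    have G: "g \<in> Gam" using stab_Gam g by blast
    consider "nu g = id" | "nu g = h_c"
      using hat_fix_two(1)[OF nu_in[OF G]] fx[OF g(1)] fx[OF g(2)] by auto
    then show ?thesis
    proof cases
      case 1
      then show ?thesis using single[OF g(1), of g_al] single[OF g(2), of g_be] d by auto
    next
      case 2
      have "g_c \<circ> g \<in> stab VA1" "g_c \<circ> g_ga \<circ> g \<in> stab VB1"
        using g stab_comp stab_latin(1,2) by blast+
      moreover have "nu (g_c \<circ> g) = id" "nu (g_c \<circ> g_ga \<circ> g) = id"
        using G 2 by (auto simp: nu_comp G.comp_in)
      ultimately have "g_c \<circ> g = id \<or> g_c \<circ> g = g_al" "g_c \<circ> g_ga \<circ> g = id \<or> g_c \<circ> g_ga \<circ> g = g_be"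
        using single[of "g_c \<circ> g" VA1 g_al] single[of "g_c \<circ> g_ga \<circ> g" VB1 g_be] by auto
      moreover have "g_c \<circ> g_ga \<circ> g = g_ga \<circ> (g_c \<circ> g)" by auto
      ultimately have "g_ga = id \<or> g_ga = g_be \<or> g_ga \<circ> g_al = id \<or> g_ga \<circ> g_al = g_be" by auto
      moreover have "(g_ga \<circ> g_al) [X1] \<noteq> id [X1]" "(g_ga \<circ> g_al) [X1] \<noteq> g_be [X1]" by auto
      ultimately show ?thesis using d by metis
    qed
  qed
  show "g = id" if g: "g \<in> stab VA1" "g \<in> stab VC1"
  proof -
    have G: "g \<in> Gam" using stab_Gam g by blast
    consider "nu g = id" | "nu g = h_b"
      using hat_fix_two(2)[OF nu_in[OF G]] fx[OF g(1)] fx[OF g(2)] by auto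
    then show ?thesis
    proof cases
      case 1
      then show ?thesis using single[OF g(1), of g_al] single[OF g(2), of g_ga] d by auto
    next
      case 2
      have "g_b \<circ> g \<in> stab VA1" "g_b \<circ> g_be \<circ> g \<in> stab VC1"
        using g stab_comp stab_latin(3,4) by blast+
      moreover have "nu (g_b \<circ> g) = id" "nu (g_b \<circ> g_be \<circ> g) = id"
        using G 2 by (auto simp: nu_comp G.comp_in)
      ultimately have "g_b \<circ> g = id \<or> g_b \<circ> g = g_al" "g_b \<circ> g_be \<circ> g = id \<or> g_b \<circ> g_be \<circ> g = g_ga"
        using single[of "g_b \<circ> g" VA1 g_al] single[of "g_b \<circ> g_be \<circ> g" VC1 g_ga] by auto
      moreover have "g_b \<circ> g_be \<circ> g = g_be \<circ> (g_b \<circ> g)" by auto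
      ultimately have "g_be = id \<or> g_be = g_ga \<or> g_be \<circ> g_al = id \<or> g_be \<circ> g_al = g_ga" by auto
      moreover have "(g_be \<circ> g_al) [X1] \<noteq> id [X1]" "(g_be \<circ> g_al) [X1] \<noteq> g_ga [X1]" by auto
      ultimately show ?thesis using d by metis
    qed
  qed
  show "g = id" if g: "g \<in> stab VB1" "g \<in> stab VC1"
  proof -
    have G: "g \<in> Gam" using stab_Gam g by blast
    consider "nu g = id" | "nu g = h_a"
      using hat_fix_two(3)[OF nu_in[OF G]] fx[OF g(1)] fx[OF g(2)] by auto
    then show ?thesis
    proof cases
      case 1
      then show ?thesis using single[OF g(1), of g_be] single[OF g(2), of g_ga] d by auto
    next
      case 2
      have "g_a \<circ> g \<in> stab VB1" "g_a \<circ> g_al \<circ> g \<in> stab VC1"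
        using g stab_comp stab_latin(5,6) by blast+
      moreover have "nu (g_a \<circ> g) = id" "nu (g_a \<circ> g_al \<circ> g) = id"
        using G 2 by (auto simp: nu_comp G.comp_in)
      ultimately have "g_a \<circ> g = id \<or> g_a \<circ> g = g_be" "g_a \<circ> g_al \<circ> g = id \<or> g_a \<circ> g_al \<circ> g = g_ga"
        using single[of "g_a \<circ> g" VB1 g_be] single[of "g_a \<circ> g_al \<circ> g" VC1 g_ga] by auto
      moreover have "g_a \<circ> g_al \<circ> g = g_al \<circ> (g_a \<circ> g)" by auto
      ultimately have "g_al = id \<or> g_al = g_ga \<or> g_al \<circ> g_be = id \<or> g_al \<circ> g_be = g_ga" by auto
      moreover have "(g_al \<circ> g_be) [X1] \<noteq> id [X1]" "(g_al \<circ> g_be) [X1] \<noteq> g_ga [X1]" by auto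
      ultimately show ?thesis using d by metis
    qed
  qed
qed

lemma stab_inter_ABC:
  assumes "g \<in> stab VA" "g \<in> stab VB" "g \<in> stab VC"
  shows "g = id"
proof -
  have G: "g \<in> Gam" using stab_Gam assms by blast
  have f: "isom (nu g) (1, 0) = (1, 0)" "isom (nu g) (0, 0) = (0, 0)" "isom (nu g) (0, 1) = (0, 1)"
    using stab_nu_fix[OF assms(1)] stab_nu_fix[OF assms(2)] stab_nu_fix[OF assms(3)] by simp_all
  have "nu g = id"
    using hat_fix_two(1)[OF nu_in[OF G] f(1,2)] f(3) by (auto simp: r_defs)
  then have "g \<in> gen_by (NN VA)" "g \<in> gen_by (NN VB)" "g \<in> gen_by (NN VC)"
    using stab_kernel assms by blast+
  then show ?thesis using N_AB[of g] greek_notin(3) by auto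
qed

section \<open>The intersections of the vertex stabilisers\<close>

definition GS :: "vertex set \<Rightarrow> letter aut set" where
  "GS S = (\<Inter>X\<in>S. stab X)"

text \<open>The faces with nontrivial stabiliser. Among the sets of one to three vertices, all
  others have trivial intersection by \<open>not_nts\<close>.\<close>

definition nts :: "vertex set \<Rightarrow> bool" where
  "nts S \<longleftrightarrow> S \<noteq> {} \<and> (\<exists>(T, s)\<in>tri_gen. S \<subseteq> T)"

lemma finite_vertex_set [simp]: "finite (S :: vertex set)"
proof -
  have "S \<subseteq> {VA, VB, VC, VA1, VB1, VC1}" using vertex.exhaust by blast
  then show ?thesis using finite_subset by blast
qed

lemma GS_id: "id \<in> GS S"
  by (simp add: GS_def stab_id)

lemma tri_card: "(T, s) \<in> tri_gen \<Longrightarrow> card T = 3"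
  by (auto simp: tri_gen_def)

lemma nts_card: "nts S \<Longrightarrow> 1 \<le> card S \<and> card S \<le> 3"
proof -
  assume "nts S"
  then obtain T s where "(T, s) \<in> tri_gen" "S \<subseteq> T" "S \<noteq> {}" unfolding nts_def by blast
  then show ?thesis using card_mono[OF finite_vertex_set, of S T] tri_card[of T s]
    by (simp add: Suc_le_eq card_gt_0_iff)
qed

lemma fst_tri_gen: "fst ` tri_gen = {{VA1, VA, VB}, {VB1, VA, VB}, {VC1, VA, VB}, {VA1, VA, VC},
    {VB1, VA, VC}, {VC1, VA, VC}, {VA1, VB, VC}, {VB1, VB, VC}, {VC1, VB, VC}}"
  by (simp add: tri_gen_def insert_commute)

lemma tri_gen_mem:
  assumes "M \<in> {VA, VB, VC}" "Z \<in> {VA1, VB1, VC1}"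
  shows "\<exists>s. ({VA, VB, VC} - {M} \<union> {Z}, s) \<in> tri_gen"
proof -
  have "{VA, VB, VC} - {M} \<union> {Z} \<in> fst ` tri_gen"
    unfolding fst_tri_gen using assms by (elim insertE emptyE) (simp_all add: insert_Diff_if)
  then show ?thesis by force
qed

lemma not_nts:
  assumes "1 \<le> card S" "card S \<le> 3" "\<not> nts S"
  shows "GS S = {id}"
proof -
  have ne: "S \<noteq> {}" using assms(1) by auto
  have "GS S \<subseteq> {id}"
  proof (cases "\<exists>X\<in>{VA1, VB1, VC1}. \<exists>Y\<in>{VA1, VB1, VC1}. X \<noteq> Y \<and> X \<in> S \<and> Y \<in> S")
    case True
    then have "VA1 \<in> S \<and> VB1 \<in> S \<or> VA1 \<in> S \<and> VC1 \<in> S \<or> VB1 \<in> S \<and> VC1 \<in> S" by auto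
    then show ?thesis using stab_inter_primes unfolding GS_def by blast
  next
    case False
    have "{VA, VB, VC} \<subseteq> S"
    proof (rule ccontr)
      assume "\<not> {VA, VB, VC} \<subseteq> S"
      then obtain M where M: "M \<in> {VA, VB, VC}" "M \<notin> S" by blast
      obtain Z where Z: "Z \<in> {VA1, VB1, VC1}" "\<And>Y. Y \<in> {VA1, VB1, VC1} \<Longrightarrow> Y \<in> S \<Longrightarrow> Y = Z"
        using False by blast
      have "X \<in> {VA, VB, VC} - {M} \<union> {Z}" if "X \<in> S" for X
        using that M Z(2)[of X] by (cases X) auto
      then have "nts S" unfolding nts_def using ne tri_gen_mem[OF M(1) Z(1)] by blast
      then show False using assms(3) by simp
    qed
    then show ?thesis using stab_inter_ABC unfolding GS_def by blast
  qed
  then show ?thesis using GS_id by blast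
qed

lemma tri_gen_avoid:
  assumes "(T, s) \<in> tri_gen" "X \<in> T"
  shows "\<exists>(T', s')\<in>tri_gen. T - {X} \<subseteq> T' \<and> X \<notin> T'"
proof -
  have "T \<in> fst ` tri_gen" using assms(1) by force
  then obtain M Z where MZ: "M \<in> {VA, VB, VC}" "Z \<in> {VA1, VB1, VC1}" "T = {VA, VB, VC} - {M} \<union> {Z}"
  proof -
    assume that: "\<And>M Z. M \<in> {VA, VB, VC} \<Longrightarrow> Z \<in> {VA1, VB1, VC1} \<Longrightarrow> T = {VA, VB, VC} - {M} \<union> {Z} \<Longrightarrow> thesis"
    show thesis
      using \<open>T \<in> fst ` tri_gen\<close> that[of VA VA1] that[of VA VB1] that[of VA VC1] that[of VB VA1] that[of VB VB1]
        that[of VB VC1] that[of VC VA1] that[of VC VB1] that[of VC VC1]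
      unfolding fst_tri_gen by (elim insertE emptyE) (simp_all add: insert_Diff_if)
  qed
  define M' where "M' = (if X = Z then M else X)"
  define Z' where "Z' = (if X \<noteq> Z then Z else if Z = VA1 then VB1 else VA1)"
  have M': "M' \<in> {VA, VB, VC}" using MZ assms(2) by (auto simp: M'_def)
  have Z': "Z' \<in> {VA1, VB1, VC1}" using MZ(2) by (auto simp: Z'_def)
  obtain s' where s': "({VA, VB, VC} - {M'} \<union> {Z'}, s') \<in> tri_gen" using tri_gen_mem[OF M' Z'] by blast
  have "T - {X} \<subseteq> {VA, VB, VC} - {M'} \<union> {Z'}" "X \<notin> {VA, VB, VC} - {M'} \<union> {Z'}"
  proof -
    have "T - {X} \<subseteq> {VA, VB, VC} - {M'} \<union> {Z'} \<and> X \<notin> {VA, VB, VC} - {M'} \<union> {Z'}"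
    proof (cases "X = Z")
      case True
      have "Z' \<noteq> Z" using True by (simp add: Z'_def)
      then show ?thesis using True MZ unfolding M'_def by auto
    next
      case False
      then have "M' = X" "Z' = Z" by (simp_all add: M'_def Z'_def)
      then show ?thesis using False unfolding MZ(3) by blast
    qed
    then show "T - {X} \<subseteq> {VA, VB, VC} - {M'} \<union> {Z'}" "X \<notin> {VA, VB, VC} - {M'} \<union> {Z'}" by blast+
  qed
  then show ?thesis using s' by blast
qed

text \<open>A vertex outside \<open>S\<close> is separated from it by the involution of a triangle
  that contains \<open>S\<close> and avoids that vertex. Hence \<open>S\<close> can be recovered
  from \<open>GS S\<close>, and positions are well defined.\<close>

lemma nts_GS_sub:
  assumes "nts S" "GS S \<subseteq> stab X"
  shows "X \<in> S"
proof (rule ccontr)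
  assume X: "X \<notin> S"
  obtain T s where "(T, s) \<in> tri_gen" "S \<subseteq> T" using assms(1) unfolding nts_def by blast
  then obtain T' s' where T': "(T', s') \<in> tri_gen" "S \<subseteq> T'" "X \<notin> T'"
  proof (cases "X \<in> T")
    case True
    assume that: "\<And>T' s'. (T', s') \<in> tri_gen \<Longrightarrow> S \<subseteq> T' \<Longrightarrow> X \<notin> T' \<Longrightarrow> thesis"
    obtain T' s' where "(T', s') \<in> tri_gen" "T - {X} \<subseteq> T'" "X \<notin> T'"
      using tri_gen_avoid[OF \<open>(T, s) \<in> tri_gen\<close> True] by blast
    then show thesis using that \<open>S \<subseteq> T\<close> X by blast
  qed (use \<open>(T, s) \<in> tri_gen\<close> \<open>S \<subseteq> T\<close> in blast)
  then have "s' \<in> GS S" using tri_gen_stab[OF T'(1)] unfolding GS_def by blast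
  then show False using assms(2) tri_gen_stab[OF T'(1)] T'(3) by blast
qed

lemma nts_GS_le:
  assumes "nts S"
  shows "GS S \<subseteq> GS S' \<longleftrightarrow> S' \<subseteq> S"
proof
  assume le: "GS S \<subseteq> GS S'"
  show "S' \<subseteq> S"
  proof
    fix X assume "X \<in> S'"
    then have "GS S' \<subseteq> stab X" unfolding GS_def by (rule INF_lower)
    then show "X \<in> S" using nts_GS_sub[OF assms] le by simp
  qed
next
  assume "S' \<subseteq> S"
  then show "GS S \<subseteq> GS S'" unfolding GS_def by (rule INF_superset_mono) simp
qed

lemma nts_GS_inj: "nts S \<Longrightarrow> nts S' \<Longrightarrow> GS S = GS S' \<Longrightarrow> S = S'"
  using nts_GS_le by blast

lemma nts_GS_ne_id: "nts S \<Longrightarrow> GS S \<noteq> {id}"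
proof
  assume S: "nts S" "GS S = {id}"
  have "GS S \<subseteq> stab X" for X using S stab_id by auto
  then have "VA1 \<in> S" "VB1 \<in> S" using nts_GS_sub S(1) by blast+
  then show False using S(1) unfolding nts_def tri_gen_def by auto
qed

lemma GS_ABC: "GS {VA, VB, VC} = {id}"
  using stab_inter_ABC GS_id unfolding GS_def by auto

lemma GG_eq: "GG = insert {id} (GS ` {S. nts S})"
proof
  show "GG \<subseteq> insert {id} (GS ` {S. nts S})"
    unfolding GG_def using not_nts by (auto simp: GS_def[symmetric])
  have "{id} \<in> GG"
    unfolding GG_def using GS_ABC[unfolded GS_def] by (auto intro!: exI[of _ "{VA, VB, VC}"])
  moreover have "GS S \<in> GG" if "nts S" for S
    unfolding GG_def using nts_card[OF that] by (auto simp: GS_def)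
  ultimately show "insert {id} (GS ` {S. nts S}) \<subseteq> GG" by auto
qed

lemma pos_id: "pos {id} = barycenter {VA, VB, VC}"
  by (simp add: pos_def)

lemma pos_GS:
  assumes "nts S"
  shows "pos (GS S) = barycenter S"
proof -
  have "(THE p. \<exists>S'. 1 \<le> card S' \<and> card S' \<le> 3 \<and> GS S = (\<Inter>X\<in>S'. stab X) \<and> p = barycenter S') = barycenter S"
  proof (rule the_equality)
    show "\<exists>S'. 1 \<le> card S' \<and> card S' \<le> 3 \<and> GS S = (\<Inter>X\<in>S'. stab X) \<and> barycenter S = barycenter S'"
      using nts_card[OF assms] by (auto simp: GS_def)
  next
    fix p assume "\<exists>S'. 1 \<le> card S' \<and> card S' \<le> 3 \<and> GS S = (\<Inter>X\<in>S'. stab X) \<and> p = barycenter S'"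
    then obtain S' where S': "1 \<le> card S'" "card S' \<le> 3" "GS S = GS S'" "p = barycenter S'"
      by (auto simp: GS_def)
    then have "nts S'" using not_nts nts_GS_ne_id[OF assms] by metis
    then show "p = barycenter S" using nts_GS_inj[OF assms _ S'(3)] S'(4) by simp
  qed
  then show ?thesis using nts_GS_ne_id[OF assms] by (simp add: pos_def)
qed

lemma GS_Gam: "F \<noteq> {} \<Longrightarrow> g \<in> GS F \<Longrightarrow> g \<in> Gam"
  unfolding GS_def using stab_Gam by blast

lemma tetra_cases:
  assumes "S \<in> tetrahedra"
  obtains Z where "Z \<in> {VA1, VB1, VC1}" "S = {Z, VA, VB, VC}"
  using assms unfolding tetrahedra_def by auto

text \<open>If \<open>F\<close> lies over two corners, then \<open>nu g\<close> fixes both and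
  preserves orientation, hence is trivial, and the two kernels share only the identity or single
  Greek letters. For a single vertex \<open>stab_fix\<close> applies. If \<open>F\<close> is an
  unprimed vertex with its primed copy, the dihedral part belongs to both stabilisers; cancelling it
  leaves an element of both kernels, which is trivial.\<close>

lemma GS_orbit:
  assumes F: "F \<noteq> {}" "F \<subseteq> S" "S \<in> tetrahedra" and g: "g \<in> GS F" and par: "par (nu g) = 1"
    and mu: "map mu_letter (g v) = map mu_letter v"
  shows "\<exists>n\<in>gen_by ({g_al, g_be, g_ga} \<inter> GS F). g v = n v"
proof -
  obtain Z where Z: "Z \<in> {VA1, VB1, VC1}" "S = {Z, VA, VB, VC}" using F(3) by (rule tetra_cases)
  have gX: "g \<in> stab X" if "X \<in> F" for X using g that unfolding GS_def by blast
  show ?thesis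
  proof (cases "\<exists>X\<in>F. \<exists>Y\<in>F. P_vert X \<noteq> P_vert Y")
    case True
    then obtain X Y where XY: "X \<in> F" "Y \<in> F" "P_vert X \<noteq> P_vert Y" by blast
    have "nu g = id"
      using hat_fix_two_par[of "nu g" X Y] XY gX stab_nu_fix GS_Gam[OF F(1) g] par by simp
    then have "g \<in> gen_by (NN X)" "g \<in> gen_by (NN Y)" using stab_kernel gX XY by blast+
    then have "g \<in> {id, g_al, g_be, g_ga}" using NN_inter XY(3) by blast
    then have "g \<in> gen_by ({g_al, g_be, g_ga} \<inter> GS F)"
      using g gen_by_id by (cases "g = id") (auto intro: gen_by_incl)
    then show ?thesis by blast
  next
    case False
    obtain X where X: "X \<in> F" using F(1) by blast
    show ?thesis
    proof (cases "F = {X}")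
      case True
      obtain n where n: "n \<in> gen_by (NN X)" "g v = n v"
        using stab_fix[OF gX[OF X] par mu] by metis
      have "NN X \<subseteq> {g_al, g_be, g_ga} \<inter> GS F"
        using NN_sub[of X] NN_sg[of X] stab_incl[of _ X] unfolding GS_def True by blast
      moreover have "involutive ({g_al, g_be, g_ga} \<inter> GS F)" by (auto simp: involutive_def)
      ultimately have "gen_by (NN X) \<subseteq> gen_by ({g_al, g_be, g_ga} \<inter> GS F)"
        by (intro gen_by_least[OF involutive_NN] gen_by_id gen_by_comp) (auto intro: gen_by_incl)
      then show ?thesis using n by blast
    next
      case F': False
      then obtain Y where Y: "Y \<in> F" "Y \<noteq> X" using X by blast
      have P: "P_vert X = P_vert Y" using False X Y by blast
      have "(X = Z \<or> Y = Z) \<and> X \<in> S \<and> Y \<in> S"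
        using X Y F(2) P Z(1) unfolding Z(2) by (cases X; cases Y) auto
      then obtain Y' where Y': "Y' \<in> {X, Y}" "Z \<in> {X, Y}" "Y' \<noteq> Z" "Y' \<in> {VA, VB, VC}" "P_vert Y' = P_vert Z"
        using Y(2) P unfolding Z(2) by (cases "X = Z") auto
      have gZ: "g \<in> stab Z" and gY': "g \<in> stab Y'" using Y' gX X Y by auto
      obtain n d where nd: "n \<in> gen_by (NN Z)" "d \<in> gen_by {d1 Z, d2 Z}" "g = n \<circ> d" "g v = n v"
        using stab_fix[OF gZ par mu] by metis
      have dY': "d \<in> stab Y'"
      proof -
        have "d1 Z = d1 Y' \<and> d2 Z = d2 Y'" using Y'(4,5) Z(1) by auto
        then show ?thesis using nd(2) gen_d_stab by auto
      qed
      have "n \<in> stab Y'"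
      proof -
        obtain d' where d': "d' \<in> stab Y'" "d \<circ> d' = id" using stab_inv[OF dY'] by blast
        have "g \<circ> d' = n" using nd(3) d'(2) by (metis comp_assoc comp_id)
        then show ?thesis using stab_comp[OF gY' d'(1)] by simp
      qed
      moreover have "nu n = id" using nu_gen_greek[OF NN_sub nd(1)] by blast
      moreover have "n = id \<or> (n = g_al \<and> Z = VA1 \<or> n = g_be \<and> Z = VB1 \<or> n = g_ga \<and> Z = VC1)"
      proof -
        have "n = id \<or> n = s" if "n \<in> gen_by {s}" "s \<in> {g_al, g_be, g_ga}" for s
          using gen_by_single[OF involutive_greek] that by blast
        from this[of g_al] this[of g_be] this[of g_ga] show ?thesis
          using Z(1) nd(1) by (elim insertE emptyE) simp_all
      qed
      ultimately have "n = id" using greek_stab[of Y'] Y'(4,5) by (elim disjE conjE) auto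
      then show ?thesis using nd(4) gen_by_id by blast
    qed
  qed
qed

text \<open>The vertices that may carry weight at a point over (p, q): a corner whose barycentric
  coordinate vanishes contributes none (\<open>fc_over\<close>).\<close>

definition over :: "real \<times> real \<Rightarrow> vertex set" where
  "over = (\<lambda>(p, q). {X. (P_vert X = (1, 0) \<longrightarrow> p \<noteq> 0) \<and> (P_vert X = (0, 1) \<longrightarrow> q \<noteq> 0) \<and>
     (P_vert X = (0, 0) \<longrightarrow> p + q \<noteq> 1)})"

lemma hat_lift:
  assumes k: "k \<in> GamHat" and y: "(p, q) \<in> DD" "isom k (p, q) = (p, q)" and S: "S \<in> tetrahedra"
  shows "\<exists>g\<in>Gam. nu g = k \<and> (\<forall>X\<in>S \<inter> over (p, q). g \<in> stab X)"
proof -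
  obtain Z where Z: "Z \<in> {VA1, VB1, VC1}" "S = {Z, VA, VB, VC}" using S by (rule tetra_cases)
  let ?H = "{s. s = h_a \<and> p = 0 \<or> s = h_b \<and> p + q = 1 \<or> s = h_c \<and> q = 0}"
  have inv: "involutive ?H" by (auto simp: involutive_def)
  \<comment> \<open>Each reflection has two lifts that differ by a Greek letter and fix different
    primed vertices. The choice follows the primed vertex \<open>Z\<close> of the
    tetrahedron.\<close>
  define la lb lc where "la = (if Z = VC1 then g_a \<circ> g_al else g_a)"
    and "lb = (if Z = VC1 then g_b \<circ> g_be else g_b)" and "lc = (if Z = VB1 then g_c \<circ> g_ga else g_c)"
  have gens: "\<exists>t\<in>Gam. nu t = s \<and> (\<forall>X\<in>S \<inter> over (p, q). t \<in> stab X)" if "s \<in> ?H" for s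
  proof -
    from that consider "s = h_a" "p = 0" | "s = h_b" "p + q = 1" | "s = h_c" "q = 0" by blast
    then show ?thesis
    proof cases
      case 1
      have "la \<in> Gam" "nu la = h_a" by (auto simp: la_def nu_comp G.comp_in)
      moreover have "la \<in> stab X" if "X \<in> S \<inter> over (p, q)" for X
        using that 1 Z unfolding la_def by (auto simp: over_def stab_latin)
      ultimately show ?thesis using 1 by blast
    next
      case 2
      have "lb \<in> Gam" "nu lb = h_b" by (auto simp: lb_def nu_comp G.comp_in)
      moreover have "lb \<in> stab X" if "X \<in> S \<inter> over (p, q)" for X
        using that 2 Z unfolding lb_def by (auto simp: over_def stab_latin)
      ultimately show ?thesis using 2 by blast
    next
      case 3
      have "lc \<in> Gam" "nu lc = h_c" by (auto simp: lc_def nu_comp G.comp_in)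
      moreover have "lc \<in> stab X" if "X \<in> S \<inter> over (p, q)" for X
        using that 3 Z unfolding lc_def by (auto simp: over_def stab_latin)
      ultimately show ?thesis using 3 by blast
    qed
  qed
  show ?thesis
    using inv hat_stab[OF k y]
  proof (rule gen_by_induct[where P = "\<lambda>k. \<exists>g\<in>Gam. nu g = k \<and> (\<forall>X\<in>S \<inter> over (p, q). g \<in> stab X)"])
    show "\<exists>g\<in>Gam. nu g = id \<and> (\<forall>X\<in>S \<inter> over (p, q). g \<in> stab X)"
      using G.id_in nu_gens(7) stab_id by blast
  next
    fix s k assume s: "s \<in> ?H" and "\<exists>g\<in>Gam. nu g = k \<and> (\<forall>X\<in>S \<inter> over (p, q). g \<in> stab X)"
    then obtain g t where "g \<in> Gam" "nu g = k" "\<forall>X\<in>S \<inter> over (p, q). g \<in> stab X"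
      "t \<in> Gam" "nu t = s" "\<forall>X\<in>S \<inter> over (p, q). t \<in> stab X" using gens[OF s] by blast
    then show "\<exists>g\<in>Gam. nu g = s \<circ> k \<and> (\<forall>X\<in>S \<inter> over (p, q). g \<in> stab X)"
      using nu_comp G.comp_in stab_comp by (intro bexI[of _ "t \<circ> g"]) auto
  qed
qed

section \<open>Barycentric coordinates\<close>

lemma UNIV_vertex: "(UNIV :: vertex set) = {VA, VB, VC, VA1, VB1, VC1}"
  using vertex.exhaust by blast

lemma sum_vertex: "sum f (UNIV :: vertex set) = f VA + (f VB + (f VC + (f VA1 + (f VB1 + f VC1))))"
  for f :: "vertex \<Rightarrow> 'b::comm_monoid_add"
  unfolding UNIV_vertex by simp

lemma all_vertex: "(\<forall>X. P X) \<longleftrightarrow> P VA \<and> P VB \<and> P VC \<and> P VA1 \<and> P VB1 \<and> P VC1"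
  using vertex.exhaust by metis

lemma finite_vertex_sets [simp]: "finite (A :: vertex set set)"
proof -
  have "finite (Pow (UNIV :: vertex set))" by (simp only: finite_Pow_iff finite_vertex_set)
  then show ?thesis by (rule rev_finite_subset) blast
qed

lemma five_distinct [simp]:
  "(1::5) \<noteq> 3" "(1::5) \<noteq> 4" "(1::5) \<noteq> 5" "(2::5) \<noteq> 3" "(2::5) \<noteq> 4" "(2::5) \<noteq> 5"
  "(3::5) \<noteq> 4" "(3::5) \<noteq> 5" "(4::5) \<noteq> 5"
  "(2::5) \<noteq> 1" "(3::5) \<noteq> 1" "(4::5) \<noteq> 1" "(5::5) \<noteq> 1" "(3::5) \<noteq> 2" "(4::5) \<noteq> 2" "(5::5) \<noteq> 2"
  "(4::5) \<noteq> 3" "(5::5) \<noteq> 3" "(5::5) \<noteq> 4"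
  by simp_all

lemma vec5_nth [simp]:
  "vec5 p q r s t $ 1 = p" "vec5 p q r s t $ 2 = q" "vec5 p q r s t $ 3 = r"
  "vec5 p q r s t $ 4 = s" "vec5 p q r s t $ 5 = t"
  unfolding vec5_def by (simp_all add: axis_def)

lemma vec5_eq [simp]: "vec5 p q r s t = vec5 p' q' r' s' t' \<longleftrightarrow> p = p' \<and> q = q' \<and> r = r' \<and> s = s' \<and> t = t'"
  by (metis vec5_nth)

lemma vec5_arith:
  "vec5 p q r s t + vec5 p' q' r' s' t' = vec5 (p + p') (q + q') (r + r') (s + s') (t + t')"
  "c *\<^sub>R vec5 p q r s t = vec5 (c * p) (c * q) (c * r) (c * s) (c * t)"
  "vec5 p q r s t - vec5 p' q' r' s' t' = vec5 (p - p') (q - q') (r - r') (s - s') (t - t')"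
  unfolding vec5_def by (simp_all add: algebra_simps)

definition EE :: "(vertex \<Rightarrow> real) \<Rightarrow> real ^ 5" where
  "EE w = (\<Sum>X\<in>UNIV. w X *\<^sub>R vpos X)"

lemma EE_vec5: "EE w = vec5 (w VA + w VA1) (w VC + w VC1) (w VA1) (w VB1) (w VC1)"
  unfolding EE_def sum_vertex by (simp add: vec5_arith algebra_simps)

text \<open>The six vertices are affinely independent in the five-dimensional space.\<close>

lemma EE_inj:
  assumes "EE w = EE w'" "sum w UNIV = sum w' UNIV"
  shows "w = w'"
proof -
  have "\<forall>X. w X = w' X" using assms unfolding all_vertex EE_vec5 sum_vertex by auto
  then show ?thesis by auto
qed

definition bw :: "vertex set \<Rightarrow> vertex \<Rightarrow> real" where
  "bw S X = (if X \<in> S then 1 / card S else 0)"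

lemma barycenter_bw: "barycenter S = EE (bw S)"
proof -
  have "EE (bw S) = (\<Sum>X\<in>S. (1 / card S) *\<^sub>R vpos X)"
    unfolding EE_def bw_def by (rule sum.mono_neutral_cong_right) auto
  then show ?thesis by (simp add: barycenter_def scaleR_sum_right)
qed

lemma sum_bw: "S \<noteq> {} \<Longrightarrow> sum (bw S) UNIV = 1"
proof -
  assume "S \<noteq> {}"
  have "sum (bw S) UNIV = (\<Sum>X\<in>S. 1 / card S)"
    unfolding bw_def by (rule sum.mono_neutral_cong_right) auto
  then show ?thesis using \<open>S \<noteq> {}\<close> by simp
qed

abbreviation "ABC \<equiv> {VA, VB, VC}"

text \<open>The coordinates of \<xi> refer to a barycentric subdivision. Spreading each of them
  evenly over the vertices of its face yields barycentric coordinates in the tetrahedra themselves;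
  the trivial group stands for the barycenter of ABC.\<close>

definition wt :: "xi \<Rightarrow> vertex \<Rightarrow> real" where
  "wt \<xi> X = \<xi> {id} * bw ABC X + (\<Sum>S | nts S. \<xi> (GS S) * bw S X)"

lemma sum_GG:
  fixes f :: "letter aut set \<Rightarrow> 'b::comm_monoid_add"
  assumes "A \<subseteq> GG" "\<And>G. G \<in> GG - A \<Longrightarrow> f G = 0"
  shows "sum f A = f {id} + (\<Sum>S | nts S. f (GS S))"
proof -
  have "finite GG" unfolding GG_eq by simp
  then have "sum f A = sum f GG" using assms by (intro sum.mono_neutral_left) auto
  also have "\<dots> = f {id} + sum f (GS ` {S. nts S})"
    unfolding GG_eq using nts_GS_ne_id by (subst sum.insert) auto
  also have "sum f (GS ` {S. nts S}) = (\<Sum>S | nts S. f (GS S))"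
    using nts_GS_inj by (subst sum.reindex) (auto simp: inj_on_def)
  finally show ?thesis .
qed

lemma T0_emb:
  assumes "supp \<xi> \<subseteq> GG"
  shows "emb \<xi> = EE (wt \<xi>)" "sum \<xi> (supp \<xi>) = sum (wt \<xi>) UNIV"
proof -
  have "emb \<xi> = \<xi> {id} *\<^sub>R EE (bw ABC) + (\<Sum>S | nts S. \<xi> (GS S) *\<^sub>R EE (bw S))"
    unfolding emb_def
    by (subst sum_GG[OF assms]) (auto simp: supp_def pos_id pos_GS barycenter_bw)
  also have "\<dots> = (\<Sum>X\<in>UNIV. (\<xi> {id} * bw ABC X) *\<^sub>R vpos X) + (\<Sum>X\<in>UNIV. \<Sum>S | nts S. (\<xi> (GS S) * bw S X) *\<^sub>R vpos X)"
    by (subst sum.swap) (simp add: EE_def scaleR_sum_right)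
  also have "\<dots> = EE (wt \<xi>)"
    unfolding EE_def wt_def by (simp add: scaleR_add_left sum.distrib scaleR_sum_left)
  finally show "emb \<xi> = EE (wt \<xi>)" .
  have "sum \<xi> (supp \<xi>) = \<xi> {id} * sum (bw ABC) UNIV + (\<Sum>S | nts S. \<xi> (GS S) * sum (bw S) UNIV)"
    by (subst sum_GG[OF assms]) (auto simp: supp_def sum_bw nts_def intro!: sum.cong)
  also have "\<dots> = sum (wt \<xi>) UNIV"
  proof -
    have "(\<Sum>X\<in>UNIV. \<Sum>S | nts S. \<xi> (GS S) * bw S X) = (\<Sum>S | nts S. \<Sum>X\<in>UNIV. \<xi> (GS S) * bw S X)"
      by (rule sum.swap)
    then show ?thesis unfolding wt_def sum.distrib by (simp add: sum_distrib_left)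
  qed
  finally show "sum \<xi> (supp \<xi>) = sum (wt \<xi>) UNIV" .
qed

definition Wt :: "(vertex \<Rightarrow> real) set" where
  "Wt = {w. (\<forall>X. 0 \<le> w X) \<and> sum w UNIV = 1 \<and> (\<exists>S\<in>tetrahedra. \<forall>X. X \<notin> S \<longrightarrow> w X = 0)}"

lemma chain_greatest:
  fixes F :: "'a set set"
  assumes "finite F" "F \<noteq> {}" "\<And>S T. S \<in> F \<Longrightarrow> T \<in> F \<Longrightarrow> S \<subseteq> T \<or> T \<subseteq> S"
  shows "\<exists>M\<in>F. \<forall>S\<in>F. S \<subseteq> M"
proof -
  obtain M where "M \<in> F" "\<forall>S\<in>F. M \<subseteq> S \<longrightarrow> M = S"
    using finite_has_maximal[OF assms(1,2)] by auto
  then show ?thesis using assms(3) by blast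
qed

lemma chain_least:
  fixes F :: "'a set set"
  assumes "finite F" "F \<noteq> {}" "\<And>S T. S \<in> F \<Longrightarrow> T \<in> F \<Longrightarrow> S \<subseteq> T \<or> T \<subseteq> S"
  shows "\<exists>M\<in>F. \<forall>S\<in>F. M \<subseteq> S"
proof -
  obtain M where "M \<in> F" "\<forall>S\<in>F. S \<subseteq> M \<longrightarrow> M = S"
    using finite_has_minimal[OF assms(1,2)] by auto
  then show ?thesis using assms(3) by blast
qed

text \<open>A nonnegative function supported on a chain of nonempty sets is determined by its total values at points: the
  largest set of the chain is the set of points with positive value, and its coefficient is the least
  such value.\<close>

lemma chain_top:
  fixes c :: "vertex set \<Rightarrow> real"
  assumes c: "\<And>S. 0 \<le> c S" "\<And>S T. c S \<noteq> 0 \<Longrightarrow> c T \<noteq> 0 \<Longrightarrow> S \<subseteq> T \<or> T \<subseteq> S" "c {} = 0"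
    and ne: "c S0 \<noteq> 0"
  shows "\<exists>M. c M \<noteq> 0 \<and> M = {X. (\<Sum>S | X \<in> S. c S) > 0} \<and> (\<forall>X\<in>M. c M \<le> (\<Sum>S | X \<in> S. c S)) \<and>
    (\<exists>X\<in>M. (\<Sum>S | X \<in> S. c S) = c M)"
proof -
  let ?w = "\<lambda>X. \<Sum>S | X \<in> S. c S"
  obtain M where M: "c M \<noteq> 0" "\<And>S. c S \<noteq> 0 \<Longrightarrow> S \<subseteq> M"
  proof -
    assume that: "\<And>M. c M \<noteq> 0 \<Longrightarrow> (\<And>S. c S \<noteq> 0 \<Longrightarrow> S \<subseteq> M) \<Longrightarrow> thesis"
    have "\<exists>M\<in>{S. c S \<noteq> 0}. \<forall>S\<in>{S. c S \<noteq> 0}. S \<subseteq> M"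
     
      proof (rule chain_greatest)
        show "finite {S. c S \<noteq> 0}" by simp
        show "{S. c S \<noteq> 0} \<noteq> {}" using ne by blast
        show "S \<subseteq> T \<or> T \<subseteq> S" if "S \<in> {S. c S \<noteq> 0}" "T \<in> {S. c S \<noteq> 0}" for S T
          using c(2)[of S T] that by simp
      qed
    then show thesis using that by blast
  qed
  have ge: "c S \<le> ?w X" if "X \<in> S" for X S
    using member_le_sum[of S "{S. X \<in> S}" c] that c(1) by simp
  have cM: "c M > 0" using M(1) c(1)[of M] by simp
  have zero: "?w X = 0" if "X \<notin> M" for X
    using that M(2) by (intro sum.neutral) blast
  have Meq: "M = {X. ?w X > 0}"
  proof (rule equalityI; rule subsetI)
    fix X assume "X \<in> M"
    then show "X \<in> {X. ?w X > 0}" using ge[of X M] cM by simp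
  next
    fix X assume "X \<in> {X. ?w X > 0}"
    then show "X \<in> M" using zero[of X] by (cases "X \<in> M") auto
  qed
  \<comment> \<open>A point of the largest set outside the second largest one lies in no other
    member of the chain, so its total is the coefficient of the largest set.\<close>
  have "\<exists>X\<in>M. \<forall>S. c S \<noteq> 0 \<longrightarrow> X \<in> S \<longrightarrow> S = M"
  proof (cases "\<exists>S. c S \<noteq> 0 \<and> S \<noteq> M")
    case True
    then obtain N where N: "c N \<noteq> 0" "N \<noteq> M" "\<And>S. c S \<noteq> 0 \<Longrightarrow> S \<noteq> M \<Longrightarrow> S \<subseteq> N"
    proof -
      assume that: "\<And>N. c N \<noteq> 0 \<Longrightarrow> N \<noteq> M \<Longrightarrow> (\<And>S. c S \<noteq> 0 \<Longrightarrow> S \<noteq> M \<Longrightarrow> S \<subseteq> N) \<Longrightarrow> thesis"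
      have "\<exists>N\<in>{S. c S \<noteq> 0 \<and> S \<noteq> M}. \<forall>S\<in>{S. c S \<noteq> 0 \<and> S \<noteq> M}. S \<subseteq> N"
       
      proof (rule chain_greatest)
        show "finite {S. c S \<noteq> 0 \<and> S \<noteq> M}" by simp
        show "{S. c S \<noteq> 0 \<and> S \<noteq> M} \<noteq> {}" using True by blast
        show "S \<subseteq> T \<or> T \<subseteq> S" if "S \<in> {S. c S \<noteq> 0 \<and> S \<noteq> M}" "T \<in> {S. c S \<noteq> 0 \<and> S \<noteq> M}" for S T
          using c(2)[of S T] that by simp
      qed
      then show thesis using that by blast
    qed
    then obtain X where "X \<in> M" "X \<notin> N" using M(2)[of N] by blast
    then show ?thesis using N(3) by blast
  next
    case False
    have "M \<noteq> {}" using M(1) c(3) by auto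
    then show ?thesis using False by blast
  qed
  then obtain X where X: "X \<in> M" "\<And>S. c S \<noteq> 0 \<Longrightarrow> X \<in> S \<Longrightarrow> S = M" by blast
  have "?w X = (\<Sum>S\<in>{M}. c S)"
    by (rule sum.mono_neutral_right) (use X in auto)
  then have wX: "?w X = c M" by simp
  show ?thesis
  proof (intro exI[of _ M] conjI)
    show "c M \<noteq> 0" by (rule M(1))
    show "M = {X. ?w X > 0}" by (rule Meq)
    show "\<forall>X\<in>M. c M \<le> ?w X" using ge by blast
    show "\<exists>X\<in>M. ?w X = c M" using X(1) wX by blast
  qed
qed

text \<open>The largest sets and their coefficients agree, being read off from the totals; removing
  them lowers both families of totals by the same amount, and the number of nonzero coefficients
  drops.\<close>

lemma chain_unique:
  fixes c d :: "vertex set \<Rightarrow> real"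
  assumes "\<And>S. 0 \<le> c S" "\<And>S T. c S \<noteq> 0 \<Longrightarrow> c T \<noteq> 0 \<Longrightarrow> S \<subseteq> T \<or> T \<subseteq> S" "c {} = 0"
    and "\<And>S. 0 \<le> d S" "\<And>S T. d S \<noteq> 0 \<Longrightarrow> d T \<noteq> 0 \<Longrightarrow> S \<subseteq> T \<or> T \<subseteq> S" "d {} = 0"
    and "\<And>X. (\<Sum>S | X \<in> S. c S) = (\<Sum>S | X \<in> S. d S)"
  shows "c = d"
  using assms
proof (induction "card {S. c S \<noteq> 0}" arbitrary: c d)
  case 0
  then have c: "c S = 0" for S by auto
  have "d S = 0" for S
  proof (cases "S = {}")
    case False
    then obtain X where X: "X \<in> S" by blast
    have "d S \<le> (\<Sum>S | X \<in> S. d S)" using X 0(5) by (intro member_le_sum) auto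
    also have "\<dots> = 0" using 0(8)[of X, symmetric] by (simp add: c)
    finally show ?thesis using 0(5)[of S] by simp
  qed (use 0 in auto)
  then show ?case using c by auto
next
  case (Suc n)
  note c = Suc(3) Suc(4) Suc(5) and d = Suc(6) Suc(7) Suc(8) and eq = Suc(9)
  let ?w = "\<lambda>X. \<Sum>S | X \<in> S. c S"
  have "{S. c S \<noteq> 0} \<noteq> {}" using Suc(2) by force
  then obtain S0 where "c S0 \<noteq> 0" by blast
  have "\<exists>M. c M \<noteq> 0 \<and> M = {X. ?w X > 0} \<and> (\<forall>X\<in>M. c M \<le> ?w X) \<and> (\<exists>X\<in>M. ?w X = c M)"
    by (rule chain_top[OF c(1) _ c(3) \<open>c S0 \<noteq> 0\<close>]) (rule c(2), assumption+)
  then obtain M where M: "c M \<noteq> 0" "M = {X. ?w X > 0}" "\<forall>X\<in>M. c M \<le> ?w X" "\<exists>X\<in>M. ?w X = c M"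
    by (elim exE conjE)
  have "\<exists>S. d S \<noteq> 0"
  proof (rule ccontr)
    assume "\<nexists>S. d S \<noteq> 0"
    then have "?w X = 0" for X using eq by simp
    then show False using M(2,4) by auto
  qed
  then obtain S1 where "d S1 \<noteq> 0" by blast
  have "\<exists>M. d M \<noteq> 0 \<and> M = {X. (\<Sum>S | X \<in> S. d S) > 0} \<and> (\<forall>X\<in>M. d M \<le> (\<Sum>S | X \<in> S. d S)) \<and>
      (\<exists>X\<in>M. (\<Sum>S | X \<in> S. d S) = d M)"
    by (rule chain_top[OF d(1) _ d(3) \<open>d S1 \<noteq> 0\<close>]) (rule d(2), assumption+)
  then obtain M' where M': "d M' \<noteq> 0" "M' = {X. ?w X > 0}" "\<forall>X\<in>M'. d M' \<le> ?w X" "\<exists>X\<in>M'. ?w X = d M'"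
    unfolding eq by (elim exE conjE)
  have MM: "M' = M" using M(2) M'(2) by simp
  have cd: "c M = d M" using M(3,4) M'(3,4) unfolding MM by (metis order_antisym)
  define c' d' where "c' = c(M := 0)" and "d' = d(M := 0)"
  have "{S. c S \<noteq> 0} = insert M {S. c' S \<noteq> 0}" using M(1) by (auto simp: c'_def)
  then have "card {S. c' S \<noteq> 0} = n" using Suc(2) by (simp add: c'_def)
  moreover have "(\<Sum>S | X \<in> S. c' S) = (\<Sum>S | X \<in> S. d' S)" for X
  proof (cases "X \<in> M")
    case True
    have *: "(\<Sum>S | X \<in> S. f S) = f M + (\<Sum>S\<in>{S. X \<in> S} - {M}. f S)" for f :: "vertex set \<Rightarrow> real"
      using True by (subst sum.remove[of _ M]) auto
    have "(\<Sum>S\<in>{S. X \<in> S} - {M}. c S) = (\<Sum>S\<in>{S. X \<in> S} - {M}. d S)"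
      using eq[of X] *[of c] *[of d] cd by simp
    then show ?thesis unfolding *[of c'] *[of d'] by (simp add: c'_def d'_def)
  next
    case False
    then have "(\<Sum>S | X \<in> S. c' S) = ?w X" "(\<Sum>S | X \<in> S. d' S) = (\<Sum>S | X \<in> S. d S)"
      by (auto intro!: sum.cong simp: c'_def d'_def)
    then show ?thesis using eq by simp
  qed
  ultimately have "c' = d'"
  proof (intro Suc(1))
    show "S \<subseteq> T \<or> T \<subseteq> S" if "c' S \<noteq> 0" "c' T \<noteq> 0" for S T
      using c(2)[of S T] that by (simp add: c'_def split: if_splits)
    show "S \<subseteq> T \<or> T \<subseteq> S" if "d' S \<noteq> 0" "d' T \<noteq> 0" for S T
      using d(2)[of S T] that by (simp add: d'_def split: if_splits)
  qed (simp_all add: c'_def d'_def c(1,3) d(1,3))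
  then show ?case using cd by (metis c'_def d'_def fun_upd_triv fun_upd_upd)
qed

lemma T0_D:
  assumes "\<xi> \<in> T0"
  shows "\<And>C. 0 \<le> \<xi> C" "supp \<xi> \<subseteq> GG" "finite (supp \<xi>)" "sum \<xi> (supp \<xi>) = 1"
    "\<And>C D. C \<in> supp \<xi> \<Longrightarrow> D \<in> supp \<xi> \<Longrightarrow> C \<subseteq> D \<or> D \<subseteq> C"
  using assms unfolding T0_def Xi_def by blast+

text \<open>Division by the cardinality gives the amount that this member of the chain contributes
  to each of its vertices.\<close>

definition coef :: "xi \<Rightarrow> vertex set \<Rightarrow> real" where
  "coef \<xi> S = (if nts S then \<xi> (GS S) / card S else 0)"

lemma coef_props:
  assumes "\<xi> \<in> T0"
  shows "0 \<le> coef \<xi> S" "coef \<xi> S \<noteq> 0 \<Longrightarrow> coef \<xi> T \<noteq> 0 \<Longrightarrow> S \<subseteq> T \<or> T \<subseteq> S" "coef \<xi> {} = 0"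
    "wt \<xi> X = (if X \<in> ABC then \<xi> {id} / 3 else 0) + (\<Sum>S | X \<in> S. coef \<xi> S)"
proof -
  show "0 \<le> coef \<xi> S" using T0_D(1)[OF assms] by (simp add: coef_def)
  show "coef \<xi> {} = 0" by (simp add: coef_def nts_def)
  show "S \<subseteq> T \<or> T \<subseteq> S" if "coef \<xi> S \<noteq> 0" "coef \<xi> T \<noteq> 0"
  proof -
    have "nts S" "nts T" "GS S \<in> supp \<xi>" "GS T \<in> supp \<xi>"
      using that by (auto simp: coef_def supp_def split: if_splits)
    then show ?thesis
      using T0_D(5)[OF assms, of "GS S" "GS T"] nts_GS_le[of S T] nts_GS_le[of T S] by blast
  qed
  have "(\<Sum>S | nts S. \<xi> (GS S) * bw S X) = (\<Sum>S | X \<in> S. coef \<xi> S)"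
    by (rule sum.mono_neutral_cong) (auto simp: coef_def bw_def)
  then show "wt \<xi> X = (if X \<in> ABC then \<xi> {id} / 3 else 0) + (\<Sum>S | X \<in> S. coef \<xi> S)"
    by (simp add: wt_def bw_def)
qed

lemma coef_triangle:
  assumes "\<xi> \<in> T0"
  obtains M Z where "M \<in> ABC" "Z \<in> {VA1, VB1, VC1}" "\<And>X S. coef \<xi> S \<noteq> 0 \<Longrightarrow> X \<in> S \<Longrightarrow> X \<in> ABC - {M} \<union> {Z}"
proof (cases "\<exists>S. coef \<xi> S \<noteq> 0")
  case True
  then obtain T where T: "coef \<xi> T \<noteq> 0" "\<And>S. coef \<xi> S \<noteq> 0 \<Longrightarrow> S \<subseteq> T"
  proof -
    assume that: "\<And>T. coef \<xi> T \<noteq> 0 \<Longrightarrow> (\<And>S. coef \<xi> S \<noteq> 0 \<Longrightarrow> S \<subseteq> T) \<Longrightarrow> thesis"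
    have "\<exists>M\<in>{S. coef \<xi> S \<noteq> 0}. \<forall>S\<in>{S. coef \<xi> S \<noteq> 0}. S \<subseteq> M"
     
      proof (rule chain_greatest)
        show "finite {S. coef \<xi> S \<noteq> 0}" by simp
        show "{S. coef \<xi> S \<noteq> 0} \<noteq> {}" using True by blast
        show "S \<subseteq> T \<or> T \<subseteq> S" if "S \<in> {S. coef \<xi> S \<noteq> 0}" "T \<in> {S. coef \<xi> S \<noteq> 0}" for S T
          using coef_props(2)[OF assms, of S T] that by simp
      qed
    then show thesis using that by blast
  qed
  then have "nts T" by (auto simp: coef_def split: if_splits)
  then obtain U s where "(U, s) \<in> tri_gen" "T \<subseteq> U" unfolding nts_def by blast
  then have U: "U \<in> fst ` tri_gen" "T \<subseteq> U" by force+
  have "\<exists>M Z. M \<in> ABC \<and> Z \<in> {VA1, VB1, VC1} \<and> U \<subseteq> ABC - {M} \<union> {Z}"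
    using U(1) unfolding fst_tri_gen
    by (elim insertE emptyE) (simp; rule exI[of _ VC] exI[of _ VB] exI[of _ VA]; simp add: insert_Diff_if)+
  then obtain M Z where "M \<in> ABC" "Z \<in> {VA1, VB1, VC1}" "U \<subseteq> ABC - {M} \<union> {Z}" by blast
  show ?thesis
  proof (rule that[of M Z])
    show "X \<in> ABC - {M} \<union> {Z}" if "coef \<xi> S \<noteq> 0" "X \<in> S" for X S
      using T(2)[OF that(1)] that(2) U(2) \<open>U \<subseteq> ABC - {M} \<union> {Z}\<close> by blast
  qed fact+
next
  case False
  show ?thesis by (rule that[of VA VA1]) (use False in auto)
qed

text \<open>The remaining members of the chain lie in a triangle other than ABC, so one of A, B, C
  receives weight from the trivial group alone. This recovers the coefficient of the trivial
  group.\<close>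

lemma T0_wt_min:
  assumes "\<xi> \<in> T0"
  shows "\<xi> {id} / 3 = min (wt \<xi> VA) (min (wt \<xi> VB) (wt \<xi> VC))"
proof -
  obtain M Z where M: "M \<in> ABC" "Z \<in> {VA1, VB1, VC1}"
    "\<And>X S. coef \<xi> S \<noteq> 0 \<Longrightarrow> X \<in> S \<Longrightarrow> X \<in> ABC - {M} \<union> {Z}"
    using coef_triangle[OF assms] by blast
  have "(\<Sum>S | M \<in> S. coef \<xi> S) = 0" using M by (intro sum.neutral) blast
  then have "wt \<xi> M = \<xi> {id} / 3" using coef_props(4)[OF assms, of M] M(1) by simp
  moreover have ge: "wt \<xi> X \<ge> \<xi> {id} / 3" if "X \<in> ABC" for X
    using coef_props(4)[OF assms, of X] that sum_nonneg[of "{S. X \<in> S}" "coef \<xi>"] coef_props(1)[OF assms] by simp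
  then have "wt \<xi> VA \<ge> \<xi> {id} / 3" "wt \<xi> VB \<ge> \<xi> {id} / 3" "wt \<xi> VC \<ge> \<xi> {id} / 3" by blast+
  ultimately show ?thesis using M(1)
    by (elim insertE emptyE) (auto simp: min_def)
qed

lemma T0_wt_inj:
  assumes "\<xi> \<in> T0" "\<eta> \<in> T0" "wt \<xi> = wt \<eta>"
  shows "\<xi> = \<eta>"
proof -
  have id: "\<xi> {id} = \<eta> {id}" using T0_wt_min[OF assms(1)] T0_wt_min[OF assms(2)] assms(3) by simp
  have "coef \<xi> = coef \<eta>"
  proof (rule chain_unique)
    show "(\<Sum>S | X \<in> S. coef \<xi> S) = (\<Sum>S | X \<in> S. coef \<eta> S)" for X
      using coef_props(4)[OF assms(1), of X] coef_props(4)[OF assms(2), of X] assms(3) id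
      by (cases "X \<in> ABC") simp_all
    show "0 \<le> coef \<xi> S" "0 \<le> coef \<eta> S" for S using coef_props(1) assms(1,2) by auto
    show "coef \<xi> {} = 0" "coef \<eta> {} = 0" using coef_props(3) assms(1,2) by auto
    show "S \<subseteq> T \<or> T \<subseteq> S" if "coef \<xi> S \<noteq> 0" "coef \<xi> T \<noteq> 0" for S T
      using coef_props(2)[OF assms(1) that] .
    show "S \<subseteq> T \<or> T \<subseteq> S" if "coef \<eta> S \<noteq> 0" "coef \<eta> T \<noteq> 0" for S T
      using coef_props(2)[OF assms(2) that] .
  qed
  then have coef: "coef \<xi> S = coef \<eta> S" for S by simp
  have "\<xi> (GS S) = \<eta> (GS S)" if "nts S" for S
  proof -
    have "S \<noteq> {}" using that by (simp add: nts_def)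
    then show ?thesis using coef[of S] that by (simp add: coef_def)
  qed
  moreover have "\<xi> C = 0 \<and> \<eta> C = 0" if "C \<notin> GG" for C
    using T0_D(2)[OF assms(1)] T0_D(2)[OF assms(2)] that by (auto simp: supp_def)
  ultimately have "\<xi> C = \<eta> C" for C using id unfolding GG_eq by (cases "C \<in> GG") (auto simp: GG_eq)
  then show ?thesis by auto
qed

lemma tetrahedra_primed: "Z \<in> {VA1, VB1, VC1} \<Longrightarrow> {Z, VA, VB, VC} \<in> tetrahedra"
  by (auto simp: tetrahedra_def)

lemma T0_wt_Wt:
  assumes "\<xi> \<in> T0"
  shows "wt \<xi> \<in> Wt"
proof -
  obtain M Z where M: "M \<in> ABC" "Z \<in> {VA1, VB1, VC1}"
    "\<And>X S. coef \<xi> S \<noteq> 0 \<Longrightarrow> X \<in> S \<Longrightarrow> X \<in> ABC - {M} \<union> {Z}"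
    using coef_triangle[OF assms] by blast
  have "wt \<xi> X = 0" if "X \<notin> {Z, VA, VB, VC}" for X
  proof -
    have "(\<Sum>S | X \<in> S. coef \<xi> S) = 0" using M(3) that by (intro sum.neutral) blast
    then show ?thesis using coef_props(4)[OF assms, of X] that by simp
  qed
  moreover have "0 \<le> wt \<xi> X" for X
    using coef_props(4)[OF assms, of X] sum_nonneg[of "{S. X \<in> S}" "coef \<xi>"] coef_props(1)[OF assms]
      T0_D(1)[OF assms, of "{id}"] by (simp split: if_splits)
  moreover have "sum (wt \<xi>) UNIV = 1" using T0_emb(2)[OF T0_D(2)[OF assms]] T0_D(4)[OF assms] by simp
  ultimately show ?thesis unfolding Wt_def using tetrahedra_primed[OF M(2)] by blast
qed

lemma sort3:
  fixes f :: "vertex \<Rightarrow> real"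
  assumes "card T = 3"
  obtains X Y Z where "T = {X, Y, Z}" "X \<noteq> Y" "X \<noteq> Z" "Y \<noteq> Z" "f X \<ge> f Y" "f Y \<ge> f Z"
proof -
  obtain X Y Z where T: "T = {X, Y, Z}" "X \<noteq> Y" "X \<noteq> Z" "Y \<noteq> Z"
    using assms by (auto simp: card_3_iff)
  show ?thesis
    using that[of X Y Z] that[of X Z Y] that[of Y X Z] that[of Y Z X] that[of Z X Y] that[of Z Y X] T
      linear[of "f X" "f Y"] linear[of "f Y" "f Z"] linear[of "f X" "f Z"]
    by (metis insert_commute)
qed

lemma nts_mono: "nts T \<Longrightarrow> S \<subseteq> T \<Longrightarrow> S \<noteq> {} \<Longrightarrow> nts S"
  unfolding nts_def by blast

lemma GG_cosets: "G \<in> GG \<Longrightarrow> G \<in> cosets"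
  unfolding cosets_def using G.id_in by (force intro!: exI[of _ G] exI[of _ id])

text \<open>The subdivision is inverted explicitly: the common minimum over A, B, C goes to the
  trivial group, and the remaining weights live on three vertices and are sorted by size.\<close>

lemma T0_wt_surj:
  assumes w: "w \<in> Wt"
  shows "\<exists>\<xi>\<in>T0. wt \<xi> = w"
proof -
  define t where "t = min (w VA) (min (w VB) (w VC))"
  define v where "v X = w X - (if X \<in> ABC then t else 0)" for X
  have w0: "0 \<le> w X" for X using w by (simp add: Wt_def)
  have t0: "0 \<le> t" using w0 by (simp add: t_def)
  obtain S where S: "S \<in> tetrahedra" "\<And>X. X \<notin> S \<Longrightarrow> w X = 0" using w unfolding Wt_def by blast
  obtain Z0 where Z0: "Z0 \<in> {VA1, VB1, VC1}" "S = {Z0, VA, VB, VC}" using S(1) by (rule tetra_cases)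
  have "v VA = 0 \<or> v VB = 0 \<or> v VC = 0" unfolding v_def t_def by (simp add: min_def)
  then obtain M where M: "M \<in> ABC" "v M = 0" by blast
  obtain s where T: "(ABC - {M} \<union> {Z0}, s) \<in> tri_gen" using tri_gen_mem[OF M(1) Z0(1)] by blast
  have "t \<le> w VA" "t \<le> w VB" "t \<le> w VC" by (simp_all add: t_def)
  then have v0: "0 \<le> v X" for X using w0 by (cases X) (simp_all add: v_def)
  have vT: "v X = 0" if "X \<notin> ABC - {M} \<union> {Z0}" for X
  proof (cases "X = M")
    case False
    then have X: "X \<notin> ABC" "X \<noteq> Z0" using that by auto
    then have "w X = 0" using S(2)[of X] Z0(2) by simp
    then show ?thesis using X by (simp add: v_def)
  qed (use M in simp)
  obtain X Y Z where XYZ: "ABC - {M} \<union> {Z0} = {X, Y, Z}" "X \<noteq> Y" "X \<noteq> Z" "Y \<noteq> Z" "v X \<ge> v Y" "v Y \<ge> v Z"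
    using sort3[OF tri_card[OF T], of v] by blast
  have n: "nts {X, Y, Z}" using T XYZ(1) unfolding nts_def by auto
  then have nts: "nts {X}" "nts {X, Y}" "nts {X, Y, Z}" using nts_mono[OF n] by auto
  define F where "F = {{X}, {X, Y}, {X, Y, Z}}"
  have neq: "{X} \<noteq> {X, Y}" "{X} \<noteq> {X, Y, Z}" "{X, Y} \<noteq> {X, Y, Z}" using XYZ by auto
  \<comment> \<open>Successive differences of the sorted weights, multiplied by the number of
    vertices among which each of them is shared.\<close>
  define c where "c S = (if S = {X} then v X - v Y else if S = {X, Y} then 2 * (v Y - v Z)
    else if S = {X, Y, Z} then 3 * v Z else 0)" for S
  define \<xi> where "\<xi> G = (if G = {id} then 3 * t else if \<exists>S\<in>F. G = GS S then c (THE S. S \<in> F \<and> G = GS S) else 0)" for G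
  have FN: "S \<in> F \<Longrightarrow> nts S" for S using nts by (auto simp: F_def)
  have \<xi>GS: "\<xi> (GS S) = c S" if "nts S" for S
  proof (cases "S \<in> F")
    case True
    then have "(THE S'. S' \<in> F \<and> GS S = GS S') = S" using FN nts_GS_inj that by (intro the_equality) auto
    then show ?thesis using True nts_GS_ne_id[OF that] by (auto simp: \<xi>_def)
  next
    case False
    then have "\<not> (\<exists>S'\<in>F. GS S = GS S')" using FN nts_GS_inj that by metis
    then show ?thesis using False nts_GS_ne_id[OF that] by (auto simp: \<xi>_def c_def F_def)
  qed
  have c0: "c S \<ge> 0" for S using XYZ v0 by (auto simp: c_def)
  have \<xi>0: "\<xi> G \<ge> 0" for G using c0 t0 by (simp add: \<xi>_def)
  have supp: "supp \<xi> \<subseteq> {{id}, GS {X}, GS {X, Y}, GS {X, Y, Z}}"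
    by (auto simp: supp_def \<xi>_def F_def split: if_splits)
  also have "\<dots> \<subseteq> GG" using nts unfolding GG_eq by auto
  finally have suppGG: "supp \<xi> \<subseteq> GG" .
  have wt: "wt \<xi> V = w V" for V
  proof -
    have "(\<Sum>S | nts S. \<xi> (GS S) * bw S V) = (\<Sum>S\<in>F. c S * bw S V)"
      by (rule sum.mono_neutral_cong_right) (use FN \<xi>GS in \<open>auto simp: c_def F_def\<close>)
    also have "\<dots> = c {X} * bw {X} V + (c {X, Y} * bw {X, Y} V + c {X, Y, Z} * bw {X, Y, Z} V)"
      unfolding F_def using neq by simp
    also have "\<dots> = v V"
    proof -
      have c: "c {X} = v X - v Y" "c {X, Y} = 2 * (v Y - v Z)" "c {X, Y, Z} = 3 * v Z"
        using neq by (simp_all add: c_def)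
      have b: "bw {X} V = (if V = X then 1 else 0)" "bw {X, Y} V = (if V = X \<or> V = Y then 1 / 2 else 0)"
        "bw {X, Y, Z} V = (if V = X \<or> V = Y \<or> V = Z then 1 / 3 else 0)"
        using XYZ(2-4) by (simp_all add: bw_def)
      have "v V = 0" if "V \<noteq> X" "V \<noteq> Y" "V \<noteq> Z" using vT[of V] that unfolding XYZ(1) by simp
      then show ?thesis unfolding c b using XYZ(2-4)
        by (cases "V = X"; cases "V = Y"; cases "V = Z") (simp_all add: field_simps)
    qed
    finally show ?thesis by (simp add: wt_def bw_def v_def \<xi>_def)
  qed
  then have wt': "wt \<xi> = w" by auto
  have sum: "sum \<xi> (supp \<xi>) = 1" using T0_emb(2)[OF suppGG] wt' w by (simp add: Wt_def)
  have chain: "C \<subseteq> D \<or> D \<subseteq> C" if "C \<in> supp \<xi>" "D \<in> supp \<xi>" for C D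
  proof -
    have mono: "GS {X, Y, Z} \<subseteq> GS {X, Y}" "GS {X, Y} \<subseteq> GS {X}" "GS {X, Y, Z} \<subseteq> GS {X}"
      by (auto simp: GS_def)
    have "C \<in> {{id}, GS {X}, GS {X, Y}, GS {X, Y, Z}}" "D \<in> {{id}, GS {X}, GS {X, Y}, GS {X, Y, Z}}"
      using subsetD[OF supp] that by blast+
    then show ?thesis
      by (elim insertE emptyE) (simp_all add: mono GS_id)
  qed
  have "\<xi> \<in> Xi" unfolding Xi_def
    using \<xi>0 finite_subset[OF supp] suppGG GG_cosets sum chain by simp blast
  then show ?thesis using wt' suppGG unfolding T0_def by blast
qed

section \<open>Points of \<open>T0\<close> given by their weights\<close>

definition pt :: "(vertex \<Rightarrow> real) \<Rightarrow> xi" where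
  "pt w = T0_point (EE w)"

lemma Wt_sum: "w \<in> Wt \<Longrightarrow> sum w UNIV = 1"
  by (simp add: Wt_def)

lemma T0_emb': "\<xi> \<in> T0 \<Longrightarrow> emb \<xi> = EE (wt \<xi>)"
  using T0_emb(1) T0_D(2) by blast

lemma T0_point_EE:
  assumes "\<xi> \<in> T0"
  shows "T0_point (EE (wt \<xi>)) = \<xi>"
  unfolding T0_point_def
proof (rule the_equality)
  show "\<xi> \<in> T0 \<and> emb \<xi> = EE (wt \<xi>)" using assms T0_emb' by blast
  fix \<eta> assume \<eta>: "\<eta> \<in> T0 \<and> emb \<eta> = EE (wt \<xi>)"
  then have "wt \<eta> = wt \<xi>" using EE_inj[of "wt \<eta>" "wt \<xi>"] T0_emb' Wt_sum T0_wt_Wt assms by metis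
  then show "\<eta> = \<xi>" using T0_wt_inj \<eta> assms by blast
qed

lemma pt_wt: "\<xi> \<in> T0 \<Longrightarrow> pt (wt \<xi>) = \<xi>"
  unfolding pt_def by (rule T0_point_EE)

lemma wt_pt: "w \<in> Wt \<Longrightarrow> wt (pt w) = w" and pt_T0: "w \<in> Wt \<Longrightarrow> pt w \<in> T0"
  and emb_pt: "w \<in> Wt \<Longrightarrow> emb (pt w) = EE w"
  using T0_wt_surj pt_wt T0_emb' by metis+

lemma pt_inj: "w \<in> Wt \<Longrightarrow> w' \<in> Wt \<Longrightarrow> pt w = pt w' \<Longrightarrow> w = w'"
  using wt_pt by metis

section \<open>The action on \<open>\<Xi>\<close>\<close>

lemma shift_vimage:
  fixes g g' :: "'x aut" and C :: "'x aut set"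
  assumes "g \<circ> g' = id" "g' \<circ> g = id"
  shows "(\<lambda>h. h \<circ> g) -` C = (\<lambda>h. h \<circ> g') ` C"
proof (rule equalityI; rule subsetI)
  fix h :: "'x aut" assume "h \<in> (\<lambda>h. h \<circ> g) -` C"
  moreover have "h \<circ> g \<circ> g' = h" using assms by (simp add: comp_assoc)
  ultimately show "h \<in> (\<lambda>h. h \<circ> g') ` C" by (metis imageI vimage_eq)
next
  fix h :: "'x aut" assume "h \<in> (\<lambda>h. h \<circ> g') ` C"
  then obtain k where "k \<in> C" "h = k \<circ> g'" by blast
  moreover have "k \<circ> g' \<circ> g = k" using assms by (simp add: comp_assoc)
  ultimately show "h \<in> (\<lambda>h. h \<circ> g) -` C" by simp
qed

lemma shift_shift: "(\<lambda>h. h \<circ> g) ` (\<lambda>h. h \<circ> k) ` C = (\<lambda>h. h \<circ> (k \<circ> g)) ` C"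
  by (auto simp: image_image comp_assoc)

lemma shift_inverse: "k \<circ> g = id \<Longrightarrow> (\<lambda>h. h \<circ> g) ` (\<lambda>h. h \<circ> k) ` C = C"
  unfolding shift_shift by simp

lemma supp_xi_act:
  assumes "g \<circ> g' = id" "g' \<circ> g = id"
  shows "supp (xi_act \<xi> g) = (\<lambda>C. (\<lambda>h. h \<circ> g) ` C) ` supp \<xi>"
proof (rule equalityI; rule subsetI)
  fix C assume "C \<in> supp (xi_act \<xi> g)"
  then have "(\<lambda>h. h \<circ> g') ` C \<in> supp \<xi>" by (simp add: supp_def xi_act_def shift_vimage[OF assms])
  then show "C \<in> (\<lambda>C. (\<lambda>h. h \<circ> g) ` C) ` supp \<xi>" using shift_inverse[OF assms(2), of C] by (metis imageI)
next
  fix C assume "C \<in> (\<lambda>C. (\<lambda>h. h \<circ> g) ` C) ` supp \<xi>"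
  then obtain D where D: "D \<in> supp \<xi>" "C = (\<lambda>h. h \<circ> g) ` D" by blast
  then have "(\<lambda>h. h \<circ> g') ` C = D" using shift_inverse[OF assms(1), of D] by simp
  then show "C \<in> supp (xi_act \<xi> g)" using D(1) by (simp add: supp_def xi_act_def shift_vimage[OF assms])
qed

lemma cosets_shift: "C \<in> cosets \<Longrightarrow> g \<in> Gam \<Longrightarrow> (\<lambda>h. h \<circ> g) ` C \<in> cosets"
  unfolding cosets_def
proof clarify
  fix H k assume "H \<in> GG" "k \<in> Gam" "g \<in> Gam"
  then show "\<exists>G k'. (\<lambda>h. h \<circ> g) ` (\<lambda>h. h \<circ> k) ` H = (\<lambda>h. h \<circ> k') ` G \<and> G \<in> GG \<and> k' \<in> Gam"
    unfolding shift_shift using G.comp_in by blast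
qed

lemma xi_act_in:
  assumes "\<xi> \<in> Xi" "g \<in> Gam"
  shows "xi_act \<xi> g \<in> Xi"
proof -
  obtain g' where g': "g' \<in> Gam" "g \<circ> g' = id" "g' \<circ> g = id" using G.inv_ex assms(2) by blast
  have s: "supp (xi_act \<xi> g) = (\<lambda>C. (\<lambda>h. h \<circ> g) ` C) ` supp \<xi>" by (rule supp_xi_act[OF g'(2,3)])
  have inj: "inj_on (\<lambda>C. (\<lambda>h. h \<circ> g) ` C) (supp \<xi>)"
    by (rule inj_on_inverseI[of _ "\<lambda>C. (\<lambda>h. h \<circ> g') ` C"]) (rule shift_inverse[OF g'(2)])
  have val: "xi_act \<xi> g ((\<lambda>h. h \<circ> g) ` C) = \<xi> C" for C
    unfolding xi_act_def shift_vimage[OF g'(2,3)] shift_inverse[OF g'(2)] ..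
  have "sum (xi_act \<xi> g) (supp (xi_act \<xi> g)) = sum \<xi> (supp \<xi>)"
    unfolding s sum.reindex[OF inj] by (simp add: val)
  moreover have "\<forall>C\<in>supp (xi_act \<xi> g). \<forall>D\<in>supp (xi_act \<xi> g). C \<subseteq> D \<or> D \<subseteq> C"
  proof -
    have "(\<lambda>h. h \<circ> g) ` C \<subseteq> (\<lambda>h. h \<circ> g) ` D \<or> (\<lambda>h. h \<circ> g) ` D \<subseteq> (\<lambda>h. h \<circ> g) ` C"
      if "C \<in> supp \<xi>" "D \<in> supp \<xi>" for C D
    proof -
      have "C \<subseteq> D \<or> D \<subseteq> C" using assms(1) that unfolding Xi_def by blast
      then show ?thesis by (elim disjE) (simp_all add: image_mono)
    qed
    then show ?thesis unfolding s by blast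
  qed
  moreover have "supp (xi_act \<xi> g) \<subseteq> cosets"
    unfolding s using assms cosets_shift unfolding Xi_def by blast
  moreover have "finite (supp (xi_act \<xi> g))" unfolding s using assms(1) unfolding Xi_def by blast
  moreover have "\<forall>C. 0 \<le> xi_act \<xi> g C" using assms(1) by (simp add: xi_act_def Xi_def)
  ultimately show ?thesis using assms(1) unfolding Xi_def by simp
qed

interpretation G: ssaction Gam xi_act Xi
proof unfold_locales
  show "xi_act \<xi> id = \<xi>" for \<xi> by (simp add: xi_act_def)
  show "xi_act \<xi> (g \<circ> h) = xi_act (xi_act \<xi> g) h" for \<xi> g h
    by (simp add: xi_act_def vimage_def comp_assoc)
qed (rule xi_act_in)

lemma T0_Xi: "\<xi> \<in> T0 \<Longrightarrow> \<xi> \<in> Xi"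
  by (simp add: T0_def)

lemma GG_group:
  assumes "H \<in> GG"
  shows "id \<in> H" "H \<subseteq> Gam" "g \<in> H \<Longrightarrow> h \<in> H \<Longrightarrow> g \<circ> h \<in> H" "g \<in> H \<Longrightarrow> g \<circ> g' = id \<Longrightarrow> g' \<circ> g = id \<Longrightarrow> g' \<in> H"
proof -
  consider "H = {id}" | S where "nts S" "H = GS S" using assms unfolding GG_eq by blast
  then have "id \<in> H \<and> H \<subseteq> Gam \<and> (g \<in> H \<longrightarrow> h \<in> H \<longrightarrow> g \<circ> h \<in> H) \<and>
    (g \<in> H \<longrightarrow> g \<circ> g' = id \<longrightarrow> g' \<circ> g = id \<longrightarrow> g' \<in> H)"
  proof cases
    case 1
    then show ?thesis using G.id_in by auto
  next
    case 2
    have "g' \<in> stab X" if s: "g \<in> stab X" "g \<circ> g' = id" "g' \<circ> g = id" for X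
    proof -
      obtain k where "k \<in> stab X" "g \<circ> k = id" "k \<circ> g = id" using stab_inv[OF s(1)] by blast
      then have "k = g'" using s by (metis comp_assoc comp_id id_comp)
      then show ?thesis using \<open>k \<in> stab X\<close> by simp
    qed
    note inv = this
    have "S \<noteq> {}" using 2(1) by (simp add: nts_def)
    then have "H \<subseteq> Gam" using GS_Gam[of S] 2(2) by blast
    moreover have "id \<in> H" using GS_id 2(2) by simp
    moreover have "g \<circ> h \<in> H" if "g \<in> H" "h \<in> H" using that unfolding 2(2) GS_def by (simp add: stab_comp)
    moreover have "g' \<in> H" if "g \<in> H" "g \<circ> g' = id" "g' \<circ> g = id"
      using that inv unfolding 2(2) GS_def by simp
    ultimately show ?thesis by simp
  qed
  then show "id \<in> H" "H \<subseteq> Gam" "g \<in> H \<Longrightarrow> h \<in> H \<Longrightarrow> g \<circ> h \<in> H"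
    "g \<in> H \<Longrightarrow> g \<circ> g' = id \<Longrightarrow> g' \<circ> g = id \<Longrightarrow> g' \<in> H" by blast+
qed

lemma GG_shift_self:
  assumes "H \<in> GG" "g \<in> H"
  shows "(\<lambda>h. h \<circ> g) ` H = H"
proof -
  obtain g' where g': "g \<circ> g' = id" "g' \<circ> g = id" using GG_group(2)[OF assms(1)] assms(2) G.inv_ex by blast
  have g'H: "g' \<in> H" using GG_group(4)[OF assms(1) assms(2) g'] .
  have "k \<in> (\<lambda>h. h \<circ> g) ` H" if "k \<in> H" for k
  proof -
    have "k = k \<circ> g' \<circ> g" using g' by (simp add: comp_assoc)
    then show ?thesis using GG_group(3)[OF assms(1) that g'H] by blast
  qed
  then show ?thesis using GG_group(3)[OF assms(1)] assms(2) by blast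
qed

lemma T0_supp_ne: "\<xi> \<in> T0 \<Longrightarrow> supp \<xi> \<noteq> {}"
  using T0_D(4) by fastforce

text \<open>The translate by \<open>g\<close> of the least member of the chain is again in
  \<open>GG\<close>, hence contains the identity; this puts \<open>g\<close> into that least
  subgroup and so into all the others.\<close>

lemma T0_fundamental:
  assumes \<xi>: "\<xi> \<in> T0" and g: "g \<in> Gam" and "xi_act \<xi> g \<in> T0"
  shows "g \<in> \<Inter>(supp \<xi>)"
proof -
  obtain g' where g': "g' \<in> Gam" "g \<circ> g' = id" "g' \<circ> g = id" using G.inv_ex g by blast
  obtain C where C: "C \<in> supp \<xi>" "\<And>D. D \<in> supp \<xi> \<Longrightarrow> C \<subseteq> D"
    using chain_least[OF T0_D(3)[OF \<xi>] T0_supp_ne[OF \<xi>]] T0_D(5)[OF \<xi>] by blast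
  have "(\<lambda>h. h \<circ> g) ` C \<in> supp (xi_act \<xi> g)" using C(1) unfolding supp_xi_act[OF g'(2,3)] by blast
  then have "(\<lambda>h. h \<circ> g) ` C \<in> GG" using T0_D(2)[OF assms(3)] by blast
  then have "id \<in> (\<lambda>h. h \<circ> g) ` C" by (rule GG_group(1))
  then obtain k where k: "k \<in> C" "k \<circ> g = id" by force
  have "k = g'" using k(2) g' by (metis comp_assoc comp_id id_comp)
  then have "g' \<in> C" using k by simp
  then have "g \<in> C" using GG_group(4)[of C g' g] C(1) T0_D(2)[OF \<xi>] g' by blast
  then show ?thesis using C(2) by blast
qed

lemma T0_fixed:
  assumes \<xi>: "\<xi> \<in> T0" and g: "g \<in> \<Inter>(supp \<xi>)"
  shows "xi_act \<xi> g = \<xi>"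
proof -
  obtain C0 where C0: "C0 \<in> supp \<xi>" using T0_supp_ne[OF \<xi>] by blast
  have "g \<in> Gam" using g C0 T0_D(2)[OF \<xi>] GG_group(2)[of C0] by blast
  then obtain g' where g': "g' \<in> Gam" "g \<circ> g' = id" "g' \<circ> g = id" using G.inv_ex by blast
  have fix1: "(\<lambda>h. h \<circ> g) ` C = C" if "C \<in> supp \<xi>" for C
    using GG_shift_self[of C g] that g T0_D(2)[OF \<xi>] by blast
  have fix2: "(\<lambda>h. h \<circ> g') ` C = C" if "C \<in> supp \<xi>" for C
    using GG_shift_self[of C g'] GG_group(4)[of C g g'] that g g' T0_D(2)[OF \<xi>] by blast
  have "\<xi> ((\<lambda>h. h \<circ> g') ` C) = \<xi> C" for C
  proof (cases "C \<in> supp \<xi>")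
    case True
    then show ?thesis using fix2 by simp
  next
    case False
    have "(\<lambda>h. h \<circ> g') ` C \<notin> supp \<xi>"
    proof
      assume "(\<lambda>h. h \<circ> g') ` C \<in> supp \<xi>"
      then have "(\<lambda>h. h \<circ> g) ` (\<lambda>h. h \<circ> g') ` C = (\<lambda>h. h \<circ> g') ` C" using fix1 by blast
      then have "C \<in> supp \<xi>" using shift_inverse[OF g'(3), of C] \<open>(\<lambda>h. h \<circ> g') ` C \<in> supp \<xi>\<close> by simp
      then show False using False by simp
    qed
    then show ?thesis using False by (simp add: supp_def)
  qed
  then show ?thesis unfolding xi_act_def shift_vimage[OF g'(2,3)] by simp
qed

text \<open>The vertices of nonzero weight are those of the faces occurring in the chain. So the
  intersection of the chain is the stabiliser of the smallest face containing the point, including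
  the case of the trivial group.\<close>

lemma T0_stab:
  assumes \<xi>: "\<xi> \<in> T0"
  shows "\<Inter>(supp \<xi>) = GS {X. wt \<xi> X \<noteq> 0}"
proof -
  have supp_cases: "C = {id} \<or> (\<exists>S. nts S \<and> C = GS S)" if "C \<in> supp \<xi>" for C
    using T0_D(2)[OF \<xi>] that unfolding GG_eq by blast
  have wt0: "wt \<xi> X = (if X \<in> ABC then \<xi> {id} / 3 else 0) + (\<Sum>S | X \<in> S. coef \<xi> S)" for X
    by (rule coef_props(4)[OF \<xi>])
  have nn: "0 \<le> \<xi> {id}" "0 \<le> coef \<xi> S" for S using T0_D(1)[OF \<xi>] coef_props(1)[OF \<xi>] by auto
  have pos1: "wt \<xi> X \<noteq> 0" if "X \<in> ABC" "\<xi> {id} \<noteq> 0" for X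
    using wt0[of X] that nn sum_nonneg[of "{S. X \<in> S}" "coef \<xi>"] by auto
  have pos2: "wt \<xi> X \<noteq> 0" if "X \<in> S" "nts S" "\<xi> (GS S) \<noteq> 0" for X S
  proof -
    have "S \<noteq> {}" using that(1) by blast
    then have "coef \<xi> S \<noteq> 0" using that by (simp add: coef_def)
    then have "0 < coef \<xi> S" using nn(2)[of S] by simp
    also have "\<dots> \<le> (\<Sum>S | X \<in> S. coef \<xi> S)" using that nn by (intro member_le_sum) auto
    also have "\<dots> \<le> wt \<xi> X" using wt0[of X] nn by simp
    finally show ?thesis by simp
  qed
  show ?thesis
  proof
    show "\<Inter>(supp \<xi>) \<subseteq> GS {X. wt \<xi> X \<noteq> 0}"
    proof
      fix g assume g: "g \<in> \<Inter>(supp \<xi>)"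
      have "g \<in> stab X" if X: "wt \<xi> X \<noteq> 0" for X
      proof (cases "\<exists>S. X \<in> S \<and> coef \<xi> S \<noteq> 0")
        case True
        then obtain S where S0: "X \<in> S" "coef \<xi> S \<noteq> 0" by blast
        then have S: "X \<in> S" "nts S" "\<xi> (GS S) \<noteq> 0" by (simp_all add: coef_def split: if_splits)
        then have "g \<in> GS S" using g by (simp add: supp_def)
        then show ?thesis using S(1) unfolding GS_def by blast
      next
        case False
        then have "(\<Sum>S | X \<in> S. coef \<xi> S) = 0" by (intro sum.neutral) auto
        then have "{id} \<in> supp \<xi>" using X wt0[of X] by (auto simp: supp_def split: if_splits)
        then show ?thesis using g stab_id by blast
      qed
      then show "g \<in> GS {X. wt \<xi> X \<noteq> 0}" unfolding GS_def by blast
    qed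
    show "GS {X. wt \<xi> X \<noteq> 0} \<subseteq> \<Inter>(supp \<xi>)"
    proof
      fix g assume g: "g \<in> GS {X. wt \<xi> X \<noteq> 0}"
      have "g \<in> C" if C: "C \<in> supp \<xi>" for C
        using supp_cases[OF C]
      proof
        assume "C = {id}"
        then have "\<xi> {id} \<noteq> 0" using C by (simp add: supp_def)
        then have "g \<in> stab VA" "g \<in> stab VB" "g \<in> stab VC" using g pos1 unfolding GS_def by auto
        then show ?thesis using stab_inter_ABC \<open>C = {id}\<close> by blast
      next
        assume "\<exists>S. nts S \<and> C = GS S"
        then obtain S where S: "nts S" "C = GS S" by blast
        then have "\<xi> (GS S) \<noteq> 0" using C by (simp add: supp_def)
        then show ?thesis using g pos2[OF _ S(1)] S(2) unfolding GS_def by blast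
      qed
      then show "g \<in> \<Inter>(supp \<xi>)" by blast
    qed
  qed
qed

definition fc :: "(vertex \<Rightarrow> real) \<Rightarrow> vertex set" where
  "fc w = {X. w X \<noteq> 0}"

lemma pt_stab: "w \<in> Wt \<Longrightarrow> \<Inter>(supp (pt w)) = GS (fc w)"
  using T0_stab[OF pt_T0] wt_pt by (simp add: fc_def)

lemma pt_fixed: "w \<in> Wt \<Longrightarrow> g \<in> GS (fc w) \<Longrightarrow> xi_act (pt w) g = pt w"
  using T0_fixed[OF pt_T0] pt_stab by blast

lemma pt_fundamental:
  assumes "w \<in> Wt" "w' \<in> Wt" "g \<in> Gam" "xi_act (pt w) g = pt w'"
  shows "w = w' \<and> g \<in> GS (fc w)"
proof -
  have g: "g \<in> GS (fc w)"
    using T0_fundamental[OF pt_T0[OF assms(1)] assms(3)] assms pt_T0 pt_stab by simp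
  then have "pt w = pt w'" using pt_fixed assms by simp
  then show ?thesis using g pt_inj assms by blast
qed

lemma T0_pt: "\<xi> \<in> T0 \<Longrightarrow> \<exists>w\<in>Wt. \<xi> = pt w"
  using pt_wt T0_wt_Wt by metis

text \<open>Translating back by an element of the least coset makes every coset of the chain contain
  the identity, so that each becomes one of the groups in \<open>GG\<close>.\<close>

lemma Xi_rep:
  assumes \<xi>: "\<xi> \<in> Xi"
  shows "\<exists>w\<in>Wt. \<exists>g\<in>Gam. \<xi> = xi_act (pt w) g"
proof -
  have fin: "finite (supp \<xi>)" "supp \<xi> \<noteq> {}" "\<And>C D. C \<in> supp \<xi> \<Longrightarrow> D \<in> supp \<xi> \<Longrightarrow> C \<subseteq> D \<or> D \<subseteq> C" "supp \<xi> \<subseteq> cosets"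
    using \<xi> unfolding Xi_def by auto
  obtain C where C: "C \<in> supp \<xi>" "\<And>D. D \<in> supp \<xi> \<Longrightarrow> C \<subseteq> D"
    using chain_least[OF fin(1-3)] by blast
  obtain H g0 where H: "H \<in> GG" "g0 \<in> Gam" "C = (\<lambda>h. h \<circ> g0) ` H"
    using C(1) fin(4) unfolding cosets_def by blast
  have g0C: "g0 \<in> C" using imageI[OF GG_group(1)[OF H(1)], of "\<lambda>h. h \<circ> g0"] unfolding H(3) by simp
  obtain g' where g': "g' \<in> Gam" "g0 \<circ> g' = id" "g' \<circ> g0 = id" using G.inv_ex H(2) by blast
  have "(\<lambda>h. h \<circ> g') ` D \<in> GG" if D: "D \<in> supp \<xi>" for D
  proof -
    obtain K k where K: "K \<in> GG" "k \<in> Gam" "D = (\<lambda>h. h \<circ> k) ` K"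
      using D fin(4) unfolding cosets_def by blast
    obtain l where l: "l \<in> K" "g0 = l \<circ> k" using g0C C(2)[OF D] unfolding K(3) by blast
    have "(\<lambda>h. h \<circ> g0) ` K = D"
      unfolding l(2) shift_shift[symmetric] GG_shift_self[OF K(1) l(1)] K(3) ..
    then have "(\<lambda>h. h \<circ> g') ` D = K" using shift_inverse[OF g'(2), of K] by simp
    then show ?thesis using K(1) by simp
  qed
  then have "supp (xi_act \<xi> g') \<subseteq> GG" unfolding supp_xi_act[OF g'(3,2)] by blast
  then have "xi_act \<xi> g' \<in> T0" using G.act_in[OF \<xi> g'(1)] unfolding T0_def by blast
  moreover have "\<xi> = xi_act (xi_act \<xi> g') g0" using G.act_inverse[OF \<xi> g'(1) H(2) g'(3)] by simp
  ultimately show ?thesis using T0_pt H(2) by metis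
qed

section \<open>The maps in coordinates\<close>

abbreviation Mp :: "nat \<Rightarrow> xi \<Rightarrow> letter list \<Rightarrow> letter aut \<Rightarrow> M_point" where
  "Mp n \<xi> v h \<equiv> tensor_orbit IMG (Xi_tensor n \<xi> (v, h))"

abbreviation Sp :: "nat \<Rightarrow> real \<times> real \<Rightarrow> bin list \<Rightarrow> bin aut \<Rightarrow> S_point" where
  "Sp n y u k \<equiv> tensor_orbit (nu ` IMG) (XiHat_tensor n y (u, k))"

lemma IMG_Gam: "IMG \<subseteq> Gam"
  using IMG_iff by blast

lemma bimod_pair: "(v, h) \<in> bimod G n \<longleftrightarrow> length v = n \<and> h \<in> G"
  by (simp add: bimod_def)

lemma Mp_eq_iff:
  assumes "\<xi> \<in> Xi" "\<xi>' \<in> Xi" "h \<in> Gam" "h' \<in> Gam" "length v = n" "length v' = n"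
  shows "Mp n \<xi> v h = Mp n \<xi>' v' h' \<longleftrightarrow>
    (\<exists>g\<in>Gam. \<exists>k\<in>IMG. xi_act \<xi>' g = \<xi> \<and> v' = g v \<and> h' = sect g v \<circ> h \<circ> k)"
  by (rule G.tensor_orbit_eq_iff[OF IMG_Gam id_IMG IMG_comp IMG_inv assms])

lemma K_Gam: "nu ` IMG \<subseteq> GamHat"
  using IMG_Gam by auto

lemma id_K: "id \<in> nu ` IMG"
  using id_IMG nu_gens(7) by (metis imageI)

lemma K_comp: "k \<in> nu ` IMG \<Longrightarrow> k' \<in> nu ` IMG \<Longrightarrow> k \<circ> k' \<in> nu ` IMG"
proof -
  assume "k \<in> nu ` IMG" "k' \<in> nu ` IMG"
  then obtain g g' where "g \<in> IMG" "g' \<in> IMG" "k = nu g" "k' = nu g'" by blast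
  then show ?thesis using IMG_comp IMG_Gam nu_comp[of g g'] by (metis imageI subsetD)
qed

lemma K_inv: "k \<in> nu ` IMG \<Longrightarrow> \<exists>k'\<in>nu ` IMG. k \<circ> k' = id \<and> k' \<circ> k = id"
proof -
  assume "k \<in> nu ` IMG"
  then obtain g where g: "g \<in> IMG" "k = nu g" by blast
  then obtain g' where g': "g' \<in> IMG" "g \<circ> g' = id" "g' \<circ> g = id" using IMG_inv by blast
  have "k \<circ> nu g' = id" "nu g' \<circ> k = id"
  proof -
    have G: "g \<in> Gam" "g' \<in> Gam" using g(1) g'(1) IMG_Gam by blast+
    show "k \<circ> nu g' = id" unfolding g(2) using nu_comp[OF G] g'(2) nu_gens(7) by metis
    show "nu g' \<circ> k = id" unfolding g(2) using nu_comp[OF G(2,1)] g'(3) nu_gens(7) by metis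
  qed
  then show ?thesis using g'(1) by blast
qed

lemma Sp_eq_iff:
  assumes "k \<in> GamHat" "k' \<in> GamHat" "length u = n" "length u' = n"
  shows "Sp n y u k = Sp n y' u' k' \<longleftrightarrow>
    (\<exists>g\<in>GamHat. \<exists>j\<in>nu ` IMG. isom g y' = y \<and> u' = g u \<and> k' = sect g u \<circ> k \<circ> j)"
  using hat.tensor_orbit_eq_iff[OF K_Gam id_K K_comp K_inv UNIV_I UNIV_I assms, of y y']
  by (auto simp: hat_act_eq)

lemma tensor_orbit_self: "id \<in> K \<Longrightarrow> tensor_ract t id \<in> tensor_orbit K t"
  by (simp add: tensor_orbit_def)

lemma Mp_class:
  assumes "\<xi> \<in> Xi" "h \<in> Gam" "length v = n" "t \<in> Xi_n n" "Mp n \<xi> v h = tensor_orbit IMG t"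
  shows "\<exists>k\<in>IMG. t = Xi_tensor n \<xi> (v, h \<circ> k)"
proof -
  have "tensor_ract t id = t" by (auto simp: tensor_ract_def)
  then have "t \<in> tensor_orbit IMG (Xi_tensor n \<xi> (v, h))"
    using tensor_orbit_self[OF id_IMG, of t] assms(5) by simp
  then obtain k where k: "k \<in> IMG" "t = tensor_ract (Xi_tensor n \<xi> (v, h)) k"
    unfolding tensor_orbit_def by blast
  then show ?thesis using G.tensor_ract_class[OF assms(1-3), of k] IMG_Gam by blast
qed

lemma Sp_class:
  assumes "h \<in> GamHat" "length u = n" "t \<in> XiHat_n n" "Sp n y u h = tensor_orbit (nu ` IMG) t"
  shows "\<exists>k\<in>nu ` IMG. t = XiHat_tensor n y (u, h \<circ> k)"
proof -
  have "tensor_ract t id = t" by (auto simp: tensor_ract_def)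
  then have "t \<in> tensor_orbit (nu ` IMG) (XiHat_tensor n y (u, h))"
    using tensor_orbit_self[OF id_K, of t] assms(4) by simp
  then obtain k where k: "k \<in> nu ` IMG" "t = tensor_ract (XiHat_tensor n y (u, h)) k"
    unfolding tensor_orbit_def by blast
  then show ?thesis using hat.tensor_ract_class[OF UNIV_I assms(1,2), of k y] K_Gam by blast
qed

lemma Mp_k:
  assumes "\<xi> \<in> Xi" "h \<in> Gam" "length v = n" "k \<in> IMG"
  shows "Mp n \<xi> v (h \<circ> k) = Mp n \<xi> v h"
proof -
  have "h \<circ> k \<in> Gam" using assms IMG_Gam G.comp_in by blast
  moreover have "\<exists>g\<in>Gam. \<exists>k'\<in>IMG. xi_act \<xi> g = \<xi> \<and> v = g v \<and> h \<circ> k = sect g v \<circ> h \<circ> k'"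
    by (rule bexI[OF _ G.id_in], rule bexI[OF _ assms(4)]) (simp add: G.act_id[OF assms(1)])
  ultimately show ?thesis using Mp_eq_iff[OF assms(1,1,2) _ assms(3,3)] by metis
qed

lemma Sp_k:
  assumes "h \<in> GamHat" "length u = n" "k \<in> nu ` IMG"
  shows "Sp n y u (h \<circ> k) = Sp n y u h"
proof -
  have "h \<circ> k \<in> GamHat" using assms K_Gam hat.comp_in by blast
  moreover have "\<exists>g\<in>GamHat. \<exists>k'\<in>nu ` IMG. isom g y = y \<and> u = g u \<and> h \<circ> k = sect g u \<circ> h \<circ> k'"
    by (rule bexI[OF _ hat.id_in], rule bexI[OF _ assms(3)]) simp
  ultimately show ?thesis using Sp_eq_iff[OF assms(1) _ assms(2,2)] by metis
qed

lemma Xi_tensor_in: "\<xi> \<in> Xi \<Longrightarrow> h \<in> Gam \<Longrightarrow> length v = n \<Longrightarrow> Xi_tensor n \<xi> (v, h) \<in> Xi_n n"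
  using G.tensor_space_iff by blast

lemma XiHat_tensor_in: "h \<in> GamHat \<Longrightarrow> length u = n \<Longrightarrow> XiHat_tensor n y (u, h) \<in> XiHat_n n"
  using hat.tensor_space_iff by blast

lemma Mp_act:
  assumes "\<xi> \<in> Xi" "g \<in> Gam" "h \<in> Gam" "length v = n"
  shows "Mp n (xi_act \<xi> g) v h = Mp n \<xi> (g v) (sect g v \<circ> h)"
  using G.tensor_class_act[OF assms(1,2), of "(v, h)" n] assms(3,4) by (simp add: bimod_pair bimod_lact_def)

lemma pt_Xi: "w \<in> Wt \<Longrightarrow> pt w \<in> Xi"
  using pt_T0 T0_Xi by blast

lemma MM_iff: "m \<in> MM n \<longleftrightarrow> (\<exists>w\<in>Wt. \<exists>v h. length v = n \<and> h \<in> Gam \<and> m = Mp n (pt w) v h)"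
proof
  assume "m \<in> MM n"
  then obtain t where t: "t \<in> Xi_n n" "m = tensor_orbit IMG t" unfolding MM_def by (rule imageE)
  from t(1)[unfolded G.tensor_space_iff] t(2)
  obtain \<xi> v h where \<xi>: "\<xi> \<in> Xi" "length v = n" "h \<in> Gam" "m = Mp n \<xi> v h" by blast
  obtain w g where w: "w \<in> Wt" "g \<in> Gam" "\<xi> = xi_act (pt w) g" using Xi_rep[OF \<xi>(1)] by blast
  have "m = Mp n (pt w) (g v) (sect g v \<circ> h)" using Mp_act[OF pt_Xi[OF w(1)] w(2) \<xi>(3,2)] \<xi>(4) w(3) by simp
  moreover have "length (g v) = n" "sect g v \<circ> h \<in> Gam" using w \<xi> G.comp_in G.sect_in by simp_all
  ultimately show "\<exists>w\<in>Wt. \<exists>v h. length v = n \<and> h \<in> Gam \<and> m = Mp n (pt w) v h" using w(1) by blast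
next
  assume "\<exists>w\<in>Wt. \<exists>v h. length v = n \<and> h \<in> Gam \<and> m = Mp n (pt w) v h"
  then obtain w v h where "w \<in> Wt" "length v = n" "h \<in> Gam" "m = Mp n (pt w) v h" by blast
  then show "m \<in> MM n" unfolding MM_def using Xi_tensor_in[OF pt_Xi[of w], of h v n] by (simp only: imageI)
qed

lemma SS_rep:
  assumes "s \<in> SS n"
  shows "\<exists>y u k. length u = n \<and> k \<in> GamHat \<and> s = Sp n y u k"
proof -
  obtain t where t: "t \<in> XiHat_n n" "s = tensor_orbit (nu ` IMG) t" using assms unfolding SS_def by (rule imageE)
  from t(1)[unfolded hat.tensor_space_iff] t(2) show ?thesis by blast
qed

text \<open>A representation in any tetrahedron extends by zero to weights on all six vertices,
  where it is unique; so the description does not depend on the tetrahedron.\<close>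

lemma affine_ext_EE:
  assumes w: "w \<in> Wt"
  shows "affine_ext f (EE w) = (\<Sum>X\<in>UNIV. w X *\<^sub>R f X)"
  unfolding affine_ext_def
proof (rule the_equality)
  obtain S where S: "S \<in> tetrahedra" "\<And>X. X \<notin> S \<Longrightarrow> w X = 0" using w unfolding Wt_def by blast
  have "sum w S = sum w UNIV" by (rule sum.mono_neutral_left) (use S in auto)
  moreover have "EE w = (\<Sum>X\<in>S. w X *\<^sub>R vpos X)"
    unfolding EE_def by (rule sum.mono_neutral_right) (use S in auto)
  moreover have "(\<Sum>X\<in>UNIV. w X *\<^sub>R f X) = (\<Sum>X\<in>S. w X *\<^sub>R f X)"
    by (rule sum.mono_neutral_right) (use S in auto)
  ultimately show "\<exists>S\<in>tetrahedra. \<exists>wa. (\<forall>X\<in>S. 0 \<le> wa X) \<and> sum wa S = 1 \<and>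
      EE w = (\<Sum>X\<in>S. wa X *\<^sub>R vpos X) \<and> (\<Sum>X\<in>UNIV. w X *\<^sub>R f X) = (\<Sum>X\<in>S. wa X *\<^sub>R f X)"
    using S(1) w by (intro bexI[of _ S] exI[of _ w]) (auto simp: Wt_def)
next
  fix q assume "\<exists>S\<in>tetrahedra. \<exists>wa. (\<forall>X\<in>S. 0 \<le> wa X) \<and> sum wa S = 1 \<and>
      EE w = (\<Sum>X\<in>S. wa X *\<^sub>R vpos X) \<and> q = (\<Sum>X\<in>S. wa X *\<^sub>R f X)"
  then obtain S v where v: "S \<in> tetrahedra" "sum v S = 1" "EE w = (\<Sum>X\<in>S. v X *\<^sub>R vpos X)"
    "q = (\<Sum>X\<in>S. v X *\<^sub>R f X)" by blast
  define v' where "v' X = (if X \<in> S then v X else 0)" for X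
  have ext: "(\<Sum>X\<in>S. v X *\<^sub>R h X) = (\<Sum>X\<in>UNIV. v' X *\<^sub>R h X)" for h :: "vertex \<Rightarrow> 'c::real_vector"
    unfolding v'_def by (rule sum.mono_neutral_cong_left) auto
  have "sum v S = sum v' UNIV" unfolding v'_def by (rule sum.mono_neutral_cong_left) auto
  then have "w = v'" using v(2,3) ext[of vpos] Wt_sum[OF w] by (intro EE_inj) (simp_all add: EE_def)
  then show "q = (\<Sum>X\<in>UNIV. w X *\<^sub>R f X)" using v(4) ext[of f] by simp
qed

text \<open>Every vertex goes under \<open>I\<close> to the barycenter of a set of vertices.
  Recording these sets makes \<open>I\<close> a linear map on weights.\<close>

fun IS :: "letter \<Rightarrow> vertex \<Rightarrow> vertex set" where
  "IS X1 VA = {VC}"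
| "IS X2 VA = {VC1}"
| "IS X3 VA = {VA1}"
| "IS X4 VA = {VA}"
| "IS _ VB = {VA, VC}"
| "IS _ VC = {VB}"
| "IS X1 VA1 = {VC, VC1}"
| "IS X2 VA1 = {VC, VC1}"
| "IS X3 VA1 = {VA, VA1}"
| "IS X4 VA1 = {VA, VA1}"
| "IS X1 VB1 = {VC, VA1}"
| "IS X3 VB1 = {VC, VA1}"
| "IS X2 VB1 = {VA, VC1}"
| "IS X4 VB1 = {VA, VC1}"
| "IS X1 VC1 = {VB1}"
| "IS X4 VC1 = {VB1}"
| "IS X2 VC1 = {VB}"
| "IS X3 VC1 = {VB}"

lemma I_vert_IS: "I_vert x X = EE (bw (IS x X))"
  unfolding EE_vec5
  by (cases x; cases X) (simp_all add: bw_def midpoint_def vec5_arith)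

lemma IS_ne: "IS x X \<noteq> {}"
  by (cases x; cases X) simp_all

definition Iw :: "letter \<Rightarrow> (vertex \<Rightarrow> real) \<Rightarrow> vertex \<Rightarrow> real" where
  "Iw x w Z = (\<Sum>X\<in>UNIV. w X * bw (IS x X) Z)"

lemma EE_Iw: "EE (Iw x w) = (\<Sum>X\<in>UNIV. w X *\<^sub>R I_vert x X)"
proof -
  have "(\<Sum>X\<in>UNIV. w X *\<^sub>R I_vert x X) = (\<Sum>X\<in>UNIV. \<Sum>Z\<in>UNIV. (w X * bw (IS x X) Z) *\<^sub>R vpos Z)"
    unfolding I_vert_IS EE_def by (simp add: scaleR_sum_right)
  also have "\<dots> = (\<Sum>Z\<in>UNIV. \<Sum>X\<in>UNIV. (w X * bw (IS x X) Z) *\<^sub>R vpos Z)" by (rule sum.swap)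
  also have "\<dots> = EE (Iw x w)" unfolding EE_def Iw_def by (simp add: scaleR_sum_left)
  finally show ?thesis by simp
qed

lemma Iw_Wt:
  assumes w: "w \<in> Wt"
  shows "Iw x w \<in> Wt"
proof -
  have nn: "0 \<le> w X" for X using w by (simp add: Wt_def)
  have "0 \<le> Iw x w Z" for Z
    unfolding Iw_def by (intro sum_nonneg mult_nonneg_nonneg nn) (simp add: bw_def)
  moreover have "sum (Iw x w) UNIV = 1"
  proof -
    have "sum (Iw x w) UNIV = (\<Sum>X\<in>UNIV. \<Sum>Z\<in>UNIV. w X * bw (IS x X) Z)"
      unfolding Iw_def by (rule sum.swap)
    also have "\<dots> = (\<Sum>X\<in>UNIV. w X * sum (bw (IS x X)) UNIV)" by (simp add: sum_distrib_left)
    finally show ?thesis using Wt_sum[OF w] by (simp add: sum_bw IS_ne)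
  qed
  moreover have "\<exists>S\<in>tetrahedra. \<forall>Z. Z \<notin> S \<longrightarrow> Iw x w Z = 0"
  proof -
    obtain S where S: "S \<in> tetrahedra" "\<And>X. X \<notin> S \<Longrightarrow> w X = 0" using w unfolding Wt_def by blast
    obtain Z0 where Z0: "Z0 \<in> {VA1, VB1, VC1}" "S = {Z0, VA, VB, VC}" using S(1) by (rule tetra_cases)
    have "\<exists>Z1\<in>{VA1, VB1, VC1}. \<forall>X\<in>S. IS x X \<subseteq> {Z1, VA, VB, VC}"
      using Z0(1) unfolding Z0(2) by (elim insertE emptyE; cases x) simp_all
    then obtain Z1 where Z1: "Z1 \<in> {VA1, VB1, VC1}" "\<forall>X\<in>S. IS x X \<subseteq> {Z1, VA, VB, VC}" by blast
    have "w X * bw (IS x X) Z = 0" if "Z \<notin> {Z1, VA, VB, VC}" for X Z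
      using that Z1(2) S(2)[of X] by (cases "X \<in> S") (auto simp: bw_def)
    then have "Iw x w Z = 0" if "Z \<notin> {Z1, VA, VB, VC}" for Z
      using that unfolding Iw_def by (intro sum.neutral) blast
    then show ?thesis using tetrahedra_primed[OF Z1(1)] by blast
  qed
  ultimately show ?thesis unfolding Wt_def by blast
qed

lemma I_T0_pt: "w \<in> Wt \<Longrightarrow> I_T0 x (pt w) = pt (Iw x w)"
  unfolding I_T0_def by (simp add: emb_pt affine_ext_EE flip: EE_Iw) (simp add: pt_def)

text \<open>The reason why \<open>I\<close> is well defined: an element of a vertex stabiliser
  changes the letter without changing the image of that vertex, and its section stabilises the
  image.\<close>

lemma stab_I_gen:
  assumes "s \<in> sg X"
  shows "IS (hd (s [y])) X = IS y X \<and> (\<forall>Z\<in>IS y X. sect s [y] \<in> stab Z)"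
proof -
  have simps: "g_b \<circ> g_be \<circ> g_be = g_b" "g_a \<circ> g_al \<circ> g_al = g_a" by auto
  have comps: "sect (g_c \<circ> g_ga) [y] = sect g_c (g_ga [y]) \<circ> sect g_ga [y]"
    "sect (g_a \<circ> g_al) [y] = sect g_a (g_al [y]) \<circ> sect g_al [y]"
    "sect (g_b \<circ> g_be) [y] = sect g_b (g_be [y]) \<circ> sect g_be [y]" for y
    by (simp_all add: G.sect_comp)
  have more: "g_a \<circ> g_al \<circ> g_ga \<in> stab VB" "g_c \<circ> g_al \<in> stab VB"
    by (intro stab_comp; simp add: stab_latin greek_stab)+
  show ?thesis
    using assms by (cases X; simp only: sg.simps; elim insertE emptyE; cases y)
      (simp_all add: comps simps more stab_latin greek_stab stab_id)
qed

lemma stab_I: "g \<in> stab X \<Longrightarrow> IS (hd (g [y])) X = IS y X \<and> (\<forall>Z\<in>IS y X. sect g [y] \<in> stab Z)"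
proof (induction arbitrary: y rule: stab_induct)
  case one
  have "IS (hd (id [y])) X = IS y X \<and> (\<forall>Z\<in>IS y X. sect id [y] \<in> stab Z)" by (simp add: stab_id)
  then show ?case .
next
  case (step s g)
  have G: "g \<in> Gam" "s \<in> Gam" using stab_Gam[OF step(2)] subsetD[OF sg_Gam step(1)] by auto
  define z where "z = hd (g [y])"
  have z: "g [y] = [z]" unfolding z_def by (rule G.app_single[OF G(1)])
  have "sect (s \<circ> g) [y] = sect s [z] \<circ> sect g [y]" using G.sect_comp[OF G(2,1)] z by simp
  moreover have "(s \<circ> g) [y] = s [z]" using z by simp
  ultimately show "IS (hd ((s \<circ> g) [y])) X = IS y X \<and> (\<forall>Z\<in>IS y X. sect (s \<circ> g) [y] \<in> stab Z)"
    using stab_I_gen[OF step(1), of z] step(3)[of y] stab_comp unfolding z_def[symmetric] by simp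
qed

lemma stab_Iw:
  assumes g: "g \<in> GS (fc w)"
  shows "Iw (hd (g [y])) w = Iw y w" "sect g [y] \<in> GS (fc (Iw y w))"
proof -
  have *: "w X \<noteq> 0 \<Longrightarrow> g \<in> stab X" for X using g unfolding GS_def fc_def by blast
  have "Iw (hd (g [y])) w Z = Iw y w Z" for Z
    unfolding Iw_def
  proof (rule sum.cong[OF HOL.refl])
    fix X show "w X * bw (IS (hd (g [y])) X) Z = w X * bw (IS y X) Z"
      using stab_I[OF *, of X y] by (cases "w X = 0") auto
  qed
  then show "Iw (hd (g [y])) w = Iw y w" by auto
  have "sect g [y] \<in> stab Z" if "Iw y w Z \<noteq> 0" for Z
  proof -
    have "\<exists>X. w X * bw (IS y X) Z \<noteq> 0"
    proof (rule ccontr)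
      assume "\<not> (\<exists>X. w X * bw (IS y X) Z \<noteq> 0)"
      then have "Iw y w Z = 0" unfolding Iw_def by (intro sum.neutral) simp
      then show False using that by simp
    qed
    then obtain X where "w X * bw (IS y X) Z \<noteq> 0" by blast
    then have X: "w X \<noteq> 0" "Z \<in> IS y X" by (simp_all add: bw_def split: if_splits)
    show ?thesis using stab_I[OF *[OF X(1)], of y] X(2) by blast
  qed
  then show "sect g [y] \<in> GS (fc (Iw y w))" unfolding GS_def fc_def by blast
qed

lemma I_map_eq:
  assumes w: "w \<in> Wt" and g: "g \<in> Gam" and h: "h \<in> Gam"
  shows "I_map (Xi_tensor 1 (xi_act (pt w) g) ([x], h)) = xi_act (pt (Iw (hd (g [x])) w)) (sect g [x] \<circ> h)"
  unfolding I_map_def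
proof (rule the_equality)
  show "\<exists>\<xi>\<in>T0. \<exists>ga\<in>Gam. \<exists>xa. \<exists>ha\<in>Gam.
      Xi_tensor 1 (xi_act (pt w) g) ([x], h) = Xi_tensor 1 (xi_act \<xi> ga) ([xa], ha) \<and>
      xi_act (pt (Iw (hd (g [x])) w)) (sect g [x] \<circ> h) = xi_act (I_T0 (hd (ga [xa])) \<xi>) (sect ga [xa] \<circ> ha)"
    using pt_T0[OF w] g h I_T0_pt[OF w] by (intro bexI[of _ "pt w"] bexI[of _ g] exI[of _ x] bexI[of _ h]) auto
next
  fix \<eta> assume "\<exists>\<xi>\<in>T0. \<exists>ga\<in>Gam. \<exists>xa. \<exists>ha\<in>Gam.
      Xi_tensor 1 (xi_act (pt w) g) ([x], h) = Xi_tensor 1 (xi_act \<xi> ga) ([xa], ha) \<and>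
      \<eta> = xi_act (I_T0 (hd (ga [xa])) \<xi>) (sect ga [xa] \<circ> ha)"
  then obtain \<xi> g' x' h' where 1: "\<xi> \<in> T0" "g' \<in> Gam" "h' \<in> Gam"
    "Xi_tensor 1 (xi_act (pt w) g) ([x], h) = Xi_tensor 1 (xi_act \<xi> g') ([x'], h')"
    "\<eta> = xi_act (I_T0 (hd (g' [x'])) \<xi>) (sect g' [x'] \<circ> h')" by blast
  obtain w' where w': "w' \<in> Wt" "\<xi> = pt w'" using T0_pt[OF 1(1)] by blast
  have Xi: "xi_act (pt w) g \<in> Xi" "xi_act (pt w') g' \<in> Xi" using pt_Xi w w' g 1 G.act_in by auto
  obtain k where k: "k \<in> Gam" "xi_act (xi_act (pt w') g') k = xi_act (pt w) g"
    "([x'], h') = bimod_lact k ([x], h)"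
    using 1(4) G.tensor_class_eq_iff[OF Xi, of "([x], h)" 1 "([x'], h')"] h 1(3) unfolding w'(2) bimod_pair by auto
  obtain gi where gi: "gi \<in> Gam" "g \<circ> gi = id" "gi \<circ> g = id" using G.inv_ex[OF g] by blast
  \<comment> \<open>Two representatives of a class differ by this element. It fixes the point of
    \<open>T0\<close>, and by \<open>stab_Iw\<close> it has no effect on the image.\<close>
  define s where "s = g' \<circ> k \<circ> gi"
  have sG: "s \<in> Gam" unfolding s_def using G.comp_in 1(2) k(1) gi(1) by blast
  have g'k: "g' \<circ> k \<in> Gam" using G.comp_in 1(2) k(1) by blast
  have "xi_act (pt w') s = xi_act (xi_act (pt w) g) gi"
    unfolding s_def using G.act_comp[OF pt_Xi[OF w'(1)] g'k gi(1)] G.act_comp[OF pt_Xi[OF w'(1)] 1(2) k(1)] k(2) by simp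
  also have "\<dots> = pt w" by (rule G.act_inverse[OF pt_Xi[OF w] g gi(1,2)])
  finally have s: "w' = w" "s \<in> GS (fc w)" using pt_fundamental[OF w'(1) w sG] by blast+
  have sg: "s \<circ> g = g' \<circ> k" unfolding s_def by (simp add: comp_assoc gi(3))
  define y where "y = hd (g [x])"
  have y: "g [x] = [y]" unfolding y_def by (rule G.app_single[OF g])
  have kx: "k [x] = [x']" "h' = sect k [x] \<circ> h" using k(3) by (simp_all add: bimod_lact_def)
  have "hd (g' [x']) = hd (s [y])" using fun_cong[OF sg, of "[x]"] kx y by simp
  moreover have "sect g' [x'] \<circ> h' = sect s [y] \<circ> (sect g [x] \<circ> h)"
  proof -
    have "sect (s \<circ> g) [x] = sect (g' \<circ> k) [x]" using sg by simp
    then have "sect s [y] \<circ> sect g [x] = sect g' [x'] \<circ> sect k [x]"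
      using G.sect_comp[OF sG g, of "[x]"] G.sect_comp[OF 1(2) k(1), of "[x]"] kx y by simp
    then show ?thesis unfolding kx(2) by (metis comp_assoc)
  qed
  ultimately have "\<eta> = xi_act (pt (Iw y w)) (sect s [y] \<circ> (sect g [x] \<circ> h))"
    using 1(5) stab_Iw(1)[OF s(2), of y] unfolding w'(2) s(1) I_T0_pt[OF w] by simp
  also have "\<dots> = xi_act (xi_act (pt (Iw y w)) (sect s [y])) (sect g [x] \<circ> h)"
    by (rule G.act_comp[OF pt_Xi[OF Iw_Wt[OF w]] G.sect_in[OF sG] G.comp_in[OF G.sect_in[OF g] h]])
  also have "\<dots> = xi_act (pt (Iw y w)) (sect g [x] \<circ> h)"
    using pt_fixed[OF Iw_Wt[OF w] stab_Iw(2)[OF s(2)]] by simp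
  finally show "\<eta> = xi_act (pt (Iw (hd (g [x])) w)) (sect g [x] \<circ> h)" unfolding y_def .
qed

lemma I_map_single: "w \<in> Wt \<Longrightarrow> I_map (Xi_tensor 1 (pt w) ([x], id)) = pt (Iw x w)"
  using I_map_eq[of w id id x] G.id_in G.act_id[OF pt_Xi] Iw_Wt by simp

lemma I_map_Xi:
  assumes "\<xi> \<in> Xi" "h \<in> Gam"
  shows "I_map (Xi_tensor 1 \<xi> ([x], id)) \<in> Xi"
    "I_map (Xi_tensor 1 \<xi> ([x], h)) = xi_act (I_map (Xi_tensor 1 \<xi> ([x], id))) h"
proof -
  obtain w g where w: "w \<in> Wt" "g \<in> Gam" "\<xi> = xi_act (pt w) g" using Xi_rep[OF assms(1)] by blast
  have Xi: "pt (Iw (hd (g [x])) w) \<in> Xi" using pt_Xi Iw_Wt w(1) by blast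
  show "I_map (Xi_tensor 1 \<xi> ([x], id)) \<in> Xi"
    using I_map_eq[OF w(1,2) G.id_in, of x] G.act_in[OF Xi G.sect_in[OF w(2)]] unfolding w(3) by simp
  show "I_map (Xi_tensor 1 \<xi> ([x], h)) = xi_act (I_map (Xi_tensor 1 \<xi> ([x], id))) h"
    unfolding w(3) I_map_eq[OF w(1,2) G.id_in] I_map_eq[OF w(1,2) assms(2)]
    using G.act_comp[OF Xi G.sect_in[OF w(2)] assms(2)] by simp
qed

lemma I_n_eq:
  assumes \<xi>: "\<xi> \<in> Xi" and h: "h \<in> Gam" and v: "length v = n"
  shows "I_n n (Xi_tensor (Suc n) \<xi> (x # v, h)) = Xi_tensor n (I_map (Xi_tensor 1 \<xi> ([x], id))) (v, h)"
  unfolding I_n_def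
proof (rule the_equality)
  show "\<exists>\<xi>'\<in>Xi. \<exists>x' v' h'. (v', h') \<in> bimod Gam n \<and>
      Xi_tensor (Suc n) \<xi> (x # v, h) = Xi_tensor (Suc n) \<xi>' (x' # v', h') \<and>
      Xi_tensor n (I_map (Xi_tensor 1 \<xi> ([x], id))) (v, h) =
      Xi_tensor n (I_map (Xi_tensor 1 \<xi>' ([x'], id))) (v', h')"
    using \<xi> h v bimod_pair by blast
next
  fix s assume "\<exists>\<xi>'\<in>Xi. \<exists>x' v' h'. (v', h') \<in> bimod Gam n \<and>
      Xi_tensor (Suc n) \<xi> (x # v, h) = Xi_tensor (Suc n) \<xi>' (x' # v', h') \<and>
      s = Xi_tensor n (I_map (Xi_tensor 1 \<xi>' ([x'], id))) (v', h')"
  then obtain \<xi>' x' v' h' where 1: "\<xi>' \<in> Xi" "length v' = n" "h' \<in> Gam"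
    "Xi_tensor (Suc n) \<xi> (x # v, h) = Xi_tensor (Suc n) \<xi>' (x' # v', h')"
    "s = Xi_tensor n (I_map (Xi_tensor 1 \<xi>' ([x'], id))) (v', h')" unfolding bimod_pair by blast
  have "\<exists>g\<in>Gam. xi_act \<xi>' g = \<xi> \<and> (x' # v', h') = bimod_lact g (x # v, h)"
    using 1(4) G.tensor_class_eq_iff[OF \<xi> 1(1), of "(x # v, h)" "Suc n" "(x' # v', h')"] v h 1(2,3)
    unfolding bimod_pair by simp
  then obtain g where g: "g \<in> Gam" "xi_act \<xi>' g = \<xi>" "g (x # v) = x' # v'" "h' = sect g (x # v) \<circ> h"
    unfolding bimod_lact_def by auto
  have gx: "g [x] = [x']" "sect g [x] v = v'"
    using G.app_Cons[OF g(1), of x v] G.app_single[OF g(1), of x] g(3) by auto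
  have m: "([x], id) \<in> bimod Gam 1" using G.id_in by (simp add: bimod_pair)
  have "Xi_tensor 1 \<xi> ([x], id) = Xi_tensor 1 \<xi>' ([x'], sect g [x])"
    using G.tensor_class_act[OF 1(1) g(1) m] g(2) gx by (simp add: bimod_lact_def)
  then have I: "I_map (Xi_tensor 1 \<xi> ([x], id)) = xi_act (I_map (Xi_tensor 1 \<xi>' ([x'], id))) (sect g [x])"
    using I_map_Xi(2)[OF 1(1) G.sect_in[OF g(1)]] by simp
  have "(v, h) \<in> bimod Gam n" using v h by (simp add: bimod_pair)
  then have "Xi_tensor n (I_map (Xi_tensor 1 \<xi> ([x], id))) (v, h) =
      Xi_tensor n (I_map (Xi_tensor 1 \<xi>' ([x'], id))) (bimod_lact (sect g [x]) (v, h))"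
    unfolding I by (rule G.tensor_class_act[OF I_map_Xi(1)[OF 1(1) G.id_in] G.sect_in[OF g(1)]])
  also have "bimod_lact (sect g [x]) (v, h) = (v', h')"
    using gx(2) g(4) G.sect_Cons[OF g(1), of x v] by (simp add: bimod_lact_def)
  finally show "s = Xi_tensor n (I_map (Xi_tensor 1 \<xi> ([x], id))) (v, h)" unfolding 1(5) by (rule sym)
qed

lemma iota_eq:
  assumes w: "w \<in> Wt" and h: "h \<in> Gam" and v: "length v = n"
  shows "iota n (Mp (Suc n) (pt w) (x # v) h) = Mp n (pt (Iw x w)) v h"
  unfolding iota_def
proof (rule the_equality)
  have v': "length (x # v) = Suc n" using v by simp
  have I: "I_n n (Xi_tensor (Suc n) (pt w) (x # v, k)) = Xi_tensor n (pt (Iw x w)) (v, k)" if "k \<in> Gam" for k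
    using I_n_eq[OF pt_Xi[OF w] that v] I_map_single[OF w] by simp
  show "\<exists>t\<in>Xi_n (Suc n). Mp (Suc n) (pt w) (x # v) h = tensor_orbit IMG t \<and>
      Mp n (pt (Iw x w)) v h = tensor_orbit IMG (I_n n t)"
    using Xi_tensor_in[OF pt_Xi[OF w] h v'] I[OF h] by (intro bexI[of _ "Xi_tensor (Suc n) (pt w) (x # v, h)"]) simp_all
  fix m' assume "\<exists>t\<in>Xi_n (Suc n). Mp (Suc n) (pt w) (x # v) h = tensor_orbit IMG t \<and>
      m' = tensor_orbit IMG (I_n n t)"
  then obtain t where t: "t \<in> Xi_n (Suc n)" "Mp (Suc n) (pt w) (x # v) h = tensor_orbit IMG t"
    "m' = tensor_orbit IMG (I_n n t)" by blast
  obtain k where k: "k \<in> IMG" "t = Xi_tensor (Suc n) (pt w) (x # v, h \<circ> k)"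
    using Mp_class[OF pt_Xi[OF w] h v' t(1,2)] by blast
  have "h \<circ> k \<in> Gam" using h k(1) IMG_Gam G.comp_in by blast
  then have "m' = Mp n (pt (Iw x w)) v (h \<circ> k)" using t(3) k(2) I by simp
  then show "m' = Mp n (pt (Iw x w)) v h" using Mp_k[OF pt_Xi[OF Iw_Wt[OF w]] h v k(1)] by simp
qed

section \<open>The projection \<open>P\<close> in terms of weights\<close>

definition PP :: "(vertex \<Rightarrow> real) \<Rightarrow> real \<times> real" where
  "PP w = (w VA + w VA1, w VC + w VC1)"

lemma affine_ext_P: "w \<in> Wt \<Longrightarrow> affine_ext P_vert (EE w) = PP w"
  by (simp add: affine_ext_EE sum_vertex PP_def)

lemma PP_DD: "w \<in> Wt \<Longrightarrow> PP w \<in> DD"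
  by (auto simp: Wt_def PP_def DD_def all_vertex sum_vertex)

text \<open>\<open>PP w\<close> is a convex combination of corners, and every corner that occurs
  with nonzero weight is fixed by the isometry.\<close>

lemma stab_PP:
  assumes w: "w \<in> Wt" and g: "g \<in> GS (fc w)" "g \<in> Gam"
  shows "isom (nu g) (PP w) = PP w"
proof -
  have *: "w X \<noteq> 0 \<Longrightarrow> isom (nu g) (P_vert X) = P_vert X" for X
    using g stab_nu_fix unfolding GS_def fc_def by blast
  define a b c where "a = w VA + w VA1" and "b = w VB + w VB1" and "c = w VC + w VC1"
  have nn: "0 \<le> w X" for X using w by (simp add: Wt_def)
  have fa: "a *\<^sub>R isom (nu g) (1, 0) = a *\<^sub>R (1, 0)"
  proof (cases "a = 0")
    case False
    then have "w VA \<noteq> 0 \<or> w VA1 \<noteq> 0" by (auto simp: a_def)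
    then have "isom (nu g) (1, 0) = (1, 0)" using *[of VA] *[of VA1] by auto
    then show ?thesis by (simp only:)
  qed (simp add: zero_prod_def)
  have fb: "b *\<^sub>R isom (nu g) (0, 0) = b *\<^sub>R (0, 0)"
  proof (cases "b = 0")
    case False
    then have "w VB \<noteq> 0 \<or> w VB1 \<noteq> 0" by (auto simp: b_def)
    then have "isom (nu g) (0, 0) = (0, 0)" using *[of VB] *[of VB1] by auto
    then show ?thesis by (simp only:)
  qed (simp add: zero_prod_def)
  have fc: "c *\<^sub>R isom (nu g) (0, 1) = c *\<^sub>R (0, 1)"
  proof (cases "c = 0")
    case False
    then have "w VC \<noteq> 0 \<or> w VC1 \<noteq> 0" by (auto simp: c_def)
    then have "isom (nu g) (0, 1) = (0, 1)" using *[of VC] *[of VC1] by auto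
    then show ?thesis by (simp only:)
  qed (simp add: zero_prod_def)
  have s: "a + b + c = 1" using Wt_sum[OF w] by (simp add: a_def b_def c_def sum_vertex)
  have "isom (nu g) (a *\<^sub>R (1, 0) + b *\<^sub>R (0, 0) + c *\<^sub>R (0, 1)) =
      a *\<^sub>R isom (nu g) (1, 0) + b *\<^sub>R isom (nu g) (0, 0) + c *\<^sub>R isom (nu g) (0, 1)"
    by (rule W_comb[OF isom_W[OF nu_in[OF g(2)]] s])
  then show ?thesis unfolding fa fb fc by (simp add: PP_def a_def c_def)
qed

lemma P_map_eq:
  assumes w: "w \<in> Wt" and g: "g \<in> Gam"
  shows "P_map (xi_act (pt w) g) = isom (nu g) (PP w)"
  unfolding P_map_def
proof (rule the_equality)
  have val: "hat_act (affine_ext P_vert (emb (pt w))) (nu g) = isom (nu g) (PP w)" if "w \<in> Wt" "g \<in> Gam" for w g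
    using that by (simp add: emb_pt affine_ext_P hat_act_eq)
  show "\<exists>\<xi>\<in>T0. \<exists>ga\<in>Gam. xi_act (pt w) g = xi_act \<xi> ga \<and> isom (nu g) (PP w) = hat_act (affine_ext P_vert (emb \<xi>)) (nu ga)"
    using w g pt_T0 val[OF w g] by (intro bexI[of _ "pt w"] bexI[of _ g]) auto
  fix q assume "\<exists>\<xi>\<in>T0. \<exists>ga\<in>Gam. xi_act (pt w) g = xi_act \<xi> ga \<and> q = hat_act (affine_ext P_vert (emb \<xi>)) (nu ga)"
  then obtain \<xi> g' where 1: "\<xi> \<in> T0" "g' \<in> Gam" "xi_act (pt w) g = xi_act \<xi> g'"
    "q = hat_act (affine_ext P_vert (emb \<xi>)) (nu g')" by blast
  obtain w' where w': "w' \<in> Wt" "\<xi> = pt w'" using T0_pt[OF 1(1)] by blast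
  obtain gi where gi: "gi \<in> Gam" "g' \<circ> gi = id" "gi \<circ> g' = id" using G.inv_ex[OF 1(2)] by blast
  have s: "g \<circ> gi \<in> Gam" using g gi G.comp_in by blast
  have "xi_act (pt w) (g \<circ> gi) = pt w'"
    using G.act_comp[OF pt_Xi[OF w] g gi(1)] 1(3) w'(2) G.act_inverse[OF pt_Xi[OF w'(1)] 1(2) gi(1,2)] by simp
  then have eq: "w = w'" "g \<circ> gi \<in> GS (fc w)" using pt_fundamental[OF w w'(1) s] by auto
  have "isom (nu (g \<circ> gi)) (PP w) = PP w" by (rule stab_PP[OF w eq(2) s])
  moreover have "g = g \<circ> gi \<circ> g'" by (simp add: comp_assoc gi(3))
  ultimately have "isom (nu g) (PP w) = isom (nu g') (PP w)"
    using nu_comp[OF s 1(2)] isom_comp[OF nu_in[OF s] nu_in[OF 1(2)]] by (metis comp_apply)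
  then show "q = isom (nu g) (PP w)" using 1(4) val[OF w'(1) 1(2)] w'(2) eq(1) by simp
qed

lemma P_map_pt: "w \<in> Wt \<Longrightarrow> P_map (pt w) = PP w"
  using P_map_eq[of w id] G.id_in G.act_id[OF pt_Xi] by simp

lemma P_map_act:
  assumes "\<xi> \<in> Xi" "g \<in> Gam"
  shows "P_map (xi_act \<xi> g) = isom (nu g) (P_map \<xi>)"
proof -
  obtain w k where w: "w \<in> Wt" "k \<in> Gam" "\<xi> = xi_act (pt w) k" using Xi_rep[OF assms(1)] by blast
  have "P_map (xi_act \<xi> g) = isom (nu (k \<circ> g)) (PP w)"
    unfolding w(3) G.act_comp[OF pt_Xi[OF w(1)] w(2) assms(2), symmetric]
    by (rule P_map_eq[OF w(1) G.comp_in[OF w(2) assms(2)]])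
  then show ?thesis unfolding w(3) P_map_eq[OF w(1,2)] using w(2) assms(2) by (simp add: nu_comp isom_comp)
qed

lemma mu_bimod: "m \<in> bimod Gam n \<Longrightarrow> mu m \<in> bimod GamHat n"
  by (auto simp: bimod_def mu_def)

lemma mu_lact: "g \<in> Gam \<Longrightarrow> m \<in> bimod Gam n \<Longrightarrow> mu (bimod_lact g m) = bimod_lact (nu g) (mu m)"
  by (auto simp: bimod_def mu_def bimod_lact_def mu_app nu_comp nu_sect G.sect_in)

lemma P_n_eq:
  assumes \<xi>: "\<xi> \<in> Xi" and m: "m \<in> bimod Gam n"
  shows "P_n n (Xi_tensor n \<xi> m) = XiHat_tensor n (P_map \<xi>) (mu m)"
  unfolding P_n_def
proof (rule the_equality)
  fix s assume "\<exists>\<xi>'\<in>Xi. \<exists>m'\<in>bimod Gam n. Xi_tensor n \<xi> m = Xi_tensor n \<xi>' m' \<and> s = XiHat_tensor n (P_map \<xi>') (mu m')"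
  then obtain \<xi>' m' where 1: "\<xi>' \<in> Xi" "m' \<in> bimod Gam n" "Xi_tensor n \<xi> m = Xi_tensor n \<xi>' m'"
    "s = XiHat_tensor n (P_map \<xi>') (mu m')" by blast
  obtain g where g: "g \<in> Gam" "xi_act \<xi>' g = \<xi>" "m' = bimod_lact g m"
    using 1(3) G.tensor_class_eq_iff[OF \<xi> 1(1) m 1(2)] by blast
  have "XiHat_tensor n (P_map \<xi>) (mu m) = XiHat_tensor n (hat_act (P_map \<xi>') (nu g)) (mu m)"
    using P_map_act[OF 1(1) g(1)] g(2) hat_act_eq[OF nu_in[OF g(1)]] by simp
  also have "\<dots> = XiHat_tensor n (P_map \<xi>') (bimod_lact (nu g) (mu m))"
    by (rule hat.tensor_class_act[OF UNIV_I nu_in[OF g(1)] mu_bimod[OF m]])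
  finally show "s = XiHat_tensor n (P_map \<xi>) (mu m)" using 1(4) mu_lact[OF g(1) m] g(3) by simp
qed (use \<xi> m in blast)

lemma rho_eq:
  assumes \<xi>: "\<xi> \<in> Xi" and h: "h \<in> Gam" and v: "length v = n"
  shows "rho n (Mp n \<xi> v h) = Sp n (P_map \<xi>) (map mu_letter v) (nu h)"
  unfolding rho_def
proof (rule the_equality)
  have P: "P_n n (Xi_tensor n \<xi> (v, k)) = XiHat_tensor n (P_map \<xi>) (map mu_letter v, nu k)" if "k \<in> Gam" for k
    using P_n_eq[OF \<xi>, of "(v, k)" n] that v by (simp add: bimod_pair mu_def)
  show "\<exists>t\<in>Xi_n n. Mp n \<xi> v h = tensor_orbit IMG t \<and>
      Sp n (P_map \<xi>) (map mu_letter v) (nu h) = tensor_orbit (nu ` IMG) (P_n n t)"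
    using Xi_tensor_in[OF \<xi> h v] P[OF h] by (intro bexI[of _ "Xi_tensor n \<xi> (v, h)"]) simp_all
  fix s assume "\<exists>t\<in>Xi_n n. Mp n \<xi> v h = tensor_orbit IMG t \<and> s = tensor_orbit (nu ` IMG) (P_n n t)"
  then obtain t where t: "t \<in> Xi_n n" "Mp n \<xi> v h = tensor_orbit IMG t" "s = tensor_orbit (nu ` IMG) (P_n n t)" by blast
  obtain k where k: "k \<in> IMG" "t = Xi_tensor n \<xi> (v, h \<circ> k)" using Mp_class[OF \<xi> h v t(1,2)] by blast
  have kG: "k \<in> Gam" using k(1) IMG_Gam by blast
  have "s = Sp n (P_map \<xi>) (map mu_letter v) (nu h \<circ> nu k)"
    using t(3) k(2) P[OF G.comp_in[OF h kG]] nu_comp[OF h kG] by simp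
  then show "s = Sp n (P_map \<xi>) (map mu_letter v) (nu h)"
    using Sp_k[of "nu h" "map mu_letter v" n "nu k"] h v k(1) by simp
qed

text \<open>The compatibility of \<open>I\<close> with \<open>P\<close>, and the origin of the
  formula for \<open>LL\<close>.\<close>

lemma PP_Iw: "w \<in> Wt \<Longrightarrow> PP (Iw x w) = LL (mu_letter x) (PP w)"
proof -
  assume "w \<in> Wt"
  then have "w VB = 1 - w VA - w VC - w VA1 - w VB1 - w VC1" using Wt_sum[of w] by (simp add: sum_vertex)
  then show ?thesis
    by (cases x) (simp_all add: PP_def Iw_def sum_vertex bw_def LL_def field_simps)
qed

lemma P_I_map:
  assumes \<xi>: "\<xi> \<in> Xi" and h: "h \<in> Gam"
  shows "P_map (I_map (Xi_tensor 1 \<xi> ([x], h))) = isom (nu h) (LL (mu_letter x) (P_map \<xi>))"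
proof -
  obtain w g where w: "w \<in> Wt" "g \<in> Gam" "\<xi> = xi_act (pt w) g" using Xi_rep[OF \<xi>] by blast
  define y where "y = hd (g [x])"
  have "P_map (I_map (Xi_tensor 1 \<xi> ([x], h))) = isom (nu (sect g [x] \<circ> h)) (PP (Iw y w))"
    unfolding w(3) I_map_eq[OF w(1,2) h] y_def
    by (rule P_map_eq[OF Iw_Wt[OF w(1)] G.comp_in[OF G.sect_in[OF w(2)] h]])
  also have "\<dots> = isom (nu h) (isom (sect (nu g) [mu_letter x]) (LL (mu_letter y) (PP w)))"
    using w(2) h nu_sect[OF w(2), of "[x]"] G.sect_in[OF w(2), of "[x]"]
    by (simp add: nu_comp isom_comp PP_Iw[OF w(1)] hat.sect_in)
  also have "mu_letter y = hd (nu g [mu_letter x])"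
    using mu_app[OF w(2), of "[x]"] G.app_single[OF w(2), of x] unfolding y_def by (metis list.map(1,2) list.sel(1))
  also have "isom (sect (nu g) [mu_letter x]) (LL (hd (nu g [mu_letter x])) (PP w)) = LL (mu_letter x) (isom (nu g) (PP w))"
    using isom_sect[OF nu_in[OF w(2)]] by simp
  finally show ?thesis unfolding w(3) P_map_eq[OF w(1,2)] .
qed

section \<open>The maps \<open>L\<close> and \<open>lam\<close> in coordinates\<close>

definition bary :: "real \<times> real \<Rightarrow> vertex \<Rightarrow> real" where
  "bary = (\<lambda>(p, q) X. case X of VA \<Rightarrow> p | VB \<Rightarrow> 1 - p - q | VC \<Rightarrow> q | _ \<Rightarrow> 0)"

lemma bary_Wt: "y \<in> DD \<Longrightarrow> bary y \<in> Wt \<and> PP (bary y) = y"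
  by (cases y) (auto simp: Wt_def DD_def bary_def all_vertex sum_vertex PP_def tetrahedra_def)

lemma P_map_surj: "\<exists>\<xi>\<in>Xi. P_map \<xi> = y"
proof -
  obtain g where g: "g \<in> GamHat" "isom g y \<in> DD" using hat_cover by blast
  obtain g' where g': "g' \<in> GamHat" "g \<circ> g' = id" using hat.inv_ex[OF g(1)] by blast
  obtain k where k: "k \<in> Gam" "nu k = g'" using nu_surj[OF g'(1)] by blast
  note b = bary_Wt[OF g(2)]
  have "isom g' (isom g y) = y" using isom_comp[OF g(1) g'(1)] g'(2) by (metis comp_apply id_apply isom_id)
  then have "P_map (xi_act (pt (bary (isom g y))) k) = y" using P_map_eq[OF conjunct1[OF b] k(1)] b k(2) by simp
  then show ?thesis using G.act_in[OF pt_Xi[OF conjunct1[OF b]] k(1)] by blast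
qed

lemma L_map_eq:
  assumes k: "k \<in> GamHat"
  shows "L_map (XiHat_tensor 1 y ([x], k)) = isom k (LL x y)"
  unfolding L_map_def
proof (rule the_equality)
  obtain \<xi> where \<xi>: "\<xi> \<in> Xi" "P_map \<xi> = y" using P_map_surj by blast
  obtain h where h: "h \<in> Gam" "nu h = k" using nu_surj[OF k] by blast
  obtain x' where x': "mu_letter x' = x" using mu_letter_surj by blast
  show "\<exists>\<xi>\<in>Xi. \<exists>m\<in>bimod Gam 1. XiHat_tensor 1 y ([x], k) = XiHat_tensor 1 (P_map \<xi>) (mu m) \<and>
      isom k (LL x y) = P_map (I_map (Xi_tensor 1 \<xi> m))"
    using \<xi> h x' P_I_map[OF \<xi>(1) h(1), of x']
    by (intro bexI[of _ \<xi>] bexI[of _ "([x'], h)"]) (auto simp: mu_def bimod_pair)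
  fix q assume "\<exists>\<xi>\<in>Xi. \<exists>m\<in>bimod Gam 1. XiHat_tensor 1 y ([x], k) = XiHat_tensor 1 (P_map \<xi>) (mu m) \<and>
      q = P_map (I_map (Xi_tensor 1 \<xi> m))"
  then obtain \<xi>' m where 1: "\<xi>' \<in> Xi" "m \<in> bimod Gam 1" "XiHat_tensor 1 y ([x], k) = XiHat_tensor 1 (P_map \<xi>') (mu m)"
    "q = P_map (I_map (Xi_tensor 1 \<xi>' m))" by blast
  obtain z h' where m: "m = ([z], h')" "h' \<in> Gam" using 1(2) by (auto simp: bimod_def length_Suc_conv)
  have q: "q = isom (nu h') (LL (mu_letter z) (P_map \<xi>'))" using 1(4) P_I_map[OF 1(1) m(2)] m(1) by simp
  have "([x], k) \<in> bimod GamHat 1" "mu m \<in> bimod GamHat 1" using k mu_bimod[OF 1(2)] by (simp_all add: bimod_pair)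
  then obtain g where g: "g \<in> GamHat" "hat_act (P_map \<xi>') g = y" "mu m = bimod_lact g ([x], k)"
    using 1(3) hat.tensor_class_eq_iff[OF UNIV_I UNIV_I, of "([x], k)" 1 "mu m" y "P_map \<xi>'"] by blast
  have g': "[mu_letter z] = g [x]" "nu h' = sect g [x] \<circ> k" "isom g (P_map \<xi>') = y"
    using g m by (simp_all add: mu_def bimod_lact_def hat_act_eq)
  have "isom k (LL x y) = isom k (isom (sect g [x]) (LL (hd (g [x])) (P_map \<xi>')))"
    using isom_sect[OF g(1), of x "P_map \<xi>'"] g'(3) by simp
  also have "\<dots> = isom (nu h') (LL (mu_letter z) (P_map \<xi>'))"
    using g'(1)[symmetric] g'(2) isom_comp[OF hat.sect_in[OF g(1)] k] by simp
  finally show "q = isom k (LL x y)" using q by simp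
qed

lemma L_n_eq:
  assumes h: "h \<in> GamHat" and u: "length u = n"
  shows "L_n n (XiHat_tensor (Suc n) y (x # u, h)) = XiHat_tensor n (LL x y) (u, h)"
  unfolding L_n_def
proof (rule the_equality)
  have L: "L_map (XiHat_tensor 1 y ([x], id)) = LL x y" for x y using L_map_eq[OF hat.id_in] by simp
  show "\<exists>\<zeta> x' v h'. (v, h') \<in> bimod GamHat n \<and>
      XiHat_tensor (Suc n) y (x # u, h) = XiHat_tensor (Suc n) \<zeta> (x' # v, h') \<and>
      XiHat_tensor n (LL x y) (u, h) = XiHat_tensor n (L_map (XiHat_tensor 1 \<zeta> ([x'], id))) (v, h')"
    using h u L[of y x] bimod_pair by metis
  fix s assume "\<exists>\<zeta> x' v h'. (v, h') \<in> bimod GamHat n \<and>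
      XiHat_tensor (Suc n) y (x # u, h) = XiHat_tensor (Suc n) \<zeta> (x' # v, h') \<and>
      s = XiHat_tensor n (L_map (XiHat_tensor 1 \<zeta> ([x'], id))) (v, h')"
  then obtain \<zeta> x' v h' where 1: "length v = n" "h' \<in> GamHat"
    "XiHat_tensor (Suc n) y (x # u, h) = XiHat_tensor (Suc n) \<zeta> (x' # v, h')"
    "s = XiHat_tensor n (LL x' \<zeta>) (v, h')" unfolding L bimod_pair by blast
  have "\<exists>g\<in>GamHat. hat_act \<zeta> g = y \<and> (x' # v, h') = bimod_lact g (x # u, h)"
    using 1(3) hat.tensor_class_eq_iff[OF UNIV_I UNIV_I, of "(x # u, h)" "Suc n" "(x' # v, h')" y \<zeta>] h u 1(1,2)
    unfolding bimod_pair by simp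
  then obtain g where g: "g \<in> GamHat" "isom g \<zeta> = y" "g (x # u) = x' # v" "h' = sect g (x # u) \<circ> h"
    by (auto simp: hat_act_eq bimod_lact_def)
  have gx: "hd (g [x]) = x'" "sect g [x] u = v" using hat.app_Cons[OF g(1), of x u] g(3) by auto
  have "XiHat_tensor n (LL x y) (u, h) = XiHat_tensor n (hat_act (LL x' \<zeta>) (sect g [x])) (u, h)"
    using isom_sect[OF g(1), of x \<zeta>] g(2) gx(1) hat_act_eq[OF hat.sect_in[OF g(1)]] by simp
  also have "\<dots> = XiHat_tensor n (LL x' \<zeta>) (bimod_lact (sect g [x]) (u, h))"
    by (rule hat.tensor_class_act[OF UNIV_I hat.sect_in[OF g(1)]]) (use h u in \<open>simp add: bimod_pair\<close>)
  also have "bimod_lact (sect g [x]) (u, h) = (v, h')"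
    using gx(2) g(4) hat.sect_Cons[OF g(1), of x u] by (simp add: bimod_lact_def)
  finally show "s = XiHat_tensor n (LL x y) (u, h)" using 1(4) by simp
qed

lemma lam_eq:
  assumes h: "h \<in> GamHat" and u: "length u = n"
  shows "lam n (Sp (Suc n) y (x # u) h) = Sp n (LL x y) u h"
  unfolding lam_def
proof (rule the_equality)
  have u': "length (x # u) = Suc n" using u by simp
  show "\<exists>t\<in>XiHat_n (Suc n). Sp (Suc n) y (x # u) h = tensor_orbit (nu ` IMG) t \<and>
      Sp n (LL x y) u h = tensor_orbit (nu ` IMG) (L_n n t)"
    using XiHat_tensor_in[OF h u'] L_n_eq[OF h u] by (intro bexI[of _ "XiHat_tensor (Suc n) y (x # u, h)"]) simp_all
  fix s assume "\<exists>t\<in>XiHat_n (Suc n). Sp (Suc n) y (x # u) h = tensor_orbit (nu ` IMG) t \<and>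
      s = tensor_orbit (nu ` IMG) (L_n n t)"
  then obtain t where t: "t \<in> XiHat_n (Suc n)" "Sp (Suc n) y (x # u) h = tensor_orbit (nu ` IMG) t"
    "s = tensor_orbit (nu ` IMG) (L_n n t)" by blast
  obtain k where k: "k \<in> nu ` IMG" "t = XiHat_tensor (Suc n) y (x # u, h \<circ> k)" using Sp_class[OF h u' t(1,2)] by blast
  have "h \<circ> k \<in> GamHat" using h k(1) K_Gam hat.comp_in by blast
  then have "s = Sp n (LL x y) u (h \<circ> k)" using t(3) k(2) L_n_eq u by simp
  then show "s = Sp n (LL x y) u h" using Sp_k[OF h u k(1)] by simp
qed

text \<open>An identification at level n lifts: by \<open>hat_recurrent\<close> its group element is
  the section of one that sends \<open>x\<close> to \<open>x'\<close>, and injectivity of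
  \<open>LL x\<close> identifies the base points.\<close>

lemma lam_inj:
  assumes "k \<in> GamHat" "k' \<in> GamHat" "length u = n" "length u' = n"
    and "Sp n (LL x y) u k = Sp n (LL x' y') u' k'"
  shows "Sp (Suc n) y (x # u) k = Sp (Suc n) y' (x' # u') k'"
proof -
  obtain g j where g: "g \<in> GamHat" "j \<in> nu ` IMG" "isom g (LL x' y') = LL x y" "u' = g u" "k' = sect g u \<circ> k \<circ> j"
    using assms(5) unfolding Sp_eq_iff[OF assms(1-4)] by blast
  obtain l where l: "l \<in> GamHat" "l [x] = [x']" "sect l [x] = g" using hat_recurrent[OF g(1)] by blast
  have "LL x (isom l y') = LL x y" using isom_sect[OF l(1), of x y'] l(2,3) g(3) by simp
  then have ly: "isom l y' = y" by (rule LL_inj)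
  have lu: "l (x # u) = x' # u'" using hat.app_Cons[OF l(1), of x u] l(2,3) g(4) by simp
  have ls: "sect l (x # u) = sect g u" using hat.sect_Cons[OF l(1), of x u] l(3) by simp
  have len: "length (x # u) = Suc n" "length (x' # u') = Suc n" using assms(3,4) by auto
  have "\<exists>g\<in>GamHat. \<exists>j\<in>nu ` IMG. isom g y' = y \<and> x' # u' = g (x # u) \<and> k' = sect g (x # u) \<circ> k \<circ> j"
    by (rule bexI[OF _ l(1)], rule bexI[OF _ g(2)]) (simp only: ly lu ls g(5) simp_thms)
  then show ?thesis by (rule Sp_eq_iff[OF assms(1,2) len, THEN iffD2])
qed

section \<open>Gluing marked trees\<close>

definition mt :: "'a mtree \<Rightarrow> bool" where
  "mt T \<longleftrightarrow> {Zal T, Zbe T, Zga T} \<subseteq> pts T \<and>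
     (\<forall>p\<in>pts T. tdist T p p = 0) \<and>
     (\<forall>p\<in>pts T. \<forall>q\<in>pts T. 0 \<le> tdist T p q \<and> tdist T p q = tdist T q p) \<and>
     (\<forall>p\<in>pts T. \<forall>q\<in>pts T. \<forall>r\<in>pts T. tdist T p r \<le> tdist T p q + tdist T q r)"

lemma mt_D:
  assumes "mt T"
  shows "Zal T \<in> pts T" "Zbe T \<in> pts T" "Zga T \<in> pts T" "p \<in> pts T \<Longrightarrow> tdist T p p = 0"
    "p \<in> pts T \<Longrightarrow> q \<in> pts T \<Longrightarrow> 0 \<le> tdist T p q"
    "p \<in> pts T \<Longrightarrow> q \<in> pts T \<Longrightarrow> tdist T p q = tdist T q p"
    "p \<in> pts T \<Longrightarrow> q \<in> pts T \<Longrightarrow> r \<in> pts T \<Longrightarrow> tdist T p r \<le> tdist T p q + tdist T q r"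
  using assms unfolding mt_def by blast+

lemma glue_copy_eq: "glue_copy T i p = glue_copy T j q \<longleftrightarrow> p = q \<and> (i = j \<or> p = Zal T)"
  by (cases p; cases q) (auto simp: glue_copy_def)

lemma Phi_simps:
  "pts (Phi k T) = glue_copy T One ` pts T \<union> glue_copy T Two ` pts T"
  "Zal (Phi k T) = glue_copy T One (Zbe T)" "Zbe (Phi k T) = glue_copy T k (Zga T)"
  "Zga (Phi k T) = glue_copy T Two (Zbe T)"
  by (simp_all add: Phi_def)

lemma pts_Phi: "x \<in> pts (Phi k T) \<longleftrightarrow> (\<exists>i. \<exists>p\<in>pts T. x = glue_copy T i p)"
proof
  assume "x \<in> pts (Phi k T)"
  then show "\<exists>i. \<exists>p\<in>pts T. x = glue_copy T i p" unfolding Phi_simps by blast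
next
  assume "\<exists>i. \<exists>p\<in>pts T. x = glue_copy T i p"
  then obtain i p where "p \<in> pts T" "x = glue_copy T i p" by blast
  then show "x \<in> pts (Phi k T)" unfolding Phi_simps by (cases i) simp_all
qed

lemma tdist_Phi:
  assumes "mt T" "p \<in> pts T" "q \<in> pts T"
  shows "tdist (Phi k T) (glue_copy T i p) (glue_copy T j q) =
    (if i = j then tdist T p q else tdist T p (Zal T) + tdist T (Zal T) q)"
proof -
  \<comment> \<open>The point \<open>Zal T\<close> always carries the letter \<open>One\<close>, so
    different copies may end up with equal letters and conversely. Both formulas agree there because
    \<open>Zal T\<close> has distance zero to itself.\<close>
  have "tdist (Phi k T) (glue_copy T i p) (glue_copy T j q) =
    (if (if p = Zal T then One else i) = (if q = Zal T then One else j) then tdist T p q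
     else tdist T p (Zal T) + tdist T (Zal T) q)"
    by (simp add: Phi_def glue_copy_def)
  moreover have "tdist T (Zal T) (Zal T) = 0" using mt_D(1,4)[OF assms(1)] by blast
  ultimately show ?thesis by (cases i; cases j; cases "p = Zal T"; cases "q = Zal T") simp_all
qed

lemma mt_Phi:
  assumes T: "mt T"
  shows "mt (Phi k T)"
proof -
  note D = mt_D[OF T]
  have dist: "tdist (Phi k T) (glue_copy T i p) (glue_copy T j q) =
    (if i = j then tdist T p q else tdist T p (Zal T) + tdist T (Zal T) q)"
    if "p \<in> pts T" "q \<in> pts T" for i j p q using tdist_Phi[OF T that] .
  have tri: "tdist (Phi k T) (glue_copy T i p) (glue_copy T l r) \<le>
      tdist (Phi k T) (glue_copy T i p) (glue_copy T j q) + tdist (Phi k T) (glue_copy T j q) (glue_copy T l r)"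
    if "p \<in> pts T" "q \<in> pts T" "r \<in> pts T" for i j l p q r
  proof -
    have "tdist T p r \<le> tdist T p q + tdist T q r" "tdist T p r \<le> tdist T p (Zal T) + tdist T (Zal T) r"
      "tdist T p (Zal T) \<le> tdist T p q + tdist T q (Zal T)" "tdist T (Zal T) r \<le> tdist T (Zal T) q + tdist T q r"
      "0 \<le> tdist T (Zal T) q" "0 \<le> tdist T q (Zal T)" "tdist T q (Zal T) = tdist T (Zal T) q"
      using D that by blast+
    then show ?thesis using that by (cases i; cases j; cases l) (simp_all add: dist)
  qed
  have "{Zal (Phi k T), Zbe (Phi k T), Zga (Phi k T)} \<subseteq> pts (Phi k T)"
    using D(1-3) unfolding pts_Phi Phi_simps(2-4) by (auto simp: pts_Phi)
  moreover have "tdist (Phi k T) x x = 0" if "x \<in> pts (Phi k T)" for x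
    using that D(4) dist unfolding pts_Phi by force
  moreover have "0 \<le> tdist (Phi k T) x y \<and> tdist (Phi k T) x y = tdist (Phi k T) y x"
    if xy: "x \<in> pts (Phi k T)" "y \<in> pts (Phi k T)" for x y
  proof -
    obtain i p where x: "p \<in> pts T" "x = glue_copy T i p" using xy(1) unfolding pts_Phi by blast
    obtain j q where y: "q \<in> pts T" "y = glue_copy T j q" using xy(2) unfolding pts_Phi by blast
    have "tdist T p q = tdist T q p" "tdist T p (Zal T) = tdist T (Zal T) p" "tdist T q (Zal T) = tdist T (Zal T) q"
      "0 \<le> tdist T p q" "0 \<le> tdist T p (Zal T)" "0 \<le> tdist T (Zal T) q"
      using D x(1) y(1) by blast+
    then show ?thesis unfolding x(2) y(2) using x(1) y(1) by (simp add: dist)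
  qed
  moreover have "tdist (Phi k T) x z \<le> tdist (Phi k T) x y + tdist (Phi k T) y z"
    if "x \<in> pts (Phi k T)" "y \<in> pts (Phi k T)" "z \<in> pts (Phi k T)" for x y z
    using that tri unfolding pts_Phi by blast
  ultimately show ?thesis unfolding mt_def by blast
qed

lemma mt_foldr: "mt T \<Longrightarrow> mt (foldr Phi ks T)"
  by (induction ks) (simp_all add: mt_Phi)

lemma pts_foldr:
  "x \<in> pts (foldr Phi ks T) \<longleftrightarrow> (\<exists>t p. length t = length ks \<and> p \<in> pts T \<and> x = copy_emb ks T t p)"
proof (induction ks arbitrary: x)
  case Nil
  show ?case by (cases x) simp
next
  case (Cons k ks)
  have "x \<in> pts (foldr Phi (k # ks) T) \<longleftrightarrow>
      (\<exists>i t p. length t = length ks \<and> p \<in> pts T \<and> x = glue_copy (foldr Phi ks T) i (copy_emb ks T t p))"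
    unfolding foldr_Cons comp_apply pts_Phi Bex_def Cons by blast
  also have "\<dots> \<longleftrightarrow> (\<exists>t p. length t = length (k # ks) \<and> p \<in> pts T \<and> x = copy_emb (k # ks) T t p)"
  proof
    assume "\<exists>i t p. length t = length ks \<and> p \<in> pts T \<and> x = glue_copy (foldr Phi ks T) i (copy_emb ks T t p)"
    then obtain i t p where "length t = length ks" "p \<in> pts T" "x = glue_copy (foldr Phi ks T) i (copy_emb ks T t p)" by blast
    then show "\<exists>t p. length t = length (k # ks) \<and> p \<in> pts T \<and> x = copy_emb (k # ks) T t p"
      by (intro exI[of _ "i # t"] exI[of _ p]) simp
  next
    assume "\<exists>t p. length t = length (k # ks) \<and> p \<in> pts T \<and> x = copy_emb (k # ks) T t p"
    then obtain t p where "length t = length (k # ks)" "p \<in> pts T" "x = copy_emb (k # ks) T t p" by blast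
    then show "\<exists>i t p. length t = length ks \<and> p \<in> pts T \<and> x = glue_copy (foldr Phi ks T) i (copy_emb ks T t p)"
      by (intro exI[of _ "hd t"] exI[of _ "tl t"] exI[of _ p]) simp
  qed
  finally show ?case .
qed

lemma copy_emb_in: "length t = length ks \<Longrightarrow> p \<in> pts T \<Longrightarrow> copy_emb ks T t p \<in> pts (foldr Phi ks T)"
  using pts_foldr by blast

lemma copy_emb_dist:
  assumes "mt T" "p \<in> pts T" "q \<in> pts T" "length t = length ks"
  shows "tdist (foldr Phi ks T) (copy_emb ks T t p) (copy_emb ks T t q) = tdist T p q"
  using assms(4)
proof (induction ks arbitrary: t)
  case (Cons k ks)
  have "length (tl t) = length ks" using Cons(2) by simp
  then show ?case
    using Cons(1)[of "tl t"] tdist_Phi[OF mt_foldr[OF assms(1)] copy_emb_in[OF _ assms(2)] copy_emb_in[OF _ assms(3)], of "tl t" ks "tl t"]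
    by simp
qed simp

text \<open>\<open>copy_emb\<close> peels off the outermost operation. This form peels off the
  innermost one, which is where level n + 1 differs from level n.\<close>

lemma copy_emb_snoc:
  "length t = length ks \<Longrightarrow>
    copy_emb (ks @ [k]) T (t @ [s]) p = copy_emb ks (Phi k T) t (glue_copy T s p)"
proof (induction ks arbitrary: t)
  case (Cons j ks)
  then obtain i t' where "t = i # t'" "length t' = length ks" by (cases t) auto
  then show ?case using Cons(1)[of t'] by simp
qed simp

text \<open>Indices of copies are read from the innermost letter outwards here: \<open>fA\<close>, \<open>fB\<close>, \<open>fC\<close> exchange the copies
  that share the point \<open>Zal\<close>, \<open>Zbe\<close>, \<open>Zga\<close>, respectively.\<close>

fun fA :: "bin list \<Rightarrow> bin list" where
  "fA [] = []"
| "fA (s # t) = swap s # t"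

fun fB :: "bin list \<Rightarrow> bin list \<Rightarrow> bin list" and fC :: "bin list \<Rightarrow> bin list \<Rightarrow> bin list" where
  "fB (k # u) (s # t) = s # (if s = One then fA t else fC u t)"
| "fB _ t = t"
| "fC (k # u) (s # t) = s # (if s = k then fB u t else t)"
| "fC _ t = t"

text \<open>One elementary identification of the points \<open>p\<close> in the copies
  \<open>t\<close> and \<open>t'\<close>. Its reflexive transitive closure decides when two copies
  share that point (\<open>copy_emb_eq_iff\<close>).\<close>

definition gstep :: "bin list \<Rightarrow> (bin list \<times> 'a) mtree \<Rightarrow> bin list \<times> 'a \<Rightarrow> bin list \<Rightarrow> bin list \<Rightarrow> bool" where
  "gstep u T p t t' \<longleftrightarrow> p = Zal T \<and> t' = fA t \<or> p = Zbe T \<and> t' = fB u t \<or> p = Zga T \<and> t' = fC u t"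

text \<open>The mark used one level up may come from the other copy when \<open>p\<close> is
  \<open>Zal T\<close>. The path then switches to that copy by \<open>fA\<close>, makes the step and
  switches back.\<close>

lemma gstep_lift:
  assumes "gstep u (Phi k T) (glue_copy T s p) t t'"
  shows "(gstep (k # u) T p)\<^sup>*\<^sup>* (s # t) (s # t')"
proof -
  let ?R = "(gstep (k # u) T p)\<^sup>*\<^sup>*"
  have sw: "?R (s # t) (s' # t)" if "s = s' \<or> p = Zal T" for s s' t
  proof (cases "s = s'")
    case False
    then have "s' = swap s" by (cases s; cases s') auto
    then have "gstep (k # u) T p (s # t) (s' # t)" using that False by (simp add: gstep_def)
    then show ?thesis by blast
  qed simp
  have via: "?R (s # t) (s # t')" if "s = s' \<or> p = Zal T" "gstep (k # u) T p (s' # t) (s' # t')" for s'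
  proof -
    have "?R (s # t) (s' # t)" "?R (s' # t') (s # t')" using sw that(1) by blast+
    then show ?thesis using that(2) by (meson rtranclp.rtrancl_into_rtrancl rtranclp_trans)
  qed
  from assms consider "glue_copy T s p = glue_copy T One (Zbe T)" "t' = fA t"
    | "glue_copy T s p = glue_copy T k (Zga T)" "t' = fB u t"
    | "glue_copy T s p = glue_copy T Two (Zbe T)" "t' = fC u t"
    unfolding gstep_def Phi_simps(2-4) by blast
  then show ?thesis
  proof cases
    case 1
    then show ?thesis by (intro via[of One]) (auto simp: glue_copy_eq gstep_def)
  next
    case 2
    then show ?thesis by (intro via[of k]) (auto simp: glue_copy_eq gstep_def)
  next
    case 3
    then show ?thesis by (intro via[of Two]) (auto simp: glue_copy_eq gstep_def)
  qed
qed

lemma gstep_lower: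
  assumes "gstep (k # u) T p (s # t) x"
  shows "\<exists>s' t'. x = s' # t' \<and> glue_copy T s p = glue_copy T s' p \<and>
    (gstep u (Phi k T) (glue_copy T s p))\<^sup>*\<^sup>* t t'"
proof -
  from assms consider "p = Zal T" "x = fA (s # t)" | "p = Zbe T" "x = fB (k # u) (s # t)" | "p = Zga T" "x = fC (k # u) (s # t)"
    unfolding gstep_def by blast
  then show ?thesis
  proof cases
    case 1
    then show ?thesis by (auto simp: glue_copy_eq)
  next
    case 2
    have "gstep u (Phi k T) (glue_copy T s p) t (if s = One then fA t else fC u t)"
      using 2(1) by (cases s) (simp_all add: gstep_def Phi_simps)
    then show ?thesis using 2(2) by auto
  next
    case 3
    have "(gstep u (Phi k T) (glue_copy T s p))\<^sup>*\<^sup>* t (if s = k then fB u t else t)"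
    proof (cases "s = k")
      case True
      then have "gstep u (Phi k T) (glue_copy T s p) t (fB u t)" using 3(1) by (simp add: gstep_def Phi_simps)
      then show ?thesis using True by auto
    qed simp
    then show ?thesis using 3(2) by auto
  qed
qed

lemma gstep_cons_iff:
  "(gstep (k # u) T p)\<^sup>*\<^sup>* (s # t) (s' # t') \<longleftrightarrow>
    glue_copy T s p = glue_copy T s' p \<and> (gstep u (Phi k T) (glue_copy T s p))\<^sup>*\<^sup>* t t'"
proof
  assume "(gstep (k # u) T p)\<^sup>*\<^sup>* (s # t) (s' # t')"
  then have "\<exists>s1 t1. s' # t' = s1 # t1 \<and> glue_copy T s p = glue_copy T s1 p \<and>
      (gstep u (Phi k T) (glue_copy T s p))\<^sup>*\<^sup>* t t1"
  proof (induction rule: rtranclp_induct)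
    case base
    show ?case by blast
  next
    case (step y z)
    obtain s1 t1 where 1: "y = s1 # t1" "glue_copy T s p = glue_copy T s1 p"
      "(gstep u (Phi k T) (glue_copy T s p))\<^sup>*\<^sup>* t t1" using step(3) by blast
    obtain s2 t2 where 2: "z = s2 # t2" "glue_copy T s1 p = glue_copy T s2 p"
      "(gstep u (Phi k T) (glue_copy T s1 p))\<^sup>*\<^sup>* t1 t2" using gstep_lower step(2) unfolding 1(1) by blast
    have "(gstep u (Phi k T) (glue_copy T s p))\<^sup>*\<^sup>* t t2"
      using 1(3) 2(3) unfolding 1(2)[symmetric] by (rule rtranclp_trans)
    then show ?case using 1(2) 2(1,2) by simp
  qed
  then show "glue_copy T s p = glue_copy T s' p \<and> (gstep u (Phi k T) (glue_copy T s p))\<^sup>*\<^sup>* t t'" by blast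
next
  assume *: "glue_copy T s p = glue_copy T s' p \<and> (gstep u (Phi k T) (glue_copy T s p))\<^sup>*\<^sup>* t t'"
  then have "(gstep u (Phi k T) (glue_copy T s p))\<^sup>*\<^sup>* t t'" by blast
  then have "(gstep (k # u) T p)\<^sup>*\<^sup>* (s # t) (s # t')"
  proof (induction rule: rtranclp_induct)
    case base
    show ?case by (rule rtranclp.rtrancl_refl)
  next
    case (step y z)
    show ?case by (rule rtranclp_trans[OF step(3) gstep_lift[OF step(2)]])
  qed
  moreover have "(gstep (k # u) T p)\<^sup>*\<^sup>* (s # t') (s' # t')"
  proof (cases "s = s'")
    case False
    moreover have "p = Zal T" using * False unfolding glue_copy_eq by simp
    moreover have "s' = swap s" using False by (cases s; cases s') simp_all
    ultimately have "gstep (k # u) T p (s # t') (s' # t')" by (simp add: gstep_def)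
    then show ?thesis by blast
  qed simp
  ultimately show "(gstep (k # u) T p)\<^sup>*\<^sup>* (s # t) (s' # t')" by (rule rtranclp_trans)
qed

text \<open>Induction on the innermost operation, with \<open>T\<close> replaced by
  \<open>Phi k T\<close>; this is why the index words appear reversed.\<close>

lemma copy_emb_eq_iff:
  assumes "length t = length ks" "length t' = length ks"
  shows "copy_emb ks T t p = copy_emb ks T t' p' \<longleftrightarrow> p = p' \<and> (gstep (rev ks) T p)\<^sup>*\<^sup>* (rev t) (rev t')"
  using assms
proof (induction ks arbitrary: T t t' p p' rule: rev_induct)
  case (snoc k ks)
  obtain t0 s where t: "t = t0 @ [s]" "length t0 = length ks" using snoc(2) by (cases t rule: rev_cases) auto
  obtain t0' s' where t': "t' = t0' @ [s']" "length t0' = length ks" using snoc(3) by (cases t' rule: rev_cases) auto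
  have "copy_emb (ks @ [k]) T t p = copy_emb (ks @ [k]) T t' p' \<longleftrightarrow>
      glue_copy T s p = glue_copy T s' p' \<and> (gstep (rev ks) (Phi k T) (glue_copy T s p))\<^sup>*\<^sup>* (rev t0) (rev t0')"
    unfolding t(1) t'(1) copy_emb_snoc[OF t(2)] copy_emb_snoc[OF t'(2)] by (rule snoc(1)[OF t(2) t'(2)])
  also have "\<dots> \<longleftrightarrow> p = p' \<and> glue_copy T s p = glue_copy T s' p \<and>
      (gstep (rev ks) (Phi k T) (glue_copy T s p))\<^sup>*\<^sup>* (rev t0) (rev t0')"
    by (auto simp: glue_copy_eq)
  finally show ?case unfolding t t' by (simp add: gstep_cons_iff)
qed simp

section \<open>Paths\<close>

text \<open>The steps are kept abstract so that the same path can be pushed from a tripod into a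
  copy, through the gluings and finally into a fiber.\<close>

inductive lpath :: "('a \<Rightarrow> 'a \<Rightarrow> real \<Rightarrow> bool) \<Rightarrow> 'a \<Rightarrow> 'a \<Rightarrow> real \<Rightarrow> bool" for C where
  lpath_nil: "lpath C x x 0"
| lpath_step: "lpath C x y l \<Longrightarrow> C y z r \<Longrightarrow> lpath C x z (l + r)"

lemma lpath_trans:
  assumes "lpath C y z r" "lpath C x y l"
  shows "lpath C x z (l + r)"
  using assms
proof (induction rule: lpath.induct)
  case (lpath_nil y)
  then show ?case by simp
next
  case (lpath_step y z r w s)
  have "lpath C x z (l + r)" by (rule lpath_step(3)[OF lpath_step(4)])
  from lpath.lpath_step[OF this lpath_step(2)] show ?case by (simp add: add.assoc)
qed

lemma lpath_map:
  assumes "lpath C x y l" "\<And>x y r. C x y r \<Longrightarrow> C' (f x) (f y) r"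
  shows "lpath C' (f x) (f y) l"
  using assms(1) by (induction rule: lpath.induct) (auto intro: lpath.intros assms(2))

definition copy_step where
  "copy_step ks T C x z r \<longleftrightarrow>
     (\<exists>t p q. length t = length ks \<and> C p q r \<and> x = copy_emb ks T t p \<and> z = copy_emb ks T t q)"

text \<open>Distances of a glued tree are realised by moving inside copies: a path between the two
  copies of an operation \<open>Phi\<close> goes through their common point
  \<open>Zal\<close>.\<close>

lemma copy_path:
  assumes T: "mt T" and C: "\<And>p q. p \<in> pts T \<Longrightarrow> q \<in> pts T \<Longrightarrow> lpath C p q (tdist T p q)"
  shows "x \<in> pts (foldr Phi ks T) \<Longrightarrow> z \<in> pts (foldr Phi ks T) \<Longrightarrow>
    lpath (copy_step ks T C) x z (tdist (foldr Phi ks T) x z)"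
proof (induction ks arbitrary: x z)
  case Nil
  have "lpath (copy_step [] T C) (id x) (id z) (tdist T x z)"
    by (rule lpath_map[OF C]) (use Nil in \<open>auto simp: copy_step_def\<close>)
  then show ?case by simp
next
  case (Cons k ks)
  let ?T = "foldr Phi ks T"
  have mtT: "mt ?T" by (rule mt_foldr[OF T])
  have up: "copy_step (k # ks) T C (glue_copy ?T i x) (glue_copy ?T i z) r" if cs: "copy_step ks T C x z r" for i x z r
  proof -
    obtain t p q where "length t = length ks" "C p q r" "x = copy_emb ks T t p" "z = copy_emb ks T t q"
      using cs unfolding copy_step_def by blast
    then show ?thesis unfolding copy_step_def
      by (intro exI[of _ "i # t"] exI[of _ p] exI[of _ q]) simp
  qed
  obtain i x' where x: "x' \<in> pts ?T" "x = glue_copy ?T i x'" using Cons(2) by (auto simp: pts_Phi)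
  obtain j z' where z: "z' \<in> pts ?T" "z = glue_copy ?T j z'" using Cons(3) by (auto simp: pts_Phi)
  have Z: "Zal ?T \<in> pts ?T" by (rule mt_D(1)[OF mtT])
  have d: "tdist (foldr Phi (k # ks) T) x z =
      (if i = j then tdist ?T x' z' else tdist ?T x' (Zal ?T) + tdist ?T (Zal ?T) z')"
    using tdist_Phi[OF mtT x(1) z(1)] x(2) z(2) by simp
  show ?case
  proof (cases "i = j")
    case True
    then show ?thesis
      using lpath_map[OF Cons(1)[OF x(1) z(1)], of "copy_step (k # ks) T C" "glue_copy ?T i", OF up] d x z by simp
  next
    case False
    have 1: "lpath (copy_step (k # ks) T C) x (glue_copy ?T i (Zal ?T)) (tdist ?T x' (Zal ?T))"
      unfolding x(2) by (rule lpath_map[OF Cons(1)[OF x(1) Z]]) (rule up)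
    have 2: "glue_copy ?T i (Zal ?T) = glue_copy ?T j (Zal ?T)" by (simp add: glue_copy_eq)
    have 3: "lpath (copy_step (k # ks) T C) (glue_copy ?T j (Zal ?T)) z (tdist ?T (Zal ?T) z')"
      unfolding z(2) by (rule lpath_map[OF Cons(1)[OF Z z(1)]]) (rule up)
    show ?thesis unfolding d if_not_P[OF False] by (rule lpath_trans[OF 3 1[unfolded 2]])
  qed
qed

section \<open>Tripods\<close>

definition TS :: "real \<times> real \<times> real \<Rightarrow> (real \<times> real \<times> real) set" where
  "TS = (\<lambda>(x1, x2, x3). {(s1, s2, s3). 0 \<le> s1 \<and> s1 \<le> x1 \<and> 0 \<le> s2 \<and> s2 \<le> x2 \<and> 0 \<le> s3 \<and> s3 \<le> x3 \<and>
     (s2 = 0 \<and> s3 = 0 \<or> s1 = 0 \<and> s3 = 0 \<or> s1 = 0 \<and> s2 = 0)})"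

definition nonneg3 :: "real \<times> real \<times> real \<Rightarrow> bool" where
  "nonneg3 = (\<lambda>(x1, x2, x3). 0 \<le> x1 \<and> 0 \<le> x2 \<and> 0 \<le> x3)"

lemma pts_tripod: "nonneg3 x \<Longrightarrow> pts (tripod x) = Pair [] ` TS x"
  by (cases x) (auto simp: tripod_def TS_def nonneg3_def)

lemma tripod_marks:
  "Zal (tripod (x1, x2, x3)) = ([], x1, 0, 0)" "Zbe (tripod (x1, x2, x3)) = ([], 0, x2, 0)"
  "Zga (tripod (x1, x2, x3)) = ([], 0, 0, x3)"
  by (simp_all add: tripod_def)

lemma tdist_tripod: "tdist (tripod x) (a, s1, s2, s3) (b, t1, t2, t3) = \<bar>s1 - t1\<bar> + \<bar>s2 - t2\<bar> + \<bar>s3 - t3\<bar>"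
  by (cases x) (simp add: tripod_def)

lemma mt_tripod: "nonneg3 x \<Longrightarrow> mt (tripod x)"
  by (cases x) (auto simp: mt_def pts_tripod tdist_tripod tripod_marks TS_def nonneg3_def)

definition leg :: "real \<times> real \<times> real \<Rightarrow> real \<times> real \<times> real \<Rightarrow> bool" where
  "leg = (\<lambda>(s1, s2, s3) (t1, t2, t3). s2 = 0 \<and> s3 = 0 \<and> t2 = 0 \<and> t3 = 0 \<or>
     s1 = 0 \<and> s3 = 0 \<and> t1 = 0 \<and> t3 = 0 \<or> s1 = 0 \<and> s2 = 0 \<and> t1 = 0 \<and> t2 = 0)"

definition leg_step where
  "leg_step x p q r \<longleftrightarrow> p \<in> pts (tripod x) \<and> q \<in> pts (tripod x) \<and> leg (snd p) (snd q) \<and> r = tdist (tripod x) p q"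

text \<open>Points of different legs are joined through O. The distances to O add up to the
  l1-distance because the two points have no common nonzero coordinate.\<close>

lemma tripod_path:
  assumes x: "nonneg3 x" and pq: "p \<in> pts (tripod x)" "q \<in> pts (tripod x)"
  shows "lpath (leg_step x) p q (tdist (tripod x) p q)"
proof -
  have one: "lpath (leg_step x) p q (tdist (tripod x) p q)" if "leg_step x p q (tdist (tripod x) p q)" for p q
    using lpath_step[of "leg_step x" p p 0, OF lpath_nil that] by simp
  let ?O = "([] :: bin list, 0 :: real, 0 :: real, 0 :: real)"
  have O: "?O \<in> pts (tripod x)" using x by (cases x) (auto simp: pts_tripod TS_def nonneg3_def)
  have legO: "leg (snd r) (snd ?O)" "leg (snd ?O) (snd r)" if "r \<in> pts (tripod x)" for r
    using that x by (cases x; auto simp: pts_tripod TS_def leg_def)+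
  show ?thesis
  proof (cases "leg (snd p) (snd q)")
    case True
    then show ?thesis using one pq by (simp add: leg_step_def)
  next
    case False
    have "lpath (leg_step x) p ?O (tdist (tripod x) p ?O)" "lpath (leg_step x) ?O q (tdist (tripod x) ?O q)"
      using one pq O legO by (simp_all add: leg_step_def)
    then have "lpath (leg_step x) p q (tdist (tripod x) p ?O + tdist (tripod x) ?O q)"
      by (rule lpath_trans[rotated])
    moreover have "tdist (tripod x) p ?O + tdist (tripod x) ?O q = tdist (tripod x) p q"
    proof -
      have form: "\<exists>s1 s2 s3. r = ([], s1, s2, s3) \<and> (s2 = 0 \<and> s3 = 0 \<or> s1 = 0 \<and> s3 = 0 \<or> s1 = 0 \<and> s2 = 0)"
        if "r \<in> pts (tripod x)" for r
        using that x by (cases x) (auto simp: pts_tripod TS_def)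
      obtain s1 s2 s3 where p: "p = ([], s1, s2, s3)" "s2 = 0 \<and> s3 = 0 \<or> s1 = 0 \<and> s3 = 0 \<or> s1 = 0 \<and> s2 = 0"
        using form[OF pq(1)] by blast
      obtain t1 t2 t3 where q: "q = ([], t1, t2, t3)" "t2 = 0 \<and> t3 = 0 \<or> t1 = 0 \<and> t3 = 0 \<or> t1 = 0 \<and> t2 = 0"
        using form[OF pq(2)] by blast
      show ?thesis using p(2) q(2) False unfolding p(1) q(1) tdist_tripod
        by (elim disjE) (simp_all add: leg_def)
    qed
    ultimately show ?thesis by simp
  qed
qed

section \<open>Trees consisting of a tripod and a branch\<close>

type_synonym real4 = "real \<times> real \<times> real \<times> real"

definition l1 :: "real4 \<Rightarrow> real4 \<Rightarrow> real" where
  "l1 = (\<lambda>(a1, a2, a3, a4) (b1, b2, b3, b4). \<bar>a1 - b1\<bar> + \<bar>a2 - b2\<bar> + \<bar>a3 - b3\<bar> + \<bar>a4 - b4\<bar>)"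

definition flat :: "real4 \<Rightarrow> real4" where
  "flat = (\<lambda>(a1, a2, a3, a4). (a1, a2, a3, 0))"

text \<open>\<open>K\<close> draws the tree in a four-dimensional space with the \<open>l1\<close>-metric: the legs lie on the first three
  axes, and the branch leaves the point with coordinates \<open>b1\<close> and \<open>b3\<close> in the fourth direction, so that the
  projection onto the Hubbard tripod forgets the last coordinate.\<close>

locale branched_tripod =
  fixes U :: "'a mtree" and K :: "'a \<Rightarrow> real4" and A1 A2 A3 b1 b3 E :: real
  assumes nonneg: "0 \<le> A1" "0 \<le> A2" "0 \<le> A3" "0 \<le> b1" "b1 \<le> A1" "0 \<le> b3" "b3 \<le> A3"
    and attach: "b1 = 0 \<or> b3 = 0"
    and image: "K ` pts U = {(c, 0, 0, 0) | c. 0 \<le> c \<and> c \<le> A1} \<union> {(0, c, 0, 0) | c. 0 \<le> c \<and> c \<le> A2}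
      \<union> {(0, 0, c, 0) | c. 0 \<le> c \<and> c \<le> A3} \<union> {(b1, 0, b3, e) | e. 0 \<le> e \<and> e \<le> E}"
    and dist: "p \<in> pts U \<Longrightarrow> q \<in> pts U \<Longrightarrow> tdist U p q = l1 (K p) (K q)"
    and inj: "p \<in> pts U \<Longrightarrow> q \<in> pts U \<Longrightarrow> K p = K q \<Longrightarrow> p = q"
    and marks: "Zal U \<in> pts U" "Zbe U \<in> pts U" "Zga U \<in> pts U"
      "K (Zal U) = (A1, 0, 0, 0)" "K (Zbe U) = (0, A2, 0, 0)" "K (Zga U) = (0, 0, A3, 0)"
begin

definition H :: "'a set" where
  "H = {p \<in> pts U. K p = flat (K p)}"

lemma H_cases:
  assumes "p \<in> H"
  obtains c where "0 \<le> c" "c \<le> A1" "K p = (c, 0, 0, 0)" | c where "0 \<le> c" "c \<le> A2" "K p = (0, c, 0, 0)"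
    | c where "0 \<le> c" "c \<le> A3" "K p = (0, 0, c, 0)"
proof -
  have "K p \<in> K ` pts U" "K p = flat (K p)" using assms unfolding H_def by simp_all
  then consider c where "0 \<le> c" "c \<le> A1" "K p = (c, 0, 0, 0)" | c where "0 \<le> c" "c \<le> A2" "K p = (0, c, 0, 0)"
    | c where "0 \<le> c" "c \<le> A3" "K p = (0, 0, c, 0)" | "K p = (b1, 0, b3, 0)"
    unfolding image by (auto simp: flat_def)
  then show thesis
  proof cases
    case 4
    then show thesis using attach nonneg that by auto
  qed (use that in blast)+
qed

lemma H_pts: "p \<in> H \<Longrightarrow> p \<in> pts U" by (simp add: H_def)

lemma marks_H: "Zal U \<in> H" "Zbe U \<in> H" "Zga U \<in> H"
  using marks by (simp_all add: H_def flat_def)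

lemma H_ex:
  "0 \<le> c \<Longrightarrow> c \<le> A1 \<Longrightarrow> \<exists>p\<in>H. K p = (c, 0, 0, 0)"
  "0 \<le> c \<Longrightarrow> c \<le> A2 \<Longrightarrow> \<exists>p\<in>H. K p = (0, c, 0, 0)"
  "0 \<le> c \<Longrightarrow> c \<le> A3 \<Longrightarrow> \<exists>p\<in>H. K p = (0, 0, c, 0)"
proof -
  have "\<exists>p\<in>H. K p = z" if "z \<in> K ` pts U" "flat z = z" for z
    using that unfolding H_def by auto
  then show "0 \<le> c \<Longrightarrow> c \<le> A1 \<Longrightarrow> \<exists>p\<in>H. K p = (c, 0, 0, 0)"
    "0 \<le> c \<Longrightarrow> c \<le> A2 \<Longrightarrow> \<exists>p\<in>H. K p = (0, c, 0, 0)"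
    "0 \<le> c \<Longrightarrow> c \<le> A3 \<Longrightarrow> \<exists>p\<in>H. K p = (0, 0, c, 0)"
    unfolding image by (simp_all add: flat_def)
qed

text \<open>A detour through a point with fourth coordinate \<open>e\<close> costs an additional
  \<open>2 * \<bar>e\<bar>\<close>, so segments between flat points stay flat.\<close>

lemma segment_H:
  assumes "p \<in> H" "q \<in> H"
  shows "segment U p q = {r \<in> H. l1 (K p) (K r) + l1 (K r) (K q) = l1 (K p) (K q)}"
proof -
  have "r \<in> H" if r: "r \<in> pts U" "l1 (K p) (K r) + l1 (K r) (K q) = l1 (K p) (K q)" for r
  proof -
    obtain c1 c2 c3 e where c: "K r = (c1, c2, c3, e)" by (cases "K r")
    obtain p1 p2 p3 p4 where "K p = (p1, p2, p3, p4)" by (cases "K p")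
    then have p: "K p = (p1, p2, p3, 0)" using assms(1) by (simp add: H_def flat_def)
    obtain q1 q2 q3 q4 where "K q = (q1, q2, q3, q4)" by (cases "K q")
    then have q: "K q = (q1, q2, q3, 0)" using assms(2) by (simp add: H_def flat_def)
    have tri: "\<bar>x - z\<bar> \<le> \<bar>x - y\<bar> + \<bar>y - z\<bar>" for x y z :: real by linarith
    have sum: "\<bar>p1 - c1\<bar> + \<bar>p2 - c2\<bar> + \<bar>p3 - c3\<bar> + \<bar>e\<bar> + (\<bar>c1 - q1\<bar> + \<bar>c2 - q2\<bar> + \<bar>c3 - q3\<bar> + \<bar>e\<bar>) =
      \<bar>p1 - q1\<bar> + \<bar>p2 - q2\<bar> + \<bar>p3 - q3\<bar>" using r(2) unfolding c p q by (simp add: l1_def)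
    have rearrange: "a4 = 0" if "d1 \<le> a1 + e1" "d2 \<le> a2 + e2" "d3 \<le> a3 + e3"
      "a1 + a2 + a3 + a4 + (e1 + e2 + e3 + a4) = d1 + d2 + d3" "0 \<le> a4"
      for a1 a2 a3 a4 d1 d2 d3 e1 e2 e3 :: real using that by linarith
    have "\<bar>e\<bar> = 0" by (rule rearrange[OF tri tri tri sum abs_ge_zero])
    then have "e = 0" by simp
    then show ?thesis using r(1) c by (simp add: H_def flat_def)
  qed
  then show ?thesis unfolding segment_def using dist H_pts assms by auto
qed

text \<open>The flat part is convex, and the segments from \<open>Zal\<close> to the other two marks
  already cover it.\<close>

lemma hubbard: "hubbard U = H"
proof
  have "tree_convex U H" unfolding tree_convex_def using segment_H H_pts by blast
  then show "hubbard U \<subseteq> H" unfolding hubbard_def using marks_H by blast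
next
  show "H \<subseteq> hubbard U"
    unfolding hubbard_def
  proof (intro subsetI InterI)
    fix p S assume p: "p \<in> H" and "S \<in> {S. tree_convex U S \<and> {Zal U, Zbe U, Zga U} \<subseteq> S}"
    then have S: "segment U (Zal U) (Zbe U) \<subseteq> S" "segment U (Zal U) (Zga U) \<subseteq> S"
      unfolding tree_convex_def by blast+
    have "p \<in> segment U (Zal U) (Zbe U) \<or> p \<in> segment U (Zal U) (Zga U)"
      using p unfolding segment_H[OF marks_H(1,2)] segment_H[OF marks_H(1,3)] marks
      by (cases rule: H_cases[OF p]) (simp_all add: l1_def nonneg)
    then show "p \<in> S" using S by blast
  qed
qed

lemma center: "center U \<in> H" "K (center U) = (0, 0, 0, 0)"
proof -
  obtain o' where o': "o' \<in> H" "K o' = (0, 0, 0, 0)" using H_ex(1)[of 0] nonneg by auto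
  have "center U = o'"
    unfolding center_def segment_H[OF marks_H(1,2)] segment_H[OF marks_H(2,3)] segment_H[OF marks_H(1,3)] marks
  proof (rule the_equality)
    show "o' \<in> {r \<in> H. l1 (A1, 0, 0, 0) (K r) + l1 (K r) (0, A2, 0, 0) = l1 (A1, 0, 0, 0) (0, A2, 0, 0)} \<inter>
      {r \<in> H. l1 (0, A2, 0, 0) (K r) + l1 (K r) (0, 0, A3, 0) = l1 (0, A2, 0, 0) (0, 0, A3, 0)} \<inter>
      {r \<in> H. l1 (A1, 0, 0, 0) (K r) + l1 (K r) (0, 0, A3, 0) = l1 (A1, 0, 0, 0) (0, 0, A3, 0)}"
      using o' by (simp add: l1_def)
  next
    fix r assume r: "r \<in> {r \<in> H. l1 (A1, 0, 0, 0) (K r) + l1 (K r) (0, A2, 0, 0) = l1 (A1, 0, 0, 0) (0, A2, 0, 0)} \<inter>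
      {r \<in> H. l1 (0, A2, 0, 0) (K r) + l1 (K r) (0, 0, A3, 0) = l1 (0, A2, 0, 0) (0, 0, A3, 0)} \<inter>
      {r \<in> H. l1 (A1, 0, 0, 0) (K r) + l1 (K r) (0, 0, A3, 0) = l1 (A1, 0, 0, 0) (0, 0, A3, 0)}"
    then have rH: "r \<in> H" by blast
    have "K r = (0, 0, 0, 0)" using r by (cases rule: H_cases[OF rH]) (simp_all add: l1_def)
    then show "r = o'" using inj H_pts rH o' by metis
  qed
  then show "center U \<in> H" "K (center U) = (0, 0, 0, 0)" using o' by simp_all
qed

lemma legs:
  "p \<in> segment U (center U) (Zal U) \<longleftrightarrow> p \<in> H \<and> (\<exists>c. K p = (c, 0, 0, 0))"
  "p \<in> segment U (center U) (Zbe U) \<longleftrightarrow> p \<in> H \<and> (\<exists>c. K p = (0, c, 0, 0))"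
  "p \<in> segment U (center U) (Zga U) \<longleftrightarrow> p \<in> H \<and> (\<exists>c. K p = (0, 0, c, 0))"
proof -
  have "p \<in> H \<Longrightarrow> l1 (0, 0, 0, 0) (K p) + l1 (K p) (A1, 0, 0, 0) = l1 (0, 0, 0, 0) (A1, 0, 0, 0) \<longleftrightarrow>
      (\<exists>c. K p = (c, 0, 0, 0))"
    "p \<in> H \<Longrightarrow> l1 (0, 0, 0, 0) (K p) + l1 (K p) (0, A2, 0, 0) = l1 (0, 0, 0, 0) (0, A2, 0, 0) \<longleftrightarrow>
      (\<exists>c. K p = (0, c, 0, 0))"
    "p \<in> H \<Longrightarrow> l1 (0, 0, 0, 0) (K p) + l1 (K p) (0, 0, A3, 0) = l1 (0, 0, 0, 0) (0, 0, A3, 0) \<longleftrightarrow>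
      (\<exists>c. K p = (0, 0, c, 0))"
    by (erule H_cases; simp add: l1_def)+
  then show "p \<in> segment U (center U) (Zal U) \<longleftrightarrow> p \<in> H \<and> (\<exists>c. K p = (c, 0, 0, 0))"
    "p \<in> segment U (center U) (Zbe U) \<longleftrightarrow> p \<in> H \<and> (\<exists>c. K p = (0, c, 0, 0))"
    "p \<in> segment U (center U) (Zga U) \<longleftrightarrow> p \<in> H \<and> (\<exists>c. K p = (0, 0, c, 0))"
    unfolding segment_H[OF center(1) marks_H(1)] segment_H[OF center(1) marks_H(2)]
      segment_H[OF center(1) marks_H(3)] marks center(2) by blast+
qed

lemma scaled_radius:
  assumes "p \<in> H" "K p = (c1, c2, c3, e)"
  shows "scaled_radius U p = c1 / 2 + c2 + c3 / 2"
proof -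
  have d: "tdist U (center U) p = l1 (0, 0, 0, 0) (c1, c2, c3, e)"
    using dist[OF H_pts[OF center(1)] H_pts[OF assms(1)]] assms(2) center(2) by simp
  have iff: "p \<in> segment U (center U) (Zbe U) \<longleftrightarrow> c1 = 0 \<and> c3 = 0 \<and> e = 0" using assms unfolding legs by simp
  show ?thesis unfolding scaled_radius_def d iff
    using H_cases[OF assms(1)] assms(2) by (cases rule: H_cases[OF assms(1)]) (auto simp: l1_def)
qed

text \<open>Omitting the fourth coordinate makes this map insensitive to the projection
  (\<open>F_proj\<close>), so it describes both the rescaled Hubbard tripod and the collapse onto
  it.\<close>

definition F :: "'a \<Rightarrow> bin list \<times> real \<times> real \<times> real" where
  "F p = (case K p of (c1, c2, c3, e) \<Rightarrow> ([], c1 / 2, c2, c3 / 2))"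

lemma halved_dist:
  assumes p: "p \<in> H" and q: "q \<in> H"
  shows "tdist (tripod x) (F p) (F q) = tdist (halved_hubbard U) p q"
proof -
  obtain c1 c2 c3 e where c: "K p = (c1, c2, c3, e)" by (cases "K p")
  obtain d1 d2 d3 e' where d: "K q = (d1, d2, d3, e')" by (cases "K q")
  have iff: "(\<exists>Z\<in>{Zal U, Zbe U, Zga U}. {p, q} \<subseteq> segment U (center U) Z) \<longleftrightarrow>
      e = 0 \<and> e' = 0 \<and> (c2 = 0 \<and> c3 = 0 \<and> d2 = 0 \<and> d3 = 0 \<or> c1 = 0 \<and> c3 = 0 \<and> d1 = 0 \<and> d3 = 0 \<or>
        c1 = 0 \<and> c2 = 0 \<and> d1 = 0 \<and> d2 = 0)"
    using p q by (auto simp: legs c d)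
  have cc: "0 \<le> c1" "0 \<le> c2" "0 \<le> c3" "e = 0" "c2 = 0 \<and> c3 = 0 \<or> c1 = 0 \<and> c3 = 0 \<or> c1 = 0 \<and> c2 = 0"
    using c by (cases rule: H_cases[OF p]; simp)+
  have dd: "0 \<le> d1" "0 \<le> d2" "0 \<le> d3" "e' = 0" "d2 = 0 \<and> d3 = 0 \<or> d1 = 0 \<and> d3 = 0 \<or> d1 = 0 \<and> d2 = 0"
    using d by (cases rule: H_cases[OF q]; simp)+
  have "tdist (halved_hubbard U) p q =
    (if c2 = 0 \<and> c3 = 0 \<and> d2 = 0 \<and> d3 = 0 \<or> c1 = 0 \<and> c3 = 0 \<and> d1 = 0 \<and> d3 = 0 \<or>
        c1 = 0 \<and> c2 = 0 \<and> d1 = 0 \<and> d2 = 0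
     then \<bar>(c1 / 2 + c2 + c3 / 2) - (d1 / 2 + d2 + d3 / 2)\<bar>
     else (c1 / 2 + c2 + c3 / 2) + (d1 / 2 + d2 + d3 / 2))"
    unfolding halved_hubbard_def mtree.simps iff scaled_radius[OF p c] scaled_radius[OF q d] using cc(4) dd(4) by simp
  moreover have "tdist (tripod x) (F p) (F q) = \<bar>c1 / 2 - d1 / 2\<bar> + \<bar>c2 - d2\<bar> + \<bar>c3 / 2 - d3 / 2\<bar>"
    unfolding F_def c d by (simp add: tdist_tripod)
  ultimately show ?thesis using cc dd by (elim disjE) (simp_all add: abs_if)
qed

lemma F_isometry: "marked_isometry F (halved_hubbard U) (tripod (A1 / 2, A2, A3 / 2))"
proof -
  let ?x = "(A1 / 2, A2, A3 / 2)"
  have pts: "pts (halved_hubbard U) = H" by (simp add: halved_hubbard_def hubbard)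
  have Z: "Zal (halved_hubbard U) = Zal U" "Zbe (halved_hubbard U) = Zbe U" "Zga (halved_hubbard U) = Zga U"
    by (simp_all add: halved_hubbard_def)
  have "inj_on F H"
  proof (rule inj_onI)
    fix p q assume pq: "p \<in> H" "q \<in> H" "F p = F q"
    have "K p = flat (K p)" "K q = flat (K q)" using pq by (simp_all add: H_def)
    moreover have "flat (K p) = flat (K q)" using pq(3) unfolding F_def flat_def by (auto split: prod.splits)
    ultimately show "p = q" using inj H_pts pq(1,2) by simp
  qed
  moreover have "F ` H = pts (tripod ?x)"
  proof (intro equalityI subsetI)
    fix z assume "z \<in> F ` H"
    then obtain p where p: "p \<in> H" "z = F p" by blast
    have n3: "nonneg3 ?x" using nonneg by (simp add: nonneg3_def)
    show "z \<in> pts (tripod ?x)" unfolding p(2) pts_tripod[OF n3]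
      by (cases rule: H_cases[OF p(1)]) (simp_all add: F_def TS_def nonneg)
  next
    fix z assume "z \<in> pts (tripod ?x)"
    then consider c where "z = ([], c, 0, 0)" "0 \<le> c" "c \<le> A1 / 2" | c where "z = ([], 0, c, 0)" "0 \<le> c" "c \<le> A2"
      | c where "z = ([], 0, 0, c)" "0 \<le> c" "c \<le> A3 / 2" by (auto simp: tripod_def)
    then show "z \<in> F ` H"
    proof cases
      case 1
      then obtain p where "p \<in> H" "K p = (2 * c, 0, 0, 0)" using H_ex(1)[of "2 * c"] by auto
      then show ?thesis using 1 by (intro image_eqI[of _ _ p]) (simp_all add: F_def)
    next
      case 2
      then obtain p where "p \<in> H" "K p = (0, c, 0, 0)" using H_ex(2)[of c] by auto
      then show ?thesis using 2 by (intro image_eqI[of _ _ p]) (simp_all add: F_def)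
    next
      case 3
      then obtain p where "p \<in> H" "K p = (0, 0, 2 * c, 0)" using H_ex(3)[of "2 * c"] by auto
      then show ?thesis using 3 by (intro image_eqI[of _ _ p]) (simp_all add: F_def)
    qed
  qed
  ultimately have "isometry F H (tdist (halved_hubbard U)) (pts (tripod ?x)) (tdist (tripod ?x))"
    unfolding isometry_def bij_betw_def using halved_dist by blast
  then show ?thesis
    unfolding marked_isometry_def pts Z using marks marks_H by (simp add: F_def tripod_marks)
qed

text \<open>The distance to a flat point is a distance in the first three coordinates plus the
  height, so the minimum is attained only at the foot.\<close>

lemma proj:
  assumes "p \<in> pts U"
  shows "tree_proj U (hubbard U) p \<in> H" "K (tree_proj U (hubbard U) p) = flat (K p)"
proof -
  obtain c1 c2 c3 e where c: "K p = (c1, c2, c3, e)" by (cases "K p")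
  have "K p \<in> K ` pts U" using assms by simp
  then have "\<exists>q\<in>H. K q = flat (K p)"
  proof (unfold image, elim UnE CollectE exE conjE)
    fix a assume "K p = (b1, 0, b3, a)"
    then show ?thesis using attach H_ex(1)[of b1] H_ex(3)[of b3] nonneg by (auto simp: flat_def)
  qed (use H_ex in \<open>auto simp: flat_def\<close>)
  then obtain q where q: "q \<in> H" "K q = (c1, c2, c3, 0)" unfolding c by (auto simp: flat_def)
  have dr: "tdist U p r = \<bar>c1 - r1\<bar> + \<bar>c2 - r2\<bar> + \<bar>c3 - r3\<bar> + \<bar>e\<bar>" if "r \<in> H" "K r = (r1, r2, r3, r4)" for r r1 r2 r3 r4
  proof -
    have "r4 = 0" using that by (simp add: H_def flat_def)
    then show ?thesis using dist[OF assms H_pts[OF that(1)]] that(2) c by (simp add: l1_def)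
  qed
  have "tree_proj U (hubbard U) p = q"
    unfolding tree_proj_def hubbard
  proof (rule the_equality, intro conjI ballI)
    show "q \<in> H" by (rule q(1))
    fix r assume r: "r \<in> H"
    obtain r1 r2 r3 r4 where r4: "K r = (r1, r2, r3, r4)" by (cases "K r")
    show "tdist U p q \<le> tdist U p r" unfolding dr[OF q] dr[OF r r4] by simp
  next
    fix r assume r: "r \<in> H \<and> (\<forall>s\<in>H. tdist U p r \<le> tdist U p s)"
    obtain r1 r2 r3 r4 where r4: "K r = (r1, r2, r3, r4)" by (cases "K r")
    have "tdist U p r \<le> tdist U p q" using r q(1) by blast
    then have "c1 = r1 \<and> c2 = r2 \<and> c3 = r3" unfolding dr[OF q] dr[OF conjunct1[OF r] r4] by linarith
    then have "K r = K q" using r r4 q by (simp add: H_def flat_def)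
    then show "r = q" using inj H_pts r q(1) by blast
  qed
  then show "tree_proj U (hubbard U) p \<in> H" "K (tree_proj U (hubbard U) p) = flat (K p)"
    using q c by (simp_all add: flat_def)
qed

lemma F_proj: "p \<in> pts U \<Longrightarrow> F (tree_proj U (hubbard U) p) = F p"
  unfolding F_def proj(2) by (simp add: flat_def split: prod.splits)

end

text \<open>The effect of \<open>I\<close> in leg coordinates (\<open>Iw_tw\<close>). It is
  \<open>kap\<close> without the fourth coordinate and with the legs of \<open>Zal\<close> and
  \<open>Zga\<close> halved.\<close>

fun psi :: "bin \<Rightarrow> bin \<Rightarrow> real \<Rightarrow> real \<times> real \<times> real \<Rightarrow> real \<times> real \<times> real" where
  "psi One One p (s1, s2, s3) = (s2 / 2, s3, s1 / 2)"
| "psi One Two p (s1, s2, s3) = (0, 0, p - s1 / 2 + s2 / 2)"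
| "psi Two One p (s1, s2, s3) = (p - s1 / 2 + s2 / 2, 0, 0)"
| "psi Two Two p (s1, s2, s3) = (s1 / 2, s3, s2 / 2)"

text \<open>Coordinates for \<open>Phi k\<close> of a tripod whose first leg has length
  \<open>p\<close>. The centre of copy \<open>k\<close> is the centre of the Hubbard tripod. The
  other copy is entered at distance \<open>p\<close> from it, its first leg is traversed backwards
  up to distance \<open>2 * p\<close>, and there its third leg branches off.\<close>

fun kap :: "bin \<Rightarrow> bin \<Rightarrow> real \<Rightarrow> real \<times> real \<times> real \<Rightarrow> real4" where
  "kap One One p (s1, s2, s3) = (s2, s3, s1, 0)"
| "kap One Two p (s1, s2, s3) = (0, 0, 2 * p - s1 + s2, s3)"
| "kap Two One p (s1, s2, s3) = (2 * p - s1 + s2, 0, 0, s3)"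
| "kap Two Two p (s1, s2, s3) = (s1, s3, s2, 0)"

lemma TS_iff: "(s1, s2, s3) \<in> TS (x1, x2, x3) \<longleftrightarrow> 0 \<le> s1 \<and> s1 \<le> x1 \<and> 0 \<le> s2 \<and> s2 \<le> x2 \<and> 0 \<le> s3 \<and> s3 \<le> x3 \<and>
     (s2 = 0 \<and> s3 = 0 \<or> s1 = 0 \<and> s3 = 0 \<or> s1 = 0 \<and> s2 = 0)"
  by (simp add: TS_def)

lemma kap_dist:
  assumes "(s1, s2, s3) \<in> TS (p, y2, y3)" "(t1, t2, t3) \<in> TS (p, y2, y3)"
  shows "l1 (kap k i p (s1, s2, s3)) (kap k j p (t1, t2, t3)) =
    (if i = j then \<bar>s1 - t1\<bar> + \<bar>s2 - t2\<bar> + \<bar>s3 - t3\<bar>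
     else \<bar>s1 - p\<bar> + \<bar>s2\<bar> + \<bar>s3\<bar> + (\<bar>p - t1\<bar> + \<bar>t2\<bar> + \<bar>t3\<bar>))"
proof -
  note bounds = assms[unfolded TS_iff]
  \<comment> \<open>Since \<open>s1\<close> and \<open>s2\<close> are never both nonzero,
    \<open>s2 - s1\<close> is a signed position on the line formed by the first two legs.\<close>
  have same: "\<bar>(2 * p - s1 + s2) - (2 * p - t1 + t2)\<bar> + \<bar>s3 - t3\<bar> = \<bar>s1 - t1\<bar> + \<bar>s2 - t2\<bar> + \<bar>s3 - t3\<bar>"
  proof -
    have s: "s1 = 0 \<or> s2 = 0" "0 \<le> s1" "0 \<le> s2" using bounds(1) by blast+
    have t: "t1 = 0 \<or> t2 = 0" "0 \<le> t1" "0 \<le> t2" using bounds(2) by blast+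
    have "\<bar>(2 * p - s1 + s2) - (2 * p - t1 + t2)\<bar> = \<bar>s1 - t1\<bar> + \<bar>s2 - t2\<bar>"
      using s(1) t(1)
    proof (elim disjE)
      assume "s1 = 0" "t1 = 0"
      then show ?thesis by simp
    next
      assume "s1 = 0" "t2 = 0"
      then show ?thesis using s t by simp
    next
      assume "s2 = 0" "t1 = 0"
      then show ?thesis using s t by simp
    next
      assume "s2 = 0" "t2 = 0"
      then show ?thesis by simp
    qed
    then show ?thesis by simp
  qed
  have across: "\<bar>s1 - (2 * p - t1 + t2)\<bar> = (p - s1) + (p - t1) + t2" "\<bar>(2 * p - s1 + s2) - t1\<bar> = (p - s1) + (p - t1) + s2"
    using bounds by simp_all
  have pos: "\<bar>s1 - p\<bar> = p - s1" "\<bar>p - t1\<bar> = p - t1" "\<bar>s2\<bar> = s2" "\<bar>s3\<bar> = s3" "\<bar>t2\<bar> = t2" "\<bar>t3\<bar> = t3"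
    using bounds by simp_all
  have one: "i = j \<Longrightarrow> i = k \<Longrightarrow> ?thesis" by (cases k; cases i; simp add: l1_def del: abs_mult)
  have two: "i = j \<Longrightarrow> i \<noteq> k \<Longrightarrow> ?thesis"
    using same by (cases k; cases i; simp only: kap.simps l1_def prod.case if_True diff_self abs_zero; simp)
  have three: "i \<noteq> j \<Longrightarrow> i = k \<Longrightarrow> ?thesis"
    using pos(3-6) by (cases k; cases j; simp add: l1_def pos across)
  have four: "i \<noteq> j \<Longrightarrow> i \<noteq> k \<Longrightarrow> ?thesis"
    using pos(3-6) by (cases k; cases j; cases i; simp add: l1_def pos across)
  show ?thesis using one two three four by blast
qed

lemma kap_image:
  assumes "0 \<le> p" "0 \<le> y2" "0 \<le> y3"
  shows "kap k One p ` TS (p, y2, y3) \<union> kap k Two p ` TS (p, y2, y3) =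
    {(c, 0, 0, 0) | c. 0 \<le> c \<and> c \<le> (if k = One then y2 else 2 * p + y2)} \<union> {(0, c, 0, 0) | c. 0 \<le> c \<and> c \<le> y3}
      \<union> {(0, 0, c, 0) | c. 0 \<le> c \<and> c \<le> (if k = One then 2 * p + y2 else y2)}
      \<union> {(if k = One then 0 else 2 * p, 0, if k = One then 2 * p else 0, e) | e. 0 \<le> e \<and> e \<le> y3}"
    (is "?L = ?R")
proof
  show "?L \<subseteq> ?R"
  proof
    fix z assume "z \<in> ?L"
    then obtain i s1 s2 s3 where "(s1, s2, s3) \<in> TS (p, y2, y3)" "z = kap k i p (s1, s2, s3)" by auto
    then show "z \<in> ?R" using assms unfolding TS_iff
      by (cases k; cases i; elim conjE disjE; simp)
  qed
next
  let ?T = "TS (p, y2, y3)"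
  have mem: "kap k i p s \<in> ?L" if "s \<in> ?T" for i s using that by (cases i) simp_all
  \<comment> \<open>The long leg consists of the first leg of copy \<open>k\<close>, the first leg
    of the other copy run backwards, and the second leg of the other copy.\<close>
  have long: "\<exists>i. \<exists>s\<in>?T. z = kap k i p s"
    if "z = (if k = One then (0, 0, c, 0) else (c, 0, 0, 0))" "0 \<le> c" "c \<le> 2 * p + y2" for z c
  proof -
    consider "c \<le> p" | "p \<le> c" "c \<le> 2 * p" | "2 * p \<le> c" by linarith
    then show ?thesis
    proof cases
      case 1
      then show ?thesis using that assms
        by (intro exI[of _ k] bexI[of _ "(c, 0, 0)"]) (cases k; simp add: TS_iff)+
    next
      case 2
      then show ?thesis using that assms
        by (intro exI[of _ "swap k"] bexI[of _ "(2 * p - c, 0, 0)"]) (cases k; simp add: TS_iff)+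
    next
      case 3
      then show ?thesis using that assms
        by (intro exI[of _ "swap k"] bexI[of _ "(0, c - 2 * p, 0)"]) (cases k; simp add: TS_iff)+
    qed
  qed
  have short: "\<exists>i. \<exists>s\<in>?T. z = kap k i p s"
    if "z = (if k = One then (c, 0, 0, 0) else (0, 0, c, 0))" "0 \<le> c" "c \<le> y2" for z c
    using that assms by (intro exI[of _ k] bexI[of _ "(0, c, 0)"]) (cases k; simp add: TS_iff)+
  have be: "\<exists>i. \<exists>s\<in>?T. z = kap k i p s" if "z = (0, c, 0, 0)" "0 \<le> c" "c \<le> y3" for z c
    using that assms by (intro exI[of _ k] bexI[of _ "(0, 0, c)"]) (cases k; simp add: TS_iff)+
  have branch: "\<exists>i. \<exists>s\<in>?T. z = kap k i p s"
    if "z = (if k = One then 0 else 2 * p, 0, if k = One then 2 * p else 0, e)" "0 \<le> e" "e \<le> y3" for z e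
    using that assms by (intro exI[of _ "swap k"] bexI[of _ "(0, 0, e)"]) (cases k; simp add: TS_iff)+
  have ex: "\<exists>i. \<exists>s\<in>?T. z = kap k i p s" if "z \<in> ?R" for z
    using that
  proof (elim UnE CollectE exE conjE)
    fix c assume "z = (c, 0, 0, 0)" "0 \<le> c" "c \<le> (if k = One then y2 else 2 * p + y2)"
    then show ?thesis using long[of z c] short[of z c] by (cases k) simp_all
  next
    fix c assume "z = (0, 0, c, 0)" "0 \<le> c" "c \<le> (if k = One then 2 * p + y2 else y2)"
    then show ?thesis using long[of z c] short[of z c] by (cases k) simp_all
  qed (use be branch in blast)+
  show "?R \<subseteq> ?L"
  proof
    fix z assume "z \<in> ?R"
    from ex[OF this] obtain i s where zs: "s \<in> ?T" "z = kap k i p s" by blast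
    show "z \<in> ?L" unfolding zs(2) by (rule mem[OF zs(1)])
  qed
qed

lemma Phi_halved:
  assumes "0 \<le> x1" "0 \<le> x2" "0 \<le> x3" and k: "k = (if x3 > x1 then One else Two)"
  shows "\<exists>\<phi>. marked_isometry \<phi> (halved_hubbard (Phi k (tripod (FF (x1, x2, x3))))) (tripod (x1, x2, x3)) \<and>
    (\<forall>i s. s \<in> TS (FF (x1, x2, x3)) \<longrightarrow>
       \<phi> (tree_proj (Phi k (tripod (FF (x1, x2, x3)))) (hubbard (Phi k (tripod (FF (x1, x2, x3)))))
           (glue_copy (tripod (FF (x1, x2, x3))) i ([], s))) = ([], psi k i \<bar>x1 - x3\<bar> s))"
proof -
  define p where "p = \<bar>x1 - x3\<bar>"
  define y2 where "y2 = 2 * min x1 x3"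
  have FF: "FF (x1, x2, x3) = (p, y2, x2)" by (simp add: FF_def p_def y2_def)
  have nn: "0 \<le> p" "0 \<le> y2" using assms by (simp_all add: p_def y2_def)
  define T where "T = tripod (p, y2, x2)"
  define U where "U = Phi k T"
  have n3: "nonneg3 (p, y2, x2)" using nn assms(2) by (simp add: nonneg3_def)
  have ptsT: "pts T = Pair [] ` TS (p, y2, x2)" unfolding T_def by (rule pts_tripod[OF n3])
  have mtT: "mt T" unfolding T_def by (rule mt_tripod[OF n3])
  have Zal: "Zal T = ([], p, 0, 0)" by (simp add: T_def tripod_marks)
  define K where "K = (\<lambda>z :: bin list \<times> real \<times> real \<times> real. kap k (hd (fst z)) p (snd z))"
  have Kg: "K (glue_copy T i ([], s)) = kap k i p s" for i s
    by (cases i; cases k) (auto simp: K_def glue_copy_def Zal)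
  have ptsU: "pts U = (\<lambda>(i, s). glue_copy T i ([], s)) ` (UNIV \<times> TS (p, y2, x2))"
  proof (intro equalityI subsetI)
    fix z assume "z \<in> pts U"
    then show "z \<in> (\<lambda>(i, s). glue_copy T i ([], s)) ` (UNIV \<times> TS (p, y2, x2))"
      unfolding U_def pts_Phi ptsT by force
  next
    fix z assume "z \<in> (\<lambda>(i, s). glue_copy T i ([], s)) ` (UNIV \<times> TS (p, y2, x2))"
    then show "z \<in> pts U" unfolding U_def pts_Phi ptsT by force
  qed
  have dist: "tdist U z w = l1 (K z) (K w)" if zw: "z \<in> pts U" "w \<in> pts U" for z w
  proof -
    obtain i s1 s2 s3 where z: "(s1, s2, s3) \<in> TS (p, y2, x2)" "z = glue_copy T i ([], s1, s2, s3)"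
      using zw(1) unfolding ptsU by auto
    obtain j t1 t2 t3 where w: "(t1, t2, t3) \<in> TS (p, y2, x2)" "w = glue_copy T j ([], t1, t2, t3)"
      using zw(2) unfolding ptsU by auto
    have in_T: "([], s1, s2, s3) \<in> pts T" "([], t1, t2, t3) \<in> pts T" using z w ptsT by simp_all
    show ?thesis unfolding z(2) w(2) Kg kap_dist[OF z(1) w(1)] U_def tdist_Phi[OF mtT in_T] Zal
      unfolding T_def tdist_tripod by simp
  qed
  have inj: "z = w" if zw: "z \<in> pts U" "w \<in> pts U" "K z = K w" for z w
  proof -
    obtain i s1 s2 s3 where z: "(s1, s2, s3) \<in> TS (p, y2, x2)" "z = glue_copy T i ([], s1, s2, s3)"
      using zw(1) unfolding ptsU by auto
    obtain j t1 t2 t3 where w: "(t1, t2, t3) \<in> TS (p, y2, x2)" "w = glue_copy T j ([], t1, t2, t3)"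
      using zw(2) unfolding ptsU by auto
    have "l1 (K z) (K w) = 0" unfolding zw(3) by (cases "K w") (simp add: l1_def)
    then have 0: "(if i = j then \<bar>s1 - t1\<bar> + \<bar>s2 - t2\<bar> + \<bar>s3 - t3\<bar>
     else \<bar>s1 - p\<bar> + \<bar>s2\<bar> + \<bar>s3\<bar> + (\<bar>p - t1\<bar> + \<bar>t2\<bar> + \<bar>t3\<bar>)) = 0"
      unfolding z(2) w(2) Kg kap_dist[OF z(1) w(1)] .
    show ?thesis
    proof (cases "i = j")
      case True
      then have "s1 = t1 \<and> s2 = t2 \<and> s3 = t3" using 0 unfolding if_P[OF True] by linarith
      then show ?thesis using True z w by simp
    next
      case False
      then have "s1 = p \<and> s2 = 0 \<and> s3 = 0 \<and> t1 = p \<and> t2 = 0 \<and> t3 = 0" using 0 unfolding if_not_P[OF False] by linarith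
      then show ?thesis unfolding z(2) w(2) glue_copy_eq Zal by simp
    qed
  qed
  let ?A1 = "if k = One then y2 else 2 * p + y2" and ?A3 = "if k = One then 2 * p + y2 else y2"
  \<comment> \<open>This is where the itinerary enters: both legs have length at least
    \<open>2 * min x1 x3\<close>, and \<open>k\<close> is such that the additional
    \<open>2 * \<bar>x1 - x3\<bar>\<close> falls on the side of the longer original leg.\<close>
  have A: "?A1 = 2 * x1" "?A3 = 2 * x3" using k by (auto simp: p_def y2_def)
  interpret branched_tripod U K ?A1 x2 ?A3 "if k = One then 0 else 2 * p" "if k = One then 2 * p else 0" x2
  proof (unfold_locales)
    have "K ` pts U = kap k One p ` TS (p, y2, x2) \<union> kap k Two p ` TS (p, y2, x2)"
    proof (intro equalityI subsetI)
      fix z assume "z \<in> K ` pts U"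
      then obtain i s where "s \<in> TS (p, y2, x2)" "z = kap k i p s" unfolding ptsU by (auto simp: Kg)
      then show "z \<in> kap k One p ` TS (p, y2, x2) \<union> kap k Two p ` TS (p, y2, x2)" by (cases i) simp_all
    next
      fix z assume "z \<in> kap k One p ` TS (p, y2, x2) \<union> kap k Two p ` TS (p, y2, x2)"
      then obtain i s where s: "s \<in> TS (p, y2, x2)" "z = kap k i p s" by blast
      then show "z \<in> K ` pts U" unfolding ptsU
        by (intro image_eqI[of _ _ "glue_copy T i ([], s)"] image_eqI[of _ _ "(i, s)"]) (simp_all add: Kg)
    qed
    then show "K ` pts U = {(c, 0, 0, 0) | c. 0 \<le> c \<and> c \<le> ?A1} \<union> {(0, c, 0, 0) | c. 0 \<le> c \<and> c \<le> x2}
      \<union> {(0, 0, c, 0) | c. 0 \<le> c \<and> c \<le> ?A3}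
      \<union> {(if k = One then 0 else 2 * p, 0, if k = One then 2 * p else 0, e) | e. 0 \<le> e \<and> e \<le> x2}"
      unfolding kap_image[OF nn assms(2)] .
    have "mt U" unfolding U_def by (rule mt_Phi[OF mtT])
    then show "Zal U \<in> pts U" "Zbe U \<in> pts U" "Zga U \<in> pts U" by (rule mt_D)+
    have m: "Zbe T = ([], 0, y2, 0)" "Zga T = ([], 0, 0, x2)" by (simp_all add: T_def tripod_marks)
    show "K (Zal U) = (?A1, 0, 0, 0)" unfolding U_def Phi_simps m Kg by (cases k) simp_all
    show "K (Zbe U) = (0, x2, 0, 0)" unfolding U_def Phi_simps m Kg by (cases k) simp_all
    show "K (Zga U) = (0, 0, ?A3, 0)" unfolding U_def Phi_simps m Kg by (cases k) simp_all
  qed (use nn assms dist inj in auto)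
  have "marked_isometry F (halved_hubbard U) (tripod (x1, x2, x3))" using F_isometry unfolding A by simp
  moreover have "F (tree_proj U (hubbard U) (glue_copy T i ([], s))) = ([], psi k i p s)" if "s \<in> TS (p, y2, x2)" for i s
  proof -
    have "glue_copy T i ([], s) \<in> pts U" using that unfolding ptsU by force
    then show ?thesis using F_proj unfolding F_def Kg by (cases s; cases k; cases i) (simp_all add: Kg)
  qed
  ultimately show ?thesis unfolding FF p_def[symmetric] T_def[symmetric] U_def[symmetric] by blast
qed

section \<open>The fibers as glued tripods\<close>

text \<open>A letter amounts to its image under \<open>mu_letter\<close> together with a side. Over
  a fixed word \<open>u\<close> a word is thus a list of sides, and these lists will index the
  copies.\<close>

fun mk :: "bin \<Rightarrow> bin \<Rightarrow> letter" where
  "mk One One = X1" | "mk One Two = X2" | "mk Two One = X3" | "mk Two Two = X4"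

fun side :: "letter \<Rightarrow> bin" where
  "side X1 = One" | "side X2 = Two" | "side X3 = One" | "side X4 = Two"

definition vv :: "bin list \<Rightarrow> bin list \<Rightarrow> letter list" where
  "vv u t = map2 mk u t"

lemma vv_simps [simp]: "vv [] [] = []" "vv (k # u) (s # t) = mk k s # vv u t"
  by (simp_all add: vv_def)

lemma mk_side [simp]: "mu_letter (mk k s) = k" "side (mk k s) = s" "mk (mu_letter x) (side x) = x"
  by ((cases k; cases s; simp)+) (cases x; simp)

lemma vv_props:
  assumes "length t = length u"
  shows "map mu_letter (vv u t) = u" "map side (vv u t) = t" "length (vv u t) = length u"
  using assms by (induction t u rule: list_induct2) simp_all

lemma vv_split: "v = vv (map mu_letter v) (map side v)"
  by (induction v) simp_all

text \<open>On sides, \<beta> = (\<alpha>, \<gamma>, \<alpha>, \<gamma>) continues according to the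
  side alone, while \<gamma> = (\<beta>, \<epsilon>, \<epsilon>, \<beta>) continues exactly when the
  side equals the letter of \<open>u\<close>; this is the recursion of \<open>fB\<close> and
  \<open>fC\<close>.\<close>

lemma greek_vv:
  assumes "length t = length u"
  shows "g_al (vv u t) = vv u (fA t) \<and> g_be (vv u t) = vv u (fB u t) \<and> g_ga (vv u t) = vv u (fC u t) \<and>
    length (fA t) = length u \<and> length (fB u t) = length u \<and> length (fC u t) = length u"
  using assms
proof (induction t u rule: list_induct2)
  case Nil
  show ?case by simp
next
  case (Cons s t k u)
  show ?case using Cons by (cases k; cases s) simp_all
qed

text \<open>The point over (p, q) with leg coordinates \<open>s\<close>: moving along a leg shifts
  weight from an unprimed vertex to its primed copy.\<close>

fun tw :: "real \<times> real \<Rightarrow> real \<times> real \<times> real \<Rightarrow> vertex \<Rightarrow> real" where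
  "tw (p, q) (s1, s2, s3) VA = p - s1" | "tw (p, q) (s1, s2, s3) VA1 = s1"
| "tw (p, q) (s1, s2, s3) VB = 1 - p - q - s2" | "tw (p, q) (s1, s2, s3) VB1 = s2"
| "tw (p, q) (s1, s2, s3) VC = q - s3" | "tw (p, q) (s1, s2, s3) VC1 = s3"

lemma tw_PP [simp]: "PP (tw (p, q) s) = (p, q)"
  by (cases s) (simp add: PP_def)

lemma EE_tw: "EE (tw (p, q) (s1, s2, s3)) = vec5 p q s1 s2 s3"
  unfolding EE_vec5 by simp

lemma tetrahedra_iff: "S \<in> tetrahedra \<longleftrightarrow> S = {VA1, VA, VB, VC} \<or> S = {VB1, VA, VB, VC} \<or> S = {VC1, VA, VB, VC}"
  by (simp add: tetrahedra_def)

lemma fc_subset: "fc w \<subseteq> S \<longleftrightarrow> (\<forall>X. X \<notin> S \<longrightarrow> w X = 0)"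
  by (auto simp: fc_def)

lemma tw_Wt:
  assumes "s \<in> TS (p, 1 - p - q, q)"
  shows "tw (p, q) s \<in> Wt"
proof -
  obtain s1 s2 s3 where s: "s = (s1, s2, s3)" by (cases s)
  note TS = assms[unfolded s TS_iff]
  have "\<exists>S\<in>tetrahedra. fc (tw (p, q) s) \<subseteq> S"
  proof -
    have fc: "s2 = 0 \<and> s3 = 0 \<Longrightarrow> fc (tw (p, q) s) \<subseteq> {VA1, VA, VB, VC}"
      "s1 = 0 \<and> s3 = 0 \<Longrightarrow> fc (tw (p, q) s) \<subseteq> {VB1, VA, VB, VC}"
      "s1 = 0 \<and> s2 = 0 \<Longrightarrow> fc (tw (p, q) s) \<subseteq> {VC1, VA, VB, VC}"
      unfolding fc_subset all_vertex s by simp_all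
    have "s2 = 0 \<and> s3 = 0 \<or> s1 = 0 \<and> s3 = 0 \<or> s1 = 0 \<and> s2 = 0" using TS by blast
    then show ?thesis unfolding Bex_def tetrahedra_iff using fc by blast
  qed
  moreover have "\<forall>X. 0 \<le> tw (p, q) s X" using TS by (simp add: all_vertex s)
  moreover have "sum (tw (p, q) s) UNIV = 1" unfolding sum_vertex by (simp add: s)
  ultimately show ?thesis unfolding Wt_def fc_subset by blast
qed

lemma leg_tetrahedron:
  assumes "s \<in> TS (p, 1 - p - q, q)" "t \<in> TS (p, 1 - p - q, q)"
  shows "leg s t \<longleftrightarrow> (\<exists>S\<in>tetrahedra. fc (tw (p, q) s) \<subseteq> S \<and> fc (tw (p, q) t) \<subseteq> S)"
proof -
  obtain s1 s2 s3 t1 t2 t3 where s: "s = (s1, s2, s3)" "t = (t1, t2, t3)" by (cases s; cases t)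
  show ?thesis unfolding s Bex_def tetrahedra_iff fc_subset leg_def by (auto simp: all_vertex)
qed

lemma tw_ex:
  assumes w: "w \<in> Wt" and "PP w = (p, q)"
  shows "\<exists>s\<in>TS (p, 1 - p - q, q). w = tw (p, q) s"
proof -
  have PP: "w VA = p - w VA1" "w VC = q - w VC1" using assms(2) by (auto simp: PP_def)
  have sum: "w VB = 1 - p - q - w VB1" using Wt_sum[OF w] PP unfolding sum_vertex by simp
  obtain S where S: "S \<in> tetrahedra" "\<forall>X. X \<notin> S \<longrightarrow> w X = 0" and nn: "\<forall>X. 0 \<le> w X"
    using w unfolding Wt_def by blast
  have legs: "w VB1 = 0 \<and> w VC1 = 0 \<or> w VA1 = 0 \<and> w VC1 = 0 \<or> w VA1 = 0 \<and> w VB1 = 0"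
    using S(1) S(2) unfolding tetrahedra_iff all_vertex by (elim disjE) simp_all
  have "w = tw (p, q) (w VA1, w VB1, w VC1)"
  proof
    fix X show "w X = tw (p, q) (w VA1, w VB1, w VC1) X" using PP sum by (cases X) simp_all
  qed
  moreover have "(w VA1, w VB1, w VC1) \<in> TS (p, 1 - p - q, q)"
    unfolding TS_iff using legs nn[unfolded all_vertex] PP sum by simp
  ultimately show ?thesis by blast
qed

text \<open>At the end of a leg an unprimed vertex has lost all its weight, which leaves only
  vertices fixed by the corresponding Greek generator.\<close>

lemma greek_GS:
  "g_al \<in> GS (fc (tw (p, q) s)) \<longleftrightarrow> s = (p, 0, 0)"
  "g_be \<in> GS (fc (tw (p, q) s)) \<longleftrightarrow> s = (0, 1 - p - q, 0)"
  "g_ga \<in> GS (fc (tw (p, q) s)) \<longleftrightarrow> s = (0, 0, q)"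
proof -
  obtain s1 s2 s3 where s: "s = (s1, s2, s3)" by (cases s)
  have GS: "g \<in> GS F \<longleftrightarrow> (\<forall>X. X \<in> F \<longrightarrow> g \<in> stab X)" for g F unfolding GS_def by blast
  show "g_al \<in> GS (fc (tw (p, q) s)) \<longleftrightarrow> s = (p, 0, 0)"
    unfolding GS greek_stab s fc_def mem_Collect_eq all_vertex by (simp, argo)
  show "g_be \<in> GS (fc (tw (p, q) s)) \<longleftrightarrow> s = (0, 1 - p - q, 0)"
    unfolding GS greek_stab s fc_def mem_Collect_eq all_vertex by (simp, argo)
  show "g_ga \<in> GS (fc (tw (p, q) s)) \<longleftrightarrow> s = (0, 0, q)"
    unfolding GS greek_stab s fc_def mem_Collect_eq all_vertex by (simp, argo)
qed

lemma fc_ne: "w \<in> Wt \<Longrightarrow> fc w \<noteq> {}"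
proof
  assume w: "w \<in> Wt" "fc w = {}"
  then have "w X = 0" for X by (auto simp: fc_def)
  then show False using Wt_sum[OF w(1)] by simp
qed

lemma fc_over:
  assumes "w \<in> Wt"
  shows "fc w \<subseteq> over (PP w)"
proof -
  have nn: "0 \<le> w VA" "0 \<le> w VB" "0 \<le> w VC" "0 \<le> w VA1" "0 \<le> w VB1" "0 \<le> w VC1"
    using assms by (simp_all add: Wt_def)
  have sum: "w VB + w VB1 = 1 - (w VA + w VA1 + (w VC + w VC1))" using Wt_sum[OF assms] unfolding sum_vertex by simp
  have "X \<in> over (PP w)" if X: "w X \<noteq> 0" for X
    using X nn sum unfolding over_def PP_def prod.case mem_Collect_eq by (cases X) auto
  then show ?thesis unfolding fc_def by blast
qed

text \<open>By \<open>IMG_iff\<close> elements of equal sign lie in one coset of \<open>IMG\<close>,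
  so in \<open>MM n\<close> only the sign of the group component matters.\<close>

lemma Mp_par:
  assumes "\<xi> \<in> Xi" "h \<in> Gam" "h' \<in> Gam" "length v = n" "par (nu h) = par (nu h')"
  shows "Mp n \<xi> v h = Mp n \<xi> v h'"
proof -
  obtain hi where hi: "hi \<in> Gam" "h \<circ> hi = id" "hi \<circ> h = id" using G.inv_ex[OF assms(2)] by blast
  have "par (nu hi) * par (nu h) = par (nu (hi \<circ> h))" by (simp add: nu_comp par_comp hi(1) assms)
  also have "\<dots> = 1" by (simp add: hi(3))
  finally have "par (nu (hi \<circ> h')) = 1" by (simp add: nu_comp par_comp hi(1) assms)
  then have "hi \<circ> h' \<in> IMG" by (simp add: IMG_iff G.comp_in hi(1) assms(3))
  then have "Mp n \<xi> v (h \<circ> (hi \<circ> h')) = Mp n \<xi> v h" by (rule Mp_k[OF assms(1,2,4)])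
  moreover have "h \<circ> (hi \<circ> h') = h'" unfolding comp_assoc[symmetric] hi(2) by simp
  ultimately show ?thesis by simp
qed

text \<open>Uniqueness of weights turns the hull condition of a fiber path into a condition on the
  vertices of nonzero weight.\<close>

lemma hull_supp:
  assumes "w \<in> Wt" "EE w \<in> convex hull (vpos ` S)"
  shows "fc w \<subseteq> S"
proof -
  let ?C = "{EE w' | w'. (\<forall>X. X \<notin> S \<longrightarrow> w' X = 0) \<and> sum w' UNIV = 1}"
  have "vpos ` S \<subseteq> ?C"
  proof
    fix z assume "z \<in> vpos ` S"
    then obtain X where X: "X \<in> S" "z = vpos X" by blast
    have "EE (\<lambda>Y. if Y = X then 1 else 0) = vpos X" unfolding EE_def by (simp add: if_distrib[of "\<lambda>c. c *\<^sub>R _"] cong: if_cong)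
    moreover have "sum (\<lambda>Y. if Y = X then 1 else (0::real)) UNIV = 1" by simp
    ultimately show "z \<in> ?C" using X by (intro CollectI exI[of _ "\<lambda>Y. if Y = X then 1 else 0"]) auto
  qed
  moreover have "convex ?C"
  proof (rule convexI)
    fix x z :: "real ^ 5" and a b :: real assume "x \<in> ?C" "z \<in> ?C" and ab: "0 \<le> a" "0 \<le> b" "a + b = 1"
    then obtain w1 w2 where w: "x = EE w1" "\<forall>X. X \<notin> S \<longrightarrow> w1 X = 0" "sum w1 UNIV = 1"
      "z = EE w2" "\<forall>X. X \<notin> S \<longrightarrow> w2 X = 0" "sum w2 UNIV = 1" by blast
    have "a *\<^sub>R x + b *\<^sub>R z = EE (\<lambda>X. a * w1 X + b * w2 X)"
      unfolding w EE_def by (simp add: scaleR_sum_right sum.distrib scaleR_add_left)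
    moreover have "sum (\<lambda>X. a * w1 X + b * w2 X) UNIV = 1"
      using w(3,6) ab by (simp add: sum.distrib sum_distrib_left[symmetric])
    ultimately show "a *\<^sub>R x + b *\<^sub>R z \<in> ?C" using w(2,5) by (intro CollectI exI[of _ "\<lambda>X. a * w1 X + b * w2 X"]) simp
  qed
  ultimately have "convex hull (vpos ` S) \<subseteq> ?C" by (rule hull_minimal)
  then obtain w' where w': "EE w = EE w'" "\<forall>X. X \<notin> S \<longrightarrow> w' X = 0" "sum w' UNIV = 1" using assms(2) by blast
  have "w = w'" by (rule EE_inj[OF w'(1)]) (simp add: Wt_sum assms(1) w'(3))
  then show ?thesis using w'(2) by (simp add: fc_subset)
qed

lemma supp_hull:
  assumes "w \<in> Wt" "fc w \<subseteq> S"
  shows "EE w \<in> convex hull (vpos ` S)"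
proof -
  have 0: "\<forall>X\<in>UNIV - S. w X = 0" using assms(2) by (auto simp: fc_def)
  have "EE w = (\<Sum>X\<in>S. w X *\<^sub>R vpos X)" unfolding EE_def by (rule sum.mono_neutral_right) (use 0 in \<open>auto simp: finite_vertex_set\<close>)
  moreover have "sum w S = 1" using Wt_sum[OF assms(1)] sum.mono_neutral_right[of UNIV S w] 0 finite_vertex_set[of UNIV] by auto
  moreover have "(\<Sum>X\<in>S. w X *\<^sub>R vpos X) \<in> convex hull (vpos ` S)" if "sum w S = 1"
    by (rule convex_sum) (use that assms(1) in \<open>auto simp: finite_vertex_set Wt_def intro: hull_inc\<close>)
  ultimately show ?thesis by simp
qed

lemma emb_pt_EE: "w \<in> Wt \<Longrightarrow> emb (pt w) = EE w"
  using T0_emb'[OF pt_T0] wt_pt by simp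

text \<open>Along one leg a single coordinate varies, so the Euclidean length used in fiber paths
  agrees with the l1-length of the tripod.\<close>

lemma dist_vec5_leg:
  assumes "leg (s1, s2, s3) (t1, t2, t3)"
  shows "dist (vec5 p q s1 s2 s3) (vec5 p q t1 t2 t3) = \<bar>s1 - t1\<bar> + \<bar>s2 - t2\<bar> + \<bar>s3 - t3\<bar>"
proof -
  have "dist (vec5 p q s1 s2 s3) (vec5 p q t1 t2 t3) =
      norm ((s1 - t1) *\<^sub>R axis 3 1 + (s2 - t2) *\<^sub>R axis 4 1 + (s3 - t3) *\<^sub>R axis 5 1 :: real ^ 5)"
    unfolding dist_norm vec5_def by (simp add: algebra_simps)
  then show ?thesis using assms unfolding leg_def by auto
qed

text \<open>The data of one fiber: a base point in the triangle, the word over which the points of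
  the fiber lie, and a group element that matters only through its orientation.\<close>

locale fib =
  fixes p q :: real and u :: "bin list" and g0 :: "letter aut" and n :: nat
  assumes DD: "(p, q) \<in> DD" and g0: "g0 \<in> Gam" and n: "n = length u"
begin

abbreviation "x3 \<equiv> (p, 1 - p - q, q)"
abbreviation "Tr \<equiv> tripod x3"
abbreviation "base \<equiv> Sp n (p, q) u (nu g0)"

lemma x3: "nonneg3 x3" using DD by (simp add: nonneg3_def DD_def)

lemma pts_Tr: "([], s) \<in> pts Tr \<longleftrightarrow> s \<in> TS x3"
  unfolding pts_tripod[OF x3] by blast

definition fb :: "bin list \<Rightarrow> real \<times> real \<times> real \<Rightarrow> M_point" where
  "fb t s = Mp n (pt (tw (p, q) s)) (vv u t) g0"

lemma gstep_iff:
  "gstep u Tr ([], s) t t' \<longleftrightarrow> (g_al \<in> GS (fc (tw (p, q) s)) \<and> t' = fA t) \<or>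
     (g_be \<in> GS (fc (tw (p, q) s)) \<and> t' = fB u t) \<or> (g_ga \<in> GS (fc (tw (p, q) s)) \<and> t' = fC u t)"
  unfolding gstep_def tripod_marks greek_GS by auto

text \<open>A Greek generator fixing the point is carried across the tensor sign. Its section is
  trivial under \<open>nu\<close>, so \<open>Mp_par\<close> absorbs the change of the group
  component.\<close>

lemma fb_move:
  assumes s: "s \<in> TS x3" and t: "length t = length u" "length t' = length u"
    and g: "g \<in> {g_al, g_be, g_ga}" "g \<in> GS (fc (tw (p, q) s))" "g (vv u t) = vv u t'"
  shows "fb t s = fb t' s"
proof -
  have w: "tw (p, q) s \<in> Wt" by (rule tw_Wt[OF s])
  have gG: "g \<in> Gam" "nu g = id" using g(1) Gam_gens by auto
  have len: "length (vv u t) = n" "length (vv u t') = n" using vv_props(3) t n by simp_all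
  have "fb t s = Mp n (xi_act (pt (tw (p, q) s)) g) (vv u t) g0"
    unfolding fb_def pt_fixed[OF w g(2)] ..
  also have "\<dots> = Mp n (pt (tw (p, q) s)) (vv u t') (sect g (vv u t) \<circ> g0)"
    using Mp_act[OF pt_Xi[OF w] gG(1) g0 len(1)] g(3) by simp
  also have "\<dots> = fb t' s"
    unfolding fb_def
    by (rule Mp_par[OF pt_Xi[OF w] G.comp_in[OF G.sect_in[OF gG(1)] g0] g0 len(2)])
      (simp add: nu_comp G.sect_in gG g0 nu_sect)
  finally show ?thesis .
qed

lemma gstep_fb:
  assumes "s \<in> TS x3" "length t = length u" "gstep u Tr ([], s) t t'"
  shows "length t' = length u \<and> fb t s = fb t' s"
  using assms(3) greek_vv[OF assms(2)] fb_move[OF assms(1,2)] unfolding gstep_iff by blast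

lemma gsteps_fb:
  assumes "s \<in> TS x3" "length t = length u" "(gstep u Tr ([], s))\<^sup>*\<^sup>* t t'"
  shows "length t' = length u \<and> fb t s = fb t' s"
  using assms(3)
proof (induction rule: rtranclp_induct)
  case base
  show ?case using assms by simp
next
  case (step y z)
  then show ?case using gstep_fb[OF assms(1) _ step(2)] by simp
qed

lemma greek_gsteps:
  assumes "m \<in> gen_by ({g_al, g_be, g_ga} \<inter> GS (fc (tw (p, q) s)))"
  shows "\<forall>t :: bin list. length t = length u \<longrightarrow> (\<exists>t' :: bin list. length t' = length u \<and> m (vv u t) = vv u t' \<and> (gstep u Tr ([], s))\<^sup>*\<^sup>* t t')"
proof -
  let ?R = "(gstep u Tr ([], s))\<^sup>*\<^sup>*"
  have inv: "involutive ({g_al, g_be, g_ga} \<inter> GS (fc (tw (p, q) s)))"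
    using involutive_greek unfolding involutive_def by blast
  show ?thesis
  proof (rule gen_by_induct[OF inv assms, where P = "\<lambda>m. \<forall>t :: bin list. length t = length u \<longrightarrow>
      (\<exists>t' :: bin list. length t' = length u \<and> m (vv u t) = vv u t' \<and> ?R t t')"])
    show "\<forall>t :: bin list. length t = length u \<longrightarrow> (\<exists>t' :: bin list. length t' = length u \<and> id (vv u t) = vv u t' \<and> ?R t t')"
      by auto
  next
    fix g m assume g: "g \<in> {g_al, g_be, g_ga} \<inter> GS (fc (tw (p, q) s))"
      and IH: "\<forall>t :: bin list. length t = length u \<longrightarrow> (\<exists>t' :: bin list. length t' = length u \<and> m (vv u t) = vv u t' \<and> ?R t t')"
    show "\<forall>t :: bin list. length t = length u \<longrightarrow> (\<exists>t' :: bin list. length t' = length u \<and> (g \<circ> m) (vv u t) = vv u t' \<and> ?R t t')"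
    proof (intro allI impI)
      fix t :: "bin list" assume "length t = length u"
      with IH obtain t1 where t1: "length t1 = length u" "m (vv u t) = vv u t1" "?R t t1" by blast
      have "\<exists>t' :: bin list. length t' = length u \<and> g (vv u t1) = vv u t' \<and> gstep u Tr ([], s) t1 t'"
        using greek_vv[OF t1(1)] g unfolding gstep_iff by blast
      then obtain t' where t': "length t' = length u" "g (vv u t1) = vv u t'" "gstep u Tr ([], s) t1 t'" by blast
      have "?R t t'" using t1(3) t'(3) by (rule rtranclp.rtrancl_into_rtrancl)
      then show "\<exists>t' :: bin list. length t' = length u \<and> (g \<circ> m) (vv u t) = vv u t' \<and> ?R t t'"
        using t' t1(2) by (intro exI[of _ t']) simp
    qed
  qed
qed

lemma fb_eq_iff:
  assumes s: "s \<in> TS x3" "s' \<in> TS x3" and t: "length t = length u" "length t' = length u"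
  shows "fb t s = fb t' s' \<longleftrightarrow> s = s' \<and> (gstep u Tr ([], s))\<^sup>*\<^sup>* t t'"
proof
  assume "s = s' \<and> (gstep u Tr ([], s))\<^sup>*\<^sup>* t t'"
  then show "fb t s = fb t' s'" using gsteps_fb[OF s(1) t(1)] by blast
next
  assume eq: "fb t s = fb t' s'"
  note w = tw_Wt[OF s(1)] and w' = tw_Wt[OF s(2)]
  have len: "length (vv u t) = n" "length (vv u t') = n" using vv_props(3) t n by simp_all
  obtain g j where g: "g \<in> Gam" "j \<in> IMG" "xi_act (pt (tw (p, q) s')) g = pt (tw (p, q) s)"
    "vv u t' = g (vv u t)" "g0 = sect g (vv u t) \<circ> g0 \<circ> j"
    using eq unfolding fb_def Mp_eq_iff[OF pt_Xi[OF w] pt_Xi[OF w'] g0 g0 len] by blast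
  have fund: "tw (p, q) s' = tw (p, q) s" "g \<in> GS (fc (tw (p, q) s'))"
    using pt_fundamental[OF w' w g(1,3)] by (rule conjunct1, rule conjunct2)
  have "EE (tw (p, q) s') = EE (tw (p, q) s)" using fund(1) by simp
  then have ss: "s = s'" by (cases s; cases s') (simp add: EE_tw)
  have sG: "sect g (vv u t) \<in> Gam" by (rule G.sect_in[OF g(1)])
  have jG: "j \<in> Gam" "par (nu j) = 1" using g(2) by (simp_all add: IMG_iff)
  \<comment> \<open>The sign of \<open>g0\<close> cancels and \<open>j\<close> has sign 1, so the
    section of \<open>g\<close> preserves orientation. By \<open>par_sect\<close> so does
    \<open>g\<close> itself, which is what \<open>GS_orbit\<close> requires.\<close>
  have "par (nu g0) = par (nu (sect g (vv u t) \<circ> g0 \<circ> j))" by (rule arg_cong[OF g(5)])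
  also have "\<dots> = par (nu (sect g (vv u t))) * par (nu g0)"
    by (simp add: nu_comp par_comp sG g0 jG G.comp_in hat.comp_in)
  finally have ps: "par (nu (sect g (vv u t))) = 1" using par_cases[OF nu_in[OF g0]] by auto
  have fix_u: "nu g u = u" using arg_cong[OF g(4), of "map mu_letter"] vv_props(1)[OF t(1)] vv_props(1)[OF t(2)]
    by (simp add: mu_app[OF g(1)])
  have "par (nu g) = 1"
    using ps par_sect[OF nu_in[OF g(1)] fix_u] unfolding nu_sect[OF g(1)] vv_props(1)[OF t(1)] by simp
  moreover have "map mu_letter (g (vv u t)) = map mu_letter (vv u t)"
    unfolding g(4)[symmetric] vv_props(1)[OF t(1)] vv_props(1)[OF t(2)] ..
  moreover obtain S where S: "S \<in> tetrahedra" "fc (tw (p, q) s') \<subseteq> S" using w' unfolding Wt_def fc_subset by blast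
  ultimately obtain m where m: "m \<in> gen_by ({g_al, g_be, g_ga} \<inter> GS (fc (tw (p, q) s')))" "g (vv u t) = m (vv u t)"
    using GS_orbit[OF fc_ne[OF w'] S(2,1) fund(2)] by blast
  obtain t1 where t1: "length t1 = length u" "m (vv u t) = vv u t1" "(gstep u Tr ([], s'))\<^sup>*\<^sup>* t t1"
    using greek_gsteps[OF m(1)] t(1) by blast
  have "vv u t' = vv u t1" using g(4) m(2) t1(2) by simp
  then have "t' = t1" using vv_props(2) t(2) t1(1) by metis
  then show "s = s' \<and> (gstep u Tr ([], s))\<^sup>*\<^sup>* t t'" using ss t1(3) by simp
qed

lemma fb_copy:
  assumes s: "s \<in> TS x3" "s' \<in> TS x3" and t: "length t = length u" "length t' = length u"
  shows "fb t s = fb t' s' \<longleftrightarrow> copy_emb (rev u) Tr (rev t) ([], s) = copy_emb (rev u) Tr (rev t') ([], s')"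
  unfolding fb_eq_iff[OF assms] by (subst copy_emb_eq_iff) (simp_all add: t)

lemma fb_fiber:
  assumes "s \<in> TS x3" "length t = length u"
  shows "fb t s \<in> fiber n base"
proof -
  note w = tw_Wt[OF assms(1)]
  have len: "length (vv u t) = n" using vv_props(3)[OF assms(2)] n by simp
  have "fb t s \<in> MM n" unfolding fb_def MM_iff using w len g0 by blast
  moreover have "rho n (fb t s) = base"
    unfolding fb_def rho_eq[OF pt_Xi[OF w] g0 len] P_map_pt[OF w] vv_props(1)[OF assms(2)] by simp
  ultimately show ?thesis by (simp add: fiber_def)
qed

text \<open>One index \<open>t\<close> serves all points of the tetrahedron \<open>S\<close> over
  the same base point. Hence a step of a fiber path stays inside one copy of the tripod.\<close>

lemma normal_form:
  assumes w: "w \<in> Wt" and h: "h \<in> Gam" and v: "length v = n"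
    and m: "Mp n (pt w) v h \<in> fiber n base" and S: "S \<in> tetrahedra" "fc w \<subseteq> S"
  shows "\<exists>t. length t = length u \<and> (\<forall>w'\<in>Wt. PP w' = PP w \<and> fc w' \<subseteq> S \<longrightarrow>
    (\<exists>s\<in>TS x3. w' = tw (p, q) s \<and> Mp n (pt w') v h = fb t s))"
proof -
  have "base = Sp n (PP w) (map mu_letter v) (nu h)"
    using m rho_eq[OF pt_Xi[OF w] h v] P_map_pt[OF w] by (simp add: fiber_def)
  then have eq: "Sp n (PP w) (map mu_letter v) (nu h) = base" by (rule sym)
  have len: "length (map mu_letter v) = n" using v by simp
  from Sp_eq_iff[OF nu_in[OF h] nu_in[OF g0] len n[symmetric], THEN iffD1, OF eq]
  obtain k j where k: "k \<in> GamHat" "j \<in> nu ` IMG" "isom k (p, q) = PP w" "u = k (map mu_letter v)"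
    "nu g0 = sect k (map mu_letter v) \<circ> nu h \<circ> j"
    by blast
  have PPw: "PP w = (p, q)"
    using W_fundamental[OF isom_W[OF k(1)] DD] PP_DD[OF w] k(3) by simp
  have kfix: "isom k (p, q) = (p, q)" using k(3) PPw by simp
  obtain g where g: "g \<in> Gam" "nu g = k" "\<forall>X\<in>S \<inter> over (p, q). g \<in> stab X"
    using hat_lift[OF k(1) DD kfix S(1)] by blast
  obtain j' where j': "j' \<in> IMG" "j = nu j'" using k(2) by blast
  have jG: "j' \<in> Gam" "par (nu j') = 1" using j'(1) by (simp_all add: IMG_iff)
  have sG: "sect g v \<in> Gam" by (rule G.sect_in[OF g(1)])
  have gv: "length (g v) = n" using g(1) v by simp
  have mugv: "map mu_letter (g v) = u" using mu_app[OF g(1)] g(2) k(4) by simp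
  have "nu g0 = nu (sect g v) \<circ> nu h \<circ> nu j'" unfolding nu_sect[OF g(1)] g(2) j'(2)[symmetric] by (rule k(5))
  then have "par (nu g0) = par (nu (sect g v) \<circ> nu h \<circ> nu j')" by (rule arg_cong)
  then have pars: "par (nu (sect g v \<circ> h)) = par (nu g0)"
    by (simp add: nu_comp par_comp sG h jG hat.comp_in)
  define t where "t = map side (g v)"
  have t: "length t = length u" using gv n by (simp add: t_def)
  have gvt: "g v = vv u t" using vv_split[of "g v"] unfolding mugv t_def .
  have "\<exists>s\<in>TS x3. w' = tw (p, q) s \<and> Mp n (pt w') v h = fb t s"
    if w': "w' \<in> Wt" "PP w' = PP w" "fc w' \<subseteq> S" for w'
  proof -
    have "g \<in> GS (fc w')" unfolding GS_def using g(3) fc_over[OF w'(1)] w'(2,3) PPw by auto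
    then have "Mp n (pt w') v h = Mp n (xi_act (pt w') g) v h" using pt_fixed[OF w'(1)] by simp
    also have "\<dots> = Mp n (pt w') (g v) (sect g v \<circ> h)" by (rule Mp_act[OF pt_Xi[OF w'(1)] g(1) h v])
    also have "\<dots> = Mp n (pt w') (g v) g0" by (rule Mp_par[OF pt_Xi[OF w'(1)] G.comp_in[OF sG h] g0 gv pars])
    finally have "Mp n (pt w') v h = Mp n (pt w') (vv u t) g0" unfolding gvt .
    moreover obtain s where "s \<in> TS x3" "w' = tw (p, q) s" using tw_ex[OF w'(1)] w'(2) PPw by auto
    ultimately show ?thesis unfolding fb_def by blast
  qed
  then show ?thesis using t by blast
qed

lemma fiber_fb:
  assumes "m \<in> fiber n base"
  shows "\<exists>t s. length t = length u \<and> s \<in> TS x3 \<and> m = fb t s"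
proof -
  obtain w v h where w: "w \<in> Wt" "length v = n" "h \<in> Gam" "m = Mp n (pt w) v h"
    using assms unfolding fiber_def MM_iff by blast
  obtain S where S: "S \<in> tetrahedra" "fc w \<subseteq> S" using w(1) unfolding Wt_def fc_subset by blast
  show ?thesis
    using normal_form[OF w(1,3,2) assms[unfolded w(4)] S] w(1,4) S(2) by blast
qed

definition hh :: "M_point \<Rightarrow> bin list \<times> real \<times> real \<times> real" where
  "hh m = (THE z. \<exists>t s. length t = length u \<and> s \<in> TS x3 \<and> m = fb t s \<and> z = copy_emb (rev u) Tr (rev t) ([], s))"

lemma hh_fb:
  assumes "s \<in> TS x3" "length t = length u"
  shows "hh (fb t s) = copy_emb (rev u) Tr (rev t) ([], s)"
  unfolding hh_def
proof (rule the_equality)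
  show "\<exists>t' s'. length t' = length u \<and> s' \<in> TS x3 \<and> fb t s = fb t' s' \<and>
    copy_emb (rev u) Tr (rev t) ([], s) = copy_emb (rev u) Tr (rev t') ([], s')" using assms by blast
next
  fix z assume "\<exists>t' s'. length t' = length u \<and> s' \<in> TS x3 \<and> fb t s = fb t' s' \<and> z = copy_emb (rev u) Tr (rev t') ([], s')"
  then obtain t' s' where z: "length t' = length u" "s' \<in> TS x3" "fb t s = fb t' s'" "z = copy_emb (rev u) Tr (rev t') ([], s')"
    by blast
  show "z = copy_emb (rev u) Tr (rev t) ([], s)"
    using fb_copy[OF assms(1) z(2) assms(2) z(1)] z(3,4) by simp
qed

lemma hh_bij: "bij_betw hh (fiber n base) (pts (foldr Phi (rev u) Tr))"
  unfolding bij_betw_def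
proof
  show "inj_on hh (fiber n base)"
  proof (rule inj_onI)
    fix m m' assume mm: "m \<in> fiber n base" "m' \<in> fiber n base" "hh m = hh m'"
    obtain t s where t: "length t = length u" "s \<in> TS x3" "m = fb t s" using fiber_fb[OF mm(1)] by blast
    obtain t' s' where t': "length t' = length u" "s' \<in> TS x3" "m' = fb t' s'" using fiber_fb[OF mm(2)] by blast
    show "m = m'" using mm(3) fb_copy[OF t(2) t'(2) t(1) t'(1)]
      unfolding t(3) t'(3) hh_fb[OF t(2,1)] hh_fb[OF t'(2,1)] by blast
  qed
  show "hh ` fiber n base = pts (foldr Phi (rev u) Tr)"
  proof (intro equalityI subsetI)
    fix z assume "z \<in> hh ` fiber n base"
    then obtain m where m: "m \<in> fiber n base" "z = hh m" by blast
    obtain t s where t: "length t = length u" "s \<in> TS x3" "m = fb t s" using fiber_fb[OF m(1)] by blast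
    show "z \<in> pts (foldr Phi (rev u) Tr)"
      unfolding m(2) t(3) hh_fb[OF t(2,1)] by (rule copy_emb_in) (simp_all add: t pts_Tr)
  next
    fix z assume "z \<in> pts (foldr Phi (rev u) Tr)"
    then obtain t z' where tz: "length t = length (rev u)" "z' \<in> pts Tr" "z = copy_emb (rev u) Tr t z'"
      unfolding pts_foldr by blast
    obtain s where s: "z' = ([], s)" "s \<in> TS x3" using tz(2) unfolding pts_tripod[OF x3] by blast
    have "length (rev t) = length u" using tz(1) by simp
    then have "hh (fb (rev t) s) = z" "fb (rev t) s \<in> fiber n base"
      using hh_fb[OF s(2)] fb_fiber[OF s(2)] tz(3) s(1) by simp_all
    then show "z \<in> hh ` fiber n base" by blast
  qed
qed

abbreviation "dd m m' \<equiv> tdist (foldr Phi (rev u) Tr) (hh m) (hh m')"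

lemma hh_in: "m \<in> fiber n base \<Longrightarrow> hh m \<in> pts (foldr Phi (rev u) Tr)"
  using hh_bij unfolding bij_betw_def by blast

lemma mt_fold: "mt (foldr Phi (rev u) Tr)"
  by (rule mt_foldr[OF mt_tripod[OF x3]])

lemma dd_fb:
  assumes "s \<in> TS x3" "s' \<in> TS x3" "length t = length u"
  shows "dd (fb t s) (fb t s') = tdist Tr ([], s) ([], s')"
  unfolding hh_fb[OF assms(1,3)] hh_fb[OF assms(2,3)]
  by (rule copy_emb_dist[OF mt_tripod[OF x3]]) (simp_all add: pts_Tr assms)

lemma leg_dist:
  assumes s: "s \<in> TS x3" "s' \<in> TS x3" and leg: "leg s s'"
  shows "dist (emb (pt (tw (p, q) s))) (emb (pt (tw (p, q) s'))) = tdist Tr ([], s) ([], s')"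
proof -
  obtain s1 s2 s3 t1 t2 t3 where st: "s = (s1, s2, s3)" "s' = (t1, t2, t3)" by (cases s; cases s')
  show ?thesis unfolding emb_pt_EE[OF tw_Wt[OF s(1)]] emb_pt_EE[OF tw_Wt[OF s(2)]]
    unfolding st EE_tw tdist_tripod by (rule dist_vec5_leg[OF leg[unfolded st]])
qed

text \<open>The length of a step equals the distance in the glued tree, so the triangle inequality
  bounds the total. That a path stays in its fiber has to be proved along with it, since the next
  step relies on it.\<close>

lemma fiber_path_lower:
  assumes "fiber_path n m m' l" "m \<in> fiber n base"
  shows "m' \<in> fiber n base \<and> dd m m' \<le> l"
  using assms
proof (induction rule: fiber_path.induct)
  case (refl m)
  then show ?case using mt_D(4)[OF mt_fold hh_in] by simp
next
  case (step m \<xi> w l \<xi>' S)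
  obtain v h where vh: "w = (v, h)" "length v = n" "h \<in> Gam" using step(2) unfolding bimod_def by auto
  obtain w1 where w1: "w1 \<in> Wt" "\<xi> = pt w1" using T0_pt[OF step(3)] by blast
  obtain w2 where w2: "w2 \<in> Wt" "\<xi>' = pt w2" using T0_pt[OF step(4)] by blast
  have IH: "Mp n (pt w1) v h \<in> fiber n base" "dd m (Mp n (pt w1) v h) \<le> l"
    using step(8)[OF step(9)] unfolding w1(2) vh(1) by blast+
  have S1: "fc w1 \<subseteq> S" by (rule hull_supp[OF w1(1)]) (use step(7) emb_pt_EE[OF w1(1)] w1(2) in simp)
  have S2: "fc w2 \<subseteq> S" by (rule hull_supp[OF w2(1)]) (use step(7) emb_pt_EE[OF w2(1)] w2(2) in simp)
  have PP: "PP w2 = PP w1" using step(5) unfolding w1(2) w2(2) P_map_pt[OF w1(1)] P_map_pt[OF w2(1)] by simp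
  obtain t where t: "length t = length u" "\<forall>w'\<in>Wt. PP w' = PP w1 \<and> fc w' \<subseteq> S \<longrightarrow>
    (\<exists>s\<in>TS x3. w' = tw (p, q) s \<and> Mp n (pt w') v h = fb t s)"
    using normal_form[OF w1(1) vh(3,2) IH(1) step(6) S1] by blast
  obtain s where s: "s \<in> TS x3" "w1 = tw (p, q) s" "Mp n (pt w1) v h = fb t s"
    using t(2)[rule_format, OF w1(1)] S1 by blast
  obtain s' where s': "s' \<in> TS x3" "w2 = tw (p, q) s'" "Mp n (pt w2) v h = fb t s'"
    using t(2)[rule_format, OF w2(1)] S2 PP by blast
  have "leg s s'" unfolding leg_tetrahedron[OF s(1) s'(1)] using S1 S2 step(6) s(2) s'(2) by blast
  then have d: "dist (emb \<xi>) (emb \<xi>') = dd (fb t s) (fb t s')"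
    unfolding w1(2) w2(2) s(2) s'(2) dd_fb[OF s(1) s'(1) t(1)] by (rule leg_dist[OF s(1) s'(1)])
  have f2: "fb t s' \<in> fiber n base" by (rule fb_fiber[OF s'(1) t(1)])
  have "dd m (fb t s') \<le> dd m (fb t s) + dd (fb t s) (fb t s')"
    by (rule mt_D(7)[OF mt_fold hh_in[OF step(9)] hh_in[OF fb_fiber[OF s(1) t(1)]] hh_in[OF f2]])
  then show ?case unfolding vh(1) d unfolding w2(2) s'(3) using f2 IH(2)[unfolded s(3)] by simp
qed

text \<open>Leg steps of the glued tree lift one by one to steps in the fiber. With
  \<open>copy_path\<close> this shows that the infimum of the lengths is attained.\<close>

lemma fiber_path_upper:
  assumes "lpath (copy_step (rev u) Tr (leg_step x3)) z z' l" "m \<in> fiber n base" "z = hh m"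
  shows "\<exists>m'\<in>fiber n base. hh m' = z' \<and> fiber_path n m m' l"
  using assms
proof (induction rule: lpath.induct)
  case (lpath_nil z)
  then show ?case using fiber_path.refl[of m n] by (auto simp: fiber_def)
next
  case (lpath_step z z1 l z2 r)
  obtain m1 where m1: "m1 \<in> fiber n base" "hh m1 = z1" "fiber_path n m m1 l"
    using lpath_step(3)[OF lpath_step(4,5)] by blast
  obtain t a b where ab: "length t = length (rev u)" "leg_step x3 a b r" "z1 = copy_emb (rev u) Tr t a"
    "z2 = copy_emb (rev u) Tr t b" using lpath_step(2) unfolding copy_step_def by blast
  obtain s where s: "a = ([], s)" "s \<in> TS x3" using ab(2) unfolding leg_step_def pts_tripod[OF x3] by blast
  obtain s' where s': "b = ([], s')" "s' \<in> TS x3" using ab(2) unfolding leg_step_def pts_tripod[OF x3] by blast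
  have leg: "leg s s'" and r: "r = tdist Tr ([], s) ([], s')" using ab(2) unfolding leg_step_def s(1) s'(1) by simp_all
  have t: "length (rev t) = length u" using ab(1) by simp
  have hz: "hh (fb (rev t) s) = z1" "hh (fb (rev t) s') = z2"
    using hh_fb[OF s(2) t] hh_fb[OF s'(2) t] ab(3,4) s(1) s'(1) by simp_all
  have "m1 = fb (rev t) s"
    using hh_bij m1(1,2) hz(1) fb_fiber[OF s(2) t] unfolding bij_betw_def inj_on_def by metis
  then have fp: "fiber_path n m (fb (rev t) s) l" using m1(3) by simp
  obtain S where S: "S \<in> tetrahedra" "fc (tw (p, q) s) \<subseteq> S" "fc (tw (p, q) s') \<subseteq> S"
    using leg leg_tetrahedron[OF s(2) s'(2)] by blast
  note w = tw_Wt[OF s(2)] and w' = tw_Wt[OF s'(2)]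
  have "fiber_path n m (fb (rev t) s') (l + dist (emb (pt (tw (p, q) s))) (emb (pt (tw (p, q) s'))))"
    unfolding fb_def
  proof (rule fiber_path.step[OF fp[unfolded fb_def] _ pt_T0[OF w] pt_T0[OF w'] _ S(1)])
    show "(vv u (rev t), g0) \<in> bimod Gam n" using vv_props(3)[OF t] g0 n by (simp add: bimod_pair)
    show "P_map (pt (tw (p, q) s)) = P_map (pt (tw (p, q) s'))" by (simp add: P_map_pt w w')
    show "{emb (pt (tw (p, q) s)), emb (pt (tw (p, q) s'))} \<subseteq> convex hull (vpos ` S)"
      using supp_hull[OF w S(2)] supp_hull[OF w' S(3)] by (simp add: emb_pt_EE w w')
  qed
  then have "fiber_path n m (fb (rev t) s') (l + r)" unfolding leg_dist[OF s(2) s'(2) leg] r .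
  then show ?case using fb_fiber[OF s'(2) t] hz(2) by blast
qed

lemma fiber_dist_dd:
  assumes "m \<in> fiber n base" "m' \<in> fiber n base"
  shows "fiber_dist n m m' = dd m m'"
  unfolding fiber_dist_def
proof (rule cInf_eq_minimum)
  have "lpath (copy_step (rev u) Tr (leg_step x3)) (hh m) (hh m') (dd m m')"
    by (rule copy_path[OF mt_tripod[OF x3] tripod_path[OF x3] hh_in hh_in]) (use assms in auto)
  then obtain m1 where m1: "m1 \<in> fiber n base" "hh m1 = hh m'" "fiber_path n m m1 (dd m m')"
    using fiber_path_upper[OF _ assms(1)] by blast
  have "m1 = m'" using hh_bij m1(1,2) assms(2) unfolding bij_betw_def inj_on_def by metis
  then show "dd m m' \<in> {l. fiber_path n m m' l}" using m1(3) by simp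
next
  fix l assume "l \<in> {l. fiber_path n m m' l}"
  then show "dd m m' \<le> l" using fiber_path_lower assms(1) by blast
qed

lemma hh_isometry:
  "isometry hh (fiber n base) (fiber_dist n) (pts (foldr Phi (rev u) Tr)) (tdist (foldr Phi (rev u) Tr))"
  unfolding isometry_def using hh_bij fiber_dist_dd by simp

end

section \<open>The itinerary\<close>

text \<open>The link between the definition of \<open>I\<close> and the trees: \<open>psi\<close>
  collects the weights that \<open>I\<close> puts on the primed vertices.\<close>

lemma Iw_tw: "Iw (mk k c) (tw (p, q) s) = tw (LL k (p, q)) (psi k c p s)"
proof
  fix X
  obtain s1 s2 s3 where s: "s = (s1, s2, s3)" by (cases s)
  show "Iw (mk k c) (tw (p, q) s) X = tw (LL k (p, q)) (psi k c p s) X"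
    unfolding Iw_def sum_vertex s bw_def by (cases k; cases c; cases X; simp add: LL_def field_simps)
qed

lemma iota_fb:
  assumes a: "fib p' q' (k # u) g (Suc n)" and b: "fib p q u g n" and LL: "LL k (p', q') = (p, q)"
    and s: "s \<in> TS (p', 1 - p' - q', q')" and t: "length t = length u"
  shows "psi k c p' s \<in> TS (p, 1 - p - q, q) \<and>
    iota n (fib.fb p' q' (k # u) g (Suc n) (c # t) s) = fib.fb p q u g n t (psi k c p' s)"
proof -
  interpret a: fib p' q' "k # u" g "Suc n" by (rule a)
  interpret b: fib p q u g n by (rule b)
  note w = tw_Wt[OF s]
  have eq: "Iw (mk k c) (tw (p', q') s) = tw (p, q) (psi k c p' s)" unfolding Iw_tw LL ..
  have "tw (p, q) (psi k c p' s) \<in> Wt" using Iw_Wt[OF w, of "mk k c"] unfolding eq .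
  then obtain s' where s': "s' \<in> TS (p, 1 - p - q, q)" "tw (p, q) (psi k c p' s) = tw (p, q) s'"
    using tw_ex[OF _ tw_PP] by blast
  have "EE (tw (p, q) (psi k c p' s)) = EE (tw (p, q) s')" by (rule arg_cong[OF s'(2)])
  then have "psi k c p' s = s'" by (cases "psi k c p' s"; cases s') (simp add: EE_tw)
  moreover have "iota n (a.fb (c # t) s) = b.fb t (psi k c p' s)"
    unfolding a.fb_def b.fb_def vv_simps
    using iota_eq[OF w b.g0, of "vv u t" n "mk k c"] vv_props(3)[OF t] b.n unfolding eq by simp
  ultimately show ?thesis using s'(1) by simp
qed

text \<open>The total length 1 of the tripod is preserved because
  \<open>\<bar>p - q\<bar> + 2 * min p q = p + q\<close>, so the new leg lengths again describe a
  point of the triangle. The comparison of \<open>p\<close> and \<open>q\<close> selects the half in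
  which the old point lies.\<close>

lemma FF_step:
  assumes "(p, q) \<in> DD" and "k = (if q > p then One else Two)"
  shows "\<exists>p' q'. FF (p, 1 - p - q, q) = (p', 1 - p' - q', q') \<and> (p', q') \<in> DD \<and> LL k (p', q') = (p, q)"
proof (intro exI conjI)
  show "FF (p, 1 - p - q, q) = (\<bar>p - q\<bar>, 1 - \<bar>p - q\<bar> - (1 - p - q), 1 - p - q)"
    by (auto simp: FF_def)
  show "(\<bar>p - q\<bar>, 1 - p - q) \<in> DD" using assms(1) by (auto simp: DD_def)
  show "LL k (\<bar>p - q\<bar>, 1 - p - q) = (p, q)" using assms(2) by (auto simp: LL_def field_simps)
qed

lemma itinerary_Suc: "(FF ^^ n) x = (y1, y2, y3) \<Longrightarrow> itinerary x (Suc n) = (if y3 > y1 then One else Two)"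
  by (simp add: itinerary_def)

lemma itinerary_prefix_Suc: "itinerary_prefix x (Suc n) = itinerary_prefix x n @ [itinerary x (Suc n)]"
  by (simp add: itinerary_prefix_def)

lemma length_itinerary_prefix [simp]: "length (itinerary_prefix x n) = n"
  by (simp add: itinerary_prefix_def)

text \<open>The three distances between the marks determine the legs of a tripod. Hence the given
  lengths are the barycentric coordinates of the base point.\<close>

lemma fiber0_coordinates:
  assumes "(p, q) \<in> DD" "g \<in> Gam" "marked_isometry f (fiber0 p q g) (tripod x)" "nonneg3 x"
  shows "x = (p, 1 - p - q, q)"
proof -
  interpret fib p q "[]" g 0 by unfold_locales (simp_all add: assms)
  obtain x1 x2 x3 where x: "x = (x1, x2, x3)" by (cases x)
  have Z: "pts (fiber0 p q g) = fiber 0 base" "tdist (fiber0 p q g) = fiber_dist 0"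
    "Zal (fiber0 p q g) = fb [] (p, 0, 0)" "Zbe (fiber0 p q g) = fb [] (0, 1 - p - q, 0)"
    "Zga (fiber0 p q g) = fb [] (0, 0, q)"
    by (simp_all add: fiber0_def fiber0_base_def fb_def pt_def EE_tw Let_def)
  have TS: "(p, 0, 0) \<in> TS (p, 1 - p - q, q)" "(0, 1 - p - q, 0) \<in> TS (p, 1 - p - q, q)" "(0, 0, q) \<in> TS (p, 1 - p - q, q)"
    using assms(1) by (simp_all add: TS_iff DD_def)
  have d: "fiber_dist 0 (fb [] s) (fb [] s') = tdist Tr ([], s) ([], s')"
    if "s \<in> TS (p, 1 - p - q, q)" "s' \<in> TS (p, 1 - p - q, q)" for s s'
    using fiber_dist_dd[OF fb_fiber[OF that(1), of "[]"] fb_fiber[OF that(2), of "[]"]] dd_fb[OF that, of "[]"] by simp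
  have fZ: "f (fb [] (p, 0, 0)) = ([], x1, 0, 0)" "f (fb [] (0, 1 - p - q, 0)) = ([], 0, x2, 0)"
    "f (fb [] (0, 0, q)) = ([], 0, 0, x3)"
    using assms(3) unfolding marked_isometry_def Z x tripod_marks by blast+
  have iso: "tdist (tripod x) (f (fb [] s)) (f (fb [] s')) = fiber_dist 0 (fb [] s) (fb [] s')"
    if "s \<in> TS (p, 1 - p - q, q)" "s' \<in> TS (p, 1 - p - q, q)" for s s'
    using assms(3) fb_fiber[OF that(1), of "[]"] fb_fiber[OF that(2), of "[]"]
    unfolding marked_isometry_def isometry_def Z by simp
  have "\<bar>x1\<bar> + \<bar>x2\<bar> = \<bar>p\<bar> + \<bar>q - (1 - p)\<bar>" "\<bar>x2\<bar> + \<bar>x3\<bar> = \<bar>1 - p - q\<bar> + \<bar>q\<bar>" "\<bar>x1\<bar> + \<bar>x3\<bar> = \<bar>p\<bar> + \<bar>q\<bar>"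
    using iso[OF TS(1,2)] iso[OF TS(2,3)] iso[OF TS(1,3)]
    unfolding d[OF TS(1,2)] d[OF TS(2,3)] d[OF TS(1,3)] fZ tdist_tripod by simp_all
  moreover have "0 \<le> x1" "0 \<le> x2" "0 \<le> x3" "0 \<le> p" "0 \<le> q" "0 \<le> 1 - p - q"
    using assms(1,4) by (simp_all add: nonneg3_def x DD_def)
  ultimately show ?thesis unfolding x by simp
qed

text \<open>The expected point of the next level is mapped by \<open>lam\<close> to the given one,
  and \<open>lam_inj\<close> shows that it is the only one. Each step prepends its itinerary letter,
  whence the reversal.\<close>

lemma fiber_base:
  assumes "\<zeta> \<in> S_infinity" "\<zeta> 0 = Sp 0 (p, q) [] (nu g)" "(p, q) \<in> DD" "g \<in> Gam" "x = (p, 1 - p - q, q)"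
  shows "\<exists>p' q'. (FF ^^ n) x = (p', 1 - p' - q', q') \<and> (p', q') \<in> DD \<and>
    \<zeta> n = Sp n (p', q') (rev (itinerary_prefix x n)) (nu g)"
proof (induction n)
  case 0
  show ?case using assms by (simp add: itinerary_prefix_def)
next
  case (Suc n)
  then obtain p1 q1 where 1: "(FF ^^ n) x = (p1, 1 - p1 - q1, q1)" "(p1, q1) \<in> DD"
    "\<zeta> n = Sp n (p1, q1) (rev (itinerary_prefix x n)) (nu g)" by blast
  let ?k = "itinerary x (Suc n)"
  obtain p2 q2 where 2: "FF (p1, 1 - p1 - q1, q1) = (p2, 1 - p2 - q2, q2)" "(p2, q2) \<in> DD" "LL ?k (p2, q2) = (p1, q1)"
    using FF_step[OF 1(2) itinerary_Suc[OF 1(1)]] by blast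
  have "\<zeta> (Suc n) \<in> SS (Suc n)" and lam: "lam n (\<zeta> (Suc n)) = \<zeta> n" using assms(1) unfolding S_infinity_def by blast+
  then obtain y v k where v: "length v = Suc n" "k \<in> GamHat" "\<zeta> (Suc n) = Sp (Suc n) y v k" using SS_rep by blast
  obtain c v' where v': "v = c # v'" "length v' = n" using v(1) by (cases v) auto
  have "Sp n (LL c y) v' k = Sp n (LL ?k (p2, q2)) (rev (itinerary_prefix x n)) (nu g)"
    using lam lam_eq[OF v(2) v'(2)] unfolding v(3) v'(1) 2(3) 1(3) by simp
  then have "\<zeta> (Suc n) = Sp (Suc n) (p2, q2) (?k # rev (itinerary_prefix x n)) (nu g)"
    unfolding v(3) v'(1) by (intro lam_inj) (simp_all add: v v' assms(4))
  then show ?case using 1(1) 2 by (simp add: itinerary_prefix_Suc)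
qed

theorem proposition6p6:
  fixes \<zeta> :: "nat \<Rightarrow> S_point" and x :: "real \<times> real \<times> real"
  assumes "\<zeta> \<in> S_infinity"
    and "fiber0_is_tripod (\<zeta> 0) x"
  shows "\<exists>(h :: nat \<Rightarrow> M_point \<Rightarrow> bin list \<times> (real \<times> real \<times> real)) \<phi>. \<forall>n.
    (let T = tripod ((FF ^^ n) x);
         T' = tripod ((FF ^^ Suc n) x);
         ks = itinerary_prefix x n;
         U = Phi (itinerary x (Suc n)) T'
     in isometry (h n) (fiber n (\<zeta> n)) (fiber_dist n) (pts (foldr Phi ks T)) (tdist (foldr Phi ks T)) \<and>
        iota n ` fiber (Suc n) (\<zeta> (Suc n)) \<subseteq> fiber n (\<zeta> n) \<and>
        marked_isometry (\<phi> n) (halved_hubbard U) T \<and>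
        (\<forall>m\<in>fiber (Suc n) (\<zeta> (Suc n)). \<forall>u p. length u = n \<and> p \<in> pts U \<and>
           h (Suc n) m = copy_emb ks U u p \<longrightarrow>
           h n (iota n m) = copy_emb ks T u (\<phi> n (tree_proj U (hubbard U) p))))"
proof -
  obtain x1 x2 x3 where x: "x = (x1, x2, x3)" by (cases x)
  obtain p0 q0 g f where pq: "nonneg3 x" "g \<in> Gam" "(p0, q0) \<in> DD" "\<zeta> 0 = fiber0_base p0 q0 g"
    "marked_isometry f (fiber0 p0 q0 g) (tripod x)"
    using assms(2) unfolding fiber0_is_tripod_def x prod.case nonneg3_def DD_def by blast
  have "x = (p0, 1 - p0 - q0, q0)" by (rule fiber0_coordinates[OF pq(3,2,5,1)])
  moreover have "\<zeta> 0 = Sp 0 (p0, q0) [] (nu g)" unfolding pq(4) fiber0_base_def ..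
  ultimately have "\<exists>y. (FF ^^ n) x = (fst y, 1 - fst y - snd y, snd y) \<and> y \<in> DD \<and>
      \<zeta> n = Sp n y (rev (itinerary_prefix x n)) (nu g)" for n
    using fiber_base[OF assms(1) _ pq(3,2), of x n] by auto
  then obtain y where y: "\<And>n. (FF ^^ n) x = (fst (y n), 1 - fst (y n) - snd (y n), snd (y n))" "\<And>n. y n \<in> DD"
      "\<And>n. \<zeta> n = Sp n (y n) (rev (itinerary_prefix x n)) (nu g)" by metis
  define p q u where "p n = fst (y n)" and "q n = snd (y n)" and "u n = rev (itinerary_prefix x n)" for n
  have FFn: "(FF ^^ n) x = (p n, 1 - p n - q n, q n)" for n using y(1) by (simp add: p_def q_def)
  have DD: "(p n, q n) \<in> DD" for n using y(2) by (simp add: p_def q_def)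
  have \<zeta>: "\<zeta> n = Sp n (p n, q n) (u n) (nu g)" for n using y(3) by (simp add: p_def q_def u_def)
  have fib: "fib (p n) (q n) (u n) g n" for n by unfold_locales (simp_all add: DD pq(2) u_def)
  define h where "h n = fib.hh (p n) (q n) (u n) g n" for n
  have "\<exists>\<phi>. (let T = tripod ((FF ^^ n) x);
         T' = tripod ((FF ^^ Suc n) x);
         ks = itinerary_prefix x n;
         U = Phi (itinerary x (Suc n)) T'
     in isometry (h n) (fiber n (\<zeta> n)) (fiber_dist n) (pts (foldr Phi ks T)) (tdist (foldr Phi ks T)) \<and>
        iota n ` fiber (Suc n) (\<zeta> (Suc n)) \<subseteq> fiber n (\<zeta> n) \<and>
        marked_isometry \<phi> (halved_hubbard U) T \<and>
        (\<forall>m\<in>fiber (Suc n) (\<zeta> (Suc n)). \<forall>u p. length u = n \<and> p \<in> pts U \<and>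
           h (Suc n) m = copy_emb ks U u p \<longrightarrow>
           h n (iota n m) = copy_emb ks T u (\<phi> (tree_proj U (hubbard U) p))))" for n
  proof -
    define k where "k = itinerary x (Suc n)"
    have kp: "k = (if q n > p n then One else Two)" unfolding k_def by (rule itinerary_Suc[OF FFn])
    have uS: "u (Suc n) = k # u n" by (simp add: u_def itinerary_prefix_Suc k_def)
    have ks: "itinerary_prefix x n = rev (u n)" by (simp add: u_def)
    interpret b: fib "p n" "q n" "u n" g n by (rule fib)
    have fibS: "fib (p (Suc n)) (q (Suc n)) (k # u n) g (Suc n)" using fib[of "Suc n"] unfolding uS .
    interpret a: fib "p (Suc n)" "q (Suc n)" "k # u n" g "Suc n" by (rule fibS)
    have FS: "FF (p n, 1 - p n - q n, q n) = (p (Suc n), 1 - p (Suc n) - q (Suc n), q (Suc n))"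
      using FFn[of "Suc n"] FFn[of n] by simp
    have LL: "LL k (p (Suc n), q (Suc n)) = (p n, q n)"
    proof -
      obtain p' q' where "FF (p n, 1 - p n - q n, q n) = (p', 1 - p' - q', q')" "LL k (p', q') = (p n, q n)"
        using FF_step[OF DD kp] by blast
      then show ?thesis unfolding FS by simp
    qed
    have pS: "p (Suc n) = \<bar>p n - q n\<bar>" using FS by (simp add: FF_def)
    have nn: "0 \<le> p n" "0 \<le> 1 - p n - q n" "0 \<le> q n" using DD[of n] by (simp_all add: DD_def)
    define U where "U = Phi k a.Tr"
    obtain \<phi> where \<phi>: "marked_isometry \<phi> (halved_hubbard U) b.Tr"
      "\<And>i s. s \<in> TS a.x3 \<Longrightarrow> \<phi> (tree_proj U (hubbard U) (glue_copy a.Tr i ([], s))) = ([], psi k i (p (Suc n)) s)"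
      using Phi_halved[OF nn kp] unfolding FS pS[symmetric] U_def by blast
    have im: "iota n (a.fb (c # t) s) = b.fb t (psi k c (p (Suc n)) s) \<and> psi k c (p (Suc n)) s \<in> TS b.x3"
      if "s \<in> TS a.x3" "length t = length (u n)" for c t s
      using iota_fb[OF fibS fib LL that] by blast
    have "iota n ` fiber (Suc n) (\<zeta> (Suc n)) \<subseteq> fiber n (\<zeta> n)"
    proof
      fix m' assume "m' \<in> iota n ` fiber (Suc n) (\<zeta> (Suc n))"
      then obtain m where m: "m \<in> fiber (Suc n) a.base" "m' = iota n m" unfolding \<zeta> uS by blast
      obtain t' s where t': "length t' = length (k # u n)" "s \<in> TS a.x3" "m = a.fb t' s" using a.fiber_fb[OF m(1)] by blast
      obtain c t where t: "t' = c # t" "length t = length (u n)" using t'(1) by (cases t') auto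
      show "m' \<in> fiber n (\<zeta> n)" unfolding \<zeta> m(2) t'(3) t(1) using im[OF t'(2) t(2)] b.fb_fiber t(2) by simp
    qed
    moreover have "h n (iota n m) = copy_emb (rev (u n)) b.Tr v (\<phi> (tree_proj U (hubbard U) z))"
      if m: "m \<in> fiber (Suc n) (\<zeta> (Suc n))" and v: "length v = n" and z: "z \<in> pts U"
        and hm: "h (Suc n) m = copy_emb (rev (u n)) U v z" for m v z
    proof -
      obtain c z' where z': "z' \<in> pts a.Tr" "z = glue_copy a.Tr c z'" using z unfolding U_def pts_Phi by blast
      obtain s where s: "z' = ([], s)" "s \<in> TS a.x3" using z'(1) unfolding pts_tripod[OF a.x3] by blast
      have rv: "length (rev v) = length (u n)" using v b.n by simp
      then have rvS: "length (c # rev v) = length (k # u n)" by simp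
      have "a.hh m = copy_emb (rev (u n)) U v z" using hm unfolding h_def uS .
      \<comment> \<open>The index \<open>v\<close> of the copy of \<open>U\<close> and the side
        \<open>c\<close> inside \<open>U\<close> combine to the word \<open>c # rev v\<close>: the
        innermost operation contributes the first letter, which is the one consumed by
        \<open>iota\<close>.\<close>
      also have "\<dots> = a.hh (a.fb (c # rev v) s)"
        unfolding a.hh_fb[OF s(2) rvS] using copy_emb_snoc[of v "rev (u n)" k a.Tr c "([], s)"] v b.n
        by (simp add: U_def z' s)
      finally have "m = a.fb (c # rev v) s"
        using a.hh_bij m a.fb_fiber[OF s(2) rvS] unfolding bij_betw_def inj_on_def \<zeta> uS by blast
      then have "iota n m = b.fb (rev v) (psi k c (p (Suc n)) s)" using im[OF s(2) rv] by simp
      then have "h n (iota n m) = copy_emb (rev (u n)) b.Tr v ([], psi k c (p (Suc n)) s)"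
        unfolding h_def using b.hh_fb[OF conjunct2[OF im[OF s(2) rv]] rv] by simp
      then show ?thesis unfolding z'(2) s(1) \<phi>(2)[OF s(2)] .
    qed
    ultimately show ?thesis
      unfolding Let_def FFn ks k_def[symmetric] U_def[symmetric]
      using b.hh_isometry \<phi>(1) unfolding h_def[of n] \<zeta>[of n] by blast
  qed
  then have "\<exists>\<phi>. \<forall>n. (let T = tripod ((FF ^^ n) x);
         T' = tripod ((FF ^^ Suc n) x);
         ks = itinerary_prefix x n;
         U = Phi (itinerary x (Suc n)) T'
     in isometry (h n) (fiber n (\<zeta> n)) (fiber_dist n) (pts (foldr Phi ks T)) (tdist (foldr Phi ks T)) \<and>
        iota n ` fiber (Suc n) (\<zeta> (Suc n)) \<subseteq> fiber n (\<zeta> n) \<and>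
        marked_isometry (\<phi> n) (halved_hubbard U) T \<and>
        (\<forall>m\<in>fiber (Suc n) (\<zeta> (Suc n)). \<forall>u p. length u = n \<and> p \<in> pts U \<and>
           h (Suc n) m = copy_emb ks U u p \<longrightarrow>
           h n (iota n m) = copy_emb ks T u (\<phi> n (tree_proj U (hubbard U) p))))"
    by (intro choice allI)
  then show ?thesis by blast
qed

end
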